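(* (Poincaré inequality.) Let Assumptions 1 and 2 of the context be satisfied. If the semigroup $S_\infty$ (the restriction of $S$ to $H_\infty$) is uniformly exponentially stable, then there is a constant $C$ such that for all $\phi\in W^{1,2}_H(E,\mu_\infty)$ we have $$\int_E(\phi-\overline\phi)^2\,d\mu_\infty\le C\int_E\|D^H\phi\|_H^2\,d\mu_\infty,$$ where $\overline\phi=\int_E\phi\,d\mu_\infty$.
   Context: $E$ is a real Banach space, $H$ is a real Hilbert space with inner product $[\cdot,\cdot]$, and $i:H\to E$ is a bounded injective linear operator. $(\Omega,\mathbb P)$ is a probability space and $W^H$ is an $H$-cylindrical Brownian motion: a linear map $W^H:L^2(\mathbb R_+;H)\to L^2(\Omega,\mathbb P)$ such that each $W^Hf$ is centred Gaussian and $\mathbb E(W^Hf\,W^Hg)=\int_0^\infty [f(t),g(t)]\,dt$. $S=(S(t))_{t\ge0}$ is a $C_0$-semigroup on $E$ with generator $A$. Assumption 1 (existence of an invariant measure for $dX=AX\,dt+dW^H$): there is a centred Gaussian Radon measure $\mu_\infty$ on $E$ such that $\int_E\langle x,x^*\rangle^2\,d\mu_\infty(x)=\int_0^\infty\|i^*S^*(t)x^*\|_H^2\,dt$ for all $x^*\in E^*$. Mild solution: $X^x(t)=S(t)x+\int_0^tS(t-s)\,i\,dW^H(s)$, where the stochastic integral is the (strongly measurable, Gaussian) $E$-valued random variable $Y(t)$ with $\langle Y(t),x^*\rangle=W^H(\mathbf 1_{[0,t]}(\cdot)\,i^*S^*(t-\cdot)x^* )$ a.s. for all $x^*\in E^*$.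 Ornstein-Uhlenbeck semigroup: $P(t)f(x)=\mathbb E f(X^x(t))$ for bounded Borel $f$, extended to a $C_0$-semigroup of contractions on $L^2(E,\mu_\infty)$. Assumption 2: the complexification of $P$ is an analytic $C_0$-semigroup on $L^2(E,\mu_\infty;\mathbb C)$. Reproducing kernel space: $H_\infty$ is the closure in $L^2(E,\mu_\infty)$ of the functions $\langle\cdot,x^*\rangle$, $x^*\in E^*$; $i_\infty:H_\infty\to E$, $i_\infty h=\int_E h(x)\,x\,d\mu_\infty(x)$, is bounded and injective, with adjoint $i_\infty^*x^*=\langle\cdot,x^*\rangle$. Let $\phi_h\in L^2(E,\mu_\infty)$ denote $h\in H_\infty$ viewed as a function. Under Assumption 1, $S$ maps $i_\infty(H_\infty)$ (identified with $H_\infty$) into itself and restricts to a $C_0$-contraction semigroup $S_\infty$ on $H_\infty$. Gradient: the operator $U:H_\infty\to H$, $U i_\infty^*x^*:=i^*x^*$, is closable under Assumptions 1 and 2; its closure, with domain $\mathsf D(U)$, is again denoted $U$. For $f=\varphi(\phi_{h_1},\dots,\phi_{h_n})$ with $n\ge1$, $\varphi\in C^1_{\rm b}(\mathbb R^n)$ (bounded, continuous, with bounded continuous first derivatives) and $h_j\in\mathsf D(U)$, set $D^Hf=\sum_{j=1}^n\partial_j\varphi(\phi_{h_1},\dots,\phi_{h_n})\otimes Uh_j$. Then $D^H$ is closable from $L^2(E,\mu_\infty)$ to $L^2(E,\mu_\infty;H)$; its closure is again denoted $D^H$, and $W^{1,2}_H(E,\mu_\infty):=\mathsf D(D^H)$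 is the domain of this closure. *)

theory Defs
  imports "HOL-Probability.Probability"
begin

section \<open>Spaces \<open>L\<^sup>2(M; F)\<close> of functions with values in a possibly nonseparable space\<close>

text \<open>
  The Bochner integral of the library is restricted to second countable spaces, and Borel
  measurability is too weak for functions with values in a nonseparable space. Strong
  measurability means being a pointwise limit of simple functions; for values in a separable
  space it coincides with Borel measurability.
\<close>

definition strongly_measurable :: "'a measure \<Rightarrow> ('a \<Rightarrow> 'b::real_normed_vector) \<Rightarrow> bool" where
  "strongly_measurable M f \<longleftrightarrow>
     (\<exists>s :: nat \<Rightarrow> 'a \<Rightarrow> 'b. (\<forall>n. simple_function M (s n)) \<and>
        (\<forall>x\<in>space M. (\<lambda>n. s n x) \<longlonglongrightarrow> f x))"

text \<open>
  Elements of \<open>L\<^sup>2\<close> are represented by functions; equality in \<open>L\<^sup>2\<close> is equality almost everywhere.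
  Maps between such spaces act on representatives.
\<close>

definition L2 :: "'a measure \<Rightarrow> ('a \<Rightarrow> 'b::real_normed_vector) set" where
  "L2 M = {f. strongly_measurable M f \<and> integrable M (\<lambda>x. (norm (f x))\<^sup>2)}"

definition l2norm :: "'a measure \<Rightarrow> ('a \<Rightarrow> 'b::real_normed_vector) \<Rightarrow> real" where
  "l2norm M f = sqrt (\<integral>x. (norm (f x))\<^sup>2 \<partial>M)"

text \<open>
  Same as \<^const>\<open>has_bochner_integral\<close>, without the restriction to second countable spaces.
\<close>

definition has_vector_bochner_integral ::
  "'a measure \<Rightarrow> ('a \<Rightarrow> 'b::real_normed_vector) \<Rightarrow> 'b \<Rightarrow> bool" where
  "has_vector_bochner_integral M f y \<longleftrightarrow>
     f \<in> borel_measurable M \<and>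
     (\<exists>s. (\<forall>n. Bochner_Integration.simple_bochner_integrable M (s n)) \<and>
        (\<lambda>n. \<integral>\<^sup>+x. ennreal (norm (f x - s n x)) \<partial>M) \<longlonglongrightarrow> 0 \<and>
        (\<lambda>n. Bochner_Integration.simple_bochner_integral M (s n)) \<longlonglongrightarrow> y)"


section \<open>Gaussian measures and cylindrical Brownian motion\<close>

text \<open>Variance zero, that is, the Dirac measure at the origin, is allowed.\<close>

definition centred_gaussian :: "'a measure \<Rightarrow> ('a \<Rightarrow> real) \<Rightarrow> bool" where
  "centred_gaussian M X \<longleftrightarrow> X \<in> borel_measurable M \<and>
     (distr M borel X = return borel 0 \<or>
      (\<exists>\<sigma>>0. distr M borel X = density lborel (\<lambda>r. ennreal (normal_density 0 \<sigma> r))))"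

definition radon_probability :: "'e::topological_space measure \<Rightarrow> bool" where
  "radon_probability \<mu> \<longleftrightarrow> prob_space \<mu> \<and> sets \<mu> = sets borel \<and>
     (\<forall>B\<in>sets borel. emeasure \<mu> B = (SUP K\<in>{K. compact K \<and> K \<subseteq> B}. emeasure \<mu> K))"

definition centred_gaussian_radon :: "'e::real_normed_vector measure \<Rightarrow> bool" where
  "centred_gaussian_radon \<mu> \<longleftrightarrow> radon_probability \<mu> \<and>
     (\<forall>x' :: 'e \<Rightarrow>\<^sub>L real. centred_gaussian \<mu> (blinfun_apply x'))"

definition lborel_nonneg :: "real measure" where
  "lborel_nonneg = restrict_space lborel {0..}"

definition cylindrical_brownian_motion ::
  "'w measure \<Rightarrow> ((real \<Rightarrow> 'h::real_inner) \<Rightarrow> 'w \<Rightarrow> real) \<Rightarrow> bool" where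
  "cylindrical_brownian_motion P W \<longleftrightarrow>
     (\<forall>f\<in>L2 lborel_nonneg. W f \<in> L2 P \<and> centred_gaussian P (W f)) \<and>
     (\<forall>f\<in>L2 lborel_nonneg. \<forall>g\<in>L2 lborel_nonneg.
        (AE t in lborel_nonneg. f t = g t) \<longrightarrow> (AE \<omega> in P. W f \<omega> = W g \<omega>)) \<and>
     (\<forall>f\<in>L2 lborel_nonneg. \<forall>g\<in>L2 lborel_nonneg. \<forall>a b :: real.
        AE \<omega> in P. W (\<lambda>t. a *\<^sub>R f t + b *\<^sub>R g t) \<omega> = a * W f \<omega> + b * W g \<omega>) \<and>
     (\<forall>f\<in>L2 lborel_nonneg. \<forall>g\<in>L2 lborel_nonneg.
        (\<integral>\<omega>. W f \<omega> * W g \<omega> \<partial>P) = (\<integral>t. inner (f t) (g t) \<partial>lborel_nonneg))"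


section \<open>Semigroups\<close>

definition C0_semigroup :: "(real \<Rightarrow> 'e::real_normed_vector \<Rightarrow>\<^sub>L 'e) \<Rightarrow> bool" where
  "C0_semigroup S \<longleftrightarrow> S 0 = id_blinfun \<and>
     (\<forall>s\<ge>0. \<forall>t\<ge>0. S (s + t) = S s o\<^sub>L S t) \<and>
     (\<forall>x. ((\<lambda>t. blinfun_apply (S t) x) \<longlongrightarrow> x) (at_right 0))"

definition bounded_operator_L2 ::
  "'a measure \<Rightarrow> (('a \<Rightarrow> complex) \<Rightarrow> 'a \<Rightarrow> complex) \<Rightarrow> bool" where
  "bounded_operator_L2 M T \<longleftrightarrow>
     (\<forall>f\<in>L2 M. T f \<in> L2 M) \<and>
     (\<forall>f\<in>L2 M. \<forall>g\<in>L2 M. (AE x in M. f x = g x) \<longrightarrow> (AE x in M. T f x = T g x)) \<and>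
     (\<forall>f\<in>L2 M. \<forall>g\<in>L2 M. \<forall>a b :: complex.
        AE x in M. T (\<lambda>x. a * f x + b * g x) x = a * T f x + b * T g x) \<and>
     (\<exists>K. \<forall>f\<in>L2 M. l2norm M (T f) \<le> K * l2norm M f)"

definition C0_semigroup_L2 ::
  "'a measure \<Rightarrow> (real \<Rightarrow> ('a \<Rightarrow> complex) \<Rightarrow> 'a \<Rightarrow> complex) \<Rightarrow> bool" where
  "C0_semigroup_L2 M T \<longleftrightarrow>
     (\<forall>t\<ge>0. bounded_operator_L2 M (T t)) \<and>
     (\<forall>f\<in>L2 M. AE x in M. T 0 f x = f x) \<and>
     (\<forall>s\<ge>0. \<forall>t\<ge>0. \<forall>f\<in>L2 M. AE x in M. T (s + t) f x = T s (T t f) x) \<and>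
     (\<forall>f\<in>L2 M. ((\<lambda>t. l2norm M (\<lambda>x. T t f x - f x)) \<longlongrightarrow> 0) (at_right 0))"

definition sector :: "real \<Rightarrow> complex set" where
  "sector \<theta> = {z. z \<noteq> 0 \<and> \<bar>Arg z\<bar> < \<theta>}"

text \<open>
  Analytic \<open>C\<^sub>0\<close>-semigroup: the semigroup extends to an open sector around the positive half-line;
  the extension satisfies the semigroup law, all its orbits are (complex) differentiable with
  respect to the \<open>L\<^sup>2\<close> norm, and it is strongly continuous at \<open>0\<close> in every strictly smaller sector.
\<close>

definition analytic_C0_semigroup_L2 ::
  "'a measure \<Rightarrow> (real \<Rightarrow> ('a \<Rightarrow> complex) \<Rightarrow> 'a \<Rightarrow> complex) \<Rightarrow> bool" where
  "analytic_C0_semigroup_L2 M T \<longleftrightarrow> C0_semigroup_L2 M T \<and>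
     (\<exists>\<theta>\<in>{0<..pi/2}. \<exists>V :: complex \<Rightarrow> ('a \<Rightarrow> complex) \<Rightarrow> 'a \<Rightarrow> complex.
        (\<forall>z\<in>sector \<theta>. bounded_operator_L2 M (V z)) \<and>
        (\<forall>t>0. \<forall>f\<in>L2 M. AE x in M. V (of_real t) f x = T t f x) \<and>
        (\<forall>z\<in>sector \<theta>. \<forall>w\<in>sector \<theta>. \<forall>f\<in>L2 M. AE x in M. V (z + w) f x = V z (V w f) x) \<and>
        (\<forall>f\<in>L2 M. \<forall>z\<in>sector \<theta>. \<exists>g\<in>L2 M.
           ((\<lambda>w. l2norm M (\<lambda>x. (V w f x - V z f x) / (w - z) - g x)) \<longlongrightarrow> 0) (at z)) \<and>
        (\<forall>f\<in>L2 M. \<forall>\<theta>'\<in>{0<..<\<theta>}.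
           ((\<lambda>z. l2norm M (\<lambda>x. V z f x - f x)) \<longlongrightarrow> 0) (at 0 within sector \<theta>')))"


section \<open>The Ornstein-Uhlenbeck semigroup\<close>

text \<open>The adjoint \<open>i\<^sup>*\<close> as a map into \<open>H\<close>, via the Riesz identification of \<open>H\<^sup>*\<close> with \<open>H\<close>.\<close>

definition adj :: "('h::real_inner \<Rightarrow>\<^sub>L 'e::real_normed_vector) \<Rightarrow> ('e \<Rightarrow>\<^sub>L real) \<Rightarrow> 'h" where
  "adj i x' = (THE h. \<forall>g. inner h g = blinfun_apply x' (blinfun_apply i g))"

text \<open>Assumption 1. Note that \<open>x' o\<^sub>L S t\<close> is \<open>S\<^sup>*(t)x'\<close>.\<close>

definition invariant_measure ::
  "('h::real_inner \<Rightarrow>\<^sub>L 'e::banach) \<Rightarrow> (real \<Rightarrow> 'e \<Rightarrow>\<^sub>L 'e) \<Rightarrow> 'e measure \<Rightarrow> bool" where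
  "invariant_measure i S \<mu> \<longleftrightarrow> centred_gaussian_radon \<mu> \<and>
     (\<forall>x'. (\<integral>\<^sup>+x. ennreal ((blinfun_apply x' x)\<^sup>2) \<partial>\<mu>) =
           (\<integral>\<^sup>+t. ennreal ((norm (adj i (x' o\<^sub>L S t)))\<^sup>2) \<partial>lborel_nonneg))"

text \<open>
  \<open>Y\<close> is (a version of) the stochastic integral \<open>\<integral>\<^sub>0\<^sup>t S(t-s) i dW(s)\<close>.
\<close>

definition stochastic_convolution ::
  "'w measure \<Rightarrow> ((real \<Rightarrow> 'h::real_inner) \<Rightarrow> 'w \<Rightarrow> real) \<Rightarrow> ('h \<Rightarrow>\<^sub>L 'e::banach) \<Rightarrow>
   (real \<Rightarrow> 'e \<Rightarrow>\<^sub>L 'e) \<Rightarrow> real \<Rightarrow> ('w \<Rightarrow> 'e) \<Rightarrow> bool" where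
  "stochastic_convolution P W i S t Y \<longleftrightarrow> strongly_measurable P Y \<and>
     (\<forall>x'. centred_gaussian P (\<lambda>\<omega>. blinfun_apply x' (Y \<omega>)) \<and>
        (AE \<omega> in P. blinfun_apply x' (Y \<omega>) =
           W (\<lambda>s. indicator {0..t} s *\<^sub>R adj i (x' o\<^sub>L S (t - s))) \<omega>))"

definition mild_solution ::
  "(real \<Rightarrow> 'e::banach \<Rightarrow>\<^sub>L 'e) \<Rightarrow> (real \<Rightarrow> 'w \<Rightarrow> 'e) \<Rightarrow> 'e \<Rightarrow> real \<Rightarrow> 'w \<Rightarrow> 'e" where
  "mild_solution S Y x t \<omega> = blinfun_apply (S t) x + Y t \<omega>"

definition OU ::
  "'w measure \<Rightarrow> (real \<Rightarrow> 'e::banach \<Rightarrow>\<^sub>L 'e) \<Rightarrow> (real \<Rightarrow> 'w \<Rightarrow> 'e) \<Rightarrow>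
   real \<Rightarrow> ('e \<Rightarrow> real) \<Rightarrow> 'e \<Rightarrow> real" where
  "OU P S Y t f x = (\<integral>\<omega>. f (mild_solution S Y x t \<omega>) \<partial>P)"

text \<open>Extension by continuity from the bounded Borel functions to \<open>L\<^sup>2(E, \<mu>)\<close>.\<close>

definition OU_L2 ::
  "'w measure \<Rightarrow> (real \<Rightarrow> 'e::banach \<Rightarrow>\<^sub>L 'e) \<Rightarrow> (real \<Rightarrow> 'w \<Rightarrow> 'e) \<Rightarrow> 'e measure \<Rightarrow>
   real \<Rightarrow> ('e \<Rightarrow> real) \<Rightarrow> 'e \<Rightarrow> real" where
  "OU_L2 P S Y \<mu> t f = (SOME g. g \<in> L2 \<mu> \<and>
     (\<exists>F :: nat \<Rightarrow> 'e \<Rightarrow> real.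
        (\<forall>n. F n \<in> borel_measurable borel \<and> bounded (range (F n))) \<and>
        (\<lambda>n. l2norm \<mu> (\<lambda>x. F n x - f x)) \<longlonglongrightarrow> 0 \<and>
        (\<lambda>n. l2norm \<mu> (\<lambda>x. OU P S Y t (F n) x - g x)) \<longlonglongrightarrow> 0))"

definition complexification ::
  "(('a \<Rightarrow> real) \<Rightarrow> 'a \<Rightarrow> real) \<Rightarrow> ('a \<Rightarrow> complex) \<Rightarrow> 'a \<Rightarrow> complex" where
  "complexification T f = (\<lambda>x. Complex (T (\<lambda>y. Re (f y)) x) (T (\<lambda>y. Im (f y)) x))"


section \<open>The reproducing kernel space and the restricted semigroup\<close>

text \<open>
  Elements of \<open>H\<^sub>\<infinity>\<close> are functions (modulo equality almost everywhere), so that \<open>\<phi>\<^sub>h\<close> is \<open>h\<close> itself;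
  \<open>i\<^sub>\<infinity>\<^sup>*x'\<close> is the function \<^term>\<open>blinfun_apply x'\<close>, and the norm is \<^term>\<open>l2norm \<mu>\<close>.
\<close>

definition H_inf :: "'e::banach measure \<Rightarrow> ('e \<Rightarrow> real) set" where
  "H_inf \<mu> = {h \<in> L2 \<mu>. \<exists>x' :: nat \<Rightarrow> 'e \<Rightarrow>\<^sub>L real.
     (\<lambda>n. l2norm \<mu> (\<lambda>x. blinfun_apply (x' n) x - h x)) \<longlonglongrightarrow> 0}"

definition i_inf :: "'e::banach measure \<Rightarrow> ('e \<Rightarrow> real) \<Rightarrow> 'e" where
  "i_inf \<mu> h = (THE y. has_vector_bochner_integral \<mu> (\<lambda>x. h x *\<^sub>R x) y)"

definition S_inf ::
  "(real \<Rightarrow> 'e::banach \<Rightarrow>\<^sub>L 'e) \<Rightarrow> 'e measure \<Rightarrow> real \<Rightarrow> ('e \<Rightarrow> real) \<Rightarrow> 'e \<Rightarrow> real" where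
  "S_inf S \<mu> t h = (SOME g. g \<in> H_inf \<mu> \<and> i_inf \<mu> g = blinfun_apply (S t) (i_inf \<mu> h))"

definition S_inf_exponentially_stable ::
  "(real \<Rightarrow> 'e::banach \<Rightarrow>\<^sub>L 'e) \<Rightarrow> 'e measure \<Rightarrow> bool" where
  "S_inf_exponentially_stable S \<mu> \<longleftrightarrow>
     (\<exists>K \<omega>. \<omega> > 0 \<and>
        (\<forall>t\<ge>0. \<forall>h\<in>H_inf \<mu>. l2norm \<mu> (S_inf S \<mu> t h) \<le> K * exp (- \<omega> * t) * l2norm \<mu> h))"


section \<open>The gradient\<close>

text \<open>Graph of the closure of \<open>i\<^sub>\<infinity>\<^sup>*x' \<mapsto> i\<^sup>*x'\<close>.\<close>

definition U_graph ::
  "('h::real_inner \<Rightarrow>\<^sub>L 'e::banach) \<Rightarrow> 'e measure \<Rightarrow> (('e \<Rightarrow> real) \<times> 'h) set" where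
  "U_graph i \<mu> = {(h, u). h \<in> H_inf \<mu> \<and>
     (\<exists>x' :: nat \<Rightarrow> 'e \<Rightarrow>\<^sub>L real.
        (\<lambda>n. l2norm \<mu> (\<lambda>x. blinfun_apply (x' n) x - h x)) \<longlonglongrightarrow> 0 \<and>
        (\<lambda>n. adj i (x' n)) \<longlonglongrightarrow> u)}"

definition dom_U :: "('h::real_inner \<Rightarrow>\<^sub>L 'e::banach) \<Rightarrow> 'e measure \<Rightarrow> ('e \<Rightarrow> real) set" where
  "dom_U i \<mu> = Domain (U_graph i \<mu>)"

definition U :: "('h::real_inner \<Rightarrow>\<^sub>L 'e::banach) \<Rightarrow> 'e measure \<Rightarrow> ('e \<Rightarrow> real) \<Rightarrow> 'h" where
  "U i \<mu> h = (THE u. (h, u) \<in> U_graph i \<mu>)"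

text \<open>
  As in \<^const>\<open>Euclidean_space\<close>, a vector in \<open>\<real>\<^sup>n\<close> is a sequence vanishing from index \<open>n\<close> on, with the
  topology of pointwise convergence. The coordinates are numbered \<open>0, \<dots>, n-1\<close>.
\<close>

definition partial :: "nat \<Rightarrow> ((nat \<Rightarrow> real) \<Rightarrow> real) \<Rightarrow> (nat \<Rightarrow> real) \<Rightarrow> real" where
  "partial j \<phi> a = deriv (\<lambda>s. \<phi> (a(j := s))) (a j)"

definition C1b :: "nat \<Rightarrow> ((nat \<Rightarrow> real) \<Rightarrow> real) set" where
  "C1b n = {\<phi>. continuous_map (Euclidean_space n) euclideanreal \<phi> \<and>
     bounded (\<phi> ` topspace (Euclidean_space n)) \<and>
     (\<forall>j<n.
        (\<forall>a\<in>topspace (Euclidean_space n).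
           (\<lambda>s. \<phi> (a(j := s))) field_differentiable (at (a j))) \<and>
        continuous_map (Euclidean_space n) euclideanreal (partial j \<phi>) \<and>
        bounded (partial j \<phi> ` topspace (Euclidean_space n)))}"

definition eval_vec :: "nat \<Rightarrow> (nat \<Rightarrow> 'e \<Rightarrow> real) \<Rightarrow> 'e \<Rightarrow> nat \<Rightarrow> real" where
  "eval_vec n h x = (\<lambda>j. if j < n then h j x else 0)"

text \<open>Graph of the gradient on cylindrical functions.\<close>

definition DH_cyl_graph ::
  "('h::real_inner \<Rightarrow>\<^sub>L 'e::banach) \<Rightarrow> 'e measure \<Rightarrow> (('e \<Rightarrow> real) \<times> ('e \<Rightarrow> 'h)) set" where
  "DH_cyl_graph i \<mu> =
     {(\<lambda>x. \<phi> (eval_vec n h x), \<lambda>x. \<Sum>j<n. partial j \<phi> (eval_vec n h x) *\<^sub>R U i \<mu> (h j)) | n \<phi> h.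
        1 \<le> n \<and> \<phi> \<in> C1b n \<and> (\<forall>j<n. h j \<in> dom_U i \<mu>)}"

text \<open>Graph of its closure from \<open>L\<^sup>2(E, \<mu>)\<close> to \<open>L\<^sup>2(E, \<mu>; H)\<close>.\<close>

definition DH_graph ::
  "('h::real_inner \<Rightarrow>\<^sub>L 'e::banach) \<Rightarrow> 'e measure \<Rightarrow> (('e \<Rightarrow> real) \<times> ('e \<Rightarrow> 'h)) set" where
  "DH_graph i \<mu> = {(f, F). f \<in> L2 \<mu> \<and> F \<in> L2 \<mu> \<and>
     (\<exists>g G. (\<forall>n::nat. (g n, G n) \<in> DH_cyl_graph i \<mu>) \<and>
        (\<lambda>n. l2norm \<mu> (\<lambda>x. g n x - f x)) \<longlonglongrightarrow> 0 \<and>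
        (\<lambda>n. l2norm \<mu> (\<lambda>x. G n x - F x)) \<longlonglongrightarrow> 0)}"

definition W12 :: "('h::real_inner \<Rightarrow>\<^sub>L 'e::banach) \<Rightarrow> 'e measure \<Rightarrow> ('e \<Rightarrow> real) set" where
  "W12 i \<mu> = Domain (DH_graph i \<mu>)"

text \<open>Determined up to equality almost everywhere, hence \<open>SOME\<close> instead of \<open>THE\<close>.\<close>

definition DH :: "('h::real_inner \<Rightarrow>\<^sub>L 'e::banach) \<Rightarrow> 'e measure \<Rightarrow> ('e \<Rightarrow> real) \<Rightarrow> 'e \<Rightarrow> 'h" where
  "DH i \<mu> f = (SOME F. (f, F) \<in> DH_graph i \<mu>)"

end

theory Submission
  imports Defs "HOL-Complex_Analysis.Complex_Analysis" "HOL-Real_Asymp.Real_Asymp"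
begin

text \<open>
  For functions of finitely many functionals, the Gaussian rotation \<open>(cos r x + sin r y)\<close> of
  two independent copies of \<open>\<mu>\<close> yields a Poincare inequality with the right-hand side
  \<open>\<integral>\<parallel>\<Sum> \<partial>\<^sub>j\<phi> x'\<^sub>j\<parallel>\<^sup>2\<close>, the norm being that of \<open>H\<^sub>\<infinity>\<close>. It remains to bound this norm by that of \<open>H\<close>,
  that is, to prove \<open>\<parallel>x'\<parallel>\<^sub>\<infinity> \<le> C \<parallel>i\<^sup>*x'\<parallel>\<close>.

  The Ornstein-Uhlenbeck semigroup maps the coherent state of \<open>w\<close> to that of \<open>S\<^sup>*(t)w\<close>, and inner
  products of coherent states are exponentials of covariances. Differentiating, analyticity
  becomes the sector condition \<open>\<bar>\<langle>A\<^sup>*x', y'\<rangle>\<^sub>\<infinity>\<bar> \<le> K \<parallel>i\<^sup>*x'\<parallel> \<parallel>i\<^sup>*y'\<parallel>\<close>, while invariance of \<open>\<mu>\<close> gives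
  \<open>\<parallel>i\<^sup>*x'\<parallel>\<^sup>2 = - 2 \<langle>A\<^sup>*x', x'\<rangle>\<^sub>\<infinity>\<close>. Applying the former to \<open>g = \<integral>\<^sub>0\<^sup>N S\<^sup>*(r)x' dr\<close>, for which
  \<open>A\<^sup>*g = S\<^sup>*(N)x' - x'\<close>, with \<open>N\<close> so large that \<open>\<parallel>S\<^sup>*(N)\<parallel>\<^sub>\<infinity> \<le> 1/2\<close>, gives the desired bound. The two
  relations also show that \<open>U\<close> is closable.
\<close>

section \<open>Functional analysis\<close>

text \<open>Analyticity only says that the time derivative of the semigroup at t is of order 1/t. To
  obtain a bound that survives t -> 0, coherent states are taken large: for a functional r w the
  exponential factor in the estimate is governed by r^2 (|w|^2 - |S^*(t) w|^2), of order r^2 t |i^*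
  w|^2. Choosing r^2 of order 1/t balances both effects and leaves |i^* w|^2. Complex functionals
  enter because real ones only show the symmetric part of the form, which invariance already
  determines.

  The second obstacle is regularity. E need be neither reflexive nor separable, so adjoint orbits
  are in general only weak* continuous, and the adjoint generator is only weak* densely defined.
  Statements are proved on its domain, where orbits are Lipschitz, and extended along bounded,
  pointwise convergent functionals. Such convergence is L2 convergence because the norm of E is
  square integrable under \<open>\<mu>\<close>, which is why Fernique's theorem is proved.
  Nonseparability also forces measurability and uniqueness arguments through cylinder sets; the
  Radon property supplies a separable support.\<close>

definition sublinear :: "('a::real_vector \<Rightarrow> real) \<Rightarrow> bool" where
  "sublinear p \<longleftrightarrow> (\<forall>x y. p (x + y) \<le> p x + p y) \<and> (\<forall>c\<ge>0. \<forall>x. p (c *\<^sub>R x) = c * p x)"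

lemma sublinear_add: "sublinear p \<Longrightarrow> p (x + y) \<le> p x + p y"
  and sublinear_scale: "sublinear p \<Longrightarrow> c \<ge> 0 \<Longrightarrow> p (c *\<^sub>R x) = c * p x"
  by (auto simp: sublinear_def)

lemma sublinear_0: "sublinear p \<Longrightarrow> p 0 = 0"
  using sublinear_scale[of p 0 0] by simp

lemma sublinear_neg: "sublinear p \<Longrightarrow> - p (- x) \<le> p x"
  using sublinear_add[of p x "- x"] sublinear_0[of p] by simp

lemma sublinearI:
  assumes add: "\<And>x y. p (x + y) \<le> p x + p y"
    and zero: "p 0 = 0"
    and scale: "\<And>c x. c > 0 \<Longrightarrow> p (c *\<^sub>R x) \<le> c * p x"
  shows "sublinear p"
  unfolding sublinear_def
proof (intro conjI allI impI add)
  fix c :: real and x assume "c \<ge> 0"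
  show "p (c *\<^sub>R x) = c * p x"
  proof (cases "c = 0")
    case False
    with \<open>c \<ge> 0\<close> have c: "c > 0" by simp
    have "p (inverse c *\<^sub>R (c *\<^sub>R x)) \<le> inverse c * p (c *\<^sub>R x)"
      using c by (intro scale) simp
    then have "c * p x \<le> p (c *\<^sub>R x)" using c by (simp add: field_simps)
    with scale[OF c, of x] show ?thesis by simp
  qed (simp add: zero)
qed

text \<open>Lies below \<open>q\<close> (take t = 0) and is at most \<open>- q y\<close> at
  \<open>- y\<close> (take t = 1). Hence every linear functional below it attains \<open>q\<close>
  at \<open>y\<close>.\<close>

definition sublinear_shift :: "('a::real_vector \<Rightarrow> real) \<Rightarrow> 'a \<Rightarrow> 'a \<Rightarrow> real" where
  "sublinear_shift q y x = (INF t\<in>{0..}. q (x + t *\<^sub>R y) - t * q y)"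

lemma sublinear_shift_le:
  assumes "sublinear q" "t \<ge> 0"
  shows "sublinear_shift q y x \<le> q (x + t *\<^sub>R y) - t * q y"
  unfolding sublinear_shift_def
proof (rule cINF_lower)
  show "bdd_below ((\<lambda>t. q (x + t *\<^sub>R y) - t * q y) ` {0..})"
  proof (rule bdd_belowI2)
    fix t :: real assume "t \<in> {0..}"
    then show "- q (- x) \<le> q (x + t *\<^sub>R y) - t * q y"
      using sublinear_add[OF assms(1), of "x + t *\<^sub>R y" "- x"] sublinear_scale[OF assms(1), of t y]
      by simp
  qed
qed (use assms in auto)

lemma sublinear_shift_greatest:
  assumes "\<And>t. t \<ge> 0 \<Longrightarrow> a \<le> q (x + t *\<^sub>R y) - t * q y"
  shows "a \<le> sublinear_shift q y x"
  unfolding sublinear_shift_def using assms by (intro cINF_greatest) auto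

lemma sublinear_sublinear_shift:
  assumes q: "sublinear q"
  shows "sublinear (sublinear_shift q y)"
proof (rule sublinearI)
  fix x1 x2
  have "sublinear_shift q y (x1 + x2) - (q (x2 + s *\<^sub>R y) - s * q y) \<le> sublinear_shift q y x1"
    if s: "s \<ge> 0" for s
  proof (rule sublinear_shift_greatest)
    fix t :: real assume t: "t \<ge> 0"
    have "sublinear_shift q y (x1 + x2) \<le> q (x1 + x2 + (s + t) *\<^sub>R y) - (s + t) * q y"
      using s t by (intro sublinear_shift_le q) simp
    moreover have "q (x1 + x2 + (s + t) *\<^sub>R y) \<le> q (x1 + t *\<^sub>R y) + q (x2 + s *\<^sub>R y)"
      using sublinear_add[OF q, of "x1 + t *\<^sub>R y" "x2 + s *\<^sub>R y"] by (simp add: algebra_simps)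
    ultimately show "sublinear_shift q y (x1 + x2) - (q (x2 + s *\<^sub>R y) - s * q y)
        \<le> q (x1 + t *\<^sub>R y) - t * q y"
      by (simp add: algebra_simps)
  qed
  then have "sublinear_shift q y (x1 + x2) - sublinear_shift q y x1 \<le> sublinear_shift q y x2"
    by (intro sublinear_shift_greatest) (simp add: algebra_simps)
  then show "sublinear_shift q y (x1 + x2) \<le> sublinear_shift q y x1 + sublinear_shift q y x2"
    by simp
next
  have "sublinear_shift q y 0 \<le> q (0 + 0 *\<^sub>R y) - 0 * q y"
    by (rule sublinear_shift_le[OF q]) simp
  moreover have "0 \<le> sublinear_shift q y 0"
    by (rule sublinear_shift_greatest) (simp add: sublinear_scale[OF q])
  ultimately show "sublinear_shift q y 0 = 0" by (simp add: sublinear_0[OF q])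
next
  fix c :: real and x assume c: "c > 0"
  have "inverse c * sublinear_shift q y (c *\<^sub>R x) \<le> sublinear_shift q y x"
  proof (rule sublinear_shift_greatest)
    fix t :: real assume t: "t \<ge> 0"
    have "sublinear_shift q y (c *\<^sub>R x) \<le> q (c *\<^sub>R x + (c * t) *\<^sub>R y) - (c * t) * q y"
      using c t by (intro sublinear_shift_le q) simp
    also have "c *\<^sub>R x + (c * t) *\<^sub>R y = c *\<^sub>R (x + t *\<^sub>R y)" by (simp add: algebra_simps)
    also have "q \<dots> = c * q (x + t *\<^sub>R y)" using c by (intro sublinear_scale q) simp
    finally show "inverse c * sublinear_shift q y (c *\<^sub>R x) \<le> q (x + t *\<^sub>R y) - t * q y"
      using c by (simp add: field_simps)
  qed
  then show "sublinear_shift q y (c *\<^sub>R x) \<le> c * sublinear_shift q y x"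
    using c by (simp add: field_simps)
qed

text \<open>Each shift lies below \<open>q\<close> and therefore equals \<open>q\<close>; the choice
  t = 1 in the infimum then gives superadditivity.\<close>

lemma sublinear_minimal_imp_linear:
  assumes q: "sublinear q" and min: "\<And>r. sublinear r \<Longrightarrow> r \<le> q \<Longrightarrow> r = q"
  shows "linear q"
proof -
  have "sublinear_shift q y = q" for y
  proof (rule min[OF sublinear_sublinear_shift[OF q]])
    show "sublinear_shift q y \<le> q"
      using sublinear_shift_le[OF q, of 0 y] by (simp add: le_fun_def)
  qed
  then have "q x \<le> q (x + y) - q y" for x y
    using sublinear_shift_le[OF q, of 1 y x] by simp
  then have add: "q (x + y) = q x + q y" for x y
    using sublinear_add[OF q, of x y] by (smt (verit))
  have neg: "q (- x) = - q x" for x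
    using add[of x "- x"] sublinear_0[OF q] by simp
  have "q (c *\<^sub>R x) = c *\<^sub>R q x" for c x
    using sublinear_scale[OF q, of "\<bar>c\<bar>" x] neg[of "c *\<^sub>R x"] by (cases "c \<ge> 0") auto
  with add show ?thesis by (simp add: linear_iff)
qed

text \<open>Hahn-Banach without extension from a subspace: Zorn's lemma for the reversed order gives
  a minimal sublinear functional below \<open>p\<close>, and minimal ones are linear.\<close>

lemma linear_below_sublinear:
  assumes p: "sublinear p"
  shows "\<exists>f. linear f \<and> f \<le> p"
proof -
  define A where "A = {q. sublinear q \<and> q \<le> p}"
  let ?P = "\<lambda>a b :: 'a \<Rightarrow> real. b \<le> a"
  have "\<exists>m\<in>A. \<forall>a\<in>A. ?P m a \<longrightarrow> a = m"
  proof (rule predicate_Zorn)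
    show "partial_order_on A (relation_of ?P A)"
      by (rule partial_order_on_relation_ofI) auto
    fix C assume C: "C \<in> Chains (relation_of ?P A)"
    have CA: "C \<subseteq> A" using C by (auto simp: Chains_def relation_of_def)
    have tot: "a \<le> b \<or> b \<le> a" if "a \<in> C" "b \<in> C" for a b
      using C that by (auto simp: Chains_def relation_of_def)
    show "\<exists>u\<in>A. \<forall>a\<in>C. ?P a u"
    proof (cases "C = {}")
      case True
      with p show ?thesis by (auto simp: A_def)
    next
      case False
      define u where "u = (\<lambda>x. INF q\<in>C. q x)"
      have bdd: "bdd_below ((\<lambda>q. q x) ` C)" for x
      proof (rule bdd_belowI2)
        fix q assume "q \<in> C"
        then have "sublinear q" "q (- x) \<le> p (- x)" using CA by (auto simp: A_def le_fun_def)
        then show "- p (- x) \<le> q x" using sublinear_neg[of q x] by simp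
      qed
      have lower: "u x \<le> q x" if "q \<in> C" for q x
        unfolding u_def by (rule cINF_lower[OF bdd that])
      have greatest: "a \<le> u x" if "\<And>q. q \<in> C \<Longrightarrow> a \<le> q x" for a x
        unfolding u_def using False that by (intro cINF_greatest) auto
      have sub: "sublinear q" if "q \<in> C" for q using that CA by (auto simp: A_def)
      have "sublinear u"
      proof (rule sublinearI)
        fix x y
        \<comment> \<open>One of \<open>q1\<close>, \<open>q2\<close> lies below the other, and the
          subadditivity of the smaller one suffices.\<close>
        have *: "u (x + y) \<le> q1 x + q2 y" if "q1 \<in> C" "q2 \<in> C" for q1 q2
        proof -
          have 1: "u (x + y) \<le> q1 x + q1 y"
            using lower[OF that(1), of "x + y"] sublinear_add[OF sub[OF that(1)], of x y] by linarith
          have 2: "u (x + y) \<le> q2 x + q2 y"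
            using lower[OF that(2), of "x + y"] sublinear_add[OF sub[OF that(2)], of x y] by linarith
          show ?thesis using tot[OF that] 1 2 by (auto simp: le_fun_def) (smt (verit))+
        qed
        have "u (x + y) - u x \<le> u y"
        proof (rule greatest)
          fix q2 assume q2: "q2 \<in> C"
          have "u (x + y) - q2 y \<le> u x" using *[OF _ q2] by (intro greatest) (simp add: algebra_simps)
          then show "u (x + y) - u x \<le> q2 y" by simp
        qed
        then show "u (x + y) \<le> u x + u y" by simp
      next
        show "u 0 = 0" using False by (simp add: u_def sublinear_0[OF sub])
      next
        fix c :: real and x assume c: "c > 0"
        have "inverse c * u (c *\<^sub>R x) \<le> u x"
        proof (rule greatest)
          fix q assume q: "q \<in> C"
          have "u (c *\<^sub>R x) \<le> c * q x"
            using lower[OF q, of "c *\<^sub>R x"] sublinear_scale[OF sub[OF q], of c x] c by simp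
          then show "inverse c * u (c *\<^sub>R x) \<le> q x" using c by (simp add: field_simps)
        qed
        then show "u (c *\<^sub>R x) \<le> c * u x" using c by (simp add: field_simps)
      qed
      moreover have "u \<le> p"
      proof -
        obtain q where "q \<in> C" using False by auto
        then have "u x \<le> q x" "q x \<le> p x" for x using lower[of q] CA by (auto simp: A_def le_fun_def)
        then show ?thesis unfolding le_fun_def by (blast intro: order_trans)
      qed
      ultimately have "u \<in> A" by (simp add: A_def)
      then show ?thesis using lower by (auto simp: le_fun_def)
    qed
  qed
  then obtain m where m: "m \<in> A" "\<And>a. a \<in> A \<Longrightarrow> a \<le> m \<Longrightarrow> a = m" by auto
  have "linear m"
  proof (rule sublinear_minimal_imp_linear)
    show "sublinear m" using m by (simp add: A_def)
    fix r assume "sublinear r" "r \<le> m"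
    then show "r = m" using m by (auto simp: A_def)
  qed
  then show ?thesis using m by (auto simp: A_def)
qed

text \<open>The shift of the norm in direction \<open>z\<close> builds the desired value at
  \<open>z\<close> into the majorant, so any linear functional below it is norming.\<close>

lemma norming_functional:
  fixes z :: "'a::real_normed_vector"
  shows "\<exists>x' :: 'a \<Rightarrow>\<^sub>L real. norm x' \<le> 1 \<and> blinfun_apply x' z = norm z"
proof -
  have n: "sublinear (norm :: 'a \<Rightarrow> real)"
    by (auto simp: sublinear_def norm_triangle_ineq)
  obtain f where f: "linear f" "f \<le> sublinear_shift norm z"
    using linear_below_sublinear[OF sublinear_sublinear_shift[OF n]] by blast
  have le: "f x \<le> norm x" for x
    using f(2) sublinear_shift_le[OF n, of 0 z x] by (auto simp: le_fun_def intro: order_trans)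
  have neg: "f (- x) = - f x" for x using f(1) by (rule linear_neg)
  have abs: "\<bar>f x\<bar> \<le> norm x" for x
    using le[of x] le[of "- x"] neg[of x] by simp
  have "f (- z) \<le> - norm z"
    using f(2) sublinear_shift_le[OF n, of 1 z "- z"] by (auto simp: le_fun_def intro: order_trans)
  with le[of z] neg[of z] have fz: "f z = norm z" by simp
  have bl: "bounded_linear f"
    using f(1) abs by (intro bounded_linear_intro[where K = 1]) (auto simp: linear_iff)
  have "norm (Blinfun f) \<le> 1"
    by (rule norm_blinfun_bound) (use abs bl in \<open>auto simp: bounded_linear_Blinfun_apply\<close>)
  then show ?thesis using fz bl by (intro exI[of _ "Blinfun f"]) (simp add: bounded_linear_Blinfun_apply)
qed

lemma eq_if_functionals_eq:
  fixes x y :: "'a::real_normed_vector"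
  assumes "\<And>x' :: 'a \<Rightarrow>\<^sub>L real. blinfun_apply x' x = blinfun_apply x' y"
  shows "x = y"
proof -
  obtain x' :: "'a \<Rightarrow>\<^sub>L real" where "blinfun_apply x' (x - y) = norm (x - y)"
    using norming_functional by blast
  with assms[of x'] show ?thesis by (simp add: blinfun.bilinear_simps)
qed

section \<open>Riesz representation and weak closures of subspaces\<close>

lemma quadratic_nonneg_imp_discriminant:
  fixes b D e :: real
  assumes "\<And>s. 0 \<le> e + 2 * s * D + s\<^sup>2 * b" "b \<ge> 0"
  shows "D\<^sup>2 \<le> e * b"
proof (cases "b = 0")
  case True
  have "D = 0"
  proof (rule ccontr)
    assume "D \<noteq> 0"
    \<comment> \<open>This \<open>s\<close> makes the affine function e + 2 s D equal to -1.\<close>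
    then show False using assms(1)[of "- (e + 1) / (2 * D)"] True by (simp add: field_simps)
  qed
  with True show ?thesis by simp
next
  case False
  then have "b > 0" using assms(2) by simp
  then show ?thesis using assms(1)[of "- D / b"] by (simp add: field_simps power2_eq_square)
qed

text \<open>
  The Riesz representation theorem for a semi-inner product that need not be complete: the
  representing element is replaced by a minimising sequence of \<open>B v v - 2 l v\<close>.
\<close>

lemma riesz_sequence:
  fixes B :: "'v::real_vector \<Rightarrow> 'v \<Rightarrow> real"
  assumes B: "bilinear B" and sym: "\<And>x y. B x y = B y x" and pos: "\<And>x. B x x \<ge> 0"
    and V: "subspace V" and l: "linear l" and bd: "\<And>v. v \<in> V \<Longrightarrow> (l v)\<^sup>2 \<le> K * B v v"
  shows "\<exists>v. (\<forall>n :: nat. v n \<in> V) \<and>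
    (\<forall>e>0. \<exists>N. \<forall>m\<ge>N. \<forall>n\<ge>N. B (v m - v n) (v m - v n) < e) \<and>
    (\<forall>u\<in>V. (\<lambda>n. B (v n) u) \<longlonglongrightarrow> l u)"
proof -
  define J where "J = (\<lambda>v. B v v - 2 * l v)"
  note bil = bilinear_ladd[OF B] bilinear_radd[OF B] bilinear_lmul[OF B] bilinear_rmul[OF B]
    bilinear_lsub[OF B] bilinear_rsub[OF B]
  note lin = linear_add[OF l] linear_diff[OF l] linear_scale[OF l]
  \<comment> \<open>Arithmetic-geometric mean: |l v| <= sqrt (|K| B v v) <= (|K| + B v v) /
    2.\<close>
  have J_ge: "- \<bar>K\<bar> \<le> J v" if "v \<in> V" for v
  proof -
    have "(l v)\<^sup>2 \<le> \<bar>K\<bar> * B v v"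
      using bd[OF that] pos[of v] by (meson abs_ge_self mult_right_mono order_trans)
    also have "\<dots> \<le> ((\<bar>K\<bar> + B v v) / 2)\<^sup>2"
      using zero_le_power2[of "\<bar>K\<bar> - B v v"] by (simp add: power2_eq_square algebra_simps)
    finally have "\<bar>l v\<bar> \<le> (\<bar>K\<bar> + B v v) / 2"
      using pos[of v] by (simp add: abs_le_square_iff[symmetric])
    then show ?thesis by (simp add: J_def)
  qed
  then have bdd: "bdd_below (J ` V)" by (intro bdd_belowI2)
  define d where "d = (INF v\<in>V. J v)"
  have d_le: "d \<le> J v" if "v \<in> V" for v unfolding d_def by (rule cINF_lower[OF bdd that])
  have "\<exists>v\<in>V. J v < d + inverse (real (Suc n))" for n
  proof -
    have "V \<noteq> {}" using V subspace_0 by blast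
    then show ?thesis using cINF_less_iff[OF _ bdd, of "d + inverse (real (Suc n))"]
      unfolding d_def by simp
  qed
  then obtain v where v: "\<And>n. v n \<in> V" "\<And>n. J (v n) < d + inverse (real (Suc n))" by metis
  \<comment> \<open>Parallelogram identity for \<open>J\<close>: the midpoint cannot fall below the
    infimum, so a minimising sequence is Cauchy for the seminorm of \<open>B\<close>.\<close>
  have par: "B (v m - v n) (v m - v n) < 2 * inverse (real (Suc m)) + 2 * inverse (real (Suc n))"
    for m n
  proof -
    have "(1/2) *\<^sub>R (v m + v n) \<in> V"
      using V v by (intro subspace_scale subspace_add) auto
    from d_le[OF this] have "d \<le> J ((1/2) *\<^sub>R (v m + v n))" .
    moreover have "B (v m - v n) (v m - v n) =
        2 * J (v m) + 2 * J (v n) - 4 * J ((1/2) *\<^sub>R (v m + v n))"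
      unfolding J_def by (simp add: bil lin sym[of "v n" "v m"] algebra_simps)
    ultimately show ?thesis using v(2)[of m] v(2)[of n] by linarith
  qed
  have "\<exists>N. \<forall>m\<ge>N. \<forall>n\<ge>N. B (v m - v n) (v m - v n) < e" if "e > 0" for e
  proof -
    obtain N where N: "inverse (real (Suc N)) < e / 4"
      using reals_Archimedean[of "e / 4"] \<open>e > 0\<close> by auto
    have *: "inverse (real (Suc n)) \<le> inverse (real (Suc N))" if "n \<ge> N" for n
      using that by (intro le_imp_inverse_le) auto
    have "B (v m - v n) (v m - v n) < e" if "m \<ge> N" "n \<ge> N" for m n
      using par[of m n] N *[OF that(1)] *[OF that(2)] by linarith
    then show ?thesis by blast
  qed
  moreover have "(\<lambda>n. B (v n) u) \<longlonglongrightarrow> l u" if u: "u \<in> V" for u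
  proof -
    \<comment> \<open>A quantitative first-order condition. \<open>J (v n)\<close> exceeds the
      infimum by less than 1/(n+1), so along the direction \<open>u\<close> the quadratic polynomial
      stays nonnegative once this gap is added, and its discriminant bounds the defect.\<close>
    have D: "(B (v n) u - l u)\<^sup>2 \<le> inverse (real (Suc n)) * B u u" for n
    proof (rule quadratic_nonneg_imp_discriminant[OF _ pos])
      fix s
      have "v n + s *\<^sub>R u \<in> V" using V v u by (intro subspace_scale subspace_add) auto
      from d_le[OF this] have "d \<le> J (v n + s *\<^sub>R u)" .
      moreover have "J (v n + s *\<^sub>R u) = J (v n) + 2 * s * (B (v n) u - l u) + s\<^sup>2 * B u u"
        unfolding J_def by (simp add: bil lin sym[of u "v n"] algebra_simps power2_eq_square)
      ultimately show "0 \<le> inverse (real (Suc n)) + 2 * s * (B (v n) u - l u) + s\<^sup>2 * B u u"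
        using v(2)[of n] by linarith
    qed
    have "(\<lambda>n. (B (v n) u - l u)\<^sup>2) \<longlonglongrightarrow> 0"
    proof (rule tendsto_sandwich[OF _ _ tendsto_const])
      show "(\<lambda>n. inverse (real (Suc n)) * B u u) \<longlonglongrightarrow> 0"
        using tendsto_mult_right[OF LIMSEQ_inverse_real_of_nat, of "B u u"] by simp
    qed (use D in auto)
    then have "(\<lambda>n. B (v n) u - l u) \<longlonglongrightarrow> 0" by simp
    then show ?thesis by (simp add: LIM_zero_iff)
  qed
  ultimately show ?thesis using v(1) by blast
qed

lemma bilinear_inner: "bilinear (inner :: 'a::real_inner \<Rightarrow> 'a \<Rightarrow> real)"
  by (simp add: bilinear_def linear_iff inner_add_left inner_add_right)

lemma riesz_subspace:
  fixes V :: "'h::{real_inner,complete_space} set"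
  assumes V: "subspace V" and l: "linear l" and bd: "\<And>v. v \<in> V \<Longrightarrow> \<bar>l v\<bar> \<le> K * norm v"
  shows "\<exists>b\<in>closure V. \<forall>v\<in>V. inner b v = l v"
proof -
  have "(l v)\<^sup>2 \<le> K\<^sup>2 * inner v v" if "v \<in> V" for v
    using power_mono[OF bd[OF that] abs_ge_zero, of 2]
    by (simp add: power_mult_distrib power2_norm_eq_inner)
  from riesz_sequence[OF bilinear_inner inner_commute inner_ge_zero V l this]
  obtain v where v: "\<And>n :: nat. v n \<in> V"
    and C: "\<And>e. e > 0 \<Longrightarrow> \<exists>N. \<forall>m\<ge>N. \<forall>n\<ge>N. inner (v m - v n) (v m - v n) < e"
    and lim: "\<And>u. u \<in> V \<Longrightarrow> (\<lambda>n. inner (v n) u) \<longlonglongrightarrow> l u" by blast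
  have "Cauchy v"
  proof (rule CauchyI)
    fix e :: real assume "e > 0"
    then obtain N where N: "\<forall>m\<ge>N. \<forall>n\<ge>N. inner (v m - v n) (v m - v n) < e\<^sup>2"
      using C[of "e\<^sup>2"] by auto
    have "norm (v m - v n) < e" if "m \<ge> N" "n \<ge> N" for m n
      using N that \<open>e > 0\<close> by (auto simp: norm_eq_sqrt_inner real_less_lsqrt)
    then show "\<exists>M. \<forall>m\<ge>M. \<forall>n\<ge>M. norm (v m - v n) < e" by blast
  qed
  then obtain b where b: "v \<longlonglongrightarrow> b" by (auto simp: Cauchy_convergent_iff convergent_def)
  have "inner b u = l u" if "u \<in> V" for u
    using LIMSEQ_unique[OF tendsto_inner[OF b tendsto_const[of u]] lim[OF that]] by simp
  moreover have "b \<in> closure V" using v b by (auto simp: closure_sequential)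
  ultimately show ?thesis by blast
qed

text \<open>Mazur's theorem for subspaces. The Riesz representative \<open>b\<close> of
  \<open>inner y\<close> on \<open>V\<close> is the projection of \<open>y\<close>; the difference y
  - b annihilates \<open>V\<close>, hence both the weak limit \<open>y\<close> and the norm limit
  \<open>b\<close>, hence itself.\<close>

lemma weak_limit_in_closure:
  fixes V :: "'h::{real_inner,complete_space} set"
  assumes V: "subspace V" and v: "\<And>n :: nat. v n \<in> V"
    and lim: "\<And>b. (\<lambda>n. inner (v n) b) \<longlonglongrightarrow> inner y b"
  shows "y \<in> closure V"
proof -
  have "linear (inner y)" by (simp add: linear_iff inner_add_right)
  from riesz_subspace[OF V this Cauchy_Schwarz_ineq2]
  obtain b where b: "b \<in> closure V" "\<And>v. v \<in> V \<Longrightarrow> inner b v = inner y v" by blast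
  have perp: "inner v (y - b) = 0" if "v \<in> V" for v
    using b(2)[OF that] by (simp add: inner_diff_right inner_commute)
  have 1: "inner y (y - b) = 0"
    using lim[of "y - b"] v perp LIMSEQ_unique[OF _ tendsto_const] by (simp add: perp LIMSEQ_const_iff)
  obtain s where s: "\<And>n :: nat. s n \<in> V" "s \<longlonglongrightarrow> b"
    using b(1) by (auto simp: closure_sequential)
  have "(\<lambda>n. inner (s n) (y - b)) \<longlonglongrightarrow> inner b (y - b)"
    by (intro tendsto_inner s tendsto_const)
  then have 2: "inner b (y - b) = 0" by (simp add: perp s(1) LIMSEQ_const_iff)
  have "inner (y - b) (y - b) = 0" using 1 2 by (simp only: inner_diff_left)
  then show ?thesis using b by simp
qed

text \<open>
  Uniform boundedness principle by a gliding hump (after Sokal). A metric instead of a norm is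
  used because the functions in \<^const>\<open>L2\<close> do not form a type.
\<close>

lemma gliding_hump:
  fixes d :: "'v \<Rightarrow> 'v \<Rightarrow> real" and p :: "nat \<Rightarrow> 'v \<Rightarrow> real"
  assumes ne: "V \<noteq> {}" 
    and tri: "\<And>x y z. x \<in> V \<Longrightarrow> y \<in> V \<Longrightarrow> z \<in> V \<Longrightarrow> d x z \<le> d x y + d y z"
    and sym: "\<And>x y. d x y = d y x" and refl: "\<And>x. d x x = 0"
    and complete: "\<And>x. (\<And>n :: nat. x n \<in> V) \<Longrightarrow>
      (\<And>e. e > 0 \<Longrightarrow> \<exists>M. \<forall>m\<ge>M. \<forall>n\<ge>M. d (x m) (x n) < e) \<Longrightarrow> \<exists>y\<in>V. (\<lambda>n. d (x n) y) \<longlonglongrightarrow> 0"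
    and lip: "\<And>n x y. x \<in> V \<Longrightarrow> y \<in> V \<Longrightarrow> p n x \<le> p n y + L n * d x y"
    and hump: "\<And>n x r. x \<in> V \<Longrightarrow> r > 0 \<Longrightarrow> \<exists>y\<in>V. d x y \<le> r \<and> p n y \<ge> 3 / 4 * r * L n"
    and L: "\<And>n. L n \<ge> 4 ^ n"
  shows "\<exists>x\<in>V. filterlim (\<lambda>n. p n x) at_top sequentially"
proof -
  obtain x0 where x0: "x0 \<in> V" using ne by blast
  have "\<exists>h. \<forall>n x. x \<in> V \<longrightarrow> h n x \<in> V \<and> d x (h n x) \<le> (1/3) ^ n \<and> p n (h n x) \<ge> 3 / 4 * (1/3) ^ n * L n"
    using hump by (intro choice allI) (metis zero_less_power zero_less_divide_1_iff zero_less_numeral)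
  then obtain h where h: "\<And>n x. x \<in> V \<Longrightarrow> h n x \<in> V" "\<And>n x. x \<in> V \<Longrightarrow> d x (h n x) \<le> (1/3) ^ n"
    "\<And>n x. x \<in> V \<Longrightarrow> p n (h n x) \<ge> 3 / 4 * (1/3) ^ n * L n" by blast
  define x where "x = rec_nat (h 0 x0) (\<lambda>n y. h (Suc n) y)"
  have xS: "x (Suc n) = h (Suc n) (x n)" for n by (simp add: x_def)
  have xV: "x n \<in> V" for n by (induction n) (use x0 h(1) in \<open>auto simp: x_def\<close>)
  have p: "p n (x n) \<ge> 3 / 4 * (1/3) ^ n * L n" for n
  proof (cases n)
    case 0 then show ?thesis using h(3)[OF x0, of 0] by (simp add: x_def)
  next
    case (Suc k) then show ?thesis using h(3)[OF xV[of k], of "Suc k"] by (simp add: xS)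
  qed
  have step: "d (x n) (x (Suc n)) \<le> (1/3) ^ Suc n" for n
    using h(2)[OF xV, of n "Suc n"] by (simp add: xS)
  have dist: "d (x n) (x (n + k)) \<le> (1/3) ^ n / 2 - (1/3) ^ (n + k) / 2" for n k
  proof (induction k)
    case 0 then show ?case by (simp add: refl)
  next
    case (Suc k)
    have "d (x n) (x (n + Suc k)) \<le> d (x n) (x (n + k)) + d (x (n + k)) (x (Suc (n + k)))"
      using tri[OF xV xV xV] by simp
    then show ?case using Suc step[of "n + k"] by simp
  qed
  have dist': "d (x n) (x m) \<le> (1/3) ^ n / 2" if "m \<ge> n" for m n
  proof -
    have "d (x n) (x m) \<le> (1/3) ^ n / 2 - (1/3) ^ m / 2" using dist[of n "m - n"] that by simp
    moreover have "(0::real) \<le> (1/3) ^ m" by simp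
    ultimately show ?thesis by linarith
  qed
  have "\<exists>y\<in>V. (\<lambda>n. d (x n) y) \<longlonglongrightarrow> 0"
  proof (rule complete[OF xV])
    fix e :: real assume "e > 0"
    then obtain M where M: "(1/3::real) ^ M < e" using real_arch_pow_inv[of e "1/3"] by auto
    have "d (x m) (x n) < e" if "m \<ge> M" "n \<ge> M" for m n
      using tri[OF xV[of m] xV[of M] xV[of n]] dist'[OF that(1)] dist'[OF that(2)] sym[of "x m" "x M"] M
      by linarith
    then show "\<exists>M. \<forall>m\<ge>M. \<forall>n\<ge>M. d (x m) (x n) < e" by blast
  qed
  then obtain y where y: "y \<in> V" "(\<lambda>n. d (x n) y) \<longlonglongrightarrow> 0" by blast
  have dy: "d (x n) y \<le> (1/3) ^ n / 2" for n
  proof -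
    have "d (x n) y \<le> (1/3) ^ n / 2 + d (x m) y" if "m \<ge> n" for m
      using tri[OF xV xV y(1), of n m] dist'[OF that] by linarith
    then have "\<forall>\<^sub>F m in sequentially. d (x n) y \<le> (1/3) ^ n / 2 + d (x m) y"
      by (auto simp: eventually_sequentially)
    moreover have "(\<lambda>m. (1/3) ^ n / 2 + d (x m) y) \<longlonglongrightarrow> (1/3) ^ n / 2 + 0"
      by (intro tendsto_intros y)
    ultimately show ?thesis
      using tendsto_lowerbound[of "\<lambda>m. (1/3) ^ n / 2 + d (x m) y" "(1/3) ^ n / 2 + 0" sequentially]
      by simp
  qed
  \<comment> \<open>The n-th hump yields at least 3/4 of 3^-n \<open>L n\<close>. All later humps
    together move the point by at most 3^-n / 2, which costs at most half of 3^-n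
    \<open>L n\<close>. A quarter remains, and \<open>L n\<close> is at least 4^n.\<close>
  have ge: "(4/3) ^ n / 4 \<le> p n y" for n
  proof -
    have "L n > 0" using L[of n] by (rule less_le_trans[rotated]) simp
    then have "L n * d (x n) y \<le> L n * ((1/3) ^ n / 2)" using dy[of n] by (intro mult_left_mono) auto
    then have "L n * d (x n) y \<le> (1/3) ^ n * L n / 2" by (simp add: mult.commute)
    moreover have "p n (x n) \<ge> 3 * ((1/3) ^ n * L n / 4)" using p[of n] by simp
    ultimately have "p n y \<ge> (1/3) ^ n * L n / 4"
      using lip[OF xV[of n] y(1), of n] by linarith
    moreover have "(1/3) ^ n * L n \<ge> (1/3) ^ n * 4 ^ n" using L by (intro mult_left_mono) auto
    ultimately show ?thesis by (simp add: power_divide)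
  qed
  have "filterlim (\<lambda>n. (4/3::real) ^ n / 4) at_top sequentially" by real_asymp
  then have "filterlim (\<lambda>n. p n y) at_top sequentially"
    by (rule filterlim_at_top_mono) (rule always_eventually, rule allI, rule ge)
  with y(1) show ?thesis by blast
qed


lemma blinfun_almost_norming_vector:
  fixes T :: "'a::real_normed_vector \<Rightarrow>\<^sub>L 'b::real_normed_vector"
  assumes "T \<noteq> 0"
  shows "\<exists>u. norm u \<le> 1 \<and> norm (blinfun_apply T u) \<ge> 3 / 4 * norm T"
proof (rule ccontr)
  assume neg: "\<not> ?thesis"
  have *: "norm (blinfun_apply T u) < 3 / 4 * norm T" if "norm u \<le> 1" for u
    using neg that by (meson not_le_imp_less)
  have "norm T \<le> 3 / 4 * norm T"
  proof (rule norm_blinfun_bound)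
    fix x :: 'a
    show "norm (blinfun_apply T x) \<le> 3 / 4 * norm T * norm x"
    proof (cases "x = 0")
      case False
      have "norm (blinfun_apply T (x /\<^sub>R norm x)) \<le> 3 / 4 * norm T"
        using *[of "x /\<^sub>R norm x"] False by simp
      then show ?thesis using False by (simp add: blinfun.scaleR_right field_simps)
    qed simp
  qed simp
  with assms show False by simp
qed

text \<open>Since 2u = (x + u) - (x - u), at least one of the points x + u and x - u sees the full
  size of \<open>u\<close>. This lets a hump be added around any centre.\<close>

lemma seminorm_hump:
  fixes p :: "'a::real_vector \<Rightarrow> real"
  assumes "\<And>x y. p (x - y) \<le> p x + p y" "\<And>x. p (2 *\<^sub>R x) = 2 * p x"
  shows "p u \<le> p (x + u) \<or> p u \<le> p (x - u)"
proof -
  have "2 *\<^sub>R u = (x + u) - (x - u)" by (simp add: scaleR_2)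
  then have "2 * p u \<le> p (x + u) + p (x - u)"
    using assms(1)[of "x + u" "x - u"] assms(2)[of u] by metis
  then show ?thesis by linarith
qed

section \<open>Strongly continuous semigroups and the weak* generator of the adjoint
  semigroup\<close>

locale c0_semigroup =
  fixes S :: "real \<Rightarrow> 'e::banach \<Rightarrow>\<^sub>L 'e"
  assumes C0: "C0_semigroup S"
begin

lemma S_0 [simp]: "S 0 = id_blinfun"
  and S_add: "s \<ge> 0 \<Longrightarrow> t \<ge> 0 \<Longrightarrow> S (s + t) = S s o\<^sub>L S t"
  and S_lim: "((\<lambda>t. blinfun_apply (S t) x) \<longlongrightarrow> x) (at_right 0)"
  using C0 by (auto simp: C0_semigroup_def)

lemma S_add_apply: "s \<ge> 0 \<Longrightarrow> t \<ge> 0 \<Longrightarrow> S (s + t) x = S s (S t x)"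
  by (simp add: S_add)

text \<open>Otherwise there are times tending to 0 with operator norms above 4^n, and the gliding
  hump produces one vector whose orbit diverges along them, against strong continuity at 0.\<close>

lemma S_bounded_near_0: "\<exists>\<delta>>0. \<exists>M. \<forall>t\<in>{0..\<delta>}. norm (S t) \<le> M"
proof (rule ccontr)
  assume neg: "\<not> ?thesis"
  have *: "\<exists>t\<in>{0..\<delta>}. norm (S t) > M" if "\<delta> > 0" for \<delta> M
    using neg that by (meson not_le_imp_less)
  have "\<exists>t\<in>{0..inverse (real (Suc n))}. norm (S t) > 4 ^ n" for n
    using *[of "inverse (real (Suc n))" "4 ^ n"] by simp
  then obtain t where t: "\<And>n. t n \<in> {0..inverse (real (Suc n))}" "\<And>n. norm (S (t n)) > 4 ^ n"
    by metis
  have "\<exists>x\<in>UNIV. filterlim (\<lambda>n. norm (S (t n) x)) at_top sequentially"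
  proof (rule gliding_hump[where d = "\<lambda>x y. norm (x - y)" and L = "\<lambda>n. norm (S (t n))"])
    show "norm (x - z) \<le> norm (x - y) + norm (y - z)" for x y z :: 'e
      using norm_triangle_ineq[of "x - y" "y - z"] by simp
    show "norm (x - y) = norm (y - x)" for x y :: 'e by (rule norm_minus_commute)
    show "\<exists>y\<in>UNIV. (\<lambda>n. norm (x n - y)) \<longlonglongrightarrow> 0"
      if "\<And>e. e > 0 \<Longrightarrow> \<exists>M. \<forall>m\<ge>M. \<forall>n\<ge>M. norm (x m - x n) < e" for x :: "nat \<Rightarrow> 'e"
    proof -
      have "Cauchy x" using that by (rule CauchyI)
      then obtain y where "x \<longlonglongrightarrow> y" by (auto simp: Cauchy_convergent_iff convergent_def)
      then show ?thesis by (auto simp: LIM_zero_iff tendsto_norm_zero_iff)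
    qed
    show "norm (S (t n) x) \<le> norm (S (t n) y) + norm (S (t n)) * norm (x - y)" for n x y
      using norm_triangle_ineq[of "S (t n) y" "S (t n) (x - y)"] norm_blinfun[of "S (t n)" "x - y"]
      by (simp add: blinfun.diff_right)
    show "\<exists>y\<in>UNIV. norm (x - y) \<le> r \<and> norm (S (t n) y) \<ge> 3 / 4 * r * norm (S (t n))"
      if "r > 0" for n x r
    proof -
      have "S (t n) \<noteq> 0" using t(2)[of n] by (smt (verit) norm_zero zero_less_power)
      then obtain u where u: "norm u \<le> 1" "norm (S (t n) u) \<ge> 3 / 4 * norm (S (t n))"
        using blinfun_almost_norming_vector by blast
      define v where "v = r *\<^sub>R u"
      have v: "norm v \<le> r" "norm (S (t n) v) \<ge> 3 / 4 * r * norm (S (t n))"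
        using u \<open>r > 0\<close> by (auto simp: v_def blinfun.scaleR_right mult_left_le)
      have "norm (S (t n) v) \<le> norm (S (t n) (x + v)) \<or> norm (S (t n) v) \<le> norm (S (t n) (x - v))"
        by (rule seminorm_hump) (auto simp: blinfun.bilinear_simps norm_triangle_ineq4)
      then show ?thesis
      proof
        assume "norm (S (t n) v) \<le> norm (S (t n) (x + v))"
        with v show ?thesis by (intro bexI[of _ "x + v"]) auto
      next
        assume "norm (S (t n) v) \<le> norm (S (t n) (x - v))"
        with v show ?thesis by (intro bexI[of _ "x - v"]) auto
      qed
    qed
    show "4 ^ n \<le> norm (S (t n))" for n using t(2)[of n] by simp
  qed auto
  then obtain x where x: "filterlim (\<lambda>n. norm (S (t n) x)) at_top sequentially" by blast
  have "(\<lambda>n. S (t n) x) \<longlonglongrightarrow> x"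
  proof -
    have t0: "t \<longlonglongrightarrow> 0"
      by (rule tendsto_sandwich[OF _ _ tendsto_const LIMSEQ_inverse_real_of_nat])
        (use t(1) in auto)
    have pos: "t n > 0 \<or> S (t n) x = x" for n
      using t(1)[of n] by (cases "t n = 0") auto
    define f where "f = (\<lambda>t. if t = 0 then x else S t x)"
    have "((\<lambda>t. S t x) \<longlongrightarrow> x) (at 0 within {0..})"
      using S_lim[of x] by (simp add: at_within_Ici_at_right)
    then have "continuous_on {0..} f \<or> continuous (at 0 within {0..}) f"
      by (intro disjI2) (auto simp: continuous_within f_def intro: Lim_transform_within[of "\<lambda>t. S t x" _ _ _ 1])
    then have "continuous (at 0 within {0..}) (\<lambda>t. S t x)"
      using S_lim[of x] by (simp add: continuous_within at_within_Ici_at_right)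
    then show ?thesis using t0 t(1) by (simp add: continuous_within_sequentially o_def)
  qed
  then have "(\<lambda>n. norm (S (t n) x)) \<longlonglongrightarrow> norm x" by (rule tendsto_norm)
  with x show False using not_tendsto_and_filterlim_at_infinity[of sequentially] 
    filterlim_at_top_imp_at_infinity by (metis trivial_limit_sequentially)
qed

lemma S_bounded: "\<exists>M>0. \<forall>t\<in>{0..N}. norm (S t) \<le> M"
proof -
  obtain \<delta> M where \<delta>: "\<delta> > 0" "\<And>t. t \<in> {0..\<delta>} \<Longrightarrow> norm (S t) \<le> M" using S_bounded_near_0 by blast
  have "\<exists>K. \<forall>t\<in>{0..real n * \<delta>}. norm (S t) \<le> K" for n
  proof (induction n)
    case 0
    show ?case by (intro exI[of _ "norm (S 0)"]) auto
  next
    case (Suc n)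
    then obtain K where K: "\<And>t. t \<in> {0..real n * \<delta>} \<Longrightarrow> norm (S t) \<le> K" by blast
    show ?case
    proof (intro exI ballI)
      fix t assume t: "t \<in> {0..real (Suc n) * \<delta>}"
      show "norm (S t) \<le> max K (M * K)"
      proof (cases "t \<le> real n * \<delta>")
        case True then show ?thesis using K[of t] t by auto
      next
        case False
        have n: "real n * \<delta> \<ge> 0" using \<delta>(1) by simp
        have "S t = S (t - real n * \<delta>) o\<^sub>L S (real n * \<delta>)"
          using S_add[of "t - real n * \<delta>" "real n * \<delta>"] False n by simp
        also have "norm \<dots> \<le> norm (S (t - real n * \<delta>)) * norm (S (real n * \<delta>))"
          by (rule norm_blinfun_compose)
        also have "\<dots> \<le> M * K"
        proof (intro mult_mono)
          show "norm (S (t - real n * \<delta>)) \<le> M"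
            using False t by (intro \<delta>(2)) (auto simp: algebra_simps)
          show "norm (S (real n * \<delta>)) \<le> K" using n by (intro K) auto
          show "0 \<le> M" using \<delta>(2)[of 0] \<delta>(1) order_trans[OF norm_ge_zero, of "S 0" M] by simp
        qed simp
        finally show ?thesis by simp
      qed
    qed
  qed
  moreover obtain n :: nat where "N / \<delta> \<le> real n" using real_arch_simple by blast
  ultimately obtain K where K: "\<And>t. t \<in> {0..real n * \<delta>} \<Longrightarrow> norm (S t) \<le> K" by blast
  have "norm (S t) \<le> max 1 K" if "t \<in> {0..N}" for t
  proof -
    have "N \<le> real n * \<delta>" using \<open>N / \<delta> \<le> real n\<close> \<delta>(1) by (simp add: field_simps)
    then have "t \<in> {0..real n * \<delta>}" using that by auto
    from K[OF this] show ?thesis by simp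
  qed
  then show ?thesis by (intro exI[of _ "max 1 K"]) auto
qed

text \<open>For both one-sided limits the operator at the smaller of the two times is factored out,
  which leaves the convergence at 0 and a locally uniform bound.\<close>

lemma S_continuous: "continuous_on {0..} (\<lambda>t. S t x)"
  unfolding continuous_on_def
proof
  fix t :: real assume t: "t \<in> {0..}"
  obtain M where M: "M > 0" "\<And>s. s \<in> {0..t+1} \<Longrightarrow> norm (S s) \<le> M" using S_bounded by blast
  have "((\<lambda>t. S t x) \<longlongrightarrow> x) (at 0 within {0..})"
    using S_lim[of x] by (simp add: at_within_Ici_at_right)
  then have c: "continuous (at 0 within {0..}) (\<lambda>t. S t x)" by (simp add: continuous_within)
  have "((\<lambda>s. S \<bar>s - t\<bar> x) \<longlongrightarrow> S 0 x) (at t within {0..})"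
  proof (rule continuous_within_tendsto_compose[OF c])
    show "((\<lambda>s. \<bar>s - t\<bar>) \<longlongrightarrow> 0) (at t within {0..})" by (auto intro!: tendsto_eq_intros)
  qed auto
  from tendsto_mult_left[OF tendsto_norm[OF tendsto_diff[OF this tendsto_const[of x]]], of M]
  have "((\<lambda>s. M * norm (S \<bar>s - t\<bar> x - x)) \<longlongrightarrow> M * norm (S 0 x - x)) (at t within {0..})" .
  then have lim: "((\<lambda>s. M * norm (S \<bar>s - t\<bar> x - x)) \<longlongrightarrow> 0) (at t within {0..})" by simp
  have "norm (S s x - S t x) \<le> M * norm (S \<bar>s - t\<bar> x - x)" if s: "s \<in> {0..t+1}" for s
  proof -
    have "norm (S (u + v) x - S u x) \<le> M * norm (S v x - x)" if "u \<in> {0..t+1}" "v \<ge> 0" for u v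
    proof -
      have "S (u + v) x - S u x = S u (S v x - x)"
        using that by (simp add: S_add_apply blinfun.diff_right)
      also have "norm \<dots> \<le> norm (S u) * norm (S v x - x)" by (rule norm_blinfun)
      also have "\<dots> \<le> M * norm (S v x - x)" using that M by (intro mult_right_mono) auto
      finally show ?thesis .
    qed
    from this[of t "s - t"] this[of s "t - s"] show ?thesis
      using s t by (cases "s \<ge> t") (auto simp: norm_minus_commute)
  qed
  moreover have "\<forall>\<^sub>F s in at t within {0..}. s \<in> {0..t+1}"
    using eventually_at_ball[of 1 t "{0..}"] by (rule eventually_mono) (auto simp: dist_real_def)
  ultimately have "\<forall>\<^sub>F s in at t within {0..}. norm (S s x - S t x) \<le> M * norm (S \<bar>s - t\<bar> x - x)"
    by (auto elim: eventually_mono)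
  then have "((\<lambda>s. S s x - S t x) \<longlongrightarrow> 0) (at t within {0..})"
    by (rule Lim_null_comparison[OF _ lim])
  then show "((\<lambda>s. S s x) \<longlongrightarrow> S t x) (at t within {0..})" by (simp add: LIM_zero_iff)
qed

lemma functional_continuous: "continuous_on {0..} (\<lambda>t. blinfun_apply x' (S t x))"
  by (intro continuous_intros S_continuous)

lemma functional_integrable [simp]:
  assumes "a \<ge> 0" shows "(\<lambda>t. blinfun_apply x' (S t x) :: real) integrable_on {a..b}"
  using assms by (intro integrable_continuous_interval continuous_on_subset[OF functional_continuous]) auto

text \<open>A weak* integral of the adjoint orbit: r -> z' o S r need be neither norm continuous nor
  strongly measurable, so the integral is taken pointwise in x.\<close>

definition integrated_functional :: "real \<Rightarrow> ('e \<Rightarrow>\<^sub>L real) \<Rightarrow> 'e \<Rightarrow>\<^sub>L real" where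
  "integrated_functional N z' = Blinfun (\<lambda>x. integral {0..N} (\<lambda>r. z' (S r x)))"

lemma integrated_functional_bound:
  assumes "N \<ge> 0" "\<And>t. t \<in> {0..N} \<Longrightarrow> norm (S t) \<le> M"
  shows "\<bar>integral {0..N} (\<lambda>r. blinfun_apply z' (S r x))\<bar> \<le> N * M * norm z' * norm x"
proof -
  have "norm (blinfun_apply z' (S r x)) \<le> norm z' * (M * norm x)" if "r \<in> {0..N}" for r
  proof -
    have "norm (blinfun_apply z' (S r x)) \<le> norm z' * norm (S r x)" by (rule norm_blinfun)
    also have "norm (S r x) \<le> norm (S r) * norm x" by (rule norm_blinfun)
    also have "\<dots> \<le> M * norm x" using assms that by (intro mult_right_mono) auto
    finally show ?thesis by (simp add: mult_left_mono)
  qed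
  then have "norm (integral {0..N} (\<lambda>r. blinfun_apply z' (S r x))) \<le> norm z' * (M * norm x) * (N - 0)"
    using assms(1) by (intro integral_bound continuous_on_subset[OF functional_continuous]) auto
  then show ?thesis by (simp add: mult_ac)
qed

lemma integrated_functional_apply:
  assumes "N \<ge> 0"
  shows "integrated_functional N z' x = integral {0..N} (\<lambda>r. z' (S r x))"
proof -
  obtain M where M: "\<And>t. t \<in> {0..N} \<Longrightarrow> norm (S t) \<le> M" using S_bounded by blast
  have "bounded_linear (\<lambda>x. integral {0..N} (\<lambda>r. blinfun_apply z' (S r x)))"
  proof (rule bounded_linear_intro[where K = "N * M * norm z'"])
    show "norm (integral {0..N} (\<lambda>r. blinfun_apply z' (S r x))) \<le> norm x * (N * M * norm z')" for x
      using integrated_functional_bound[OF assms M, of z' x] by (simp add: mult_ac)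
  qed (simp_all add: blinfun.bilinear_simps integral_add integral_mult_right)
  then show ?thesis by (simp add: integrated_functional_def bounded_linear_Blinfun_apply)
qed

text \<open>The graph of the weak* generator \<open>A\<^sup>*\<close> of the adjoint semigroup.\<close>

definition adjoint_generator :: "('e \<Rightarrow>\<^sub>L real) \<Rightarrow> ('e \<Rightarrow>\<^sub>L real) \<Rightarrow> bool" where
  "adjoint_generator x' a' \<longleftrightarrow>
     (\<forall>t\<ge>0. \<forall>x. x' (S t x) - x' x = integral {0..t} (\<lambda>r. a' (S r x)))"

lemma adjoint_generator_add:
  "adjoint_generator x' a' \<Longrightarrow> adjoint_generator y' b' \<Longrightarrow> adjoint_generator (x' + y') (a' + b')"
  by (simp add: adjoint_generator_def blinfun.bilinear_simps integral_add algebra_simps)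

lemma adjoint_generator_scaleR:
  "adjoint_generator x' a' \<Longrightarrow> adjoint_generator (c *\<^sub>R x') (c *\<^sub>R a')"
  by (simp add: adjoint_generator_def blinfun.bilinear_simps flip: right_diff_distrib)

lemma adjoint_generator_0: "adjoint_generator 0 0"
  by (simp add: adjoint_generator_def)

lemma adjoint_generator_shift:
  assumes "adjoint_generator x' a'" "s \<ge> 0"
  shows "adjoint_generator (x' o\<^sub>L S s) (a' o\<^sub>L S s)"
  unfolding adjoint_generator_def
proof (intro allI impI)
  fix t :: real and x assume t: "t \<ge> 0"
  have "S s (S r x) = S r (S s x)" if "r \<ge> 0" for r
    using S_add_apply[of s r x] S_add_apply[of r s x] assms(2) that by (simp add: add.commute)
  then show "(x' o\<^sub>L S s) (S t x) - (x' o\<^sub>L S s) x = integral {0..t} (\<lambda>r. (a' o\<^sub>L S s) (S r x))"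
    using assms(1) t by (auto simp: adjoint_generator_def intro!: integral_cong)
qed

text \<open>The weak* form of the rule that an integrated orbit lies in the domain of the generator:
  composing with \<open>S t\<close> moves [0,N] to [t,N+t], and the overlap cancels. It supplies the
  approximants below and later the test functional of the coercivity proof.\<close>

lemma adjoint_generator_integrated:
  assumes "N \<ge> 0"
  shows "adjoint_generator (integrated_functional N z') ((z' o\<^sub>L S N) - z')"
  unfolding adjoint_generator_def
proof (intro allI impI)
  fix t :: real and x assume t: "t \<ge> 0"
  define F where "F = (\<lambda>r. blinfun_apply z' (S r x))"
  have F: "F integrable_on {a..b}" if "a \<ge> 0" for a b
    using that by (simp add: F_def)
  have shift: "integral {0..b} (\<lambda>r. F (r + c)) = integral {c..b + c} F" if "b \<ge> 0" "c \<ge> 0" for b c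
    using integral_shift_Icc_real[of 0 b F c] by (simp add: o_def add.commute)
  have e1: "integral {0..N} (\<lambda>r. z' (S r (S t x))) = integral {t..N + t} F"
  proof -
    have "integral {0..N} (\<lambda>r. z' (S r (S t x))) = integral {0..N} (\<lambda>r. F (r + t))"
      using t by (intro integral_cong) (simp add: F_def S_add_apply)
    then show ?thesis using shift[of N t] assms t by simp
  qed
  have e2: "integral {0..t} (\<lambda>r. ((z' o\<^sub>L S N) - z') (S r x)) = integral {N..t + N} F - integral {0..t} F"
  proof -
    have "integral {0..t} (\<lambda>r. ((z' o\<^sub>L S N) - z') (S r x)) = integral {0..t} (\<lambda>r. F (r + N) - F r)"
      using assms by (intro integral_cong) (simp add: F_def S_add_apply[symmetric] blinfun.diff_left add.commute)
    also have "\<dots> = integral {0..t} (\<lambda>r. F (r + N)) - integral {0..t} F"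
    proof (rule integral_diff[OF _ F])
      have "continuous_on {0..t} (\<lambda>r. F (r + N))"
        unfolding F_def using assms
        by (intro continuous_on_compose2[OF functional_continuous]) (auto intro!: continuous_intros)
      then show "(\<lambda>r. F (r + N)) integrable_on {0..t}" by (rule integrable_continuous_interval)
    qed simp
    finally show ?thesis using shift[of t N] assms t by simp
  qed
  have c1: "integral {0..t} F + integral {t..N + t} F = integral {0..N + t} F"
    using F assms t by (intro Henstock_Kurzweil_Integration.integral_combine) auto
  have c2: "integral {0..N} F + integral {N..t + N} F = integral {0..N + t} F"
    using F assms t by (subst add.commute[of t], intro Henstock_Kurzweil_Integration.integral_combine) auto
  show "integrated_functional N z' (S t x) - integrated_functional N z' x =
      integral {0..t} (\<lambda>r. ((z' o\<^sub>L S N) - z') (S r x))"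
    using e1 e2 c1 c2 by (simp add: integrated_functional_apply[OF assms] F_def)
qed

lemma adjoint_generator_le:
  assumes "adjoint_generator x' a'"
  shows "\<exists>C\<ge>0. \<forall>t\<in>{0..1}. \<forall>x. \<bar>x' (S t x) - x' x\<bar> \<le> t * C * norm x"
proof -
  obtain M where M: "M > 0" "\<And>t. t \<in> {0..1} \<Longrightarrow> norm (S t) \<le> M" using S_bounded by blast
  have "\<bar>x' (S t x) - x' x\<bar> \<le> t * (M * norm a') * norm x" if "t \<in> {0..1}" for t x
    using integrated_functional_bound[of t M a' x] M that assms
    by (auto simp: adjoint_generator_def mult_ac)
  then show ?thesis using M by (intro exI[of _ "M * norm a'"]) auto
qed

lemma adjoint_generator_norm_le:
  assumes "adjoint_generator x' a'"
  shows "\<exists>C\<ge>0. \<forall>t\<in>{0..1}. norm ((x' o\<^sub>L S t) - x') \<le> t * C"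
proof -
  obtain C where C: "C \<ge> 0" "\<And>t x. t \<in> {0..1} \<Longrightarrow> \<bar>x' (S t x) - x' x\<bar> \<le> t * C * norm x"
    using adjoint_generator_le[OF assms] by blast
  then show ?thesis
    by (intro exI[of _ C]) (auto intro!: norm_blinfun_bound simp: blinfun.diff_left)
qed

lemma adjoint_generator_derivative:
  assumes "adjoint_generator x' a'"
  shows "((\<lambda>t. (x' (S t x) - x' x) / t) \<longlongrightarrow> a' x) (at_right 0)"
proof -
  have "((\<lambda>t. integral {0..t} (\<lambda>r. a' (S r x))) has_vector_derivative a' (S 0 x)) (at 0 within {0..1})"
    by (intro integral_has_vector_derivative continuous_on_subset[OF functional_continuous]) auto
  then have "((\<lambda>t. integral {0..t} (\<lambda>r. a' (S r x))) has_real_derivative a' x) (at 0 within {0..1})"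
    by (simp add: has_real_derivative_iff_has_vector_derivative)
  then have "((\<lambda>t. integral {0..t} (\<lambda>r. a' (S r x)) / t) \<longlongrightarrow> a' x) (at 0 within {0..1})"
    by (simp add: has_field_derivative_iff)
  then have "((\<lambda>t. integral {0..t} (\<lambda>r. a' (S r x)) / t) \<longlongrightarrow> a' x) (at_right 0)"
    using at_within_Icc_at_right[of 0 "1::real"] by simp
  then show ?thesis
  proof (rule Lim_transform_eventually)
    show "\<forall>\<^sub>F t in at_right 0. integral {0..t} (\<lambda>r. a' (S r x)) / t = (x' (S t x) - x' x) / t"
      using assms by (auto simp: adjoint_generator_def eventually_at_filter)
  qed
qed

text \<open>On the domain, orbits are locally Lipschitz in the dual norm. This makes the norms of
  i^* S^*(t) x' continuous in t, so that they can be integrated and differentiated.\<close>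

lemma adjoint_generator_continuous:
  assumes "adjoint_generator x' a'"
  shows "continuous_on {0..} (\<lambda>t. x' o\<^sub>L S t)"
  unfolding continuous_on_def
proof
  fix t :: real assume t: "t \<in> {0..}"
  obtain C where C: "C \<ge> 0" "\<And>t. t \<in> {0..1} \<Longrightarrow> norm ((x' o\<^sub>L S t) - x') \<le> t * C"
    using adjoint_generator_norm_le[OF assms] by blast
  obtain M where M: "M > 0" "\<And>s. s \<in> {0..t+1} \<Longrightarrow> norm (S s) \<le> M" using S_bounded by blast
  have *: "norm ((x' o\<^sub>L S s) - (x' o\<^sub>L S t)) \<le> \<bar>s - t\<bar> * C * M" if s: "s \<in> {0..t+1}" "\<bar>s - t\<bar> \<le> 1" for s
  proof -
    have "norm ((x' o\<^sub>L S (v + u)) - (x' o\<^sub>L S u)) \<le> v * C * M"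
      if "u \<in> {0..t+1}" "v \<in> {0..1}" for u v
    proof -
      have "(x' o\<^sub>L S (v + u)) - (x' o\<^sub>L S u) = ((x' o\<^sub>L S v) - x') o\<^sub>L S u"
        using that by (intro blinfun_eqI) (simp add: S_add_apply blinfun.diff_left)
      also have "norm \<dots> \<le> norm ((x' o\<^sub>L S v) - x') * norm (S u)" by (rule norm_blinfun_compose)
      also have "\<dots> \<le> (v * C) * M" using that M C by (intro mult_mono) auto
      finally show ?thesis .
    qed
    from this[of t "s - t"] this[of s "t - s"] show ?thesis
      using s t by (cases "s \<ge> t") (auto simp: norm_minus_commute)
  qed
  have "\<forall>\<^sub>F s in at t within {0..}. s \<in> {0..t+1} \<and> \<bar>s - t\<bar> \<le> 1"
    using eventually_at_ball[of 1 t "{0..}"] by (rule eventually_mono) (auto simp: dist_real_def)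
  then have "\<forall>\<^sub>F s in at t within {0..}. norm ((x' o\<^sub>L S s) - (x' o\<^sub>L S t)) \<le> \<bar>s - t\<bar> * C * M"
    by (rule eventually_mono) (use * in blast)
  then have "((\<lambda>s. (x' o\<^sub>L S s) - (x' o\<^sub>L S t)) \<longlongrightarrow> 0) (at t within {0..})"
    by (rule Lim_null_comparison) (auto intro!: tendsto_eq_intros)
  then show "((\<lambda>s. x' o\<^sub>L S s) \<longlongrightarrow> x' o\<^sub>L S t) (at t within {0..})" by (simp add: LIM_zero_iff)
qed

text \<open>The mean of the adjoint orbit over [0, 1/(n+1)], which lies in the domain of the adjoint
  generator.\<close>

definition approximant :: "nat \<Rightarrow> ('e \<Rightarrow>\<^sub>L real) \<Rightarrow> 'e \<Rightarrow>\<^sub>L real" where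
  "approximant n z' = real (Suc n) *\<^sub>R integrated_functional (inverse (real (Suc n))) z'"

lemma approximant_bounded: "\<exists>C. \<forall>n x. \<bar>approximant n z' x\<bar> \<le> C * norm x"
proof -
  obtain M where M: "\<And>t. t \<in> {0..1} \<Longrightarrow> norm (S t) \<le> M" using S_bounded by blast
  have "\<bar>approximant n z' x\<bar> \<le> M * norm z' * norm x" for n x
  proof -
    define e where "e = inverse (real (Suc n))"
    have e: "0 < e" "e \<le> 1" by (auto simp: e_def field_simps)
    have "\<bar>integral {0..e} (\<lambda>r. z' (S r x))\<bar> \<le> e * M * norm z' * norm x"
      using e M by (intro integrated_functional_bound) auto
    then have "inverse e * \<bar>integral {0..e} (\<lambda>r. z' (S r x))\<bar> \<le> M * norm z' * norm x"
      using e by (simp add: field_simps)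
    then show ?thesis
      using e by (simp add: approximant_def blinfun.scaleR_left integrated_functional_apply e_def abs_mult)
  qed
  then show ?thesis by blast
qed

lemma approximant_tendsto: "(\<lambda>n. approximant n z' x) \<longlonglongrightarrow> z' x"
proof -
  define e where "e = (\<lambda>n :: nat. inverse (real (Suc n)))"
  have e: "e n > 0" "e n \<le> 1" for n by (auto simp: e_def field_simps)
  have e0: "e \<longlonglongrightarrow> 0" unfolding e_def by (rule LIMSEQ_inverse_real_of_nat)
  have "((\<lambda>t. integral {0..t} (\<lambda>r. z' (S r x))) has_vector_derivative z' (S 0 x)) (at 0 within {0..1})"
    by (intro integral_has_vector_derivative continuous_on_subset[OF functional_continuous]) auto
  then have "((\<lambda>t. integral {0..t} (\<lambda>r. z' (S r x))) has_real_derivative z' x) (at 0 within {0..1})"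
    by (simp add: has_real_derivative_iff_has_vector_derivative)
  then have "((\<lambda>t. integral {0..t} (\<lambda>r. z' (S r x)) / t) \<longlongrightarrow> z' x) (at 0 within {0..1})"
    by (simp add: has_field_derivative_iff)
  moreover have "filterlim e (at 0 within {0..1}) sequentially"
    unfolding filterlim_at using e e0 by (auto intro!: always_eventually simp: less_imp_le less_imp_neq[symmetric])
  ultimately have "(\<lambda>n. integral {0..e n} (\<lambda>r. z' (S r x)) / e n) \<longlonglongrightarrow> z' x"
    by (rule filterlim_compose)
  moreover have "approximant n z' x = integral {0..e n} (\<lambda>r. z' (S r x)) / e n" for n
  proof -
    have "approximant n z' x = real (Suc n) * integrated_functional (e n) z' x"
      by (simp only: approximant_def blinfun.scaleR_left e_def real_scaleR_def)
    also have "real (Suc n) = 1 / e n" by (simp add: e_def divide_inverse)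
    finally show ?thesis using e(1)[of n] by (simp add: integrated_functional_apply)
  qed
  ultimately show ?thesis by simp
qed

text \<open>Norm density of the domain can fail. Pointwise convergence with one common constant is
  the form of density that dominated convergence under a Gaussian measure turns into L2
  convergence.\<close>

lemma adjoint_generator_dense:
  fixes z' :: "'e \<Rightarrow>\<^sub>L real"
  shows "\<exists>x' a' C. (\<forall>n :: nat. adjoint_generator (x' n) (a' n)) \<and>
     (\<forall>n x. \<bar>blinfun_apply (x' n) x\<bar> \<le> C * norm x) \<and>
     (\<forall>x. (\<lambda>n. blinfun_apply (x' n) x) \<longlonglongrightarrow> z' x)"
proof -
  define a' where "a' = (\<lambda>n. real (Suc n) *\<^sub>R ((z' o\<^sub>L S (inverse (real (Suc n)))) - z'))"
  have "adjoint_generator (approximant n z') (a' n)" for n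
    unfolding approximant_def a'_def by (intro adjoint_generator_scaleR adjoint_generator_integrated) simp
  moreover obtain C where "\<forall>n x. \<bar>approximant n z' x\<bar> \<le> C * norm x" using approximant_bounded by blast
  ultimately show ?thesis
    using approximant_tendsto by (intro exI[of _ "\<lambda>n. approximant n z'"] exI[of _ a'] exI[of _ C]) blast
qed

text \<open>This cocycle identity later takes the place of Minkowski's integral inequality, which
  the mere weak* integral does not offer directly.\<close>

lemma integrated_functional_add:
  assumes "a \<ge> 0" "b \<ge> 0"
  shows "integrated_functional (a + b) z' = integrated_functional a z' + (integrated_functional b z' o\<^sub>L S a)"
proof (rule blinfun_eqI)
  fix x
  define F where "F = (\<lambda>r. blinfun_apply z' (S r x))"
  have "integral {0..b} (\<lambda>r. z' (S r (S a x))) = integral {0..b} (F \<circ> (+) a)"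
    using assms by (intro integral_cong) (auto simp: F_def S_add_apply[symmetric] add.commute)
  also have "\<dots> = integral {a..a + b} F"
    using integral_shift_Icc_real[of 0 b F a] by (simp add: add.commute)
  finally have 1: "integral {0..b} (\<lambda>r. z' (S r (S a x))) = integral {a..a + b} F" .
  have "integral {0..a} F + integral {a..a + b} F = integral {0..a + b} F"
    using assms by (intro Henstock_Kurzweil_Integration.integral_combine) (auto simp: F_def)
  with 1 show "integrated_functional (a + b) z' x = (integrated_functional a z' + (integrated_functional b z' o\<^sub>L S a)) x"
    using assms by (simp add: blinfun.add_left integrated_functional_apply F_def)
qed

end

section \<open>Square integrable functions\<close>

lemma borel_measurable_strongly_measurable:
  "strongly_measurable M f \<Longrightarrow> f \<in> borel_measurable M"
  unfolding strongly_measurable_def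
  by (blast intro: borel_measurable_LIMSEQ_metric borel_measurable_simple_function)

lemma strongly_measurable_norm:
  "strongly_measurable M f \<Longrightarrow> (\<lambda>x. norm (f x)) \<in> borel_measurable M"
  using measurable_compose[OF borel_measurable_strongly_measurable borel_measurable_norm] .

lemma strongly_measurableI:
  fixes f :: "'a \<Rightarrow> 'b::{real_normed_vector, second_countable_topology}"
  assumes "f \<in> borel_measurable M"
  shows "strongly_measurable M f"
  using borel_measurable_implies_sequence_metric[OF assms, of 0]
  unfolding strongly_measurable_def by blast

lemma strongly_measurable_add:
  assumes "strongly_measurable M f" "strongly_measurable M g"
  shows "strongly_measurable M (\<lambda>x. f x + g x)"
proof -
  obtain s t where s: "\<And>n. simple_function M (s n)" "\<And>x. x \<in> space M \<Longrightarrow> (\<lambda>n. s n x) \<longlonglongrightarrow> f x"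
    and t: "\<And>n. simple_function M (t n)" "\<And>x. x \<in> space M \<Longrightarrow> (\<lambda>n. t n x) \<longlonglongrightarrow> g x"
    using assms unfolding strongly_measurable_def by metis
  show ?thesis
    unfolding strongly_measurable_def
    using s t by (intro exI[of _ "\<lambda>n x. s n x + t n x"])
      (auto intro: simple_function_compose2[where h = "(+)"] tendsto_add)
qed

lemma strongly_measurable_scaleR:
  fixes u :: "'b::real_normed_vector"
  assumes "c \<in> borel_measurable M"
  shows "strongly_measurable M (\<lambda>x. (c x :: real) *\<^sub>R u)"
proof -
  obtain s where s: "\<And>n. simple_function M (s n)" "\<And>x. x \<in> space M \<Longrightarrow> (\<lambda>n. s n x) \<longlonglongrightarrow> c x"
    using strongly_measurableI[OF assms] unfolding strongly_measurable_def by metis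
  show ?thesis
    unfolding strongly_measurable_def
    using s by (intro exI[of _ "\<lambda>n x. s n x *\<^sub>R u"])
      (auto intro: simple_function_compose1[where g = "\<lambda>r. r *\<^sub>R u"] tendsto_intros)
qed

lemma strongly_measurable_uminus:
  assumes "strongly_measurable M f"
  shows "strongly_measurable M (\<lambda>x. - f x)"
proof -
  obtain s where s: "\<And>n. simple_function M (s n)" "\<And>x. x \<in> space M \<Longrightarrow> (\<lambda>n. s n x) \<longlonglongrightarrow> f x"
    using assms unfolding strongly_measurable_def by metis
  show ?thesis
    unfolding strongly_measurable_def
    using s by (intro exI[of _ "\<lambda>n x. - s n x"])
      (auto intro: simple_function_compose1[where g = uminus] tendsto_intros)
qed

lemma strongly_measurable_sum:
  assumes "\<And>j. j \<in> J \<Longrightarrow> strongly_measurable M (f j)"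
  shows "strongly_measurable M (\<lambda>x. \<Sum>j\<in>J. f j x :: 'b::real_normed_vector)"
proof (cases "finite J")
  case True
  then show ?thesis using assms
  proof (induction J)
    case empty
    show ?case
      unfolding strongly_measurable_def by (intro exI[of _ "\<lambda>n x. 0"]) simp
  next
    case (insert j J)
    then show ?case by (auto intro: strongly_measurable_add)
  qed
next
  case False
  then show ?thesis
    unfolding strongly_measurable_def by (intro exI[of _ "\<lambda>n x. 0"]) simp
qed

lemma L2_iff:
  fixes f :: "'a \<Rightarrow> 'b::{real_normed_vector, second_countable_topology}"
  shows "f \<in> L2 M \<longleftrightarrow> f \<in> borel_measurable M \<and> integrable M (\<lambda>x. (norm (f x))\<^sup>2)"
  unfolding L2_def by (auto intro: strongly_measurableI borel_measurable_strongly_measurable)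

lemma L2_integrable: "f \<in> L2 M \<Longrightarrow> integrable M (\<lambda>x. (norm (f x))\<^sup>2)"
  and L2_strongly_measurable: "f \<in> L2 M \<Longrightarrow> strongly_measurable M f"
  and L2_borel: "f \<in> L2 M \<Longrightarrow> f \<in> borel_measurable M"
  unfolding L2_def by (auto intro: borel_measurable_strongly_measurable)

lemma L2_norm: "f \<in> L2 M \<Longrightarrow> (\<lambda>x. norm (f x)) \<in> L2 M"
  by (simp add: L2_iff L2_integrable strongly_measurable_norm L2_strongly_measurable)

lemma L2_add:
  assumes "f \<in> L2 M" "g \<in> L2 M" shows "(\<lambda>x. f x + g x) \<in> L2 M"
proof -
  have sm: "strongly_measurable M (\<lambda>x. f x + g x)"
    using assms by (intro strongly_measurable_add L2_strongly_measurable)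
  have "integrable M (\<lambda>x. (norm (f x + g x))\<^sup>2)"
  proof (rule Bochner_Integration.integrable_bound)
    show "integrable M (\<lambda>x. 2 * (norm (f x))\<^sup>2 + 2 * (norm (g x))\<^sup>2)"
      using assms by (intro Bochner_Integration.integrable_add integrable_mult_right L2_integrable)
    show "(\<lambda>x. (norm (f x + g x))\<^sup>2) \<in> borel_measurable M"
      using strongly_measurable_norm[OF sm] by measurable
    have "(norm (f x + g x))\<^sup>2 \<le> 2 * (norm (f x))\<^sup>2 + 2 * (norm (g x))\<^sup>2" for x
    proof -
      have "(norm (f x + g x))\<^sup>2 \<le> (norm (f x) + norm (g x))\<^sup>2"
        by (intro power_mono norm_triangle_ineq) simp
      also have "\<dots> \<le> 2 * (norm (f x))\<^sup>2 + 2 * (norm (g x))\<^sup>2"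
        using zero_le_power2[of "norm (f x) - norm (g x)"] by (simp add: power2_eq_square algebra_simps)
      finally show ?thesis .
    qed
    then show "AE x in M. norm ((norm (f x + g x))\<^sup>2) \<le> norm (2 * (norm (f x))\<^sup>2 + 2 * (norm (g x))\<^sup>2)"
      by simp
  qed
  with sm show ?thesis by (simp add: L2_def)
qed

lemma L2_uminus: "f \<in> L2 M \<Longrightarrow> (\<lambda>x. - f x) \<in> L2 M"
  by (simp add: L2_def strongly_measurable_uminus)

lemma L2_diff: "f \<in> L2 M \<Longrightarrow> g \<in> L2 M \<Longrightarrow> (\<lambda>x. f x - g x) \<in> L2 M"
  using L2_add[OF _ L2_uminus] by fastforce

lemma L2_mult:
  fixes f :: "'a \<Rightarrow> 'b::{real_normed_div_algebra, second_countable_topology}"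
  shows "f \<in> L2 M \<Longrightarrow> (\<lambda>x. c * f x) \<in> L2 M"
  by (auto simp: L2_iff norm_mult power_mult_distrib)

lemma L2_bounded:
  assumes "finite_measure M" "strongly_measurable M f" "\<And>x. norm (f x) \<le> C"
  shows "f \<in> L2 M"
proof -
  have "integrable M (\<lambda>x. (norm (f x))\<^sup>2)"
  proof (rule finite_measure.integrable_const_bound[OF assms(1), of _ "C\<^sup>2"])
    show "AE x in M. norm ((norm (f x))\<^sup>2) \<le> C\<^sup>2" using assms(3) by (simp add: power_mono)
    show "(\<lambda>x. (norm (f x))\<^sup>2) \<in> borel_measurable M"
      using strongly_measurable_norm[OF assms(2)] by measurable
  qed
  with assms(2) show ?thesis by (simp add: L2_def)
qed

lemma l2norm_nonneg [simp]: "l2norm M f \<ge> 0"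
  by (simp add: l2norm_def)

lemma l2norm_power2: "(l2norm M f)\<^sup>2 = (\<integral>x. (norm (f x))\<^sup>2 \<partial>M)"
  by (simp add: l2norm_def)

lemma l2norm_norm [simp]: "l2norm M (\<lambda>x. norm (f x)) = l2norm M f"
  by (simp add: l2norm_def)

lemma l2norm_uminus [simp]: "l2norm M (\<lambda>x. - f x) = l2norm M f"
  by (simp add: l2norm_def)

lemma l2norm_minus_commute: "l2norm M (\<lambda>x. f x - g x) = l2norm M (\<lambda>x. g x - f x)"
  by (simp add: l2norm_def norm_minus_commute)

lemma l2norm_0 [simp]: "l2norm M (\<lambda>x. 0) = 0"
  by (simp add: l2norm_def)

lemma l2norm_mult:
  fixes f :: "'a \<Rightarrow> 'b::real_normed_div_algebra"
  shows "l2norm M (\<lambda>x. c * f x) = norm c * l2norm M f"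
  by (simp add: l2norm_def norm_mult power_mult_distrib real_sqrt_mult)

lemma l2norm_cong_AE:
  assumes "f \<in> borel_measurable M" "g \<in> borel_measurable M" "AE x in M. f x = g x"
  shows "l2norm M f = l2norm M g"
proof -
  have [measurable]: "(\<lambda>x. norm (f x)) \<in> borel_measurable M" "(\<lambda>x. norm (g x)) \<in> borel_measurable M"
    using assms(1,2) by (auto intro: measurable_compose[OF _ borel_measurable_norm])
  have "(\<integral>x. (norm (f x))\<^sup>2 \<partial>M) = (\<integral>x. (norm (g x))\<^sup>2 \<partial>M)"
    using assms(3) by (intro integral_cong_AE) auto
  then show ?thesis by (simp add: l2norm_def)
qed

lemma L2_mult_integrable:
  fixes f g :: "'a \<Rightarrow> 'b::{real_normed_div_algebra, banach, second_countable_topology}"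
  assumes "f \<in> L2 M" "g \<in> L2 M"
  shows "integrable M (\<lambda>x. f x * g x)"
proof (rule Bochner_Integration.integrable_bound)
  show "integrable M (\<lambda>x. (norm (f x))\<^sup>2 + (norm (g x))\<^sup>2)"
    using assms by (intro Bochner_Integration.integrable_add L2_integrable)
  show "(\<lambda>x. f x * g x) \<in> borel_measurable M"
    using assms by (auto simp: L2_iff)
  have "norm (f x) * norm (g x) \<le> (norm (f x))\<^sup>2 + (norm (g x))\<^sup>2" for x
    using sum_squares_bound[of "norm (f x)" "norm (g x)"]
      mult_nonneg_nonneg[OF norm_ge_zero[of "f x"] norm_ge_zero[of "g x"]] by linarith
  then show "AE x in M. norm (f x * g x) \<le> norm ((norm (f x))\<^sup>2 + (norm (g x))\<^sup>2)"
    by (simp add: norm_mult)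
qed

lemma Cauchy_Schwarz_real:
  fixes f g :: "'a \<Rightarrow> real"
  assumes "f \<in> L2 M" "g \<in> L2 M"
  shows "\<bar>\<integral>x. f x * g x \<partial>M\<bar> \<le> l2norm M f * l2norm M g"
proof -
  have i: "integrable M (\<lambda>x. (f x)\<^sup>2)" "integrable M (\<lambda>x. (g x)\<^sup>2)" "integrable M (\<lambda>x. f x * g x)"
    using L2_integrable[OF assms(1)] L2_integrable[OF assms(2)] L2_mult_integrable[OF assms] by auto
  have "(\<integral>x. f x * g x \<partial>M)\<^sup>2 \<le> (\<integral>x. (f x)\<^sup>2 \<partial>M) * (\<integral>x. (g x)\<^sup>2 \<partial>M)"
  proof (rule quadratic_nonneg_imp_discriminant)
    fix s
    have "0 \<le> (\<integral>x. (f x + s * g x)\<^sup>2 \<partial>M)" by simp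
    also have "(\<lambda>x. (f x + s * g x)\<^sup>2) = (\<lambda>x. (f x)\<^sup>2 + (2 * s * (f x * g x) + s\<^sup>2 * (g x)\<^sup>2))"
      by (auto simp: power2_eq_square algebra_simps)
    also have "(\<integral>x. (f x)\<^sup>2 + (2 * s * (f x * g x) + s\<^sup>2 * (g x)\<^sup>2) \<partial>M) =
        (\<integral>x. (f x)\<^sup>2 \<partial>M) + (2 * s * (\<integral>x. f x * g x \<partial>M) + s\<^sup>2 * (\<integral>x. (g x)\<^sup>2 \<partial>M))"
      using i by simp
    finally show "0 \<le> (\<integral>x. (f x)\<^sup>2 \<partial>M) + 2 * s * (\<integral>x. f x * g x \<partial>M) + s\<^sup>2 * (\<integral>x. (g x)\<^sup>2 \<partial>M)"
      by simp
  qed simp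
  then have "(\<integral>x. f x * g x \<partial>M)\<^sup>2 \<le> (l2norm M f * l2norm M g)\<^sup>2"
    by (simp add: power_mult_distrib l2norm_power2)
  then show ?thesis by (simp flip: abs_le_square_iff)
qed

lemma Cauchy_Schwarz_L2:
  fixes f g :: "'a \<Rightarrow> 'b::{real_normed_div_algebra, banach, second_countable_topology}"
  assumes "f \<in> L2 M" "g \<in> L2 M"
  shows "norm (\<integral>x. f x * g x \<partial>M) \<le> l2norm M f * l2norm M g"
proof -
  have "norm (\<integral>x. f x * g x \<partial>M) \<le> (\<integral>x. norm (f x) * norm (g x) \<partial>M)"
    using integral_norm_bound[of M "\<lambda>x. f x * g x"] by (simp add: norm_mult)
  also have "\<dots> \<le> l2norm M f * l2norm M g"
    using Cauchy_Schwarz_real[OF L2_norm[OF assms(1)] L2_norm[OF assms(2)]] by simp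
  finally show ?thesis .
qed

lemma l2norm_triangle:
  assumes "f \<in> L2 M" "g \<in> L2 M"
  shows "l2norm M (\<lambda>x. f x + g x) \<le> l2norm M f + l2norm M g"
proof -
  note i = L2_integrable[OF assms(1)] L2_integrable[OF assms(2)]
    L2_mult_integrable[OF L2_norm[OF assms(1)] L2_norm[OF assms(2)]]
  have "(\<integral>x. (norm (f x + g x))\<^sup>2 \<partial>M) \<le>
      (\<integral>x. (norm (f x))\<^sup>2 + (2 * (norm (f x) * norm (g x)) + (norm (g x))\<^sup>2) \<partial>M)"
  proof (rule integral_mono)
    show "integrable M (\<lambda>x. (norm (f x + g x))\<^sup>2)" by (intro L2_integrable L2_add assms)
    show "integrable M (\<lambda>x. (norm (f x))\<^sup>2 + (2 * (norm (f x) * norm (g x)) + (norm (g x))\<^sup>2))"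
      using i by simp
    fix x
    have "(norm (f x + g x))\<^sup>2 \<le> (norm (f x) + norm (g x))\<^sup>2"
      by (intro power_mono norm_triangle_ineq) simp
    then show "(norm (f x + g x))\<^sup>2 \<le> (norm (f x))\<^sup>2 + (2 * (norm (f x) * norm (g x)) + (norm (g x))\<^sup>2)"
      by (simp add: power2_eq_square algebra_simps)
  qed
  also have "\<dots> = (l2norm M f)\<^sup>2 + (2 * (\<integral>x. norm (f x) * norm (g x) \<partial>M) + (l2norm M g)\<^sup>2)"
    using i by (simp add: l2norm_power2)
  also have "\<dots> \<le> (l2norm M f)\<^sup>2 + (2 * (l2norm M f * l2norm M g) + (l2norm M g)\<^sup>2)"
    using Cauchy_Schwarz_real[OF L2_norm[OF assms(1)] L2_norm[OF assms(2)]] by simp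
  also have "\<dots> = (l2norm M f + l2norm M g)\<^sup>2" by (simp add: power2_sum)
  finally have "(l2norm M (\<lambda>x. f x + g x))\<^sup>2 \<le> (l2norm M f + l2norm M g)\<^sup>2"
    by (simp add: l2norm_power2)
  then show ?thesis by (rule power2_le_imp_le) simp
qed

lemma l2norm_triangle_diff:
  assumes "f \<in> L2 M" "g \<in> L2 M"
  shows "l2norm M (\<lambda>x. f x - g x) \<le> l2norm M f + l2norm M g"
  using l2norm_triangle[OF assms(1) L2_uminus[OF assms(2)]] by simp

lemma l2norm_triangle3:
  assumes "f \<in> L2 M" "g \<in> L2 M" "h \<in> L2 M"
  shows "l2norm M (\<lambda>x. f x - h x) \<le> l2norm M (\<lambda>x. f x - g x) + l2norm M (\<lambda>x. g x - h x)"
  using l2norm_triangle[OF L2_diff[OF assms(1,2)] L2_diff[OF assms(2,3)]] by simp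

lemma l2norm_le_add:
  assumes "f \<in> L2 M" "g \<in> L2 M"
  shows "l2norm M f \<le> l2norm M g + l2norm M (\<lambda>x. f x - g x)"
  using l2norm_triangle[OF assms(2) L2_diff[OF assms]] by simp

lemma L2_tendsto_l2norm:
  assumes "\<And>n. f n \<in> L2 M" "g \<in> L2 M" "((\<lambda>n. l2norm M (\<lambda>x. f n x - g x)) \<longlongrightarrow> 0) F"
  shows "((\<lambda>n. l2norm M (f n)) \<longlongrightarrow> l2norm M g) F"
proof -
  have *: "norm (l2norm M (f n) - l2norm M g) \<le> l2norm M (\<lambda>x. f n x - g x)" for n
    using l2norm_le_add[OF assms(1)[of n] assms(2)] l2norm_le_add[OF assms(2) assms(1)[of n]]
    by (simp add: l2norm_minus_commute[of M g])
  have "((\<lambda>n. l2norm M (f n) - l2norm M g) \<longlongrightarrow> 0) F"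
    by (rule Lim_null_comparison[OF always_eventually assms(3)]) (intro allI *)
  then show ?thesis by (simp add: LIM_zero_iff)
qed

lemma L2_tendsto_integral_mult:
  fixes f :: "'i \<Rightarrow> 'a \<Rightarrow> 'b::{real_normed_div_algebra, banach, second_countable_topology}"
  assumes "\<And>n. f n \<in> L2 M" "g \<in> L2 M" "h \<in> L2 M" "((\<lambda>n. l2norm M (\<lambda>x. f n x - g x)) \<longlongrightarrow> 0) F"
  shows "((\<lambda>n. \<integral>x. f n x * h x \<partial>M) \<longlongrightarrow> (\<integral>x. g x * h x \<partial>M)) F"
proof -
  have *: "norm ((\<integral>x. f n x * h x \<partial>M) - (\<integral>x. g x * h x \<partial>M)) \<le> l2norm M (\<lambda>x. f n x - g x) * l2norm M h" for n
  proof -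
    have "(\<integral>x. f n x * h x \<partial>M) - (\<integral>x. g x * h x \<partial>M) = (\<integral>x. (f n x - g x) * h x \<partial>M)"
      using L2_mult_integrable[OF assms(1)[of n] assms(3)] L2_mult_integrable[OF assms(2,3)]
      by (simp add: left_diff_distrib)
    then show ?thesis
      using Cauchy_Schwarz_L2[OF L2_diff[OF assms(1)[of n] assms(2)] assms(3)] by simp
  qed
  have lim: "((\<lambda>n. l2norm M (\<lambda>x. f n x - g x) * l2norm M h) \<longlongrightarrow> 0) F"
    using tendsto_mult_right[OF assms(4), of "l2norm M h"] by simp
  have "((\<lambda>n. (\<integral>x. f n x * h x \<partial>M) - (\<integral>x. g x * h x \<partial>M)) \<longlongrightarrow> 0) F"
    by (rule Lim_null_comparison[OF always_eventually lim]) (intro allI *)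
  then show ?thesis by (simp add: LIM_zero_iff)
qed

lemma L2_dominated_convergence:
  fixes f :: "nat \<Rightarrow> 'a \<Rightarrow> 'b::{real_normed_vector, second_countable_topology}"
  assumes "\<And>n. f n \<in> borel_measurable M" "g \<in> borel_measurable M" "w \<in> L2 M"
    "AE x in M. (\<lambda>n. f n x) \<longlonglongrightarrow> g x" "\<And>n. AE x in M. norm (f n x) \<le> w x" "AE x in M. norm (g x) \<le> w x"
  shows "(\<lambda>n. l2norm M (\<lambda>x. f n x - g x)) \<longlonglongrightarrow> 0"
proof -
  have w: "integrable M (\<lambda>x. (w x)\<^sup>2)" using L2_integrable[OF assms(3)] by simp
  have "(\<lambda>n. \<integral>x. (norm (f n x - g x))\<^sup>2 \<partial>M) \<longlonglongrightarrow> (\<integral>x. 0 \<partial>M)"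
  proof (rule integral_dominated_convergence)
    show "integrable M (\<lambda>x. 4 * (w x)\<^sup>2)" using w by simp
    show "AE x in M. (\<lambda>n. (norm (f n x - g x))\<^sup>2) \<longlonglongrightarrow> 0"
      using assms(4) by eventually_elim (auto intro!: tendsto_eq_intros simp: LIM_zero_iff)
    show "AE x in M. norm ((norm (f n x - g x))\<^sup>2) \<le> 4 * (w x)\<^sup>2" for n
      using assms(5)[of n] assms(6)
    proof eventually_elim
      case (elim x)
      then have "norm (f n x - g x) \<le> 2 * w x" using norm_triangle_ineq4[of "f n x" "g x"] by linarith
      then have "(norm (f n x - g x))\<^sup>2 \<le> (2 * w x)\<^sup>2" by (intro power_mono) auto
      then show ?case by (simp add: power_mult_distrib)
    qed
  qed (use assms(1,2) in auto)
  then have "(\<lambda>n. \<integral>x. (norm (f n x - g x))\<^sup>2 \<partial>M) \<longlonglongrightarrow> 0" by simp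
  from tendsto_real_sqrt[OF this] show ?thesis by (simp add: l2norm_def)
qed

lemma (in finite_measure) L2_imp_integrable:
  fixes f :: "'a \<Rightarrow> 'b::{banach, second_countable_topology}"
  assumes "f \<in> L2 M" shows "integrable M f"
proof -
  have "integrable M (\<lambda>x. norm (f x))"
    by (rule square_integrable_imp_integrable[OF strongly_measurable_norm[OF
          L2_strongly_measurable[OF assms]] L2_integrable[OF assms]])
  then show ?thesis using L2_borel[OF assms] by (simp add: integrable_norm_iff)
qed

lemma (in prob_space) integral_norm_le_l2norm:
  fixes f :: "'a \<Rightarrow> 'b::{banach, second_countable_topology}"
  assumes "f \<in> L2 M"
  shows "(\<integral>x. norm (f x) \<partial>M) \<le> l2norm M f"
proof -
  have "(\<lambda>x. 1 :: real) \<in> L2 M" by (simp add: L2_iff)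
  from Cauchy_Schwarz_real[OF L2_norm[OF assms] this] show ?thesis
    by (simp add: l2norm_def[of M "\<lambda>x. 1"] prob_space)
qed

text \<open>Riesz-Fischer: on a probability space the sequence is Cauchy in L1, so a subsequence
  converges almost everywhere, and Fatou's lemma transfers the Cauchy estimate to the distance from
  its limit.\<close>

lemma (in prob_space) L2_complete:
  fixes f :: "nat \<Rightarrow> 'a \<Rightarrow> 'b::{banach, second_countable_topology}"
  assumes f: "\<And>n. f n \<in> L2 M"
    and Cauchy: "\<And>e. e > 0 \<Longrightarrow> \<exists>N. \<forall>m\<ge>N. \<forall>n\<ge>N. l2norm M (\<lambda>x. f m x - f n x) < e"
  shows "\<exists>g\<in>L2 M. (\<lambda>n. l2norm M (\<lambda>x. f n x - g x)) \<longlonglongrightarrow> 0"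
proof -
  note [measurable] = L2_borel[OF f]
  obtain r where r: "strict_mono r" "AE x in M. Cauchy (\<lambda>i. f (r i) x)"
  proof (rule cauchy_L1_AE_cauchy_subseq)
    show "integrable M (f n)" for n by (rule L2_imp_integrable[OF f])
    fix e :: real assume "e > 0"
    then obtain N where N: "\<forall>m\<ge>N. \<forall>n\<ge>N. l2norm M (\<lambda>x. f m x - f n x) < e" using Cauchy by blast
    have "(\<integral>x. norm (f m x - f n x) \<partial>M) < e" if "m \<ge> N" "n \<ge> N" for m n
      using integral_norm_le_l2norm[OF L2_diff[OF f f], of m n] N that by (meson le_less_trans)
    then show "\<exists>N. \<forall>i\<ge>N. \<forall>j\<ge>N. (\<integral>x. norm (f i x - f j x) \<partial>M) < e" by blast
  qed
  define g where "g = (\<lambda>x. lim (\<lambda>i. f (r i) x))"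
  have [measurable]: "g \<in> borel_measurable M" unfolding g_def by measurable
  have lim: "AE x in M. (\<lambda>i. f (r i) x) \<longlonglongrightarrow> g x"
    using r(2) by eventually_elim (simp add: g_def Cauchy_convergent_iff convergent_LIMSEQ_iff)
  have le: "(\<integral>\<^sup>+x. ennreal ((norm (f n x - g x))\<^sup>2) \<partial>M) \<le> ennreal (e\<^sup>2)"
    if N: "\<forall>m\<ge>N. \<forall>n\<ge>N. l2norm M (\<lambda>x. f m x - f n x) < e" and n: "n \<ge> N" for e N n
  proof -
    have "(\<integral>\<^sup>+x. ennreal ((norm (f n x - g x))\<^sup>2) \<partial>M) =
        (\<integral>\<^sup>+x. liminf (\<lambda>i. ennreal ((norm (f n x - f (r i) x))\<^sup>2)) \<partial>M)"
    proof (rule nn_integral_cong_AE)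
      show "AE x in M. ennreal ((norm (f n x - g x))\<^sup>2) = liminf (\<lambda>i. ennreal ((norm (f n x - f (r i) x))\<^sup>2))"
        using lim
      proof eventually_elim
        case (elim x)
        have "(\<lambda>i. ennreal ((norm (f n x - f (r i) x))\<^sup>2)) \<longlonglongrightarrow> ennreal ((norm (f n x - g x))\<^sup>2)"
          by (intro tendsto_ennrealI tendsto_power tendsto_norm tendsto_diff tendsto_const elim)
        from lim_imp_Liminf[OF _ this] show ?case by simp
      qed
    qed
    also have "\<dots> \<le> liminf (\<lambda>i. \<integral>\<^sup>+x. ennreal ((norm (f n x - f (r i) x))\<^sup>2) \<partial>M)"
      by (rule nn_integral_liminf) auto
    also have "\<dots> \<le> limsup (\<lambda>i. \<integral>\<^sup>+x. ennreal ((norm (f n x - f (r i) x))\<^sup>2) \<partial>M)"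
      by (rule Liminf_le_Limsup) simp
    also have "\<dots> \<le> ennreal (e\<^sup>2)"
    proof (rule Limsup_bounded)
      have "(\<integral>\<^sup>+x. ennreal ((norm (f n x - f (r i) x))\<^sup>2) \<partial>M) \<le> ennreal (e\<^sup>2)" if "i \<ge> N" for i
      proof -
        have "(\<integral>\<^sup>+x. ennreal ((norm (f n x - f (r i) x))\<^sup>2) \<partial>M) = ennreal ((l2norm M (\<lambda>x. f n x - f (r i) x))\<^sup>2)"
          using L2_integrable[OF L2_diff[OF f[of n] f[of "r i"]]]
          by (simp add: l2norm_power2 nn_integral_eq_integral)
        also have "\<dots> \<le> ennreal (e\<^sup>2)"
          using N n seq_suble[OF r(1), of i] that
          by (intro ennreal_leI power_mono) (auto intro!: less_imp_le[OF N[rule_format]])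
        finally show ?thesis .
      qed
      then show "\<forall>\<^sub>F i in sequentially. (\<integral>\<^sup>+x. ennreal ((norm (f n x - f (r i) x))\<^sup>2) \<partial>M) \<le> ennreal (e\<^sup>2)"
        by (auto simp: eventually_sequentially)
    qed
    finally show ?thesis .
  qed
  have L2d: "(\<lambda>x. f n x - g x) \<in> L2 M" if "\<forall>m\<ge>N. \<forall>n\<ge>N. l2norm M (\<lambda>x. f m x - f n x) < e" "n \<ge> N" for e N n
    using le[OF that] by (auto simp: L2_iff integrable_iff_bounded top.extremum_strict
        intro: le_less_trans[OF _ ennreal_less_top])
  obtain N where N: "\<forall>m\<ge>N. \<forall>n\<ge>N. l2norm M (\<lambda>x. f m x - f n x) < 1" using Cauchy[of 1] by auto
  have "(\<lambda>x. f N x - (f N x - g x)) \<in> L2 M"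
    using L2_diff[OF f[of N] L2d[OF N, of N]] by simp
  then have g: "g \<in> L2 M" by simp
  moreover have "(\<lambda>n. l2norm M (\<lambda>x. f n x - g x)) \<longlonglongrightarrow> 0"
  proof (rule LIMSEQ_I)
    fix e :: real assume "e > 0"
    then obtain N where N: "\<forall>m\<ge>N. \<forall>n\<ge>N. l2norm M (\<lambda>x. f m x - f n x) < e / 2"
      using Cauchy[of "e / 2"] by auto
    have "norm (l2norm M (\<lambda>x. f n x - g x) - 0) < e" if "n \<ge> N" for n
    proof -
      have "ennreal ((l2norm M (\<lambda>x. f n x - g x))\<^sup>2) = (\<integral>\<^sup>+x. ennreal ((norm (f n x - g x))\<^sup>2) \<partial>M)"
        using L2_integrable[OF L2_diff[OF f[of n] g]] by (simp add: l2norm_power2 nn_integral_eq_integral)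
      also have "\<dots> \<le> ennreal ((e / 2)\<^sup>2)" by (rule le[OF N that])
      finally have "(l2norm M (\<lambda>x. f n x - g x))\<^sup>2 \<le> (e / 2)\<^sup>2"
        by (subst (asm) ennreal_le_iff) auto
      then have "l2norm M (\<lambda>x. f n x - g x) \<le> e / 2"
        by (rule power2_le_imp_le) (use \<open>e > 0\<close> in simp)
      then show ?thesis using \<open>e > 0\<close> by simp
    qed
    then show "\<exists>no. \<forall>n\<ge>no. norm (l2norm M (\<lambda>x. f n x - g x) - 0) < e" by blast
  qed
  ultimately show ?thesis by blast
qed

section \<open>Uniqueness of measures with given characteristic functionals\<close>

lemma integrable_weighted_iexp:
  assumes "integrable M (\<rho> :: 'a \<Rightarrow> real)" "X \<in> borel_measurable M"
  shows "integrable M (\<lambda>x. \<rho> x *\<^sub>R iexp (X x))"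
proof (rule Bochner_Integration.integrable_bound[OF assms(1)])
  have [measurable]: "\<rho> \<in> borel_measurable M" "X \<in> borel_measurable M" using assms by auto
  show "(\<lambda>x. \<rho> x *\<^sub>R iexp (X x)) \<in> borel_measurable M" by measurable
qed simp

text \<open>Levy's theorem for the law of X under the normalised density rho / c; for c = 0 both
  weights vanish almost everywhere. The weights allow an induction on the number of functionals that
  stays one-dimensional.\<close>

lemma weighted_Levy_uniqueness:
  fixes M1 M2 :: "'a measure"
  assumes X: "X1 \<in> borel_measurable M1" "X2 \<in> borel_measurable M2"
    and w: "integrable M1 \<rho>1" "integrable M2 \<rho>2" "\<And>x. \<rho>1 x \<ge> 0" "\<And>x. \<rho>2 x \<ge> 0"
    and char: "\<And>u. (\<integral>x. \<rho>1 x *\<^sub>R iexp (u * X1 x) \<partial>M1) = (\<integral>x. \<rho>2 x *\<^sub>R iexp (u * X2 x) \<partial>M2)"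
    and g: "g \<in> borel_measurable borel"
  shows "(\<integral>x. \<rho>1 x * g (X1 x) \<partial>M1) = (\<integral>x. \<rho>2 x * (g (X2 x) :: real) \<partial>M2)"
proof -
  note [measurable] = X g borel_measurable_integrable[OF w(1)] borel_measurable_integrable[OF w(2)]
  define c where "c = (\<integral>x. \<rho>1 x \<partial>M1)"
  have "complex_of_real (\<integral>x. \<rho>1 x \<partial>M1) = complex_of_real (\<integral>x. \<rho>2 x \<partial>M2)"
    using char[of 0] w(1,2) by (simp add: scaleR_conv_of_real)
  then have c2: "c = (\<integral>x. \<rho>2 x \<partial>M2)" by (simp add: c_def)
  show ?thesis
  proof (cases "c = 0")
    case True
    have ae1: "AE x in M1. \<rho>1 x = 0" using True w integral_nonneg_eq_0_iff_AE[OF w(1)] by (simp add: c_def)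
    have ae2: "AE x in M2. \<rho>2 x = 0" using True c2 w integral_nonneg_eq_0_iff_AE[OF w(2)] by simp
    have "(\<integral>x. \<rho>1 x * g (X1 x) \<partial>M1) = (\<integral>x. 0 \<partial>M1)"
      using ae1 by (intro integral_cong_AE) auto
    moreover have "(\<integral>x. \<rho>2 x * g (X2 x) \<partial>M2) = (\<integral>x. 0 \<partial>M2)"
      using ae2 by (intro integral_cong_AE) auto
    ultimately show ?thesis by simp
  next
    case False
    have "c \<ge> 0" using w(3) by (simp add: c_def)
    with False have c: "c > 0" by simp
    define N where "N = (\<lambda>(M :: 'a measure) (X :: 'a \<Rightarrow> real) \<rho>. distr (density M (\<lambda>x. ennreal (\<rho> x / c))) borel X)"
    have dist: "real_distribution (N M X \<rho>)"
      if [measurable]: "X \<in> borel_measurable M" and \<rho>: "integrable M \<rho>" "\<And>x. \<rho> x \<ge> 0" "c = (\<integral>x. \<rho> x \<partial>M)"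
      for M :: "'a measure" and X :: "'a \<Rightarrow> real" and \<rho>
    proof -
      have [measurable]: "\<rho> \<in> borel_measurable M" using \<rho>(1) by simp
      have "(\<integral>\<^sup>+x. ennreal (\<rho> x / c) \<partial>M) = ennreal (\<integral>x. \<rho> x / c \<partial>M)"
        using \<rho> c by (intro nn_integral_eq_integral) auto
      also have "\<dots> = 1" using \<rho>(3) c by simp
      finally have "prob_space (density M (\<lambda>x. ennreal (\<rho> x / c)))"
        by (intro prob_spaceI) (simp add: emeasure_density)
      then show ?thesis
        unfolding N_def real_distribution_def real_distribution_axioms_def
        by (auto intro!: prob_space.prob_space_distr)
    qed
    have int: "integral\<^sup>L (N M X \<rho>) f = (\<integral>x. \<rho> x *\<^sub>R f (X x) \<partial>M) /\<^sub>R c"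
      if [measurable]: "X \<in> borel_measurable M" "f \<in> borel_measurable borel" and \<rho>: "integrable M \<rho>" "\<And>x. \<rho> x \<ge> 0"
      for M :: "'a measure" and X :: "'a \<Rightarrow> real" and \<rho> and f :: "real \<Rightarrow> 'c::{banach, second_countable_topology}"
    proof -
      have [measurable]: "\<rho> \<in> borel_measurable M" using \<rho>(1) by simp
      have "integral\<^sup>L (N M X \<rho>) f = (\<integral>x. f (X x) \<partial>density M (\<lambda>x. ennreal (\<rho> x / c)))"
        unfolding N_def by (rule integral_distr) auto
      also have "\<dots> = (\<integral>x. (\<rho> x / c) *\<^sub>R f (X x) \<partial>M)"
        using \<rho>(2) c by (intro integral_density) auto
      also have "\<dots> = (\<integral>x. inverse c *\<^sub>R (\<rho> x *\<^sub>R f (X x)) \<partial>M)"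
        by (simp add: divide_inverse mult.commute)
      finally show ?thesis by (simp only: integral_scaleR_right)
    qed
    have "N M1 X1 \<rho>1 = N M2 X2 \<rho>2"
    proof (rule Levy_uniqueness)
      show "real_distribution (N M1 X1 \<rho>1)" by (rule dist) (use w in \<open>auto simp: c_def\<close>)
      show "real_distribution (N M2 X2 \<rho>2)" by (rule dist) (use w c2 in auto)
      show "char (N M1 X1 \<rho>1) = char (N M2 X2 \<rho>2)"
        unfolding char_def by (intro ext, subst (1 2) int) (use w char in auto)
    qed
    then have "integral\<^sup>L (N M1 X1 \<rho>1) g = integral\<^sup>L (N M2 X2 \<rho>2) g" by (rule arg_cong)
    then have "(\<integral>x. \<rho>1 x *\<^sub>R g (X1 x) \<partial>M1) /\<^sub>R c = (\<integral>x. \<rho>2 x *\<^sub>R g (X2 x) \<partial>M2) /\<^sub>R c"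
      by (simp only: int[OF X(1) g w(1,3)] int[OF X(2) g w(2,4)])
    then show ?thesis using c by auto
  qed
qed

definition cylinder_algebra :: "('v \<Rightarrow> 'a \<Rightarrow> real) \<Rightarrow> 'a measure" where
  "cylinder_algebra L = sigma UNIV {L v -` B | v B. B \<in> sets borel}"

text \<open>The pi-system of finite intersections, built by one functional at a time to match the
  induction in the uniqueness proof.\<close>

inductive_set cylinder_sets :: "('v \<Rightarrow> 'a \<Rightarrow> real) \<Rightarrow> 'a set set" for L where
  UNIV: "UNIV \<in> cylinder_sets L"
| Int: "A \<in> cylinder_sets L \<Longrightarrow> B \<in> sets borel \<Longrightarrow> A \<inter> L v -` B \<in> cylinder_sets L"

lemma space_cylinder_algebra [simp]: "space (cylinder_algebra L) = UNIV"
  by (simp add: cylinder_algebra_def)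

lemma cylinder_algebra_measurable [measurable]: "L v \<in> borel_measurable (cylinder_algebra L)"
  by (rule measurableI) (auto simp: cylinder_algebra_def)

lemma Int_stable_cylinder_sets: "Int_stable (cylinder_sets L)"
proof (rule Int_stableI)
  fix A B assume A: "A \<in> cylinder_sets L" and "B \<in> cylinder_sets L"
  from this(2) show "A \<inter> B \<in> cylinder_sets L"
  proof induction
    case (Int B C v)
    then show ?case using cylinder_sets.Int[of "A \<inter> B" L C v] by (simp add: Int_assoc)
  qed (use A in simp)
qed

lemma sets_cylinder_algebra: "sets (cylinder_algebra L) = sigma_sets UNIV (cylinder_sets L)"
proof -
  have "cylinder_sets L \<subseteq> sets (cylinder_algebra L)"
  proof
    fix A assume "A \<in> cylinder_sets L"
    then show "A \<in> sets (cylinder_algebra L)"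
    proof induction
      case UNIV
      show ?case using sets.top[of "cylinder_algebra L"] by simp
    next
      case (Int A B v)
      have "L v -` B \<inter> space (cylinder_algebra L) \<in> sets (cylinder_algebra L)"
        using Int by (intro measurable_sets[OF cylinder_algebra_measurable])
      with Int show ?case by auto
    qed
  qed
  moreover have "{L v -` B | v B. B \<in> sets borel} \<subseteq> cylinder_sets L"
    using cylinder_sets.Int[OF cylinder_sets.UNIV] by fastforce
  ultimately show ?thesis
    unfolding cylinder_algebra_def
    by (auto simp: sets_measure_of intro: sigma_sets_mono'[THEN subsetD] dest: sigma_sets_mono[THEN subsetD, rotated])
qed

lemma measurable_cylinder_algebra:
  assumes "space M = UNIV" "\<And>v. (\<lambda>x. L v (f x)) \<in> borel_measurable M"
  shows "f \<in> measurable M (cylinder_algebra L)"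
  unfolding cylinder_algebra_def
proof (rule measurable_measure_of)
  fix A assume "A \<in> {L v -` B | v B. B \<in> sets borel}"
  then obtain v B where A: "A = L v -` B" "B \<in> sets borel" by blast
  have "(\<lambda>x. L v (f x)) -` B \<inter> space M \<in> sets M" by (rule measurable_sets[OF assms(2) A(2)])
  then show "f -` A \<inter> space M \<in> sets M" by (simp add: A vimage_def)
qed auto

text \<open>The induction over cylinder sets carries the stronger claim that the integrals of exp(i
  L u) over the set agree for all u. To add a condition on L v, Levy's theorem is applied to L v
  under trigonometric weights; linearity of L expresses the needed characteristic functions through
  the induction hypothesis at k v, k v + u and k v - u.\<close>

lemma char_functional_determines_cylinder_sets:
  fixes L :: "'v::real_vector \<Rightarrow> 'a \<Rightarrow> real"
  assumes m1: "prob_space m1" "space m1 = UNIV" and m2: "prob_space m2" "space m2 = UNIV"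
    and lin: "\<And>x. linear (\<lambda>v. L v x)"
    and meas: "\<And>v. L v \<in> borel_measurable m1" "\<And>v. L v \<in> borel_measurable m2"
    and char: "\<And>v. (\<integral>x. iexp (L v x) \<partial>m1) = (\<integral>x. iexp (L v x) \<partial>m2)"
    and A: "A \<in> sets (cylinder_algebra L)"
  shows "emeasure m1 A = emeasure m2 A"
proof -
  interpret m1: prob_space m1 by fact
  interpret m2: prob_space m2 by fact
  note [measurable] = meas
  note lin' = linear_add[OF lin] linear_diff[OF lin] linear_scale[OF lin]
  have cyl: "A \<in> sets m1 \<and> A \<in> sets m2 \<and>
      (\<forall>u. (\<integral>x. indicator A x *\<^sub>R iexp (L u x) \<partial>m1) = (\<integral>x. indicator A x *\<^sub>R iexp (L u x) \<partial>m2))"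
    if "A \<in> cylinder_sets L" for A
    using that
  proof induction
    case UNIV
    then show ?case using sets.top[of m1] sets.top[of m2] m1 m2 char by simp
  next
    case (Int A B v)
    then have [measurable]: "A \<in> sets m1" "A \<in> sets m2" "B \<in> sets borel"
      and eq: "\<And>u. (\<integral>x. indicator A x *\<^sub>R iexp (L u x) \<partial>m1) = (\<integral>x. indicator A x *\<^sub>R iexp (L u x) \<partial>m2)"
      by auto
    have Bv: "L v -` B \<in> sets m1" "L v -` B \<in> sets m2"
      using measurable_sets[OF meas(1) \<open>B \<in> sets borel\<close>] measurable_sets[OF meas(2) \<open>B \<in> sets borel\<close>] m1 m2
      by auto
    \<comment> \<open>Levy's theorem needs nonnegative weights, so 1, 1 + cos and 1 + sin take the
      place of cos and sin. All three have the form required of \<open>\<rho>\<close>.\<close>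
    have weighted: "(\<integral>x. indicator A x * \<rho> x * indicator B (L v x) \<partial>m1) =
        (\<integral>x. indicator A x * \<rho> x * indicator B (L v x) \<partial>m2)"
      if \<rho>: "\<And>x. \<rho> x \<ge> 0" "\<And>x. \<rho> x \<le> 2"
        and [measurable]: "\<rho> \<in> borel_measurable m1" "\<rho> \<in> borel_measurable m2"
        and \<rho>eq: "\<And>x. complex_of_real (\<rho> x) = 1 + a * iexp (L u x) + b * iexp (- L u x)"
      for \<rho> :: "'a \<Rightarrow> real" and a b u
    proof (rule weighted_Levy_uniqueness[OF meas])
      have bd: "norm (indicator A x * \<rho> x) \<le> 2" for x
        using \<rho>[of x] by (auto simp: indicator_def)
      show "integrable m1 (\<lambda>x. indicator A x * \<rho> x)" "integrable m2 (\<lambda>x. indicator A x * \<rho> x)"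
        using bd by (auto intro!: m1.integrable_const_bound[of _ 2] m2.integrable_const_bound[of _ 2])
      fix k :: real
      have e: "(indicator A x * \<rho> x) *\<^sub>R iexp (k * L v x) =
          indicator A x *\<^sub>R iexp (L (k *\<^sub>R v) x) + (a * (indicator A x *\<^sub>R iexp (L (k *\<^sub>R v + u) x))
          + b * (indicator A x *\<^sub>R iexp (L (k *\<^sub>R v - u) x)))" for x
        unfolding scaleR_conv_of_real of_real_mult \<rho>eq
        by (simp add: lin' exp_add exp_diff exp_minus algebra_simps field_simps)
      have i1: "integrable m1 (\<lambda>x. indicator A x *\<^sub>R iexp (L w x))" for w
        by (rule integrable_weighted_iexp[OF integrable_real_indicator meas(1)]) (simp_all add: less_top[symmetric])
      have i2: "integrable m2 (\<lambda>x. indicator A x *\<^sub>R iexp (L w x))" for w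
        by (rule integrable_weighted_iexp[OF integrable_real_indicator meas(2)]) (simp_all add: less_top[symmetric])
      note i = i1 i2
      have comb: "(\<integral>x. F x + (a * G x + b * K x) \<partial>m) = (\<integral>x. F x \<partial>m) + (a * (\<integral>x. G x \<partial>m) + b * (\<integral>x. K x \<partial>m))"
        if "integrable m F" "integrable m G" "integrable m K" for m :: "'a measure" and F G K :: "'a \<Rightarrow> complex"
        using that by (simp only: Bochner_Integration.integral_add integrable_mult_right
            Bochner_Integration.integrable_add integral_mult_right_zero)
      show "(\<integral>x. (indicator A x * \<rho> x) *\<^sub>R iexp (k * L v x) \<partial>m1) =
          (\<integral>x. (indicator A x * \<rho> x) *\<^sub>R iexp (k * L v x) \<partial>m2)"
        unfolding e comb[OF i1 i1 i1] comb[OF i2 i2 i2] eq ..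
    qed (use \<rho> in \<open>auto simp: indicator_def\<close>)
    have one: "(\<integral>x. indicator A x * indicator B (L v x) \<partial>m1) = (\<integral>x. indicator A x * (indicator B (L v x) :: real) \<partial>m2)"
    proof -
      have "(\<integral>x. indicator A x * 1 * indicator B (L v x) \<partial>m1) = (\<integral>x. indicator A x * 1 * (indicator B (L v x) :: real) \<partial>m2)"
        by (rule weighted[of "\<lambda>x. 1" 0 0 0]) simp_all
      then show ?thesis by simp
    qed
    have cos: "(\<integral>x. indicator A x * (1 + cos (L u x)) * indicator B (L v x) \<partial>m1) =
        (\<integral>x. indicator A x * (1 + cos (L u x)) * indicator B (L v x) \<partial>m2)" for u
    proof (rule weighted[of _ "1/2" u "1/2"])
      show "0 \<le> 1 + cos (L u x)" "1 + cos (L u x) \<le> 2" for x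
        using cos_ge_minus_one[of "L u x"] cos_le_one[of "L u x"] by linarith+
      show "complex_of_real (1 + cos (L u x)) = 1 + 1/2 * iexp (L u x) + 1/2 * iexp (- L u x)" for x
        by (auto simp: complex_eq_iff Re_exp Im_exp)
    qed auto
    have sin: "(\<integral>x. indicator A x * (1 + sin (L u x)) * indicator B (L v x) \<partial>m1) =
        (\<integral>x. indicator A x * (1 + sin (L u x)) * indicator B (L v x) \<partial>m2)" for u
    proof (rule weighted[of _ "- \<i> / 2" u "\<i> / 2"])
      show "0 \<le> 1 + sin (L u x)" "1 + sin (L u x) \<le> 2" for x
        using sin_ge_minus_one[of "L u x"] sin_le_one[of "L u x"] by linarith+
      show "complex_of_real (1 + sin (L u x)) = 1 + (- \<i> / 2) * iexp (L u x) + (\<i> / 2) * iexp (- L u x)" for x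
        by (auto simp: complex_eq_iff Re_exp Im_exp)
    qed auto
    \<comment> \<open>Subtracting the integral with weight 1 from those with 1 + cos and 1 + sin
      recovers the real and imaginary parts.\<close>
    have split: "(\<integral>x. indicator (A \<inter> L v -` B) x *\<^sub>R iexp (L u x) \<partial>m) =
        Complex ((\<integral>x. indicator A x * (1 + cos (L u x)) * indicator B (L v x) \<partial>m) - (\<integral>x. indicator A x * indicator B (L v x) \<partial>m))
          ((\<integral>x. indicator A x * (1 + sin (L u x)) * indicator B (L v x) \<partial>m) - (\<integral>x. indicator A x * indicator B (L v x) \<partial>m))"
      if "prob_space m" and [measurable]: "A \<in> sets m" "\<And>v. L v \<in> borel_measurable m" and Bv[measurable]: "L v -` B \<in> sets m"
      for m u
    proof -
      interpret m: prob_space m by fact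
      have i: "integrable m (\<lambda>x. indicator A x * \<rho> x * indicator B (L v x))"
        if [measurable]: "\<rho> \<in> borel_measurable m" and "\<And>x. \<bar>\<rho> x\<bar> \<le> 2" for \<rho> :: "'a \<Rightarrow> real"
        using that by (intro m.integrable_const_bound[of _ 2]) (auto simp: indicator_def)
      have i1: "integrable m (\<lambda>x. indicator A x * (1 + cos (L u x)) * indicator B (L v x))"
        by (rule i) (use abs_cos_le_one in \<open>auto intro!: order_trans[OF abs_triangle_ineq]\<close>)
      have i2: "integrable m (\<lambda>x. indicator A x * (1 + sin (L u x)) * indicator B (L v x))"
        by (rule i) (use abs_sin_le_one in \<open>auto intro!: order_trans[OF abs_triangle_ineq]\<close>)
      have i3: "integrable m (\<lambda>x. indicator A x * (indicator B (L v x) :: real))"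
        using i[of "\<lambda>x. 1"] by simp
      have "integrable m (\<lambda>x. indicator (A \<inter> L v -` B) x *\<^sub>R iexp (L u x))"
        by (rule integrable_weighted_iexp[OF integrable_real_indicator]) (auto simp: less_top[symmetric])
      then have re: "Re (\<integral>x. indicator (A \<inter> L v -` B) x *\<^sub>R iexp (L u x) \<partial>m) = (\<integral>x. Re (indicator (A \<inter> L v -` B) x *\<^sub>R iexp (L u x)) \<partial>m)"
        and im: "Im (\<integral>x. indicator (A \<inter> L v -` B) x *\<^sub>R iexp (L u x) \<partial>m) = (\<integral>x. Im (indicator (A \<inter> L v -` B) x *\<^sub>R iexp (L u x)) \<partial>m)"
        by (simp_all only: integral_Re integral_Im)
      have e: "Re (indicator (A \<inter> L v -` B) x *\<^sub>R iexp (L u x)) = indicator A x * (1 + cos (L u x)) * indicator B (L v x) - indicator A x * indicator B (L v x)"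
        "Im (indicator (A \<inter> L v -` B) x *\<^sub>R iexp (L u x)) = indicator A x * (1 + sin (L u x)) * indicator B (L v x) - indicator A x * indicator B (L v x)" for x
        by (auto simp: indicator_def Re_exp Im_exp)
      show ?thesis
        unfolding complex_eq_iff re im e using i1 i2 i3 by simp
    qed
    have "(\<integral>x. indicator (A \<inter> L v -` B) x *\<^sub>R iexp (L u x) \<partial>m1) = (\<integral>x. indicator (A \<inter> L v -` B) x *\<^sub>R iexp (L u x) \<partial>m2)" for u
      by (simp only: split[OF m1.prob_space_axioms _ meas(1) Bv(1)] split[OF m2.prob_space_axioms _ meas(2) Bv(2)]
          \<open>A \<in> sets m1\<close> \<open>A \<in> sets m2\<close> one cos sin)
    then show ?case using Bv by simp
  qed
  have sub: "cylinder_sets L \<subseteq> sets m1" "cylinder_sets L \<subseteq> sets m2" using cyl by auto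
  have subs: "sigma_sets UNIV (cylinder_sets L) \<subseteq> sets m1" "sigma_sets UNIV (cylinder_sets L) \<subseteq> sets m2"
    using sets.sigma_sets_subset[OF sub(1)] sets.sigma_sets_subset[OF sub(2)] m1 m2 by auto
  have id: "(\<lambda>x. x) \<in> measurable m1 (cylinder_algebra L)" "(\<lambda>x. x) \<in> measurable m2 (cylinder_algebra L)"
    using meas m1 m2 by (auto intro!: measurable_cylinder_algebra)
  have "distr m1 (cylinder_algebra L) (\<lambda>x. x) = distr m2 (cylinder_algebra L) (\<lambda>x. x)"
  proof (rule measure_eqI_generator_eq[OF Int_stable_cylinder_sets[of L]])
    fix X assume X: "X \<in> cylinder_sets L"
    have m: "emeasure m1 X = emeasure m2 X"
    proof -
      have "X \<in> sets m1" "X \<in> sets m2"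
        and "(\<integral>x. indicator X x *\<^sub>R iexp (L 0 x) \<partial>m1) = (\<integral>x. indicator X x *\<^sub>R iexp (L 0 x) \<partial>m2)"
        using cyl[OF X] by blast+
      then have "complex_of_real (measure m1 X) = complex_of_real (measure m2 X)"
        using m1 m2 by (simp add: linear_0[OF lin] scaleR_conv_of_real)
      then show ?thesis by (simp add: m1.emeasure_eq_measure m2.emeasure_eq_measure)
    qed
    have "X \<in> sets (cylinder_algebra L)" using X by (auto simp: sets_cylinder_algebra)
    then show "emeasure (distr m1 (cylinder_algebra L) (\<lambda>x. x)) X = emeasure (distr m2 (cylinder_algebra L) (\<lambda>x. x)) X"
      using m id m1 m2 by (simp add: emeasure_distr)
  next
    show "range (\<lambda>_ :: nat. UNIV) \<subseteq> cylinder_sets L" by (auto intro: cylinder_sets.UNIV)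
    show "emeasure (distr m1 (cylinder_algebra L) (\<lambda>x. x)) UNIV \<noteq> \<infinity>"
      using id(1) m1 m1.emeasure_space_1 sets.top[of "cylinder_algebra L"] by (simp add: emeasure_distr)
  qed (auto simp: sets_cylinder_algebra)
  then have "emeasure (distr m1 (cylinder_algebra L) (\<lambda>x. x)) A = emeasure (distr m2 (cylinder_algebra L) (\<lambda>x. x)) A"
    by simp
  then show ?thesis using A id m1 m2 by (simp add: emeasure_distr)
qed

text \<open>On the closure of \<open>D\<close>, a ball around a point of \<open>D\<close> is a
  countable intersection of slabs given by functionals norming differences of points of
  \<open>D\<close>. Open sets are countable unions of rational such balls, and the claim passes
  through the sigma-algebra operations.\<close>

lemma borel_set_cylinder_trace:
  fixes D :: "'e::real_normed_vector set"
  assumes D: "countable D" and B: "B \<in> sets borel"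
  shows "\<exists>B'\<in>sets (cylinder_algebra (blinfun_apply :: ('e \<Rightarrow>\<^sub>L real) \<Rightarrow> _)). B \<inter> closure D = B' \<inter> closure D"
proof -
  let ?C = "cylinder_algebra (blinfun_apply :: ('e \<Rightarrow>\<^sub>L real) \<Rightarrow> _)"
  obtain \<xi> :: "'e \<Rightarrow> 'e \<Rightarrow>\<^sub>L real" where \<xi>: "\<And>z. norm (\<xi> z) \<le> 1" "\<And>z. \<xi> z z = norm z"
    using norming_functional by metis
  have le: "\<bar>\<xi> z y\<bar> \<le> norm y" for z y
    using norm_blinfun[of "\<xi> z" y] mult_right_mono[OF \<xi>(1)[of z] norm_ge_zero[of y]] by simp
  \<comment> \<open>A cylinder set standing in for the closed ball: only the functionals norming d'
    - d are tested, which suffices for points that can be approximated by some d' in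
    \<open>D\<close>.\<close>
  define cb where "cb = (\<lambda>d r. \<Inter>d'\<in>D. {x. \<bar>\<xi> (d' - d) (x - d)\<bar> \<le> r})"
  have cb_sets: "cb d r \<in> sets ?C" if "D \<noteq> {}" for d r
    unfolding cb_def
  proof (rule sets.countable_INT'[OF D that])
    have [measurable]: "blinfun_apply x' \<in> borel_measurable ?C" for x' :: "'e \<Rightarrow>\<^sub>L real"
      by (rule cylinder_algebra_measurable)
    have "{x \<in> space ?C. \<bar>\<xi> (d' - d) x - \<xi> (d' - d) d\<bar> \<le> r} \<in> sets ?C" for d'
      by measurable
    then show "(\<lambda>d'. {x. \<bar>\<xi> (d' - d) (x - d)\<bar> \<le> r}) ` D \<subseteq> sets ?C"
      by (auto simp: blinfun.diff_right)
  qed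
  have cb_eq: "cb d r \<inter> closure D = cball d r \<inter> closure D" if "d \<in> D" for d r
  proof -
    have "x \<in> cb d r \<longleftrightarrow> dist d x \<le> r" if x: "x \<in> closure D" for x
    proof
      assume "dist d x \<le> r"
      then have "norm (x - d) \<le> r" by (simp add: dist_norm norm_minus_commute)
      then show "x \<in> cb d r" by (auto simp: cb_def intro: order_trans[OF le])
    next
      assume c: "x \<in> cb d r"
      show "dist d x \<le> r"
      proof (rule field_le_epsilon)
        fix e :: real assume "e > 0"
        then obtain d' where d': "d' \<in> D" "dist d' x < e / 2"
          using x closure_approachable[of x D] half_gt_zero by blast
        have "norm (d' - d) = \<xi> (d' - d) (x - d) + \<xi> (d' - d) (d' - x)"
          using \<xi>(2)[of "d' - d"] by (simp add: blinfun.diff_right)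
        also have "\<dots> \<le> r + norm (d' - x)"
          using c d' le[of "d' - d" "d' - x"] by (force simp: cb_def)
        finally have "norm (d' - d) \<le> r + norm (d' - x)" .
        moreover have "dist d x \<le> norm (d' - d) + norm (d' - x)"
          using dist_triangle[of d x d'] by (simp add: dist_norm norm_minus_commute)
        ultimately show "dist d x \<le> r + e" using d'(2) by (simp add: dist_norm)
      qed
    qed
    then show ?thesis by auto
  qed
  have "B \<in> sigma_sets UNIV {S. open S}" using B by (simp add: borel_def)
  then show ?thesis
  proof induction
    case (Basic U)
    then have U: "open U" by simp
    show ?case
    proof (cases "D = {}")
      case True
      then show ?thesis by auto
    next
      case False
      define I where "I = {(d, q). d \<in> D \<and> q \<in> \<rat> \<and> cball d q \<subseteq> U}"
      have "countable I"
        by (rule countable_subset[of _ "D \<times> \<rat>"]) (auto simp: I_def D countable_rat)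
      then have "(\<Union>(d, q)\<in>I. cb d q) \<in> sets ?C"
        using cb_sets[OF False] by (intro sets.countable_UN') auto
      moreover have "U \<inter> closure D = (\<Union>(d, q)\<in>I. cb d q) \<inter> closure D"
      proof -
        have "\<exists>(d, q)\<in>I. x \<in> cball d q" if x: "x \<in> U" "x \<in> closure D" for x
        proof -
          obtain e where e: "e > 0" "cball x e \<subseteq> U" using U x(1) open_contains_cball by blast
          obtain q where q: "q \<in> \<rat>" "0 < q" "q < e / 2" using Rats_dense_in_real[of 0 "e / 2"] e by auto
          obtain d where d: "d \<in> D" "dist d x < q" using x(2) closure_approachable[of x D] q by blast
          have "cball d q \<subseteq> cball x e"
          proof
            fix y assume "y \<in> cball d q"
            then show "y \<in> cball x e"
              using dist_triangle[of x y d] d q by (simp add: dist_commute)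
          qed
          then show ?thesis using d q e by (intro bexI[of _ "(d, q)"]) (auto simp: I_def)
        qed
        then have "U \<inter> closure D = (\<Union>(d, q)\<in>I. cball d q \<inter> closure D)"
          by (auto simp: I_def)
        also have "\<dots> = (\<Union>(d, q)\<in>I. cb d q \<inter> closure D)"
          using cb_eq by (auto simp: I_def)
        finally show ?thesis by auto
      qed
      ultimately show ?thesis by blast
    qed
  next
    case Empty
    show ?case by auto
  next
    case (Compl A)
    then obtain A' where A': "A' \<in> sets ?C" "A \<inter> closure D = A' \<inter> closure D" by blast
    then have "UNIV - A' \<in> sets ?C" using sets.compl_sets[of A' ?C] by simp
    moreover have "(UNIV - A) \<inter> closure D = (UNIV - A') \<inter> closure D" using A' by blast
    ultimately show ?case by blast
  next
    case (Union A)
    then obtain A' where A': "\<And>n. A' n \<in> sets ?C" "\<And>n. A n \<inter> closure D = A' n \<inter> closure D" by metis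
    then have "(\<Union>n. A' n) \<in> sets ?C" by auto
    moreover have "(\<Union>n. A n) \<inter> closure D = (\<Union>n. A' n) \<inter> closure D" using A'(2) by blast
    ultimately show ?case by blast
  qed
qed

text \<open>A common separable support lets every Borel set be replaced by a cylinder set up to null
  sets of both measures.\<close>

lemma char_functional_eq_imp_measure_eq:
  fixes m1 m2 :: "'e::real_normed_vector measure"
  assumes m1: "prob_space m1" "sets m1 = sets borel" and m2: "prob_space m2" "sets m2 = sets borel"
    and char: "\<And>x' :: 'e \<Rightarrow>\<^sub>L real. (\<integral>x. iexp (x' x) \<partial>m1) = (\<integral>x. iexp (x' x) \<partial>m2)"
    and D: "countable D" "AE x in m1. x \<in> closure D" "AE x in m2. x \<in> closure D"
  shows "m1 = m2"
proof (rule measure_eqI)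
  show "sets m1 = sets m2" using m1 m2 by simp
  fix B assume "B \<in> sets m1"
  then have B: "B \<in> sets borel" using m1 by simp
  let ?C = "cylinder_algebra (blinfun_apply :: ('e \<Rightarrow>\<^sub>L real) \<Rightarrow> _)"
  obtain B' where B': "B' \<in> sets ?C" "B \<inter> closure D = B' \<inter> closure D"
    using borel_set_cylinder_trace[OF D(1) B] by blast
  have sp: "space m1 = UNIV" "space m2 = UNIV"
    using m1(2) m2(2) by (auto dest: sets_eq_imp_space_eq)
  have meas: "blinfun_apply x' \<in> borel_measurable m1" "blinfun_apply x' \<in> borel_measurable m2" for x' :: "'e \<Rightarrow>\<^sub>L real"
    unfolding measurable_cong_sets[OF m1(2) refl] measurable_cong_sets[OF m2(2) refl]
    by (intro borel_measurable_continuous_onI continuous_intros)+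
  have "(\<lambda>x. x) \<in> measurable m1 ?C" "(\<lambda>x. x) \<in> measurable m2 ?C"
    by (rule measurable_cylinder_algebra, simp_all add: sp meas)+
  from this[THEN measurable_sets, OF B'(1)] sp have B'm: "B' \<in> sets m1" "B' \<in> sets m2"
    by simp_all
  have "emeasure m1 B = emeasure m1 B'"
    using D(2) B'(2) by (intro emeasure_eq_AE) (use B B'm m1 in \<open>auto elim!: eventually_mono\<close>)
  also have "\<dots> = emeasure m2 B'"
  proof (rule char_functional_determines_cylinder_sets[OF m1(1) sp(1) m2(1) sp(2) _ meas char B'(1)])
    show "linear (\<lambda>v. blinfun_apply v x)" for x :: 'e
      by (simp add: linear_iff blinfun.bilinear_simps)
  qed
  also have "\<dots> = emeasure m2 B"
    using D(3) B'(2) by (intro emeasure_eq_AE) (use B B'm m2 in \<open>auto elim!: eventually_mono\<close>)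
  finally show "emeasure m1 B = emeasure m2 B" .
qed

text \<open>Compact sets of measure close to 1 are totally bounded; the centres of their finite
  1/(m+1)-nets form the countable set.\<close>

lemma radon_separable_support:
  fixes \<mu> :: "'e::metric_space measure"
  assumes "radon_probability \<mu>"
  shows "\<exists>D. countable D \<and> (AE x in \<mu>. x \<in> closure D)"
proof -
  interpret prob_space \<mu> using assms by (simp add: radon_probability_def)
  have sets: "sets \<mu> = sets borel" using assms by (simp add: radon_probability_def)
  have sp: "space \<mu> = UNIV" using sets by (auto dest: sets_eq_imp_space_eq)
  have sup: "(SUP K\<in>{K. compact K}. emeasure \<mu> K) = 1"
  proof -
    have "\<forall>B\<in>sets borel. emeasure \<mu> B = (SUP K\<in>{K. compact K \<and> K \<subseteq> B}. emeasure \<mu> K)"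
      using assms by (simp add: radon_probability_def)
    from bspec[OF this, of UNIV]
    have "emeasure \<mu> UNIV = (SUP K\<in>{K. compact K \<and> K \<subseteq> UNIV}. emeasure \<mu> K)" by simp
    then show ?thesis using emeasure_space_1 sp by simp
  qed
  have "\<exists>K. compact K \<and> emeasure \<mu> K > 1 - ennreal (inverse (real (Suc n)))" for n
  proof -
    have "1 - ennreal (inverse (real (Suc n))) < 1"
      by (intro ennreal_between) auto
    then have "1 - ennreal (inverse (real (Suc n))) < (SUP K\<in>{K. compact K}. emeasure \<mu> K)"
      by (simp only: sup)
    then show ?thesis unfolding less_SUP_iff by blast
  qed
  then obtain K where K: "\<And>n. compact (K n)" "\<And>n. emeasure \<mu> (K n) > 1 - ennreal (inverse (real (Suc n)))"
    by metis
  have "\<exists>k. finite k \<and> K n \<subseteq> (\<Union>x\<in>k. ball x (inverse (real (Suc m))))" for n m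
    using seq_compact_imp_totally_bounded[of "K n"] K(1)[of n] compact_imp_seq_compact
    by (meson inverse_positive_iff_positive of_nat_0_less_iff zero_less_Suc)
  then obtain k where k: "\<And>n m. finite (k n m)" "\<And>n m. K n \<subseteq> (\<Union>x\<in>k n m. ball x (inverse (real (Suc m))))"
    by metis
  define D where "D = (\<Union>n m. k n m)"
  have "countable D" unfolding D_def
    by (intro countable_UN[OF countableI_type] countable_finite[OF k(1)])
  moreover have KD: "K n \<subseteq> closure D" for n
  proof
    fix x assume x: "x \<in> K n"
    show "x \<in> closure D"
      unfolding closure_approachable
    proof (intro allI impI)
      fix e :: real assume "e > 0"
      then obtain m where m: "inverse (real (Suc m)) < e" using reals_Archimedean by blast
      obtain y where "y \<in> k n m" "dist y x < inverse (real (Suc m))" using k(2)[of n m] x by auto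
      then show "\<exists>y\<in>D. dist y x < e" using m by (intro bexI[of _ y]) (auto simp: D_def)
    qed
  qed
  moreover have "AE x in \<mu>. x \<in> closure D"
  proof -
    have cl: "closure D \<in> sets \<mu>" using sets by simp
    have "prob (closure D) \<ge> 1 - inverse (real (Suc n))" for n
    proof -
      have "1 - ennreal (inverse (real (Suc n))) < emeasure \<mu> (closure D)"
        using K(2)[of n] emeasure_mono[OF KD[of n] cl] by (rule less_le_trans)
      then have "ennreal (1 - inverse (real (Suc n))) < ennreal (prob (closure D))"
        by (simp add: emeasure_eq_measure ennreal_minus flip: ennreal_1)
      then show ?thesis by (simp add: ennreal_less_iff field_simps)
    qed
    moreover have "(\<lambda>n. 1 - inverse (real (Suc n))) \<longlonglongrightarrow> 1"
      using tendsto_diff[OF tendsto_const LIMSEQ_inverse_real_of_nat, of 1] by simp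
    ultimately have "1 \<le> prob (closure D)"
      by (intro LIMSEQ_le_const2[of "\<lambda>n. 1 - inverse (real (Suc n))"]) auto
    then have "prob (closure D) = 1" using prob_le_1[of "closure D"] by simp
    then show ?thesis using prob_eq_1[OF cl] by simp
  qed
  ultimately show ?thesis by blast
qed

section \<open>Gaussian random variables\<close>

lemma centred_gaussian_cases:
  assumes "prob_space M" "centred_gaussian M X"
  obtains "AE x in M. X x = 0"
  | \<sigma> where "\<sigma> > 0" "distr M borel X = density lborel (\<lambda>r. ennreal (normal_density 0 \<sigma> r))"
proof -
  have X[measurable]: "X \<in> borel_measurable M" using assms(2) by (simp add: centred_gaussian_def)
  from assms(2) consider "distr M borel X = return borel 0" |
    \<sigma> where "\<sigma> > 0" "distr M borel X = density lborel (\<lambda>r. ennreal (normal_density 0 \<sigma> r))"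
    by (auto simp: centred_gaussian_def)
  then show thesis
  proof cases
    case 1
    have "AE r in return borel 0. r = (0::real)" by (simp add: AE_return)
    then have "AE r in distr M borel X. r = 0" by (simp only: 1)
    then have "AE x in M. X x = 0" by (simp add: AE_distr_iff)
    then show ?thesis by (rule that(1))
  qed (rule that(2))
qed

lemma integral_gaussian:
  fixes f :: "real \<Rightarrow> 'b::{banach, second_countable_topology}"
  assumes [measurable]: "X \<in> borel_measurable M" "f \<in> borel_measurable borel"
    and d: "distr M borel X = density lborel (\<lambda>r. ennreal (normal_density 0 \<sigma> r))"
  shows "integrable M (\<lambda>x. f (X x)) \<longleftrightarrow> integrable lborel (\<lambda>r. normal_density 0 \<sigma> r *\<^sub>R f r)"
    and "(\<integral>x. f (X x) \<partial>M) = (\<integral>r. normal_density 0 \<sigma> r *\<^sub>R f r \<partial>lborel)"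
proof -
  have "integrable M (\<lambda>x. f (X x)) \<longleftrightarrow> integrable (distr M borel X) f"
    by (simp add: integrable_distr_eq)
  also have "\<dots> \<longleftrightarrow> integrable lborel (\<lambda>r. normal_density 0 \<sigma> r *\<^sub>R f r)"
    unfolding d by (subst integrable_density) auto
  finally show "integrable M (\<lambda>x. f (X x)) \<longleftrightarrow> integrable lborel (\<lambda>r. normal_density 0 \<sigma> r *\<^sub>R f r)" .
  have "(\<integral>x. f (X x) \<partial>M) = integral\<^sup>L (distr M borel X) f"
    by (simp add: integral_distr)
  also have "\<dots> = (\<integral>r. normal_density 0 \<sigma> r *\<^sub>R f r \<partial>lborel)"
    unfolding d by (subst integral_density) auto
  finally show "(\<integral>x. f (X x) \<partial>M) = (\<integral>r. normal_density 0 \<sigma> r *\<^sub>R f r \<partial>lborel)" .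
qed

lemma centred_gaussian_L2:
  assumes "prob_space M" and X: "centred_gaussian M X"
  shows "X \<in> L2 M"
proof -
  have [measurable]: "X \<in> borel_measurable M" using X by (simp add: centred_gaussian_def)
  from assms show ?thesis
  proof (cases rule: centred_gaussian_cases)
    case 1
    have "integrable M (\<lambda>x. (X x)\<^sup>2) \<longleftrightarrow> integrable M (\<lambda>x. 0 :: real)"
      using 1 by (intro integrable_cong_AE) auto
    then show ?thesis by (simp add: L2_iff)
  next
    case (2 \<sigma>)
    have "integrable lborel (\<lambda>r. normal_density 0 \<sigma> r *\<^sub>R r\<^sup>2)"
      using integrable_normal_moment[OF 2(1), of 0 2] by simp
    then show ?thesis using integral_gaussian(1)[OF _ _ 2(2), of "\<lambda>r. r\<^sup>2"] by (simp add: L2_iff)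
  qed
qed

lemma centred_gaussian_exp_integrable:
  assumes "prob_space M" and X: "centred_gaussian M X"
  shows "integrable M (\<lambda>x. exp (c * X x))"
proof -
  interpret prob_space M by fact
  have [measurable]: "X \<in> borel_measurable M" using X by (simp add: centred_gaussian_def)
  from assms show ?thesis
  proof (cases rule: centred_gaussian_cases)
    case 1
    have "integrable M (\<lambda>x. exp (c * X x)) \<longleftrightarrow> integrable M (\<lambda>x. 1 :: real)"
      using 1 by (intro integrable_cong_AE) auto
    then show ?thesis by simp
  next
    case (2 \<sigma>)
    \<comment> \<open>Completing the square: up to a constant this is the normal density with mean
      shifted to \<open>c * \<sigma>\<^sup>2\<close>.\<close>
    have e: "normal_density 0 \<sigma> r *\<^sub>R exp (c * r) = exp (c\<^sup>2 * \<sigma>\<^sup>2 / 2) * normal_density (c * \<sigma>\<^sup>2) \<sigma> r" for r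
    proof -
      have "- (r - 0)\<^sup>2 / (2 * \<sigma>\<^sup>2) + c * r = c\<^sup>2 * \<sigma>\<^sup>2 / 2 + - (r - c * \<sigma>\<^sup>2)\<^sup>2 / (2 * \<sigma>\<^sup>2)"
        using 2(1) by (simp add: field_simps power2_eq_square)
      then show ?thesis
        unfolding normal_density_def by (simp add: exp_add[symmetric])
    qed
    have "integrable lborel (\<lambda>r. normal_density 0 \<sigma> r *\<^sub>R exp (c * r))"
      unfolding e using 2(1) by simp
    then show ?thesis using integral_gaussian(1)[OF _ _ 2(2), of "\<lambda>r. exp (c * r)"] by simp
  qed
qed

lemma centred_gaussian_char:
  assumes "prob_space M" and X: "centred_gaussian M X"
  shows "(\<integral>x. iexp (X x) \<partial>M) = exp (- (\<integral>x. (X x)\<^sup>2 \<partial>M) / 2)"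
proof -
  interpret prob_space M by fact
  have [measurable]: "X \<in> borel_measurable M" using X by (simp add: centred_gaussian_def)
  from assms show ?thesis
  proof (cases rule: centred_gaussian_cases)
    case 1
    have "(\<integral>x. iexp (X x) \<partial>M) = (\<integral>x. 1 \<partial>M)" "(\<integral>x. (X x)\<^sup>2 \<partial>M) = (\<integral>x. 0 \<partial>M)"
      by (intro integral_cong_AE; use 1 in auto)+
    then show ?thesis by (simp add: prob_space)
  next
    case (2 \<sigma>)
    have v: "(\<integral>x. (X x)\<^sup>2 \<partial>M) = \<sigma>\<^sup>2"
      using integral_gaussian(2)[OF _ _ 2(2), of "\<lambda>r. r\<^sup>2"] integral_normal_moment_even[OF 2(1), of 0 1] 2(1)
      by (simp add: fact_numeral)
    have e: "\<sigma> * normal_density 0 \<sigma> (\<sigma> * r) = std_normal_density r" for r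
      using 2(1) by (simp add: normal_density_def field_simps real_sqrt_mult)
    have "(\<integral>x. iexp (X x) \<partial>M) = (\<integral>r. normal_density 0 \<sigma> r *\<^sub>R iexp r \<partial>lborel)"
      by (rule integral_gaussian(2)[OF _ _ 2(2)]) auto
    also have "\<dots> = \<bar>\<sigma>\<bar> *\<^sub>R (\<integral>r. normal_density 0 \<sigma> (0 + \<sigma> * r) *\<^sub>R iexp (0 + \<sigma> * r) \<partial>lborel)"
      using 2(1) by (intro lborel_integral_real_affine) auto
    also have "\<dots> = (\<integral>r. \<sigma> *\<^sub>R (normal_density 0 \<sigma> (\<sigma> * r) *\<^sub>R iexp (\<sigma> * r)) \<partial>lborel)"
      using 2(1) by (simp only: integral_scaleR_right) simp
    also have "\<dots> = (\<integral>r. std_normal_density r *\<^sub>R iexp (\<sigma> * r) \<partial>lborel)"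
      by (simp only: scaleR_scaleR e)
    also have "\<dots> = char std_normal_distribution \<sigma>"
      unfolding char_def by (subst integral_density) auto
    also have "\<dots> = exp (- \<sigma>\<^sup>2 / 2)" by (simp add: char_std_normal_distribution)
    finally show ?thesis by (simp add: v)
  qed
qed

lemma exp_abs_le: "exp \<bar>x :: real\<bar> \<le> exp x + exp (- x)"
  by (cases "x \<ge> 0") auto

text \<open>
  Both sides are entire in \<open>z\<close> if \<open>X\<close> is replaced by \<open>z X\<close>, and for imaginary \<open>z\<close> they agree by the
  formula for the characteristic function.
\<close>

lemma gaussian_complex_exp:
  assumes M: "prob_space M" and X: "centred_gaussian M X"
    and lin: "\<And>u. centred_gaussian M (\<lambda>x. u * X x + Z x)"
  shows "(\<integral>x. exp (X x) *\<^sub>R iexp (Z x) \<partial>M) =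
    exp (complex_of_real (((\<integral>x. (X x)\<^sup>2 \<partial>M) - (\<integral>x. (Z x)\<^sup>2 \<partial>M)) / 2) + \<i> * complex_of_real (\<integral>x. X x * Z x \<partial>M))"
proof -
  interpret prob_space M by fact
  have Z: "centred_gaussian M Z" using lin[of 0] by simp
  note L2 = centred_gaussian_L2[OF M X] centred_gaussian_L2[OF M Z]
  have [measurable]: "X \<in> borel_measurable M" "Z \<in> borel_measurable M"
    using X Z by (simp_all add: centred_gaussian_def)
  define A B C where "A = (\<integral>x. (X x)\<^sup>2 \<partial>M)" and "B = (\<integral>x. (Z x)\<^sup>2 \<partial>M)" and "C = (\<integral>x. X x * Z x \<partial>M)"
  define F where "F = (\<lambda>z :: complex. \<integral>x. exp (z * complex_of_real (X x)) * iexp (Z x) \<partial>M)"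
  define G where "G = (\<lambda>z :: complex. exp ((z\<^sup>2 * A - B) / 2 + \<i> * z * C))"
  \<comment> \<open>Exponential moments of |X| dominate the whole power series below.\<close>
  have ei: "integrable M (\<lambda>x. exp (c * \<bar>X x\<bar>))" if "c \<ge> 0" for c
  proof (rule Bochner_Integration.integrable_bound)
    show "integrable M (\<lambda>x. exp (c * X x) + exp (- c * X x))"
      by (intro Bochner_Integration.integrable_add centred_gaussian_exp_integrable M X)
    show "AE x in M. norm (exp (c * \<bar>X x\<bar>)) \<le> norm (exp (c * X x) + exp (- c * X x))"
      using exp_abs_le[of "c * X x" for x] that by (auto simp: abs_mult)
  qed auto
  define a where "a = (\<lambda>n. \<integral>x. (X x ^ n / fact n) *\<^sub>R iexp (Z x) \<partial>M)"
  have ps: "(\<Sum>k<n. \<bar>y :: real\<bar> ^ k / fact k) \<le> exp \<bar>y\<bar>" for n y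
    using sum_le_suminf[OF summable_exp[of "\<bar>y\<bar>"], of "{..<n}"]
    by (simp add: exp_def scaleR_conv_of_real field_simps)
  have pow_le: "\<bar>y :: real\<bar> ^ n / fact n \<le> exp \<bar>y\<bar>" for n y
    using ps[of y "Suc n"] sum_nonneg[of "{..<n}" "\<lambda>k. \<bar>y\<bar> ^ k / fact k"] by simp
  have ai: "integrable M (\<lambda>x. (X x ^ n / fact n) *\<^sub>R iexp (Z x))" for n
  proof (rule Bochner_Integration.integrable_bound[OF ei[of 1]])
    show "AE x in M. norm ((X x ^ n / fact n) *\<^sub>R iexp (Z x)) \<le> norm (exp (1 * \<bar>X x\<bar>))"
      using pow_le by (auto simp: power_abs)
  qed auto
  \<comment> \<open>Expanding F into a power series by dominated convergence gives holomorphy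
    without differentiation under the integral.\<close>
  have sums: "(\<lambda>n. a n * (z - 0) ^ n) sums F z" for z :: complex
    unfolding sums_def
  proof -
    have "(\<lambda>n. \<integral>x. (\<Sum>k<n. ((X x ^ k / fact k) *\<^sub>R iexp (Z x)) * z ^ k) \<partial>M) \<longlonglongrightarrow> F z"
      unfolding F_def
    proof (rule integral_dominated_convergence)
      show "integrable M (\<lambda>x. exp (norm z * \<bar>X x\<bar>))" by (rule ei) simp
      have e: "((X x ^ k / fact k) *\<^sub>R iexp (Z x)) * z ^ k = ((z * complex_of_real (X x)) ^ k /\<^sub>R fact k) * iexp (Z x)" for x k
        by (simp add: scaleR_conv_of_real power_mult_distrib field_simps)
      show "AE x in M. (\<lambda>n. \<Sum>k<n. ((X x ^ k / fact k) *\<^sub>R iexp (Z x)) * z ^ k) \<longlonglongrightarrow> exp (z * complex_of_real (X x)) * iexp (Z x)"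
        unfolding e sum_distrib_right[symmetric]
        using exp_converges[of "z * complex_of_real (X x)" for x] by (auto intro!: tendsto_mult_right simp: sums_def)
      show "AE x in M. norm (\<Sum>k<n. ((X x ^ k / fact k) *\<^sub>R iexp (Z x)) * z ^ k) \<le> exp (norm z * \<bar>X x\<bar>)" for n
      proof (rule AE_I2)
        fix x
        have "norm (\<Sum>k<n. ((X x ^ k / fact k) *\<^sub>R iexp (Z x)) * z ^ k) \<le>
            (\<Sum>k<n. norm (((X x ^ k / fact k) *\<^sub>R iexp (Z x)) * z ^ k))" by (rule norm_sum)
        also have "\<dots> = (\<Sum>k<n. \<bar>norm z * \<bar>X x\<bar>\<bar> ^ k / fact k)"
          by (intro sum.cong) (simp_all add: norm_mult norm_power power_abs power_mult_distrib field_simps)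
        also have "\<dots> \<le> exp \<bar>norm z * \<bar>X x\<bar>\<bar>" by (rule ps)
        finally show "norm (\<Sum>k<n. ((X x ^ k / fact k) *\<^sub>R iexp (Z x)) * z ^ k) \<le> exp (norm z * \<bar>X x\<bar>)" by simp
      qed
    qed auto
    moreover have "(\<integral>x. (\<Sum>k<n. ((X x ^ k / fact k) *\<^sub>R iexp (Z x)) * z ^ k) \<partial>M) = (\<Sum>k<n. a k * (z - 0) ^ k)" for n
    proof -
      have "(\<integral>x. (\<Sum>k<n. ((X x ^ k / fact k) *\<^sub>R iexp (Z x)) * z ^ k) \<partial>M) =
          (\<Sum>k<n. \<integral>x. ((X x ^ k / fact k) *\<^sub>R iexp (Z x)) * z ^ k \<partial>M)"
        by (rule Bochner_Integration.integral_sum) (rule integrable_mult_left[OF ai])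
      then show ?thesis by (simp only: a_def integral_mult_left_zero diff_zero)
    qed
    ultimately show "(\<lambda>n. \<Sum>i<n. a i * (z - 0) ^ i) \<longlonglongrightarrow> F z" by simp
  qed
  \<comment> \<open>The disc of radius 2 contains both the point 1, where the value is wanted, and
    the imaginary segment, which accumulates at 0.\<close>
  have "F 1 - G 1 = 0"
  proof (rule analytic_continuation[of "\<lambda>z. F z - G z" "ball 0 2" "(\<lambda>u. \<i> * complex_of_real u) ` {-1..1}" 0])
    have "F holomorphic_on ball 0 2" by (rule power_series_holomorphic) (rule sums)
    then show "(\<lambda>z. F z - G z) holomorphic_on ball 0 2"
      unfolding G_def by (intro holomorphic_intros) auto
    show "(\<lambda>u. \<i> * complex_of_real u) ` {-1..1} \<subseteq> ball 0 2" by (auto simp: norm_mult)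
    show "0 islimpt (\<lambda>u. \<i> * complex_of_real u) ` {-1..1}"
    proof (rule islimptI)
      fix T :: "complex set" assume "0 \<in> T" "open T"
      then obtain e where e: "e > 0" "ball 0 e \<subseteq> T" using open_contains_ball by blast
      define u where "u = min 1 (e / 2)"
      have u: "u > 0" "u \<le> 1" "u < e" using e by (auto simp: u_def)
      then have "\<i> * complex_of_real u \<in> ball 0 e" by (simp add: norm_mult)
      then show "\<exists>y\<in>(\<lambda>u. \<i> * complex_of_real u) ` {-1..1}. y \<in> T \<and> y \<noteq> 0"
        using e u by (intro bexI[of _ "\<i> * complex_of_real u"]) auto
    qed
    fix z assume "z \<in> (\<lambda>u. \<i> * complex_of_real u) ` {-1..1}"
    then obtain u where z: "z = \<i> * complex_of_real u" by blast
    have "F z = (\<integral>x. iexp (u * X x + Z x) \<partial>M)"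
      unfolding F_def z by (simp add: exp_add distrib_left mult.assoc)
    also have "\<dots> = exp (- (\<integral>x. (u * X x + Z x)\<^sup>2 \<partial>M) / 2)" by (rule centred_gaussian_char[OF M lin])
    also have "(\<lambda>x. (u * X x + Z x)\<^sup>2) = (\<lambda>x. u\<^sup>2 * (X x)\<^sup>2 + (2 * u * (X x * Z x) + (Z x)\<^sup>2))"
      by (auto simp: power2_eq_square algebra_simps)
    also have "(\<integral>x. u\<^sup>2 * (X x)\<^sup>2 + (2 * u * (X x * Z x) + (Z x)\<^sup>2) \<partial>M) = u\<^sup>2 * A + (2 * u * C + B)"
      unfolding A_def B_def C_def
      using L2_integrable[OF L2(1)] L2_integrable[OF L2(2)] L2_mult_integrable[OF L2] by simp
    also have "complex_of_real (exp (- (u\<^sup>2 * A + (2 * u * C + B)) / 2)) = G z"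
      unfolding G_def z exp_of_real[symmetric]
      by (rule arg_cong[where f = exp]) (simp add: power_mult_distrib algebra_simps diff_divide_distrib add_divide_distrib)
    finally show "F z - G z = 0" by simp
  qed (auto simp: convex_connected)
  then show ?thesis
    by (simp add: F_def G_def A_def B_def C_def scaleR_conv_of_real exp_of_real)
qed

section \<open>Centred Gaussian Radon measures\<close>

locale gaussian_radon =
  fixes \<mu> :: "'e::banach measure"
  assumes gaussian: "centred_gaussian_radon \<mu>"
begin

sublocale prob_space \<mu>
  using gaussian by (simp add: centred_gaussian_radon_def radon_probability_def)

lemma sets_mu [simp, measurable_cong]: "sets \<mu> = sets borel"
  using gaussian by (simp add: centred_gaussian_radon_def radon_probability_def)

lemma space_mu [simp]: "space \<mu> = UNIV"
  using sets_eq_imp_space_eq[OF sets_mu] by simp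

lemma functional_gaussian: "centred_gaussian \<mu> (blinfun_apply x')"
  using gaussian by (simp add: centred_gaussian_radon_def)

lemma functional_measurable [measurable]: "blinfun_apply (x' :: 'e \<Rightarrow>\<^sub>L real) \<in> borel_measurable \<mu>"
  using functional_gaussian by (simp add: centred_gaussian_def)

lemma functional_L2 [simp]: "blinfun_apply (x' :: 'e \<Rightarrow>\<^sub>L real) \<in> L2 \<mu>"
  by (rule centred_gaussian_L2[OF prob_space_axioms functional_gaussian])

definition cov :: "('e \<Rightarrow>\<^sub>L real) \<Rightarrow> ('e \<Rightarrow>\<^sub>L real) \<Rightarrow> real" where
  "cov x' y' = (\<integral>x. x' x * y' x \<partial>\<mu>)"

lemma functional_mult_integrable: "integrable \<mu> (\<lambda>x. blinfun_apply x' x * blinfun_apply y' x :: real)"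
  by (rule L2_mult_integrable) simp_all

lemma cov_sym: "cov x' y' = cov y' x'"
  by (simp add: cov_def mult.commute)

lemma cov_bilinear: "bilinear cov"
  unfolding bilinear_def linear_iff cov_def
  using functional_mult_integrable
  by (simp add: blinfun.bilinear_simps algebra_simps Bochner_Integration.integral_add)

lemmas cov_add_left = bilinear_ladd[OF cov_bilinear]
  and cov_add_right = bilinear_radd[OF cov_bilinear]
  and cov_diff_left = bilinear_lsub[OF cov_bilinear]
  and cov_diff_right = bilinear_rsub[OF cov_bilinear]
  and cov_scaleR_left = bilinear_lmul[OF cov_bilinear, unfolded real_scaleR_def]
  and cov_scaleR_right = bilinear_rmul[OF cov_bilinear, unfolded real_scaleR_def]

lemma cov_zero [simp]: "cov 0 y' = 0" "cov x' 0 = 0"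
  by (simp_all add: cov_def)

lemma cov_nonneg: "cov x' x' \<ge> 0"
  by (simp add: cov_def)

lemma cov_self: "cov x' x' = (l2norm \<mu> (blinfun_apply x'))\<^sup>2"
  unfolding cov_def l2norm_power2 by (simp add: power2_eq_square)

lemma cov_Cauchy_Schwarz: "\<bar>cov x' y'\<bar> \<le> l2norm \<mu> (blinfun_apply x') * l2norm \<mu> (blinfun_apply y')"
  unfolding cov_def by (rule Cauchy_Schwarz_real) simp_all

lemma functional_char: "(\<integral>x. iexp (blinfun_apply x' x) \<partial>\<mu>) = exp (- cov x' x' / 2)"
  using centred_gaussian_char[OF prob_space_axioms functional_gaussian, of x']
  by (simp add: cov_def power2_eq_square)

lemma functional_complex_exp:
  "(\<integral>x. exp (blinfun_apply x' x) *\<^sub>R iexp (blinfun_apply y' x) \<partial>\<mu>) =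
    exp (complex_of_real ((cov x' x' - cov y' y') / 2) + \<i> * complex_of_real (cov x' y'))"
proof -
  have "centred_gaussian \<mu> (\<lambda>x. u * blinfun_apply x' x + blinfun_apply y' x)" for u
    using functional_gaussian[of "u *\<^sub>R x' + y'"] by (simp add: blinfun.bilinear_simps[abs_def])
  from gaussian_complex_exp[OF prob_space_axioms functional_gaussian this]
  show ?thesis by (simp add: cov_def power2_eq_square)
qed

lemma functional_exp_integrable: "integrable \<mu> (\<lambda>x. exp (blinfun_apply x' x) :: real)"
  using centred_gaussian_exp_integrable[OF prob_space_axioms functional_gaussian, of 1 x'] by simp

section \<open>Orthogonal transformations of two independent copies\<close>

definition pair_functional :: "('e \<Rightarrow>\<^sub>L real) \<times> ('e \<Rightarrow>\<^sub>L real) \<Rightarrow> 'e \<times> 'e \<Rightarrow> real" where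
  "pair_functional = (\<lambda>(x', y') (x, y). x' x + y' y)"

text \<open>Orthogonal with determinant -1 when a^2 + b^2 = 1. The signs are chosen so that for a =
  sin and b = cos of an angle the second component is the derivative of the first with respect to
  that angle.\<close>

definition rotate :: "real \<Rightarrow> real \<Rightarrow> 'e \<times> 'e \<Rightarrow> 'e \<times> 'e" where
  "rotate a b = (\<lambda>(x, y). (a *\<^sub>R x + b *\<^sub>R y, b *\<^sub>R x - a *\<^sub>R y))"

sublocale pair: pair_prob_space \<mu> \<mu> ..

lemma pair_functional_measurable: "pair_functional v \<in> borel_measurable (\<mu> \<Otimes>\<^sub>M \<mu>)"
  unfolding pair_functional_def by (cases v) (simp add: case_prod_beta')

lemma pair_functional_rotate:
  "pair_functional (x', y') (rotate a b z) = pair_functional (a *\<^sub>R x' + b *\<^sub>R y', b *\<^sub>R x' - a *\<^sub>R y') z"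
  by (cases z) (simp add: pair_functional_def rotate_def blinfun.bilinear_simps algebra_simps)

text \<open>The target carries the cylinder sigma-algebra, because addition on a nonseparable space
  can fail to be measurable for the product of the Borel sigma-algebras.\<close>

lemma rotate_measurable: "rotate a b \<in> measurable (\<mu> \<Otimes>\<^sub>M \<mu>) (cylinder_algebra pair_functional)"
proof (rule measurable_cylinder_algebra)
  show "(\<lambda>z. pair_functional v (rotate a b z)) \<in> borel_measurable (\<mu> \<Otimes>\<^sub>M \<mu>)" for v
    by (cases v) (simp add: pair_functional_rotate pair_functional_measurable)
qed (simp add: space_pair_measure)

lemma pair_functional_char:
  "(\<integral>z. iexp (pair_functional (x', y') z) \<partial>(\<mu> \<Otimes>\<^sub>M \<mu>)) = exp (- (cov x' x' + cov y' y') / 2)"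
proof -
  have "integrable (\<mu> \<Otimes>\<^sub>M \<mu>) (\<lambda>z. iexp (pair_functional (x', y') z))"
  proof (rule pair.P.integrable_const_bound[of _ 1])
    have [measurable]: "pair_functional v \<in> borel_measurable (\<mu> \<Otimes>\<^sub>M \<mu>)" for v by (rule pair_functional_measurable)
    show "(\<lambda>z. iexp (pair_functional (x', y') z)) \<in> borel_measurable (\<mu> \<Otimes>\<^sub>M \<mu>)" by measurable
  qed simp
  then have "(\<integral>z. iexp (pair_functional (x', y') z) \<partial>(\<mu> \<Otimes>\<^sub>M \<mu>)) =
      (\<integral>x. \<integral>y. iexp (pair_functional (x', y') (x, y)) \<partial>\<mu> \<partial>\<mu>)"
    by (subst pair.integral_fst'[symmetric]) simp_all
  also have "\<dots> = (\<integral>x. iexp (x' x) * (\<integral>y. iexp (y' y) \<partial>\<mu>) \<partial>\<mu>)"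
    by (simp add: pair_functional_def exp_add distrib_left)
  also have "\<dots> = exp (- cov x' x' / 2) * exp (- cov y' y' / 2)"
    by (simp add: functional_char)
  finally show ?thesis by (simp add: exp_add[symmetric] field_simps flip: of_real_mult)
qed

text \<open>Both laws have the same characteristic functional: orthogonality leaves the sum of the
  two variances unchanged.\<close>

lemma rotation_invariance:
  assumes ab: "a\<^sup>2 + b\<^sup>2 = 1" and A: "A \<in> sets (cylinder_algebra pair_functional)"
  shows "emeasure (\<mu> \<Otimes>\<^sub>M \<mu>) (rotate a b -` A) = emeasure (\<mu> \<Otimes>\<^sub>M \<mu>) A"
proof -
  let ?C = "cylinder_algebra pair_functional"
  have sp: "space (\<mu> \<Otimes>\<^sub>M \<mu>) = UNIV" by (simp add: space_pair_measure)
  have "emeasure (distr (\<mu> \<Otimes>\<^sub>M \<mu>) ?C (rotate a b)) A = emeasure (\<mu> \<Otimes>\<^sub>M \<mu>) A"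
  proof (rule char_functional_determines_cylinder_sets[OF _ _ _ sp _ _ pair_functional_measurable _ A])
    show "prob_space (distr (\<mu> \<Otimes>\<^sub>M \<mu>) ?C (rotate a b))"
      by (rule pair.P.prob_space_distr[OF rotate_measurable])
    show "linear (\<lambda>v. pair_functional v z)" for z
      by (cases z) (auto simp: linear_iff pair_functional_def blinfun.bilinear_simps algebra_simps split: prod.split)
    show "pair_functional v \<in> borel_measurable (distr (\<mu> \<Otimes>\<^sub>M \<mu>) ?C (rotate a b))" for v
      by simp
    show "(\<integral>z. iexp (pair_functional v z) \<partial>(distr (\<mu> \<Otimes>\<^sub>M \<mu>) ?C (rotate a b))) = (\<integral>z. iexp (pair_functional v z) \<partial>(\<mu> \<Otimes>\<^sub>M \<mu>))" for v
    proof -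
      obtain x' y' where v: "v = (x', y')" by (cases v)
      have "(\<integral>z. iexp (pair_functional v z) \<partial>(distr (\<mu> \<Otimes>\<^sub>M \<mu>) ?C (rotate a b))) =
          (\<integral>z. iexp (pair_functional v (rotate a b z)) \<partial>(\<mu> \<Otimes>\<^sub>M \<mu>))"
        by (rule integral_distr[OF rotate_measurable]) measurable
      also have "\<dots> = exp (- (cov (a *\<^sub>R x' + b *\<^sub>R y') (a *\<^sub>R x' + b *\<^sub>R y') + cov (b *\<^sub>R x' - a *\<^sub>R y') (b *\<^sub>R x' - a *\<^sub>R y')) / 2)"
        unfolding v pair_functional_rotate by (rule pair_functional_char)
      also have "cov (a *\<^sub>R x' + b *\<^sub>R y') (a *\<^sub>R x' + b *\<^sub>R y') + cov (b *\<^sub>R x' - a *\<^sub>R y') (b *\<^sub>R x' - a *\<^sub>R y') =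
          (a\<^sup>2 + b\<^sup>2) * (cov x' x' + cov y' y')"
        by (simp add: cov_add_left cov_add_right cov_diff_left cov_diff_right cov_scaleR_left cov_scaleR_right
            cov_sym[of y' x'] algebra_simps power2_eq_square)
      finally show ?thesis by (simp add: ab v pair_functional_char)
    qed
  qed (auto simp: pair.P.prob_space_axioms)
  then show ?thesis
    using A by (simp add: emeasure_distr[OF rotate_measurable] sp)
qed

lemma rotation_invariance_nn_integral:
  assumes ab: "a\<^sup>2 + b\<^sup>2 = 1" and f: "f \<in> borel_measurable (cylinder_algebra pair_functional)"
  shows "(\<integral>\<^sup>+z. f (rotate a b z) \<partial>(\<mu> \<Otimes>\<^sub>M \<mu>)) = (\<integral>\<^sup>+z. f z \<partial>(\<mu> \<Otimes>\<^sub>M \<mu>))"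
proof -
  let ?C = "cylinder_algebra pair_functional"
  have sp: "space (\<mu> \<Otimes>\<^sub>M \<mu>) = UNIV" by (simp add: space_pair_measure)
  have id: "(\<lambda>z. z) \<in> measurable (\<mu> \<Otimes>\<^sub>M \<mu>) ?C"
    by (rule measurable_cylinder_algebra) (auto simp: sp pair_functional_measurable)
  have "distr (\<mu> \<Otimes>\<^sub>M \<mu>) ?C (rotate a b) = distr (\<mu> \<Otimes>\<^sub>M \<mu>) ?C (\<lambda>z. z)"
    by (rule measure_eqI) (use rotation_invariance[OF ab] in
        \<open>auto simp: emeasure_distr[OF rotate_measurable] emeasure_distr[OF id] sp\<close>)
  then have "(\<integral>\<^sup>+z. f z \<partial>distr (\<mu> \<Otimes>\<^sub>M \<mu>) ?C (rotate a b)) = (\<integral>\<^sup>+z. f z \<partial>distr (\<mu> \<Otimes>\<^sub>M \<mu>) ?C (\<lambda>z. z))"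
    by simp
  then show ?thesis
    using f by (simp add: nn_integral_distr[OF rotate_measurable] nn_integral_distr[OF id])
qed

lemma pair_functional_simps:
  "pair_functional (x', 0) z = blinfun_apply x' (fst z)"
  "pair_functional (0, y') z = blinfun_apply y' (snd z)"
  by (cases z; simp add: pair_functional_def)+

lemma cylinder_fst [measurable]: "(\<lambda>z. blinfun_apply x' (fst z) :: real) \<in> borel_measurable (cylinder_algebra pair_functional)"
  and cylinder_snd [measurable]: "(\<lambda>z. blinfun_apply x' (snd z) :: real) \<in> borel_measurable (cylinder_algebra pair_functional)"
  using cylinder_algebra_measurable[of pair_functional "(x', 0)"]
    cylinder_algebra_measurable[of pair_functional "(0, x')"]
  by (simp_all add: pair_functional_simps[abs_def])

end

text \<open>Sums and products of measurable maps into a nonseparable space may fail to be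
  measurable. If one of them is simple, the combination is measurable piece by piece; this is used
  wherever such expressions occur.\<close>

lemma simple_piecewise_measurable:
  assumes s: "simple_function M s" and g: "\<And>v. (\<lambda>x. g v x) \<in> measurable M N"
  shows "(\<lambda>x. g (s x) x) \<in> measurable M N"
proof (rule measurable_compose_countable'[OF g])
  show "s \<in> measurable M (count_space (s ` space M))"
    using s by (subst measurable_count_space_eq2) (auto simp: simple_function_def)
  show "countable (s ` space M)" using s by (simp add: simple_function_def countable_finite)
qed

lemma borel_measurable_norm_diff_const:
  fixes f :: "'a \<Rightarrow> 'b::real_normed_vector"
  assumes "f \<in> borel_measurable M"
  shows "(\<lambda>x. norm (f x - c)) \<in> borel_measurable M"
proof -
  have "(\<lambda>y. norm (y - c)) \<in> borel_measurable borel"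
    by (intro borel_measurable_continuous_onI continuous_intros)
  from measurable_compose[OF assms this] show ?thesis .
qed

section \<open>Square integrability of the norm\<close>

context gaussian_radon
begin

lemma separable_support: "\<exists>D. countable D \<and> D \<noteq> {} \<and> (AE x in \<mu>. x \<in> closure D)"
proof -
  obtain D where D: "countable D" "AE x in \<mu>. x \<in> closure D"
    using radon_separable_support gaussian by (auto simp: centred_gaussian_radon_def)
  have "D \<noteq> {}"
  proof
    assume "D = {}"
    with D(2) have "AE x in \<mu>. False" by simp
    then show False by simp
  qed
  with D show ?thesis by blast
qed

text \<open>Norming functionals of the points of a countable set dense in the support suffice. The
  supremum, unlike the norm itself in general, is measurable for the cylinder sigma-algebra on
  pairs; the bound 1 on their norms gives the reverse inequality.\<close>

lemma norm_as_supremum: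
  "\<exists>\<eta> :: nat \<Rightarrow> 'e \<Rightarrow>\<^sub>L real. (\<forall>n. norm (\<eta> n) \<le> 1) \<and> (AE x in \<mu>. norm x \<le> (SUP n. \<bar>blinfun_apply (\<eta> n) x\<bar>))"
proof -
  obtain D where D: "countable D" "D \<noteq> {}" "AE x in \<mu>. x \<in> closure D" using separable_support by blast
  obtain \<xi> :: "'e \<Rightarrow> 'e \<Rightarrow>\<^sub>L real" where \<xi>: "\<And>z. norm (\<xi> z) \<le> 1" "\<And>z. \<xi> z z = norm z"
    using norming_functional by metis
  have le: "\<bar>\<xi> z y\<bar> \<le> norm y" for z y
    using norm_blinfun[of "\<xi> z" y] mult_right_mono[OF \<xi>(1)[of z] norm_ge_zero[of y]] by simp
  define \<eta> where "\<eta> = (\<lambda>n. \<xi> (from_nat_into D n))"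
  have "norm x \<le> (SUP n. \<bar>\<eta> n x\<bar>)" if x: "x \<in> closure D" for x
  proof (rule field_le_epsilon)
    fix e :: real assume "e > 0"
    then obtain d where d: "d \<in> D" "dist d x < e / 2"
      using x closure_approachable[of x D] half_gt_zero by blast
    obtain n where n: "d = from_nat_into D n" using d(1) D(1) by (metis from_nat_into_surj)
    have "norm d = \<xi> d x + \<xi> d (d - x)" using \<xi>(2)[of d] by (simp add: blinfun.diff_right)
    also have "\<dots> \<le> \<bar>\<eta> n x\<bar> + norm (d - x)"
      using le[of d "d - x"] by (simp add: \<eta>_def n)
    also have "\<bar>\<eta> n x\<bar> \<le> (SUP n. \<bar>\<eta> n x\<bar>)"
    proof (rule cSUP_upper)
      show "bdd_above (range (\<lambda>n. \<bar>\<eta> n x\<bar>))"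
        by (rule bdd_aboveI2[of _ _ "norm x"]) (simp add: \<eta>_def le)
    qed simp
    finally have "norm d \<le> (SUP n. \<bar>\<eta> n x\<bar>) + norm (d - x)" by simp
    moreover have "norm x \<le> norm d + norm (d - x)"
      using norm_triangle_ineq4[of d "d - x"] by simp
    ultimately show "norm x \<le> (SUP n. \<bar>\<eta> n x\<bar>) + e"
      using d(2) by (simp add: dist_norm)
  qed
  with D(3) have "AE x in \<mu>. norm x \<le> (SUP n. \<bar>\<eta> n x\<bar>)" by (auto elim!: eventually_mono)
  moreover have "\<forall>n. norm (\<eta> n) \<le> 1" by (simp add: \<eta>_def \<xi>)
  ultimately show ?thesis by blast
qed

text \<open>
  Fernique's argument: by rotation invariance, \<open>p t * (1 - p s) \<le> (p ((t - s) / sqrt 2))\<^sup>2\<close> for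
  the tail function \<open>p\<close> of the norm.
\<close>

theorem norm_L2: "(\<lambda>x. norm x) \<in> L2 \<mu>"
proof -
  obtain \<eta> :: "nat \<Rightarrow> 'e \<Rightarrow>\<^sub>L real" where \<eta>: "\<And>n. norm (\<eta> n) \<le> 1"
    and sup: "AE x in \<mu>. norm x \<le> (SUP n. \<bar>\<eta> n x\<bar>)" using norm_as_supremum by blast
  define N where "N = (\<lambda>x. SUP n. \<bar>\<eta> n x\<bar>)"
  have le: "\<bar>\<eta> n x\<bar> \<le> norm x" for n x
    using norm_blinfun[of "\<eta> n" x] mult_right_mono[OF \<eta>[of n] norm_ge_zero[of x]] by simp
  have bdd: "bdd_above (range (\<lambda>n. \<bar>\<eta> n x\<bar>))" for x by (rule bdd_aboveI2[of _ _ "norm x"]) (rule le)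
  have N_ge: "\<bar>\<eta> n x\<bar> \<le> N x" for n x unfolding N_def by (rule cSUP_upper[OF _ bdd]) simp
  have N_le: "N x \<le> c" if "\<And>n. \<bar>\<eta> n x\<bar> \<le> c" for x c unfolding N_def using that by (intro cSUP_least) auto
  have N_sub: "N (c *\<^sub>R x + d *\<^sub>R y) \<le> \<bar>c\<bar> * N x + \<bar>d\<bar> * N y" for c d x y
  proof (rule N_le)
    fix n
    have "\<bar>\<eta> n (c *\<^sub>R x + d *\<^sub>R y)\<bar> \<le> \<bar>c\<bar> * \<bar>\<eta> n x\<bar> + \<bar>d\<bar> * \<bar>\<eta> n y\<bar>"
      by (simp add: blinfun.bilinear_simps abs_mult[symmetric])
    also have "\<dots> \<le> \<bar>c\<bar> * N x + \<bar>d\<bar> * N y" by (intro add_mono mult_left_mono N_ge) auto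
    finally show "\<bar>\<eta> n (c *\<^sub>R x + d *\<^sub>R y)\<bar> \<le> \<bar>c\<bar> * N x + \<bar>d\<bar> * N y" .
  qed
  have N_nonneg: "N x \<ge> 0" for x using N_ge[of 0 x] by simp
  have [measurable]: "N \<in> borel_measurable \<mu>"
    unfolding N_def by (rule borel_measurable_cSUP) (auto intro: bdd)
  let ?C = "cylinder_algebra pair_functional"
  have [measurable]: "(\<lambda>z. N (fst z)) \<in> borel_measurable ?C" "(\<lambda>z. N (snd z)) \<in> borel_measurable ?C"
    unfolding N_def by (rule borel_measurable_cSUP; auto intro: bdd)+
  define p where "p = (\<lambda>t. prob {x. N x > t})"
  have p01: "0 \<le> p t" "p t \<le> 1" for t by (simp_all add: p_def)
  have [measurable]: "{x. N x > t} \<in> sets \<mu>" "{x. N x \<le> t} \<in> sets \<mu>" for t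
    using measurable_sets[of N \<mu> borel "{t<..}"] measurable_sets[of N \<mu> borel "{..t}"] by (auto simp: vimage_def)
  have p_antimono: "p t \<le> p s" if "s \<le> t" for s t
    unfolding p_def using that by (intro finite_measure_mono) auto
  have tail: "p t * (1 - p s) \<le> (p ((t - s) / sqrt 2))\<^sup>2" for s t
  proof -
    define u where "u = (t - s) / sqrt 2"
    define A where "A = {z. N (fst z) > t \<and> N (snd z) \<le> s}"
    have "{z \<in> space ?C. N (fst z) > t \<and> N (snd z) \<le> s} \<in> sets ?C" by measurable
    then have A: "A \<in> sets ?C" by (simp add: A_def)
    have A': "A = {x. N x > t} \<times> {x. N x \<le> s}" by (auto simp: A_def)
    have "prob {x. N x \<le> s} = 1 - p s"
    proof -
      have "{x. N x \<le> s} = space \<mu> - {x. N x > s}" by auto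
      then show ?thesis using prob_compl[of "{x. N x > s}"] by (simp add: p_def)
    qed
    then have "ennreal (p t * (1 - p s)) = emeasure (\<mu> \<Otimes>\<^sub>M \<mu>) A"
      unfolding A' by (subst emeasure_pair_measure_Times) (auto simp: emeasure_eq_measure p_def ennreal_mult[symmetric])
    also have "\<dots> = emeasure (\<mu> \<Otimes>\<^sub>M \<mu>) (rotate (1 / sqrt 2) (1 / sqrt 2) -` A)"
      by (rule rotation_invariance[OF _ A, symmetric]) (simp add: power_divide)
    also have "\<dots> \<le> emeasure (\<mu> \<Otimes>\<^sub>M \<mu>) ({x. N x > u} \<times> {x. N x > u})"
    proof (rule emeasure_mono)
      show "rotate (1 / sqrt 2) (1 / sqrt 2) -` A \<subseteq> {x. N x > u} \<times> {x. N x > u}"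
      proof
        fix z assume z: "z \<in> rotate (1 / sqrt 2) (1 / sqrt 2) -` A"
        obtain x y where xy: "z = (x, y)" by (cases z)
        define v w where "v = (1 / sqrt 2) *\<^sub>R x + (1 / sqrt 2) *\<^sub>R y" and "w = (1 / sqrt 2) *\<^sub>R x - (1 / sqrt 2) *\<^sub>R y"
        have vw: "N v > t" "N w \<le> s" using z by (auto simp: xy rotate_def A_def v_def w_def)
        \<comment> \<open>Transforming back: sqrt 2 x = v + w and sqrt 2 y = v - w, so a large v
          together with a small w makes both x and y large.\<close>
        have "v = sqrt 2 *\<^sub>R x + (-1) *\<^sub>R w" "v = sqrt 2 *\<^sub>R y + 1 *\<^sub>R w"
          by (simp_all add: v_def w_def real_div_sqrt field_simps flip: scaleR_add_left scaleR_diff_left scaleR_2)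
        then have "t < sqrt 2 * N x + s" "t < sqrt 2 * N y + s"
          using N_sub[of "sqrt 2" x "-1" w] N_sub[of "sqrt 2" y 1 w] vw by auto
        then show "z \<in> {x. N x > u} \<times> {x. N x > u}" by (simp add: xy u_def field_simps)
      qed
    qed simp
    also have "\<dots> = ennreal ((p u)\<^sup>2)"
      by (subst emeasure_pair_measure_Times) (auto simp: emeasure_eq_measure p_def ennreal_mult[symmetric] power2_eq_square)
    finally show ?thesis by (simp add: u_def)
  qed
  obtain s where s: "s \<ge> 1" "p s \<le> 1/32"
  proof -
    have "(\<lambda>n. prob {x. N x > real n}) \<longlonglongrightarrow> prob (\<Inter>n. {x. N x > real n})"
      by (rule finite_Lim_measure_decseq) (auto simp: decseq_def)
    moreover have "(\<Inter>n. {x. N x > real n}) = {}"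
      using reals_Archimedean2 by (auto simp: set_eq_iff not_less intro: less_imp_le)
    ultimately have "(\<lambda>n. p (real n)) \<longlonglongrightarrow> 0" by (simp add: p_def)
    then have "\<forall>\<^sub>F n in sequentially. p (real n) < 1/32" by (rule order_tendstoD) simp
    then obtain n where "p (real n) < 1/32" "n \<ge> 1"
      using eventually_conj[OF _ eventually_ge_at_top[of 1]] by (metis (mono_tags, lifting) eventually_sequentially order_refl)
    then show ?thesis using that[of "real n"] by simp
  qed
  \<comment> \<open>The ratio 3 is enough because (3 t_n - s) / sqrt 2 >= t_n for t_n >= s. Together
    with p s <= 1/32 the tail inequality gives p (t_(n+1)) <= 2 (p (t_n))^2 <= p (t_n) / 16.\<close>
  define t where "t = (\<lambda>n. s * 3 ^ n)"
  have p_t: "p (t n) \<le> 1/32 * (1/16) ^ n" for n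
  proof (induction n)
    case 0
    show ?case using s by (simp add: t_def)
  next
    case (Suc n)
    have small: "p (t n) \<le> 1/32"
    proof -
      have "p (t n) \<le> p s" using s by (intro p_antimono) (simp add: t_def)
      then show ?thesis using s(2) by simp
    qed
    have "t n \<le> (t (Suc n) - s) / sqrt 2"
    proof -
      have "sqrt 2 \<le> 2" by (rule real_le_lsqrt) auto
      then have "sqrt 2 * (s * 3 ^ n) \<le> 2 * (s * 3 ^ n)" using s by (intro mult_right_mono) auto
      also have "\<dots> \<le> t (Suc n) - s" using s one_le_power[of "3::real" n] by (simp add: t_def)
      finally show ?thesis by (simp add: t_def field_simps)
    qed
    then have "p ((t (Suc n) - s) / sqrt 2) \<le> p (t n)" by (rule p_antimono)
    then have "(p ((t (Suc n) - s) / sqrt 2))\<^sup>2 \<le> (p (t n))\<^sup>2" using p01 by (intro power_mono)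
    then have "p (t (Suc n)) * (1 - p s) \<le> (p (t n))\<^sup>2" using tail[of "t (Suc n)" s] by simp
    moreover have "p (t (Suc n)) * (1/2) \<le> p (t (Suc n)) * (1 - p s)"
      using s p01 by (intro mult_left_mono) auto
    moreover have "(p (t n))\<^sup>2 \<le> 1/32 * p (t n)"
      unfolding power2_eq_square using small p01 by (intro mult_right_mono) auto
    ultimately have "p (t (Suc n)) \<le> 1/16 * p (t n)" by linarith
    also have "\<dots> \<le> 1/16 * (1/32 * (1/16) ^ n)" using Suc by simp
    finally show ?case by simp
  qed
  \<comment> \<open>Layers of the seminorm N: between t_m and t_(m+1) the square of N is at most s^2
    9^(m+1), while the tail decays like 16^-m, so the layers are summable.\<close>
  define f where "f = (\<lambda>n x. ennreal (s\<^sup>2 * 9 ^ Suc n) * indicator {x. N x > t n} x)"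
  have pw: "ennreal ((N x)\<^sup>2) \<le> ennreal (s\<^sup>2) + (\<Sum>n. f n x)" for x
  proof (cases "N x \<le> s")
    case True
    then have "ennreal ((N x)\<^sup>2) \<le> ennreal (s\<^sup>2)" using N_nonneg by (intro ennreal_leI power_mono)
    also have "\<dots> \<le> ennreal (s\<^sup>2) + (\<Sum>n. f n x)" by simp
    finally show ?thesis .
  next
    case False
    have "\<exists>n. N x \<le> t n"
    proof -
      obtain n where "N x < 3 ^ n" using real_arch_pow[of 3 "N x"] by auto
      moreover have "3 ^ n \<le> t n" using s by (simp add: t_def)
      ultimately show ?thesis by (intro exI[of _ n]) linarith
    qed
    then have ex: "N x \<le> t (LEAST n. N x \<le> t n)" by (rule LeastI_ex)
    have "(LEAST n. N x \<le> t n) \<noteq> 0"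
    proof
      assume "(LEAST n. N x \<le> t n) = 0"
      with ex have "N x \<le> t 0" by (simp only:)
      with False show False by (simp add: t_def)
    qed
    then obtain m where m: "(LEAST n. N x \<le> t n) = Suc m" by (cases "LEAST n. N x \<le> t n") auto
    have 1: "N x > t m" using not_less_Least[of m "\<lambda>n. N x \<le> t n"] m by simp
    have 2: "N x \<le> t (Suc m)" using ex m by simp
    have "(N x)\<^sup>2 \<le> (t (Suc m))\<^sup>2" using 2 N_nonneg by (intro power_mono)
    also have "\<dots> = s\<^sup>2 * 9 ^ Suc m"
      by (simp add: t_def power_mult_distrib power_mult[symmetric] power2_eq_square) (simp add: power_mult_distrib[symmetric])
    finally have "ennreal ((N x)\<^sup>2) \<le> f m x" using 1 by (simp add: f_def ennreal_leI)
    also have "\<dots> = (\<Sum>n\<in>{m}. f n x)" by simp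
    also have "\<dots> \<le> (\<Sum>n. f n x)" by (rule sum_le_suminf) auto
    finally show ?thesis by (simp add: add_increasing)
  qed
  have "(\<integral>\<^sup>+x. ennreal ((norm x)\<^sup>2) \<partial>\<mu>) \<le> (\<integral>\<^sup>+x. ennreal (s\<^sup>2) + (\<Sum>n. f n x) \<partial>\<mu>)"
  proof (rule nn_integral_mono_AE)
    show "AE x in \<mu>. ennreal ((norm x)\<^sup>2) \<le> ennreal (s\<^sup>2) + (\<Sum>n. f n x)"
      using sup
    proof eventually_elim
      case (elim x)
      then have "ennreal ((norm x)\<^sup>2) \<le> ennreal ((N x)\<^sup>2)" by (intro ennreal_leI power_mono) (auto simp: N_def)
      then show ?case using pw[of x] by (rule order_trans)
    qed
  qed
  also have "\<dots> = ennreal (s\<^sup>2) + (\<Sum>n. \<integral>\<^sup>+x. f n x \<partial>\<mu>)"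
  proof -
    have fm[measurable]: "f n \<in> borel_measurable \<mu>" for n unfolding f_def by measurable
    have "(\<integral>\<^sup>+x. ennreal (s\<^sup>2) + (\<Sum>n. f n x) \<partial>\<mu>) = (\<integral>\<^sup>+x. ennreal (s\<^sup>2) \<partial>\<mu>) + (\<integral>\<^sup>+x. (\<Sum>n. f n x) \<partial>\<mu>)"
      by (rule nn_integral_add) auto
    also have "(\<integral>\<^sup>+x. (\<Sum>n. f n x) \<partial>\<mu>) = (\<Sum>n. \<integral>\<^sup>+x. f n x \<partial>\<mu>)" by (rule nn_integral_suminf) auto
    finally show ?thesis using emeasure_space_1 by simp
  qed
  also have "\<dots> \<le> ennreal (s\<^sup>2) + (\<Sum>n. ennreal (s\<^sup>2 * (9/16) ^ n))"
  proof (intro add_mono order_refl suminf_le summableI)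
    fix n
    have "(\<integral>\<^sup>+x. f n x \<partial>\<mu>) = ennreal (s\<^sup>2 * 9 ^ Suc n) * ennreal (p (t n))"
      unfolding f_def by (subst nn_integral_cmult_indicator) (auto simp: emeasure_eq_measure p_def)
    also have "\<dots> = ennreal (s\<^sup>2 * 9 ^ Suc n * p (t n))" using p01 by (simp add: ennreal_mult[symmetric])
    also have "s\<^sup>2 * 9 ^ Suc n * p (t n) \<le> s\<^sup>2 * 9 ^ Suc n * (1/32 * (1/16) ^ n)"
      by (intro mult_left_mono p_t) simp
    also have "\<dots> = 9/32 * (s\<^sup>2 * (9/16) ^ n)" by (simp add: power_divide)
    also have "\<dots> \<le> s\<^sup>2 * (9/16) ^ n" by simp
    finally show "(\<integral>\<^sup>+x. f n x \<partial>\<mu>) \<le> ennreal (s\<^sup>2 * (9/16) ^ n)" by (simp add: ennreal_leI)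
  qed
  also have "\<dots> < \<infinity>"
  proof -
    have "summable (\<lambda>n. s\<^sup>2 * (9/16) ^ n)" by (intro summable_mult summable_geometric) simp
    then have "(\<Sum>n. ennreal (s\<^sup>2 * (9/16) ^ n)) = ennreal (\<Sum>n. s\<^sup>2 * (9/16) ^ n)"
      by (intro suminf_ennreal2) auto
    then show ?thesis by simp
  qed
  finally have "integrable \<mu> (\<lambda>x. (norm x)\<^sup>2)"
    by (intro integrableI_bounded) auto
  then show ?thesis by (simp add: L2_iff)
qed

lemma L2_norm_integrable:
  assumes "h \<in> L2 \<mu>" shows "integrable \<mu> (\<lambda>x. \<bar>h x :: real\<bar> * norm x)"
  using L2_mult_integrable[OF L2_norm[OF assms] norm_L2] by simp

text \<open>The square integrable norm is the dominating function: pointwise convergence of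
  functionals with a common bound becomes L2 convergence.\<close>

lemma functional_dominated_convergence:
  fixes x' :: "nat \<Rightarrow> 'e \<Rightarrow>\<^sub>L real"
  assumes "\<And>n x. \<bar>x' n x\<bar> \<le> C * norm x" "\<And>x. (\<lambda>n. x' n x) \<longlonglongrightarrow> blinfun_apply z' x"
  shows "(\<lambda>n. l2norm \<mu> (\<lambda>x. x' n x - blinfun_apply z' x)) \<longlonglongrightarrow> 0"
proof (rule L2_dominated_convergence)
  show "(\<lambda>x. C * norm x) \<in> L2 \<mu>" by (rule L2_mult[OF norm_L2])
  have "\<bar>z' x\<bar> \<le> C * norm x" for x
    using tendsto_rabs[OF assms(2)[of x]] assms(1)[of _ x] by (intro LIMSEQ_le_const2) auto
  then show "AE x in \<mu>. norm (z' x) \<le> C * norm x" by simp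
qed (use assms in auto)

section \<open>The embedding of the reproducing kernel space\<close>

text \<open>The identity is approximated by the nearest among finitely many points of a countable
  dense subset of the support, and \<open>h\<close> by simple functions; the products are simple,
  and |h| times the norm dominates them up to a constant.\<close>

lemma bochner_integral_exists:
  assumes h: "h \<in> L2 \<mu>"
  shows "\<exists>y. has_vector_bochner_integral \<mu> (\<lambda>x. (h x :: real) *\<^sub>R x) y"
proof -
  have [measurable]: "h \<in> borel_measurable \<mu>" by (rule L2_borel[OF h])
  define f where "f = (\<lambda>x. h x *\<^sub>R x)"
  obtain D where D: "countable D" "D \<noteq> {}" "AE x in \<mu>. x \<in> closure D" using separable_support by blast
  \<comment> \<open>The origin is put first, so the nearest point is never farther than norm x,
    whence the bound 2 norm x on its norm.\<close>
  define d where "d = (\<lambda>n. case n of 0 \<Rightarrow> 0 | Suc k \<Rightarrow> from_nat_into D k)"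
  define \<kappa> where "\<kappa> = (\<lambda>n x. LEAST k. k \<le> n \<and> (\<forall>j\<le>n. dist x (d k) \<le> dist x (d j)))"
  define \<sigma> where "\<sigma> = (\<lambda>n x. d (\<kappa> n x))"
  have \<kappa>: "\<kappa> n x \<le> n" "j \<le> n \<Longrightarrow> dist x (\<sigma> n x) \<le> dist x (d j)" for n x j
  proof -
    have "\<exists>k\<in>{..n}. \<forall>j\<in>{..n}. dist x (d k) \<le> dist x (d j)"
      using ex_is_arg_min_if_finite[of "{..n}" "\<lambda>k. dist x (d k)"] by (auto simp: is_arg_min_linorder)
    then have "\<exists>k. k \<le> n \<and> (\<forall>j\<le>n. dist x (d k) \<le> dist x (d j))" by auto
    from LeastI_ex[OF this] show "\<kappa> n x \<le> n" "j \<le> n \<Longrightarrow> dist x (\<sigma> n x) \<le> dist x (d j)"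
      by (auto simp: \<kappa>_def \<sigma>_def)
  qed
  have [measurable]: "(\<lambda>x. dist x c) \<in> borel_measurable \<mu>" for c
  proof -
    have "(\<lambda>x :: 'e. dist x c) \<in> borel_measurable borel"
      by (intro borel_measurable_continuous_onI continuous_intros)
    then show ?thesis by (simp add: measurable_cong_sets[OF sets_mu refl])
  qed
  have \<kappa>_meas: "\<kappa> n \<in> measurable \<mu> (count_space UNIV)" for n
    unfolding \<kappa>_def by measurable
  have simple_\<kappa>: "simple_function \<mu> (\<kappa> n)" for n
    unfolding simple_function_def
  proof
    show "finite (\<kappa> n ` space \<mu>)" by (rule finite_subset[of _ "{..n}"]) (use \<kappa>(1) in auto)
    show "\<forall>k\<in>\<kappa> n ` space \<mu>. \<kappa> n -` {k} \<inter> space \<mu> \<in> sets \<mu>"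
      by (intro ballI measurable_sets[OF \<kappa>_meas]) simp
  qed
  have simple_\<sigma>: "simple_function \<mu> (\<sigma> n)" for n
    unfolding \<sigma>_def by (rule simple_function_compose1[OF simple_\<kappa>])
  have \<sigma>_norm: "norm (\<sigma> n x) \<le> 2 * norm x" for n x
  proof -
    have "dist x (\<sigma> n x) \<le> norm x" using \<kappa>(2)[of 0 n x] by (simp add: d_def)
    then show ?thesis using norm_triangle_ineq4[of x "x - \<sigma> n x"] by (simp add: dist_norm)
  qed
  have \<sigma>_lim: "(\<lambda>n. \<sigma> n x) \<longlonglongrightarrow> x" if x: "x \<in> closure D" for x
  proof (rule metric_LIMSEQ_I)
    fix e :: real assume "e > 0"
    then obtain v where v: "v \<in> D" "dist v x < e" using x closure_approachable[of x D] by blast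
    obtain k where k: "v = from_nat_into D k" using v(1) D(1) by (metis from_nat_into_surj)
    have "dist (\<sigma> n x) x < e" if "n \<ge> Suc k" for n
      using \<kappa>(2)[OF that, of x] v(2) by (simp add: d_def k dist_commute)
    then show "\<exists>no. \<forall>n\<ge>no. dist (\<sigma> n x) x < e" by blast
  qed
  obtain r where r: "\<And>n. simple_function \<mu> (r n)" "\<And>x. (\<lambda>n. r n x) \<longlonglongrightarrow> h x"
    "\<And>n x. dist (r n x) 0 \<le> 2 * dist (h x) 0"
    using borel_measurable_implies_sequence_metric[OF \<open>h \<in> borel_measurable \<mu>\<close>, of 0] by auto
  \<comment> \<open>Only \<open>h\<close> is approximated here: multiplication by a fixed scalar is
    continuous, so measurability holds piece by piece even without a separable range.\<close>
  have f_meas: "f \<in> borel_measurable \<mu>"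
    unfolding f_def
  proof (rule borel_measurable_LIMSEQ_metric)
    show "(\<lambda>x. r n x *\<^sub>R x) \<in> borel_measurable \<mu>" for n
    proof (rule simple_piecewise_measurable[OF r(1)])
      have "(\<lambda>x :: 'e. v *\<^sub>R x) \<in> borel_measurable borel" for v
        by (intro borel_measurable_continuous_onI continuous_intros)
      then show "(\<lambda>x. v *\<^sub>R x) \<in> borel_measurable \<mu>" for v by (simp add: measurable_cong_sets[OF sets_mu refl])
    qed
    show "(\<lambda>n. r n x *\<^sub>R x) \<longlonglongrightarrow> h x *\<^sub>R x" for x by (intro tendsto_scaleR r(2) tendsto_const)
  qed
  define s where "s = (\<lambda>n x. r n x *\<^sub>R \<sigma> n x)"
  have s_simple: "simple_function \<mu> (s n)" for n
    unfolding s_def by (rule simple_function_compose2[OF r(1) simple_\<sigma>])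
  have s_int: "Bochner_Integration.simple_bochner_integrable \<mu> (s n)" for n
    by (rule simple_bochner_integrable.intros[OF s_simple]) simp
  have diff_meas: "(\<lambda>x. norm (f x - s n x)) \<in> borel_measurable \<mu>" for n
    using simple_piecewise_measurable[OF s_simple borel_measurable_norm_diff_const[OF f_meas]] .
  have bound: "norm (f x - s n x) \<le> 5 * (\<bar>h x\<bar> * norm x)" for n x
  proof -
    have "norm (s n x) \<le> (2 * \<bar>h x\<bar>) * (2 * norm x)"
      unfolding s_def norm_scaleR using r(3)[of n x] \<sigma>_norm[of n x] by (intro mult_mono) (auto simp: dist_real_def)
    then show ?thesis using norm_triangle_ineq4[of "f x" "s n x"] by (simp add: f_def)
  qed
  have "(\<lambda>n. \<integral>x. norm (f x - s n x) \<partial>\<mu>) \<longlonglongrightarrow> (\<integral>x. 0 \<partial>\<mu>)"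
  proof (rule integral_dominated_convergence)
    show "integrable \<mu> (\<lambda>x. 5 * (\<bar>h x\<bar> * norm x))" using L2_norm_integrable[OF h] by simp
    show "AE x in \<mu>. (\<lambda>n. norm (f x - s n x)) \<longlonglongrightarrow> 0"
      using D(3)
    proof eventually_elim
      case (elim x)
      have "(\<lambda>n. s n x) \<longlonglongrightarrow> f x" unfolding s_def f_def by (intro tendsto_scaleR r(2) \<sigma>_lim elim)
      then show ?case using tendsto_norm[OF tendsto_diff[OF tendsto_const[of "f x"]]] by fastforce
    qed
    show "AE x in \<mu>. norm (norm (f x - s n x)) \<le> 5 * (\<bar>h x\<bar> * norm x)" for n using bound by simp
  qed (use diff_meas in auto)
  moreover have nn: "(\<integral>\<^sup>+x. ennreal (norm (f x - s n x)) \<partial>\<mu>) = ennreal (\<integral>x. norm (f x - s n x) \<partial>\<mu>)" for n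
  proof (rule nn_integral_eq_integral)
    show "integrable \<mu> (\<lambda>x. norm (f x - s n x))"
      by (rule Bochner_Integration.integrable_bound[of _ "\<lambda>x. 5 * (\<bar>h x\<bar> * norm x)"])
        (use L2_norm_integrable[OF h] diff_meas bound in auto)
  qed simp
  ultimately have lim0: "(\<lambda>n. \<integral>x. norm (f x - s n x) \<partial>\<mu>) \<longlonglongrightarrow> 0" by simp
  then have lim: "(\<lambda>n. \<integral>\<^sup>+x. ennreal (norm (f x - s n x)) \<partial>\<mu>) \<longlonglongrightarrow> 0"
    using tendsto_ennrealI[OF lim0] by (simp add: nn)
  have dist_le: "norm (Bochner_Integration.simple_bochner_integral \<mu> (s m) - Bochner_Integration.simple_bochner_integral \<mu> (s n)) \<le>
      (\<integral>x. norm (f x - s m x) \<partial>\<mu>) + (\<integral>x. norm (f x - s n x) \<partial>\<mu>)" for m n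
  proof -
    have i: "Bochner_Integration.simple_bochner_integrable \<mu> (\<lambda>x. s m x - s n x)"
      using simple_bochner_integrable_compose2[of "(-)" \<mu> "s m" "s n"] s_int by auto
    have i': "Bochner_Integration.simple_bochner_integrable \<mu> (\<lambda>x. norm (s m x - s n x))"
      using simple_bochner_integrable_compose2[of "\<lambda>x y. norm (x - y)" \<mu> "s m" "s n"] s_int by auto
    have "norm (Bochner_Integration.simple_bochner_integral \<mu> (s m) - Bochner_Integration.simple_bochner_integral \<mu> (s n)) =
        norm (Bochner_Integration.simple_bochner_integral \<mu> (\<lambda>x. s m x - s n x))"
      by (simp add: simple_bochner_integral_diff s_int)
    also have "\<dots> \<le> Bochner_Integration.simple_bochner_integral \<mu> (\<lambda>x. norm (s m x - s n x))"
      by (rule simple_bochner_integral_norm_bound[OF i])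
    finally have "ennreal (norm (Bochner_Integration.simple_bochner_integral \<mu> (s m) - Bochner_Integration.simple_bochner_integral \<mu> (s n))) \<le>
        ennreal (Bochner_Integration.simple_bochner_integral \<mu> (\<lambda>x. norm (s m x - s n x)))" by (rule ennreal_leI)
    also have "\<dots> = (\<integral>\<^sup>+x. ennreal (norm (s m x - s n x)) \<partial>\<mu>)"
      by (rule simple_bochner_integral_eq_nn_integral[OF i']) simp
    also have "\<dots> \<le> (\<integral>\<^sup>+x. ennreal (norm (f x - s m x)) + ennreal (norm (f x - s n x)) \<partial>\<mu>)"
    proof (rule nn_integral_mono)
      fix x
      have "norm (s m x - s n x) \<le> norm (f x - s m x) + norm (f x - s n x)"
        using norm_triangle_ineq4[of "f x - s n x" "f x - s m x"] by simp
      then show "ennreal (norm (s m x - s n x)) \<le> ennreal (norm (f x - s m x)) + ennreal (norm (f x - s n x))"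
        by (simp flip: ennreal_plus)
    qed
    also have "\<dots> = ennreal ((\<integral>x. norm (f x - s m x) \<partial>\<mu>) + (\<integral>x. norm (f x - s n x) \<partial>\<mu>))"
      using diff_meas by (simp add: nn_integral_add nn)
    finally show ?thesis by (subst (asm) ennreal_le_iff) auto
  qed
  have "Cauchy (\<lambda>n. Bochner_Integration.simple_bochner_integral \<mu> (s n))"
  proof (rule CauchyI)
    fix e :: real assume "e > 0"
    then have "\<forall>\<^sub>F n in sequentially. (\<integral>x. norm (f x - s n x) \<partial>\<mu>) < e / 2"
      using order_tendstoD(2)[OF lim0, of "e / 2"] by simp
    then obtain M where M: "\<And>n. n \<ge> M \<Longrightarrow> (\<integral>x. norm (f x - s n x) \<partial>\<mu>) < e / 2"
      by (auto simp: eventually_sequentially)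
    have "norm (Bochner_Integration.simple_bochner_integral \<mu> (s m) - Bochner_Integration.simple_bochner_integral \<mu> (s n)) < e" if "m \<ge> M" "n \<ge> M" for m n
      using dist_le[of m n] M[OF that(1)] M[OF that(2)] by linarith
    then show "\<exists>M. \<forall>m\<ge>M. \<forall>n\<ge>M. norm (Bochner_Integration.simple_bochner_integral \<mu> (s m) - Bochner_Integration.simple_bochner_integral \<mu> (s n)) < e" by blast
  qed
  then obtain y where y: "(\<lambda>n. Bochner_Integration.simple_bochner_integral \<mu> (s n)) \<longlonglongrightarrow> y"
    by (auto simp: Cauchy_convergent_iff convergent_def)
  show ?thesis
    unfolding has_vector_bochner_integral_def f_def[symmetric]
    using f_meas s_int lim y by blast
qed

lemma functional_bochner_integral:
  fixes x' :: "'e \<Rightarrow>\<^sub>L real"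
  assumes h: "h \<in> L2 \<mu>" and y: "has_vector_bochner_integral \<mu> (\<lambda>x. (h x :: real) *\<^sub>R x) y"
  shows "x' y = (\<integral>x. h x * x' x \<partial>\<mu>)"
proof -
  have f_meas: "(\<lambda>x. h x *\<^sub>R x) \<in> borel_measurable \<mu>"
    using y by (simp add: has_vector_bochner_integral_def)
  obtain s where "(\<forall>n. Bochner_Integration.simple_bochner_integrable \<mu> (s n)) \<and>
      (\<lambda>n. \<integral>\<^sup>+x. ennreal (norm (h x *\<^sub>R x - s n x)) \<partial>\<mu>) \<longlonglongrightarrow> 0 \<and>
      (\<lambda>n. Bochner_Integration.simple_bochner_integral \<mu> (s n)) \<longlonglongrightarrow> y"
    using y unfolding has_vector_bochner_integral_def by (elim conjE exE) (rule that, intro conjI, assumption+)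
  then have s: "\<And>n. Bochner_Integration.simple_bochner_integrable \<mu> (s n)"
    and lim: "(\<lambda>n. \<integral>\<^sup>+x. ennreal (norm (h x *\<^sub>R x - s n x)) \<partial>\<mu>) \<longlonglongrightarrow> 0"
    and y: "(\<lambda>n. Bochner_Integration.simple_bochner_integral \<mu> (s n)) \<longlonglongrightarrow> y"
    by simp_all
  have s_simple: "simple_function \<mu> (s n)" for n using s[of n] by (auto elim: simple_bochner_integrable.cases)
  have i: "Bochner_Integration.simple_bochner_integrable \<mu> (\<lambda>x. x' (s n x))" for n
    using s[of n] by (rule simple_bochner_integrable_compose2[of "\<lambda>x _. x' x" \<mu> "s n" "s n", simplified])
  have int: "integrable \<mu> (\<lambda>x. x' (s n x))" "(\<integral>x. x' (s n x) \<partial>\<mu>) = Bochner_Integration.simple_bochner_integral \<mu> (\<lambda>x. x' (s n x))" for n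
    using has_bochner_integral_simple_bochner_integrable[OF i[of n]]
    by (auto simp: has_bochner_integral_iff)
  have lin: "Bochner_Integration.simple_bochner_integral \<mu> (\<lambda>x. x' (s n x)) = x' (Bochner_Integration.simple_bochner_integral \<mu> (s n))" for n
    by (rule simple_bochner_integral_linear[OF _ s]) (simp add: linear_iff blinfun.bilinear_simps)
  have hx: "integrable \<mu> (\<lambda>x. h x * x' x)" by (rule L2_mult_integrable[OF h functional_L2])
  have le: "ennreal (norm ((\<integral>x. x' (s n x) \<partial>\<mu>) - (\<integral>x. h x * x' x \<partial>\<mu>))) \<le>
      ennreal (norm x') * (\<integral>\<^sup>+x. ennreal (norm (h x *\<^sub>R x - s n x)) \<partial>\<mu>)" for n
  proof -
    have meas: "(\<lambda>x. norm (h x *\<^sub>R x - s n x)) \<in> borel_measurable \<mu>"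
      using simple_piecewise_measurable[OF s_simple borel_measurable_norm_diff_const[OF f_meas]] .
    have "ennreal (norm ((\<integral>x. x' (s n x) \<partial>\<mu>) - (\<integral>x. h x * x' x \<partial>\<mu>))) = ennreal (norm (\<integral>x. x' (s n x) - h x * x' x \<partial>\<mu>))"
      using int(1)[of n] hx by simp
    also have "\<dots> \<le> (\<integral>\<^sup>+x. norm (x' (s n x) - h x * x' x) \<partial>\<mu>)"
      using int(1)[of n] hx by (intro integral_norm_bound_ennreal) simp
    also have "\<dots> \<le> (\<integral>\<^sup>+x. ennreal (norm x') * ennreal (norm (h x *\<^sub>R x - s n x)) \<partial>\<mu>)"
    proof (rule nn_integral_mono)
      fix x
      have "norm (x' (s n x) - h x * x' x) = norm (x' (h x *\<^sub>R x - s n x))"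
        by (simp add: blinfun.bilinear_simps abs_minus_commute)
      also have "\<dots> \<le> norm x' * norm (h x *\<^sub>R x - s n x)" by (rule norm_blinfun)
      finally show "ennreal (norm (x' (s n x) - h x * x' x)) \<le> ennreal (norm x') * ennreal (norm (h x *\<^sub>R x - s n x))"
        by (simp add: ennreal_mult[symmetric] ennreal_leI)
    qed
    also have "\<dots> = ennreal (norm x') * (\<integral>\<^sup>+x. ennreal (norm (h x *\<^sub>R x - s n x)) \<partial>\<mu>)"
      by (rule nn_integral_cmult) (use meas in simp)
    finally show ?thesis .
  qed
  have up: "(\<lambda>n. ennreal (norm x') * (\<integral>\<^sup>+x. ennreal (norm (h x *\<^sub>R x - s n x)) \<partial>\<mu>)) \<longlonglongrightarrow> 0"
    using ennreal_tendsto_cmult[OF _ lim, of "ennreal (norm x')"] by simp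
  have "(\<lambda>n. ennreal (norm ((\<integral>x. x' (s n x) \<partial>\<mu>) - (\<integral>x. h x * x' x \<partial>\<mu>)))) \<longlonglongrightarrow> 0"
    by (rule tendsto_sandwich[OF always_eventually always_eventually tendsto_const[of 0] up]) (use le in simp_all)
  then have "(\<lambda>n. norm ((\<integral>x. x' (s n x) \<partial>\<mu>) - (\<integral>x. h x * x' x \<partial>\<mu>))) \<longlonglongrightarrow> 0"
    by (subst (asm) ennreal_tendsto_0_iff) auto
  then have "(\<lambda>n. (\<integral>x. x' (s n x) \<partial>\<mu>)) \<longlonglongrightarrow> (\<integral>x. h x * x' x \<partial>\<mu>)"
    by (simp only: tendsto_norm_zero_iff LIM_zero_iff)
  then have "(\<lambda>n. x' (Bochner_Integration.simple_bochner_integral \<mu> (s n))) \<longlonglongrightarrow> (\<integral>x. h x * x' x \<partial>\<mu>)"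
    by (simp only: int(2) lin)
  moreover have "(\<lambda>n. x' (Bochner_Integration.simple_bochner_integral \<mu> (s n))) \<longlonglongrightarrow> x' y"
    by (intro tendsto_intros y)
  ultimately show ?thesis by (rule LIMSEQ_unique[rotated])
qed

text \<open>Every functional takes a determined value on a Bochner integral of h x, and functionals
  separate points; so the description by \<open>THE\<close> has a unique solution.\<close>

lemma functional_i_inf:
  fixes x' :: "'e \<Rightarrow>\<^sub>L real"
  assumes h: "h \<in> L2 \<mu>"
  shows "x' (i_inf \<mu> h) = (\<integral>x. h x * x' x \<partial>\<mu>)"
proof -
  obtain y where y: "has_vector_bochner_integral \<mu> (\<lambda>x. (h x :: real) *\<^sub>R x) y"
    using bochner_integral_exists[OF h] by blast
  have "has_vector_bochner_integral \<mu> (\<lambda>x. (h x :: real) *\<^sub>R x) (i_inf \<mu> h)"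
    unfolding i_inf_def
  proof (rule theI[where P = "has_vector_bochner_integral \<mu> (\<lambda>x. h x *\<^sub>R x)", OF y])
    fix z assume "has_vector_bochner_integral \<mu> (\<lambda>x. (h x :: real) *\<^sub>R x) z"
    note eq = functional_bochner_integral[OF h this] functional_bochner_integral[OF h y]
    show "z = y" by (rule eq_if_functionals_eq) (simp only: eq)
  qed
  from functional_bochner_integral[OF h this] show ?thesis .
qed

end

section \<open>The Gaussian Poincare inequality for functions of finitely many functionals\<close>

lemma tendsto_coordinatewise:
  assumes "\<And>i. ((\<lambda>s. p s i) \<longlongrightarrow> q i) F"
  shows "((p :: _ \<Rightarrow> _ \<Rightarrow> 'b::topological_space) \<longlongrightarrow> q) F"
proof -
  have "limitin (product_topology (\<lambda>i. euclidean) UNIV) p q F"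
    using assms by (simp add: limitin_componentwise)
  then show ?thesis by (simp add: euclidean_product_topology)
qed

text \<open>A continuous projection of all sequences onto the coordinate subspace; composing with it
  turns maps that are continuous on the subspace into maps continuous everywhere.\<close>

definition truncate :: "nat \<Rightarrow> (nat \<Rightarrow> real) \<Rightarrow> nat \<Rightarrow> real" where
  "truncate n a = (\<lambda>j. if j < n then a j else 0)"

lemma truncate_in_Euclidean_space [simp]: "truncate n a \<in> topspace (Euclidean_space n)"
  by (simp add: truncate_def topspace_Euclidean_space)

lemma truncate_eq: "a \<in> topspace (Euclidean_space n) \<Longrightarrow> truncate n a = a"
  by (auto simp: truncate_def topspace_Euclidean_space fun_eq_iff)

lemma continuous_on_truncate: "continuous_on UNIV (truncate n)"
  unfolding truncate_def
proof (rule continuous_on_coordinatewise_then_product)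
  fix j
  show "continuous_on UNIV (\<lambda>a. if j < n then a j else 0 :: real)"
    by (cases "j < n") (auto intro: continuous_on_product_coordinates)
qed

lemma continuous_on_Euclidean_space:
  assumes "continuous_map (Euclidean_space n) euclideanreal f"
  shows "continuous_on UNIV (\<lambda>a. f (truncate n a))"
proof -
  have "continuous_on (topspace (Euclidean_space n)) f"
    using assms unfolding Euclidean_space_def euclidean_product_topology by simp
  then show ?thesis by (rule continuous_on_compose2[OF _ continuous_on_truncate]) auto
qed

lemma C1bD:
  assumes "\<phi> \<in> C1b n"
  shows "continuous_on UNIV (\<lambda>a. \<phi> (truncate n a))"
    and "j < n \<Longrightarrow> continuous_on UNIV (\<lambda>a. partial j \<phi> (truncate n a))"
    and "\<exists>B. \<forall>a\<in>topspace (Euclidean_space n). \<bar>\<phi> a\<bar> \<le> B"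
    and "j < n \<Longrightarrow> \<exists>B. \<forall>a\<in>topspace (Euclidean_space n). \<bar>partial j \<phi> a\<bar> \<le> B"
    and "j < n \<Longrightarrow> a \<in> topspace (Euclidean_space n) \<Longrightarrow>
      ((\<lambda>s. \<phi> (a(j := s))) has_real_derivative partial j \<phi> a) (at (a j))"
proof -
  show "continuous_on UNIV (\<lambda>a. \<phi> (truncate n a))"
    "j < n \<Longrightarrow> continuous_on UNIV (\<lambda>a. partial j \<phi> (truncate n a))"
    using assms by (auto simp: C1b_def intro: continuous_on_Euclidean_space)
  show "\<exists>B. \<forall>a\<in>topspace (Euclidean_space n). \<bar>\<phi> a\<bar> \<le> B"
    "j < n \<Longrightarrow> \<exists>B. \<forall>a\<in>topspace (Euclidean_space n). \<bar>partial j \<phi> a\<bar> \<le> B"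
    using assms by (auto simp: C1b_def bounded_iff)
  show "((\<lambda>s. \<phi> (a(j := s))) has_real_derivative partial j \<phi> a) (at (a j))"
    if "j < n" "a \<in> topspace (Euclidean_space n)"
    using assms that unfolding partial_def by (auto simp: C1b_def DERIV_deriv_iff_field_differentiable)
qed

lemma eval_vec_measurable:
  fixes f :: "(nat \<Rightarrow> real) \<Rightarrow> real"
  assumes f: "continuous_on UNIV (\<lambda>a. f (truncate n a))" and c: "\<And>j. j < n \<Longrightarrow> c j \<in> borel_measurable M"
  shows "(\<lambda>x. f (eval_vec n c x)) \<in> borel_measurable M"
proof -
  have "eval_vec n c \<in> borel_measurable M"
    unfolding eval_vec_def[abs_def]
  proof (rule measurable_coordinatewise_then_product)
    show "(\<lambda>x. if j < n then c j x else 0) \<in> borel_measurable M" for j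
      using c[of j] by (cases "j < n") simp_all
  qed
  from measurable_compose[OF this borel_measurable_continuous_onI[OF f]]
  show ?thesis by (simp add: truncate_def eval_vec_def cong: if_cong)
qed

text \<open>\<open>C1b\<close> provides partial derivatives, not a total one. Coordinates are
  changed one at a time, each by the mean value theorem, and continuity of the partial derivatives
  gives the limit.\<close>

lemma C1b_chain_rule:
  fixes \<gamma> :: "real \<Rightarrow> nat \<Rightarrow> real"
  assumes \<phi>: "\<phi> \<in> C1b n" and \<gamma>: "\<And>s. \<gamma> s \<in> topspace (Euclidean_space n)"
    and d: "\<And>j. j < n \<Longrightarrow> ((\<lambda>s. \<gamma> s j) has_real_derivative \<gamma>' j) (at t)"
  shows "((\<lambda>s. \<phi> (\<gamma> s)) has_real_derivative (\<Sum>j<n. partial j \<phi> (\<gamma> t) * \<gamma>' j)) (at t)"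
proof -
  \<comment> \<open>The first k coordinates have already moved to the new point; k = 0 and k = n are
    the two ends of the telescoping sum.\<close>
  define hyb where "hyb = (\<lambda>k s j. if j < k then \<gamma> s j else \<gamma> t j)"
  have hyb: "hyb k s \<in> topspace (Euclidean_space n)" for k s
    using \<gamma>[of s] \<gamma>[of t] by (auto simp: hyb_def topspace_Euclidean_space)
  have upd: "(hyb k s)(k := r) \<in> topspace (Euclidean_space n)" if "k < n" for k s r
    using hyb[of k s] that by (auto simp: topspace_Euclidean_space)
  have der: "((\<lambda>r. \<phi> ((hyb k s)(k := r))) has_real_derivative partial k \<phi> ((hyb k s)(k := r))) (at r)"
    if "k < n" for k s r
    using C1bD(5)[OF \<phi> that upd[OF that, of s r]] by simp
  have "\<exists>r. \<bar>r - \<gamma> t k\<bar> \<le> \<bar>\<gamma> s k - \<gamma> t k\<bar> \<and>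
      \<phi> (hyb (Suc k) s) - \<phi> (hyb k s) = partial k \<phi> ((hyb k s)(k := r)) * (\<gamma> s k - \<gamma> t k)"
    if k: "k < n" for k s
  proof -
    have 1: "hyb (Suc k) s = (hyb k s)(k := \<gamma> s k)" "hyb k s = (hyb k s)(k := \<gamma> t k)"
      by (auto simp: hyb_def fun_eq_iff less_Suc_eq)
    consider "\<gamma> s k = \<gamma> t k" | "\<gamma> t k < \<gamma> s k" | "\<gamma> s k < \<gamma> t k" by linarith
    then show ?thesis
    proof cases
      case 1
      then have "hyb (Suc k) s = hyb k s" by (auto simp: hyb_def fun_eq_iff less_Suc_eq)
      then show ?thesis using 1 by (intro exI[of _ "\<gamma> t k"]) simp
    next
      case 2
      obtain r where "\<gamma> t k < r" "r < \<gamma> s k"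
        "\<phi> ((hyb k s)(k := \<gamma> s k)) - \<phi> ((hyb k s)(k := \<gamma> t k)) = (\<gamma> s k - \<gamma> t k) * partial k \<phi> ((hyb k s)(k := r))"
        using MVT2[OF 2, of "\<lambda>r. \<phi> ((hyb k s)(k := r))" "\<lambda>r. partial k \<phi> ((hyb k s)(k := r))"] der[OF k] by blast
      then show ?thesis using 1 by (intro exI[of _ r]) (simp add: mult.commute)
    next
      case 3
      obtain r where "\<gamma> s k < r" "r < \<gamma> t k"
        "\<phi> ((hyb k s)(k := \<gamma> t k)) - \<phi> ((hyb k s)(k := \<gamma> s k)) = (\<gamma> t k - \<gamma> s k) * partial k \<phi> ((hyb k s)(k := r))"
        using MVT2[OF 3, of "\<lambda>r. \<phi> ((hyb k s)(k := r))" "\<lambda>r. partial k \<phi> ((hyb k s)(k := r))"] der[OF k] by blast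
      then show ?thesis using 1 by (intro exI[of _ r]) (simp add: algebra_simps)
    qed
  qed
  then obtain \<rho> where \<rho>: "\<And>k s. k < n \<Longrightarrow> \<bar>\<rho> k s - \<gamma> t k\<bar> \<le> \<bar>\<gamma> s k - \<gamma> t k\<bar>"
    "\<And>k s. k < n \<Longrightarrow> \<phi> (hyb (Suc k) s) - \<phi> (hyb k s) = partial k \<phi> ((hyb k s)(k := \<rho> k s)) * (\<gamma> s k - \<gamma> t k)"
    by metis
  have \<gamma>_lim: "((\<lambda>s. \<gamma> s j) \<longlongrightarrow> \<gamma> t j) (at t)" for j
  proof (cases "j < n")
    case True
    then show ?thesis using DERIV_isCont[OF d] by (simp add: isCont_def)
  next
    case False
    then have "\<gamma> s j = 0" for s using \<gamma>[of s] by (simp add: topspace_Euclidean_space)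
    then show ?thesis by simp
  qed
  have \<rho>_lim: "((\<lambda>s. \<rho> k s) \<longlongrightarrow> \<gamma> t k) (at t)" if "k < n" for k
  proof -
    have "((\<lambda>s. \<bar>\<gamma> s k - \<gamma> t k\<bar>) \<longlongrightarrow> 0) (at t)"
      using \<gamma>_lim[of k] by (intro tendsto_rabs_zero) (simp add: LIM_zero_iff)
    then have "((\<lambda>s. \<rho> k s - \<gamma> t k) \<longlongrightarrow> 0) (at t)"
      by (rule Lim_null_comparison[rotated]) (use \<rho>(1)[OF that] in \<open>auto intro!: always_eventually\<close>)
    then show ?thesis by (simp add: LIM_zero_iff)
  qed
  have part_lim: "((\<lambda>s. partial k \<phi> ((hyb k s)(k := \<rho> k s))) \<longlongrightarrow> partial k \<phi> (\<gamma> t)) (at t)" if k: "k < n" for k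
  proof -
    have lim: "((\<lambda>s. (hyb k s)(k := \<rho> k s)) \<longlongrightarrow> \<gamma> t) (at t)"
    proof (rule tendsto_coordinatewise)
      fix j
      show "((\<lambda>s. ((hyb k s)(k := \<rho> k s)) j) \<longlongrightarrow> \<gamma> t j) (at t)"
        using \<rho>_lim[OF k] \<gamma>_lim[of j] by (cases "j = k"; cases "j < k") (auto simp: hyb_def)
    qed
    have "isCont (\<lambda>a. partial k \<phi> (truncate n a)) (\<gamma> t)"
      using C1bD(2)[OF \<phi> k] by (simp add: continuous_on_eq_continuous_at)
    from isCont_tendsto_compose[OF this lim]
    show ?thesis by (simp add: truncate_eq[OF upd[OF k]] truncate_eq[OF \<gamma>])
  qed
  have tele: "\<phi> (\<gamma> s) - \<phi> (\<gamma> t) = (\<Sum>k<n. partial k \<phi> ((hyb k s)(k := \<rho> k s)) * (\<gamma> s k - \<gamma> t k))" for s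
  proof -
    have "hyb n s = \<gamma> s" "hyb 0 s = \<gamma> t"
      using \<gamma>[of s] \<gamma>[of t] by (auto simp: hyb_def fun_eq_iff topspace_Euclidean_space)
    then have "\<phi> (\<gamma> s) - \<phi> (\<gamma> t) = (\<Sum>k<n. \<phi> (hyb (Suc k) s) - \<phi> (hyb k s))"
      by (simp add: sum_lessThan_telescope[of "\<lambda>k. \<phi> (hyb k s)"])
    then show ?thesis by (simp add: \<rho>(2))
  qed
  have "((\<lambda>s. \<Sum>k<n. partial k \<phi> ((hyb k s)(k := \<rho> k s)) * ((\<gamma> s k - \<gamma> t k) / (s - t))) \<longlongrightarrow>
      (\<Sum>k<n. partial k \<phi> (\<gamma> t) * \<gamma>' k)) (at t)"
    using d by (intro tendsto_sum tendsto_mult part_lim) (auto simp: has_field_derivative_iff)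
  then show ?thesis
    unfolding has_field_derivative_iff tele sum_divide_distrib by simp
qed

context gaussian_radon
begin

lemma prob_UNIV [simp]: "prob UNIV = 1"
  using prob_space by simp

text \<open>Origin of the constant: Cauchy-Schwarz over the angles in [0, pi/2] costs pi/2; by
  rotation invariance the remaining integral does not depend on the angle, which gives another pi/2;
  passing from two copies to the variance divides by 2.\<close>

theorem functional_poincare:
  fixes x' :: "nat \<Rightarrow> 'e \<Rightarrow>\<^sub>L real"
  assumes \<phi>: "\<phi> \<in> C1b n"
  defines "e \<equiv> eval_vec n (\<lambda>j. blinfun_apply (x' j))"
  defines "w \<equiv> (\<lambda>x. \<Sum>j<n. partial j \<phi> (e x) *\<^sub>R x' j)"
  shows "integrable \<mu> (\<lambda>x. cov (w x) (w x))"
    and "(\<integral>x. (\<phi> (e x) - (\<integral>y. \<phi> (e y) \<partial>\<mu>))\<^sup>2 \<partial>\<mu>) \<le> pi\<^sup>2 / 8 * (\<integral>x. cov (w x) (w x) \<partial>\<mu>)"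
proof -
  let ?V = "topspace (Euclidean_space n)"
  let ?C = "cylinder_algebra pair_functional"
  have eV: "e x \<in> ?V" for x by (simp add: e_def eval_vec_def topspace_Euclidean_space)
  obtain B0 where B0: "\<And>a. a \<in> ?V \<Longrightarrow> \<bar>\<phi> a\<bar> \<le> B0" using C1bD(3)[OF \<phi>] by blast
  have "\<exists>B. \<forall>j<n. \<forall>a\<in>?V. \<bar>partial j \<phi> a\<bar> \<le> B j"
    using C1bD(4)[OF \<phi>] by metis
  then obtain B where B: "\<And>j a. j < n \<Longrightarrow> a \<in> ?V \<Longrightarrow> \<bar>partial j \<phi> a\<bar> \<le> B j" by blast
  note vec_meas = eval_vec_measurable[unfolded eval_vec_def]
  have [measurable]: "(\<lambda>x. \<phi> (e x)) \<in> borel_measurable \<mu>"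
    unfolding e_def eval_vec_def by (rule vec_meas[OF C1bD(1)[OF \<phi>]]) simp
  have part_meas: "(\<lambda>x. partial j \<phi> (e x)) \<in> borel_measurable \<mu>" if "j < n" for j
    unfolding e_def eval_vec_def by (rule vec_meas[OF C1bD(2)[OF \<phi> that]]) simp
  \<comment> \<open>The derivative of the function at the first point in the direction of the
    second. For independent copies, its conditional second moment given the first point is the
    variance of the functional w x.\<close>
  define \<Psi> where "\<Psi> = (\<lambda>z. \<Sum>j<n. partial j \<phi> (e (fst z)) * x' j (snd z))"
  have \<Psi>_meas: "\<Psi> \<in> borel_measurable ?C"
    unfolding \<Psi>_def e_def eval_vec_def
  proof (intro borel_measurable_sum borel_measurable_times cylinder_snd)
    fix j assume "j \<in> {..<n}"
    then show "(\<lambda>z. partial j \<phi> (\<lambda>j. if j < n then x' j (fst z) else 0)) \<in> borel_measurable ?C"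
      by (intro vec_meas[OF C1bD(2)[OF \<phi>]] cylinder_fst) auto
  qed
  have \<Psi>_w: "\<Psi> (x, y) = w x y" for x y
    by (simp add: \<Psi>_def w_def blinfun.sum_left blinfun.scaleR_left)
  have cov_w: "cov (w x) (w x) = (\<Sum>j<n. \<Sum>k<n. partial j \<phi> (e x) * partial k \<phi> (e x) * cov (x' j) (x' k))" for x
    unfolding w_def by (simp add: bilinear_sum[OF cov_bilinear] sum.cartesian_product[symmetric]
        cov_scaleR_left cov_scaleR_right mult_ac)
  show int_w: "integrable \<mu> (\<lambda>x. cov (w x) (w x))"
    unfolding cov_w
  proof (intro Bochner_Integration.integrable_sum integrable_mult_left)
    fix j k assume "j \<in> {..<n}" "k \<in> {..<n}"
    then show "integrable \<mu> (\<lambda>x. partial j \<phi> (e x) * partial k \<phi> (e x))"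
      using B[of j "e _"] B[of k "e _"] eV part_meas
      by (intro integrable_const_bound[of _ "B j * B k"]) (auto simp: abs_mult intro!: mult_mono order_trans[OF abs_ge_zero])
  qed
  have bound_g: "\<bar>\<phi> (e x)\<bar> \<le> B0" for x using B0 eV by blast
  have rot: "rotate (sin \<theta>) (cos \<theta>) z = (sin \<theta> *\<^sub>R fst z + cos \<theta> *\<^sub>R snd z, cos \<theta> *\<^sub>R fst z - sin \<theta> *\<^sub>R snd z)" for \<theta> z
    by (cases z) (simp add: rotate_def)
  have deriv: "((\<lambda>\<theta>. \<phi> (e (fst (rotate (sin \<theta>) (cos \<theta>) z)))) has_real_derivative \<Psi> (rotate (sin \<theta>) (cos \<theta>) z)) (at \<theta>)" for \<theta> z
    unfolding \<Psi>_def
  proof (rule C1b_chain_rule[OF \<phi>])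
    fix j assume "j < n"
    then show "((\<lambda>\<theta>. e (fst (rotate (sin \<theta>) (cos \<theta>) z)) j) has_real_derivative x' j (snd (rotate (sin \<theta>) (cos \<theta>) z))) (at \<theta>)"
      by (auto simp: e_def eval_vec_def rot blinfun.bilinear_simps intro!: derivative_eq_intros)
  qed (rule eV)
  have e_rot: "e (fst (rotate (sin \<theta>) (cos \<theta>) z)) = (\<lambda>j. if j < n then sin \<theta> * x' j (fst z) + cos \<theta> * x' j (snd z) else 0)" for \<theta> z
    by (auto simp: e_def eval_vec_def rot blinfun.bilinear_simps)
  have \<Psi>_rot: "\<Psi> (rotate (sin \<theta>) (cos \<theta>) z) = (\<Sum>j<n. partial j \<phi> (\<lambda>j. if j < n then sin \<theta> * x' j (fst z) + cos \<theta> * x' j (snd z) else 0)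
      * (cos \<theta> * x' j (fst z) - sin \<theta> * x' j (snd z)))" for \<theta> z
    unfolding \<Psi>_def e_rot by (simp add: rot blinfun.bilinear_simps)
  have cont: "isCont (\<lambda>\<theta>. \<Psi> (rotate (sin \<theta>) (cos \<theta>) z)) \<theta>" for \<theta> z
  proof -
    have "isCont (\<lambda>\<theta>. partial j \<phi> (e (fst (rotate (sin \<theta>) (cos \<theta>) z)))) \<theta>" if j: "j < n" for j
    proof -
      have "isCont (\<lambda>\<theta>. e (fst (rotate (sin \<theta>) (cos \<theta>) z))) \<theta>"
        unfolding isCont_def e_rot
      proof (rule tendsto_coordinatewise)
        show "((\<lambda>\<theta>. if i < n then sin \<theta> * x' i (fst z) + cos \<theta> * x' i (snd z) else 0) \<longlongrightarrow>
            (if i < n then sin \<theta> * x' i (fst z) + cos \<theta> * x' i (snd z) else 0)) (at \<theta>)" for i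
          by (cases "i < n") (auto intro!: tendsto_intros)
      qed
      moreover have "isCont (\<lambda>a. partial j \<phi> (truncate n a)) (e (fst (rotate (sin \<theta>) (cos \<theta>) z)))"
        using C1bD(2)[OF \<phi> j] by (simp add: continuous_on_eq_continuous_at)
      ultimately have "isCont (\<lambda>\<theta>. partial j \<phi> (truncate n (e (fst (rotate (sin \<theta>) (cos \<theta>) z))))) \<theta>"
        by (rule isCont_o2)
      then show ?thesis by (simp add: truncate_eq[OF eV])
    qed
    then show ?thesis unfolding \<Psi>_def by (intro continuous_intros) (auto simp: rot)
  qed
  define I where "I = (\<lambda>\<theta> :: real. indicator {0..pi/2} \<theta> :: real)"
  \<comment> \<open>The fundamental theorem of calculus along the quarter circle from the second
    point (angle 0) to the first (angle pi/2), followed by Cauchy-Schwarz in the angle.\<close>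
  have key: "ennreal ((\<phi> (e (fst z)) - \<phi> (e (snd z)))\<^sup>2) \<le>
      ennreal (pi / 2) * (\<integral>\<^sup>+\<theta>. ennreal ((\<Psi> (rotate (sin \<theta>) (cos \<theta>) z))\<^sup>2 * I \<theta>) \<partial>lborel)" for z
  proof -
    define f where "f = (\<lambda>\<theta>. \<Psi> (rotate (sin \<theta>) (cos \<theta>) z))"
    have f2: "integrable lborel (\<lambda>\<theta>. (f \<theta>)\<^sup>2 * I \<theta>)"
      unfolding I_def f_def by (rule borel_integrable_atLeastAtMost) (intro isCont_power cont)
    have [measurable]: "f \<in> borel_measurable borel"
      using cont unfolding f_def by (intro borel_measurable_continuous_onI continuous_at_imp_continuous_on) auto
    have sq: "(I \<theta>)\<^sup>2 = I \<theta>" for \<theta> by (simp add: I_def indicator_def)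
    have L2: "I \<in> L2 lborel" "(\<lambda>\<theta>. f \<theta> * I \<theta>) \<in> L2 lborel"
    proof -
      show "I \<in> L2 lborel" by (simp add: L2_iff sq) (simp add: I_def)
      show "(\<lambda>\<theta>. f \<theta> * I \<theta>) \<in> L2 lborel"
        using f2 by (simp add: L2_iff sq power_mult_distrib) (simp add: I_def)
    qed
    have "(\<integral>\<theta>. f \<theta> * I \<theta> \<partial>lborel) = \<phi> (e (fst z)) - \<phi> (e (snd z))"
    proof -
      have "(\<integral>\<theta>. f \<theta> * I \<theta> \<partial>lborel) =
          \<phi> (e (fst (rotate (sin (pi/2)) (cos (pi/2)) z))) - \<phi> (e (fst (rotate (sin 0) (cos 0) z)))"
        unfolding I_def f_def
        by (rule integral_FTC_Icc_real) (use deriv cont in \<open>auto\<close>)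
      then show ?thesis by (simp add: rotate_def case_prod_beta)
    qed
    then have "(\<phi> (e (fst z)) - \<phi> (e (snd z)))\<^sup>2 = (\<integral>\<theta>. I \<theta> * (f \<theta> * I \<theta>) \<partial>lborel)\<^sup>2"
      by (simp add: mult.left_commute[of "I _"] sq[unfolded power2_eq_square])
    also have "\<dots> \<le> (l2norm lborel I * l2norm lborel (\<lambda>\<theta>. f \<theta> * I \<theta>))\<^sup>2"
      using Cauchy_Schwarz_real[OF L2] by (subst power2_abs[symmetric], intro power_mono) auto
    also have "\<dots> = pi / 2 * (\<integral>\<theta>. (f \<theta>)\<^sup>2 * I \<theta> \<partial>lborel)"
      unfolding power_mult_distrib l2norm_power2 by (simp add: sq power_mult_distrib) (simp add: I_def)
    finally have "ennreal ((\<phi> (e (fst z)) - \<phi> (e (snd z)))\<^sup>2) \<le> ennreal (pi / 2 * (\<integral>\<theta>. (f \<theta>)\<^sup>2 * I \<theta> \<partial>lborel))"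
      by (rule ennreal_leI)
    also have "\<dots> = ennreal (pi / 2) * ennreal (\<integral>\<theta>. (f \<theta>)\<^sup>2 * I \<theta> \<partial>lborel)"
      by (rule ennreal_mult) (auto intro!: integral_nonneg_AE simp: I_def)
    also have "ennreal (\<integral>\<theta>. (f \<theta>)\<^sup>2 * I \<theta> \<partial>lborel) = (\<integral>\<^sup>+\<theta>. ennreal ((f \<theta>)\<^sup>2 * I \<theta>) \<partial>lborel)"
      by (rule nn_integral_eq_integral[symmetric, OF f2]) (simp add: I_def)
    finally show ?thesis by (simp add: f_def)
  qed
  interpret lp: pair_sigma_finite lborel "\<mu> \<Otimes>\<^sub>M \<mu>" ..
  have joint: "(\<lambda>(\<theta>, z). ennreal ((\<Psi> (rotate (sin \<theta>) (cos \<theta>) z))\<^sup>2 * I \<theta>)) \<in> borel_measurable (lborel \<Otimes>\<^sub>M (\<mu> \<Otimes>\<^sub>M \<mu>))"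
  proof -
    have [measurable]: "(\<lambda>p. partial j \<phi> (\<lambda>j. if j < n then sin (fst p) * x' j (fst (snd p)) + cos (fst p) * x' j (snd (snd p)) else 0))
        \<in> borel_measurable (lborel \<Otimes>\<^sub>M (\<mu> \<Otimes>\<^sub>M \<mu>))" if "j < n" for j
      by (rule vec_meas[OF C1bD(2)[OF \<phi> that]]) measurable
    have "(\<lambda>p. \<Sum>j<n. partial j \<phi> (\<lambda>j. if j < n then sin (fst p) * x' j (fst (snd p)) + cos (fst p) * x' j (snd (snd p)) else 0)
        * (cos (fst p) * x' j (fst (snd p)) - sin (fst p) * x' j (snd (snd p)))) \<in> borel_measurable (lborel \<Otimes>\<^sub>M (\<mu> \<Otimes>\<^sub>M \<mu>))"
      by (intro borel_measurable_sum) measurable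
    then have [measurable]: "(\<lambda>p. \<Psi> (rotate (sin (fst p)) (cos (fst p)) (snd p))) \<in> borel_measurable (lborel \<Otimes>\<^sub>M (\<mu> \<Otimes>\<^sub>M \<mu>))"
      by (simp only: \<Psi>_rot)
    show ?thesis unfolding case_prod_beta' I_def by measurable
  qed
  have inner: "(\<integral>\<^sup>+z. ennreal ((\<Psi> z)\<^sup>2) \<partial>(\<mu> \<Otimes>\<^sub>M \<mu>)) = ennreal (\<integral>x. cov (w x) (w x) \<partial>\<mu>)"
  proof -
    have [measurable]: "\<Psi> \<in> borel_measurable (\<mu> \<Otimes>\<^sub>M \<mu>)"
    proof -
      have "(\<lambda>z. z) \<in> measurable (\<mu> \<Otimes>\<^sub>M \<mu>) ?C"
        by (rule measurable_cylinder_algebra) (auto simp: space_pair_measure pair_functional_measurable)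
      from measurable_compose[OF this \<Psi>_meas] show ?thesis .
    qed
    have "(\<integral>\<^sup>+z. ennreal ((\<Psi> z)\<^sup>2) \<partial>(\<mu> \<Otimes>\<^sub>M \<mu>)) = (\<integral>\<^sup>+x. \<integral>\<^sup>+y. ennreal ((\<Psi> (x, y))\<^sup>2) \<partial>\<mu> \<partial>\<mu>)"
      by (rule nn_integral_fst[symmetric]) measurable
    also have "\<dots> = (\<integral>\<^sup>+x. ennreal (cov (w x) (w x)) \<partial>\<mu>)"
    proof (rule nn_integral_cong)
      fix x
      have "(\<integral>\<^sup>+y. ennreal ((w x y)\<^sup>2) \<partial>\<mu>) = ennreal (\<integral>y. (w x y)\<^sup>2 \<partial>\<mu>)"
        using functional_mult_integrable[of "w x" "w x"] by (intro nn_integral_eq_integral) (auto simp: power2_eq_square)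
      then show "(\<integral>\<^sup>+y. ennreal ((\<Psi> (x, y))\<^sup>2) \<partial>\<mu>) = ennreal (cov (w x) (w x))"
        by (simp add: \<Psi>_w cov_def power2_eq_square)
    qed
    also have "\<dots> = ennreal (\<integral>x. cov (w x) (w x) \<partial>\<mu>)"
      using int_w cov_nonneg by (intro nn_integral_eq_integral) auto
    finally show ?thesis .
  qed
  have g_meas[measurable]: "(\<lambda>z. \<phi> (e (fst z))) \<in> borel_measurable (\<mu> \<Otimes>\<^sub>M \<mu>)" "(\<lambda>z. \<phi> (e (snd z))) \<in> borel_measurable (\<mu> \<Otimes>\<^sub>M \<mu>)"
    by measurable
  have "(\<integral>\<^sup>+z. ennreal ((\<phi> (e (fst z)) - \<phi> (e (snd z)))\<^sup>2) \<partial>(\<mu> \<Otimes>\<^sub>M \<mu>)) \<le>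
      (\<integral>\<^sup>+z. ennreal (pi / 2) * (\<integral>\<^sup>+\<theta>. ennreal ((\<Psi> (rotate (sin \<theta>) (cos \<theta>) z))\<^sup>2 * I \<theta>) \<partial>lborel) \<partial>(\<mu> \<Otimes>\<^sub>M \<mu>))"
    by (intro nn_integral_mono key)
  also have "\<dots> = ennreal (pi / 2) * (\<integral>\<^sup>+z. \<integral>\<^sup>+\<theta>. ennreal ((\<Psi> (rotate (sin \<theta>) (cos \<theta>) z))\<^sup>2 * I \<theta>) \<partial>lborel \<partial>(\<mu> \<Otimes>\<^sub>M \<mu>))"
    using measurable_compose[OF measurable_pair_swap' joint]
    by (intro nn_integral_cmult lborel.borel_measurable_nn_integral) (simp add: case_prod_beta')
  also have "(\<integral>\<^sup>+z. \<integral>\<^sup>+\<theta>. ennreal ((\<Psi> (rotate (sin \<theta>) (cos \<theta>) z))\<^sup>2 * I \<theta>) \<partial>lborel \<partial>(\<mu> \<Otimes>\<^sub>M \<mu>)) =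
      (\<integral>\<^sup>+\<theta>. \<integral>\<^sup>+z. ennreal ((\<Psi> (rotate (sin \<theta>) (cos \<theta>) z))\<^sup>2 * I \<theta>) \<partial>(\<mu> \<Otimes>\<^sub>M \<mu>) \<partial>lborel)"
    by (rule lp.Fubini'[OF joint])
  also have "\<dots> = (\<integral>\<^sup>+\<theta>. ennreal (\<integral>x. cov (w x) (w x) \<partial>\<mu>) * indicator {0..pi/2} \<theta> \<partial>lborel)"
  proof (rule nn_integral_cong)
    fix \<theta> :: real
    have "(\<integral>\<^sup>+z. ennreal ((\<Psi> (rotate (sin \<theta>) (cos \<theta>) z))\<^sup>2) \<partial>(\<mu> \<Otimes>\<^sub>M \<mu>)) = (\<integral>\<^sup>+z. ennreal ((\<Psi> z)\<^sup>2) \<partial>(\<mu> \<Otimes>\<^sub>M \<mu>))"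
      using \<Psi>_meas by (intro rotation_invariance_nn_integral[of "sin \<theta>" "cos \<theta>" "\<lambda>z. ennreal ((\<Psi> z)\<^sup>2)"]) auto
    then show "(\<integral>\<^sup>+z. ennreal ((\<Psi> (rotate (sin \<theta>) (cos \<theta>) z))\<^sup>2 * I \<theta>) \<partial>(\<mu> \<Otimes>\<^sub>M \<mu>)) =
        ennreal (\<integral>x. cov (w x) (w x) \<partial>\<mu>) * indicator {0..pi/2} \<theta>"
      by (auto simp: I_def inner indicator_def)
  qed
  also have "\<dots> = ennreal (\<integral>x. cov (w x) (w x) \<partial>\<mu>) * ennreal (pi / 2)"
    by (subst nn_integral_cmult_indicator) auto
  finally have upper: "(\<integral>\<^sup>+z. ennreal ((\<phi> (e (fst z)) - \<phi> (e (snd z)))\<^sup>2) \<partial>(\<mu> \<Otimes>\<^sub>M \<mu>)) \<le>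
      ennreal (pi / 2 * ((\<integral>x. cov (w x) (w x) \<partial>\<mu>) * (pi / 2)))"
  proof -
    assume *: "(\<integral>\<^sup>+z. ennreal ((\<phi> (e (fst z)) - \<phi> (e (snd z)))\<^sup>2) \<partial>(\<mu> \<Otimes>\<^sub>M \<mu>)) \<le>
        ennreal (pi / 2) * (ennreal (\<integral>x. cov (w x) (w x) \<partial>\<mu>) * ennreal (pi / 2))"
    have "0 \<le> (\<integral>x. cov (w x) (w x) \<partial>\<mu>)" using cov_nonneg by (intro integral_nonneg_AE) simp
    then show ?thesis using * by (subst ennreal_mult, simp, simp, subst ennreal_mult) simp_all
  qed
  define g where "g = (\<lambda>x. \<phi> (e x))"
  have [measurable]: "g \<in> borel_measurable \<mu>" unfolding g_def by measurable
  have gb: "\<bar>g x\<bar> \<le> B0" for x using bound_g by (simp add: g_def)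
  have gi: "integrable \<mu> g" using gb by (intro integrable_const_bound[of _ B0]) auto
  have g2i: "integrable \<mu> (\<lambda>x. (g x)\<^sup>2)"
  proof (rule integrable_const_bound[of _ "B0\<^sup>2"])
    show "AE x in \<mu>. norm ((g x)\<^sup>2) \<le> B0\<^sup>2" using power_mono[OF gb abs_ge_zero, of _ 2] by simp
  qed simp
  define m where "m = (\<integral>x. g x \<partial>\<mu>)"
  define q where "q = (\<integral>x. (g x)\<^sup>2 \<partial>\<mu>)"
  have dev: "(\<integral>x. (g x - c)\<^sup>2 \<partial>\<mu>) = q - 2 * c * m + c\<^sup>2" "integrable \<mu> (\<lambda>x. (g x - c)\<^sup>2)" for c
  proof -
    have e: "(\<lambda>x. (g x - c)\<^sup>2) = (\<lambda>x. (g x)\<^sup>2 - (2 * c) * g x + c\<^sup>2)"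
      by (auto simp: power2_eq_square algebra_simps)
    show "integrable \<mu> (\<lambda>x. (g x - c)\<^sup>2)" unfolding e using gi g2i by auto
    show "(\<integral>x. (g x - c)\<^sup>2 \<partial>\<mu>) = q - 2 * c * m + c\<^sup>2" unfolding e q_def m_def using gi g2i by (simp add: prob_space)
  qed
  \<comment> \<open>For two independent copies the mean squared difference is twice the
    variance.\<close>
  have "(\<integral>\<^sup>+z. ennreal ((g (fst z) - g (snd z))\<^sup>2) \<partial>(\<mu> \<Otimes>\<^sub>M \<mu>)) =
      (\<integral>\<^sup>+x. \<integral>\<^sup>+y. ennreal ((g x - g y)\<^sup>2) \<partial>\<mu> \<partial>\<mu>)"
    by (subst nn_integral_fst[symmetric]) auto
  also have "\<dots> = (\<integral>\<^sup>+x. ennreal (q - 2 * g x * m + (g x)\<^sup>2) \<partial>\<mu>)"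
  proof (rule nn_integral_cong)
    fix x
    have "(\<integral>\<^sup>+y. ennreal ((g y - g x)\<^sup>2) \<partial>\<mu>) = ennreal (q - 2 * g x * m + (g x)\<^sup>2)"
      using nn_integral_eq_integral[OF dev(2)[of "g x"]] dev(1)[of "g x"] by simp
    then show "(\<integral>\<^sup>+y. ennreal ((g x - g y)\<^sup>2) \<partial>\<mu>) = ennreal (q - 2 * g x * m + (g x)\<^sup>2)"
      by (simp add: power2_commute)
  qed
  also have "\<dots> = ennreal (\<integral>x. q - 2 * g x * m + (g x)\<^sup>2 \<partial>\<mu>)"
  proof (rule nn_integral_eq_integral)
    show "AE x in \<mu>. 0 \<le> q - 2 * g x * m + (g x)\<^sup>2"
      unfolding dev(1)[symmetric] by simp
  qed (use gi g2i in auto)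
  also have "(\<integral>x. q - 2 * g x * m + (g x)\<^sup>2 \<partial>\<mu>) = q - 2 * m * m + q"
    using gi g2i by (simp flip: m_def q_def)
  also have "\<dots> = 2 * (\<integral>x. (g x - m)\<^sup>2 \<partial>\<mu>)"
    unfolding dev(1) by (simp add: power2_eq_square)
  finally have "ennreal (2 * (\<integral>x. (g x - m)\<^sup>2 \<partial>\<mu>)) \<le> ennreal (pi / 2 * ((\<integral>x. cov (w x) (w x) \<partial>\<mu>) * (pi / 2)))"
    using upper by (simp add: g_def)
  then have "2 * (\<integral>x. (g x - m)\<^sup>2 \<partial>\<mu>) \<le> pi / 2 * ((\<integral>x. cov (w x) (w x) \<partial>\<mu>) * (pi / 2))"
    by (subst (asm) ennreal_le_iff) (auto intro!: mult_nonneg_nonneg integral_nonneg_AE simp: cov_nonneg)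
  then show "(\<integral>x. (\<phi> (e x) - (\<integral>y. \<phi> (e y) \<partial>\<mu>))\<^sup>2 \<partial>\<mu>) \<le> pi\<^sup>2 / 8 * (\<integral>x. cov (w x) (w x) \<partial>\<mu>)"
    by (simp add: g_def m_def power2_eq_square field_simps)
qed

end

section \<open>The Ornstein-Uhlenbeck semigroup\<close>

lemma inner_adj:
  fixes i :: "'h::{real_inner,complete_space} \<Rightarrow>\<^sub>L 'e::real_normed_vector"
  shows "inner (adj i x') g = x' (i g)"
proof -
  have l: "linear (\<lambda>g. blinfun_apply x' (i g))" by (simp add: linear_iff blinfun.bilinear_simps)
  have bd: "\<bar>blinfun_apply x' (i g)\<bar> \<le> norm x' * norm i * norm g" for g
  proof -
    have "\<bar>blinfun_apply x' (i g)\<bar> \<le> norm x' * norm (i g)" using norm_blinfun[of x' "i g"] by simp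
    also have "\<dots> \<le> norm x' * (norm i * norm g)" by (intro mult_left_mono norm_blinfun) simp
    finally show ?thesis by (simp add: mult.assoc)
  qed
  obtain b where b: "\<And>g. inner b g = blinfun_apply x' (i g)"
    using riesz_subspace[OF subspace_UNIV l bd] by auto
  have "\<forall>g. inner (adj i x') g = blinfun_apply x' (i g)"
    unfolding adj_def
  proof (rule theI[where P = "\<lambda>h. \<forall>g. inner h g = blinfun_apply x' (i g)"])
    show "\<forall>g. inner b g = blinfun_apply x' (i g)" using b by simp
    fix h assume "\<forall>g. inner h g = blinfun_apply x' (i g)"
    then have "inner (h - b) (h - b) = 0" using b by (simp add: inner_diff_left)
    then show "h = b" by simp
  qed
  then show ?thesis by simp
qed

lemma adj_eqI:
  fixes i :: "'h::{real_inner,complete_space} \<Rightarrow>\<^sub>L 'e::real_normed_vector"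
  assumes "\<And>g. inner h g = blinfun_apply x' (i g)"
  shows "adj i x' = h"
proof -
  have "inner (adj i x' - h) (adj i x' - h) = 0" using assms by (simp add: inner_diff_left inner_adj)
  then show ?thesis by simp
qed

lemma bounded_linear_adj:
  fixes i :: "'h::{real_inner,complete_space} \<Rightarrow>\<^sub>L 'e::real_normed_vector"
  shows "bounded_linear (adj i)"
proof (rule bounded_linear_intro[where K = "norm i"])
  show "adj i (x' + y') = adj i x' + adj i y'" for x' y'
    by (rule adj_eqI) (simp add: inner_add_left inner_adj blinfun.add_left)
  show "adj i (r *\<^sub>R x') = r *\<^sub>R adj i x'" for r x'
    by (rule adj_eqI) (simp add: inner_adj blinfun.scaleR_left)
  fix x' :: "'e \<Rightarrow>\<^sub>L real"
  have "(norm (adj i x'))\<^sup>2 = x' (i (adj i x'))" by (simp add: power2_norm_eq_inner inner_adj)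
  also have "\<dots> \<le> norm x' * norm (i (adj i x'))" using norm_blinfun[of x' "i (adj i x')"] by simp
  also have "\<dots> \<le> norm x' * (norm i * norm (adj i x'))" by (intro mult_left_mono norm_blinfun) simp
  finally have "norm (adj i x') * norm (adj i x') \<le> (norm x' * norm i) * norm (adj i x')"
    by (simp add: power2_eq_square mult.assoc)
  then show "norm (adj i x') \<le> norm x' * norm i"
    by (cases "adj i x' = 0") auto
qed

lemmas adj_add = linear_add[OF bounded_linear.linear[OF bounded_linear_adj]]
  and adj_diff = linear_diff[OF bounded_linear.linear[OF bounded_linear_adj]]
  and adj_scaleR = linear_scale[OF bounded_linear.linear[OF bounded_linear_adj]]
  and adj_sum = linear_sum[OF bounded_linear.linear[OF bounded_linear_adj]]
  and adj_0 = linear_0[OF bounded_linear.linear[OF bounded_linear_adj]]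

section \<open>Integrals in time\<close>

lemma nn_integral_lborel_nonneg:
  "(\<integral>\<^sup>+t. f t \<partial>lborel_nonneg) = (\<integral>\<^sup>+t. f t * indicator {0..} t \<partial>lborel)"
  unfolding lborel_nonneg_def by (rule nn_integral_restrict_space) simp

lemma nn_integral_continuous_Icc:
  fixes f :: "real \<Rightarrow> real"
  assumes "continuous_on {0..t} f" "\<And>s. f s \<ge> (0::real)" "t \<ge> 0"
  shows "(\<integral>\<^sup>+s. ennreal (f s) * indicator {0..t} s \<partial>lborel) = ennreal (integral {0..t} f)"
proof -
  have e: "(\<lambda>s. if s \<in> {0..t} then f s else 0) = (\<lambda>s. indicator {0..t} s *\<^sub>R f s)"
    by (auto simp: indicator_def)
  have "(\<integral>\<^sup>+s. ennreal (indicator {0..t} s *\<^sub>R f s) \<partial>lborel) = ennreal (integral {0..t} f)"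
  proof (rule nn_integral_has_integral_lborel)
    show "(\<lambda>s. indicator {0..t} s *\<^sub>R f s) \<in> borel_measurable borel"
      by (rule borel_measurable_continuous_on_indicator[OF _ assms(1)]) simp
    have "(f has_integral integral {0..t} f) {0..t}"
      by (rule integrable_integral[OF integrable_continuous_interval[OF assms(1)]])
    then show "((\<lambda>s. indicator {0..t} s *\<^sub>R f s) has_integral integral {0..t} f) UNIV"
      by (simp only: e[symmetric] has_integral_restrict_UNIV)
  qed (use assms in \<open>auto simp: indicator_def\<close>)
  moreover have "ennreal (f s) * indicator {0..t} s = ennreal (indicator {0..t} s *\<^sub>R f s)" for s
    by (auto simp: indicator_def)
  ultimately show ?thesis by simp
qed

text \<open>The step functions rounding time down to a grid of mesh 1/(n+1) converge by continuity.
  Explicit simple functions are needed because H may be nonseparable.\<close>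

lemma strongly_measurable_continuous_Icc:
  fixes G :: "real \<Rightarrow> 'b::real_normed_vector"
  assumes G: "continuous_on {0..t} G"
  shows "strongly_measurable lborel_nonneg (\<lambda>s. indicator {0..t} s *\<^sub>R G s)"
proof -
  \<comment> \<open>The value -1 marks times outside [0,t], where the step function is 0. Rounding
    down keeps the grid point inside [0,t], the only place where G is known to be
    continuous.\<close>
  define k where "k = (\<lambda>n s. if s \<in> {0..t} then \<lfloor>real (Suc n) * s\<rfloor> else - 1)"
  define r where "r = (\<lambda>n (j :: int). real_of_int j / real (Suc n))"
  have k_meas: "k n \<in> measurable lborel (count_space UNIV)" for n
    unfolding k_def
  proof (rule measurable_If_set)
    show "(\<lambda>s. \<lfloor>real (Suc n) * s\<rfloor>) \<in> measurable lborel (count_space UNIV)"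
      by (rule measurable_compose[OF _ measurable_real_floor]) simp
  qed simp_all
  have simple_k: "simple_function lborel_nonneg (k n)" for n
    unfolding simple_function_def
  proof
    have "k n s \<in> {-1..max 0 \<lfloor>real (Suc n) * t\<rfloor>}" for s
    proof (cases "s \<in> {0..t}")
      case True
      then have "0 \<le> \<lfloor>real (Suc n) * s\<rfloor>" "\<lfloor>real (Suc n) * s\<rfloor> \<le> \<lfloor>real (Suc n) * t\<rfloor>"
        by (auto intro!: floor_mono mult_left_mono)
      moreover have "k n s = \<lfloor>real (Suc n) * s\<rfloor>" using True by (simp add: k_def)
      ultimately show ?thesis unfolding atLeastAtMost_iff by linarith
    next
      case False
      then have "k n s = - 1" by (auto simp: k_def)
      then show ?thesis by (simp add: le_max_iff_disj)
    qed
    then have "k n ` space lborel_nonneg \<subseteq> {-1..max 0 \<lfloor>real (Suc n) * t\<rfloor>}" by blast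
    then show "finite (k n ` space lborel_nonneg)" by (rule finite_subset) simp
    have "k n \<in> measurable lborel_nonneg (count_space UNIV)"
      unfolding lborel_nonneg_def by (rule measurable_restrict_space1[OF k_meas])
    then show "\<forall>j\<in>k n ` space lborel_nonneg. k n -` {j} \<inter> space lborel_nonneg \<in> sets lborel_nonneg"
      by (intro ballI measurable_sets) auto
  qed
  define s' where "s' = (\<lambda>n s. if k n s = - 1 then 0 else G (r n (k n s)))"
  have "simple_function lborel_nonneg (s' n)" for n
    unfolding s'_def by (rule simple_function_compose1[OF simple_k, where g = "\<lambda>j. if j = - 1 then 0 else G (r n j)"])
  moreover have "(\<lambda>n. s' n s) \<longlonglongrightarrow> indicator {0..t} s *\<^sub>R G s" for s
  proof (cases "s \<in> {0..t}")
    case False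
    then have "k n s = - 1" for n by (auto simp: k_def)
    with False show ?thesis by (simp add: s'_def)
  next
    case True
    have k: "k n s = \<lfloor>real (Suc n) * s\<rfloor>" "k n s \<noteq> - 1" for n
    proof -
      show "k n s = \<lfloor>real (Suc n) * s\<rfloor>" using True by (simp add: k_def)
      moreover have "0 \<le> \<lfloor>real (Suc n) * s\<rfloor>" using True by simp
      ultimately show "k n s \<noteq> - 1" by linarith
    qed
    have r: "0 \<le> r n (k n s)" "r n (k n s) \<le> s" "s - inverse (real (Suc n)) \<le> r n (k n s)" for n
    proof -
      have a: "real_of_int \<lfloor>real (Suc n) * s\<rfloor> \<le> real (Suc n) * s" "real (Suc n) * s \<le> real_of_int \<lfloor>real (Suc n) * s\<rfloor> + 1"
        by linarith+
      have b: "0 \<le> \<lfloor>real (Suc n) * s\<rfloor>" using True by simp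
      show "0 \<le> r n (k n s)" using b by (simp add: k(1) r_def)
      show "r n (k n s) \<le> s" using a(1) unfolding r_def k(1)
        by (subst pos_divide_le_eq) (simp_all add: mult.commute)
      have "s - inverse (real (Suc n)) = (real (Suc n) * s - 1) / real (Suc n)" by (simp add: field_simps)
      also have "\<dots> \<le> r n (k n s)" unfolding r_def k(1) using a(2) by (intro divide_right_mono) auto
      finally show "s - inverse (real (Suc n)) \<le> r n (k n s)" .
    qed
    have lim: "(\<lambda>n. s - inverse (real (Suc n))) \<longlonglongrightarrow> s"
      using tendsto_diff[OF tendsto_const LIMSEQ_inverse_real_of_nat, of s] by simp
    have "(\<lambda>n. r n (k n s)) \<longlonglongrightarrow> s"
      by (rule tendsto_sandwich[OF _ _ lim tendsto_const]) (use r in auto)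
    then have "(\<lambda>n. G (r n (k n s))) \<longlonglongrightarrow> G s"
    proof (rule continuous_on_tendsto_compose[OF G])
      have "r n (k n s) \<in> {0..t}" for n using True r(1)[of n] r(2)[of n] by auto
      then show "\<forall>\<^sub>F n in sequentially. r n (k n s) \<in> {0..t}" by simp
    qed (use True in simp)
    then show ?thesis using True by (simp add: s'_def k(2))
  qed
  ultimately show ?thesis unfolding strongly_measurable_def by (intro exI[of _ s']) blast
qed

section \<open>Covariances and the stochastic convolution\<close>

locale ornstein_uhlenbeck = gaussian_radon \<mu> + c0_semigroup S
  for \<mu> :: "'e::banach measure" and S :: "real \<Rightarrow> 'e \<Rightarrow>\<^sub>L 'e" +
  fixes i :: "'h::{real_inner,complete_space} \<Rightarrow>\<^sub>L 'e" and P :: "'w measure"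
    and W :: "(real \<Rightarrow> 'h) \<Rightarrow> 'w \<Rightarrow> real" and Y :: "real \<Rightarrow> 'w \<Rightarrow> 'e"
  assumes P: "prob_space P" and W: "cylindrical_brownian_motion P W"
    and inv: "invariant_measure i S \<mu>"
    and Y: "t \<ge> 0 \<Longrightarrow> stochastic_convolution P W i S t (Y t)"
begin

sublocale P: prob_space P by (rule P)

lemma covariance_formula:
  "ennreal (cov x' x') = (\<integral>\<^sup>+t. ennreal ((norm (adj i (x' o\<^sub>L S t)))\<^sup>2) * indicator {0..} t \<partial>lborel)"
proof -
  have "ennreal (cov x' x') = (\<integral>\<^sup>+x. ennreal ((x' x)\<^sup>2) \<partial>\<mu>)"
    using functional_mult_integrable[of x' x'] by (simp add: cov_def power2_eq_square nn_integral_eq_integral)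
  then show ?thesis
    using inv by (simp add: invariant_measure_def nn_integral_lborel_nonneg)
qed

lemma adj_orbit_continuous:
  assumes "adjoint_generator x' a'"
  shows "continuous_on {0..} (\<lambda>t. adj i (x' o\<^sub>L S t))"
  by (rule bounded_linear.continuous_on[OF bounded_linear_adj adjoint_generator_continuous[OF assms]])

text \<open>The covariance of the solution started at 0. Defining it as a difference encodes
  invariance: the stationary covariance is its transport by S(t) plus the noise collected up to time
  t.\<close>

definition qt :: "real \<Rightarrow> ('e \<Rightarrow>\<^sub>L real) \<Rightarrow> ('e \<Rightarrow>\<^sub>L real) \<Rightarrow> real" where
  "qt t x' y' = cov x' y' - cov (x' o\<^sub>L S t) (y' o\<^sub>L S t)"

lemma compose_S_add: "s \<ge> 0 \<Longrightarrow> t \<ge> 0 \<Longrightarrow> (x' o\<^sub>L S s) o\<^sub>L S t = x' o\<^sub>L S (s + t)"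
  by (rule blinfun_eqI) (simp add: S_add)

text \<open>The integral of \<open>covariance_formula\<close> is split at t; its tail, shifted by t,
  is the same formula for x' o S t.\<close>

lemma qt_eq_integral:
  assumes g: "adjoint_generator x' a'" and t: "t \<ge> 0"
  shows "qt t x' x' = integral {0..t} (\<lambda>s. (norm (adj i (x' o\<^sub>L S s)))\<^sup>2)"
proof -
  define n where "n = (\<lambda>s. (norm (adj i (x' o\<^sub>L S s)))\<^sup>2)"
  have n: "continuous_on {0..} n"
    unfolding n_def by (intro continuous_intros adj_orbit_continuous[OF g])
  define N where "N = (\<lambda>s. ennreal (indicator {0..} s *\<^sub>R n s))"
  have [measurable]: "(\<lambda>s. indicator {0..} s *\<^sub>R n s) \<in> borel_measurable borel"
    using n by (intro borel_measurable_continuous_on_indicator) auto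
  have N[measurable]: "N \<in> borel_measurable borel" unfolding N_def by measurable
  have "ennreal (cov x' x') = (\<integral>\<^sup>+s. N s \<partial>lborel)"
    unfolding covariance_formula N_def n_def by (intro nn_integral_cong) (auto simp: indicator_def)
  also have "\<dots> = (\<integral>\<^sup>+s. N s * indicator {0..t} s + N s * indicator {t..} s \<partial>lborel)"
  proof (rule nn_integral_cong_AE)
    show "AE s in lborel. N s = N s * indicator {0..t} s + N s * indicator {t..} s"
      using AE_lborel_singleton[of t] by eventually_elim (auto simp: N_def indicator_def)
  qed
  also have "\<dots> = (\<integral>\<^sup>+s. N s * indicator {0..t} s \<partial>lborel) + (\<integral>\<^sup>+s. N s * indicator {t..} s \<partial>lborel)"
    by (rule nn_integral_add) auto
  also have "(\<integral>\<^sup>+s. N s * indicator {0..t} s \<partial>lborel) = ennreal (integral {0..t} n)"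
  proof -
    have "(\<integral>\<^sup>+s. N s * indicator {0..t} s \<partial>lborel) = (\<integral>\<^sup>+s. ennreal (n s) * indicator {0..t} s \<partial>lborel)"
      by (intro nn_integral_cong) (auto simp: N_def indicator_def)
    also have "\<dots> = ennreal (integral {0..t} n)"
      using t by (intro nn_integral_continuous_Icc continuous_on_subset[OF n]) (auto simp: n_def)
    finally show ?thesis .
  qed
  also have "(\<integral>\<^sup>+s. N s * indicator {t..} s \<partial>lborel) = ennreal (cov (x' o\<^sub>L S t) (x' o\<^sub>L S t))"
  proof -
    have "(\<integral>\<^sup>+s. N s * indicator {t..} s \<partial>lborel) = ennreal \<bar>1\<bar> * (\<integral>\<^sup>+s. N (t + 1 * s) * indicator {t..} (t + 1 * s) \<partial>lborel)"
      by (rule nn_integral_real_affine) auto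
    also have "\<dots> = (\<integral>\<^sup>+s. ennreal ((norm (adj i ((x' o\<^sub>L S t) o\<^sub>L S s)))\<^sup>2) * indicator {0..} s \<partial>lborel)"
      using t by (simp, intro nn_integral_cong) (auto simp: N_def n_def indicator_def compose_S_add)
    finally show ?thesis by (simp add: covariance_formula)
  qed
  finally have "ennreal (cov x' x') = ennreal (integral {0..t} n) + ennreal (cov (x' o\<^sub>L S t) (x' o\<^sub>L S t))" .
  moreover have "0 \<le> integral {0..t} n"
    by (rule integral_nonneg[OF integrable_continuous_interval[OF continuous_on_subset[OF n]]]) (auto simp: n_def)
  ultimately have "ennreal (cov x' x') = ennreal (integral {0..t} n + cov (x' o\<^sub>L S t) (x' o\<^sub>L S t))"
    and "0 \<le> integral {0..t} n + cov (x' o\<^sub>L S t) (x' o\<^sub>L S t)"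
    by (simp_all add: ennreal_plus cov_nonneg)
  then have "cov x' x' = integral {0..t} n + cov (x' o\<^sub>L S t) (x' o\<^sub>L S t)"
    by (subst (asm) ennreal_inj) (simp_all add: cov_nonneg)
  then show ?thesis by (simp add: qt_def n_def)
qed

lemma qt_nonneg:
  assumes "adjoint_generator x' a'" "t \<ge> 0"
  shows "qt t x' x' \<ge> 0"
  unfolding qt_eq_integral[OF assms]
  using assms(2) by (intro integral_nonneg integrable_continuous_interval continuous_intros
      continuous_on_subset[OF adj_orbit_continuous[OF assms(1)]]) auto

text \<open>Here the norm of H appears: it is the rate at which variance is collected at time
  0.\<close>

lemma qt_derivative:
  assumes g: "adjoint_generator x' a'"
  shows "((\<lambda>t. qt t x' x' / t) \<longlongrightarrow> (norm (adj i x'))\<^sup>2) (at_right 0)"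
proof -
  define n where "n = (\<lambda>s. (norm (adj i (x' o\<^sub>L S s)))\<^sup>2)"
  have n: "continuous_on {0..1} n"
    unfolding n_def by (intro continuous_intros continuous_on_subset[OF adj_orbit_continuous[OF g]]) auto
  have "((\<lambda>t. integral {0..t} n) has_vector_derivative n 0) (at 0 within {0..1})"
    by (intro integral_has_vector_derivative n) auto
  moreover have "x' o\<^sub>L S 0 = x'" by (rule blinfun_eqI) simp
  ultimately have "((\<lambda>t. integral {0..t} n) has_real_derivative (norm (adj i x'))\<^sup>2) (at 0 within {0..1})"
    by (simp add: has_real_derivative_iff_has_vector_derivative n_def)
  then have "((\<lambda>t. integral {0..t} n / t) \<longlongrightarrow> (norm (adj i x'))\<^sup>2) (at 0 within {0..1})"
    by (simp add: has_field_derivative_iff)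
  then have "((\<lambda>t. integral {0..t} n / t) \<longlongrightarrow> (norm (adj i x'))\<^sup>2) (at_right 0)"
    using at_within_Icc_at_right[of 0 "1::real"] by simp
  then show ?thesis
  proof (rule Lim_transform_eventually)
    show "\<forall>\<^sub>F t in at_right 0. integral {0..t} n / t = qt t x' x' / t"
      by (auto simp: eventually_at_filter qt_eq_integral[OF g] n_def)
  qed
qed

text \<open>On the domain of the adjoint generator the loss of variance is \<open>qt\<close>, an
  integral of squares. The general case follows by L2 approximation, applied to the functionals and
  to their compositions with \<open>S t\<close>.\<close>

lemma adjoint_semigroup_contraction:
  fixes z' :: "'e \<Rightarrow>\<^sub>L real"
  assumes t: "t \<ge> 0"
  shows "l2norm \<mu> (\<lambda>x. blinfun_apply z' (S t x)) \<le> l2norm \<mu> (blinfun_apply z')"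
proof -
  obtain x' a' C where x': "\<And>n :: nat. adjoint_generator (x' n) (a' n)"
    "\<And>n x. \<bar>blinfun_apply (x' n) x\<bar> \<le> C * norm x" "\<And>x. (\<lambda>n. blinfun_apply (x' n) x) \<longlonglongrightarrow> z' x"
    using adjoint_generator_dense[of z'] by metis
  have comp: "(\<lambda>x. y' (S t x)) = blinfun_apply (y' o\<^sub>L S t)" for y' :: "'e \<Rightarrow>\<^sub>L real" by auto
  have "l2norm \<mu> (blinfun_apply (x' n o\<^sub>L S t)) \<le> l2norm \<mu> (blinfun_apply (x' n))" for n
  proof -
    have "cov (x' n o\<^sub>L S t) (x' n o\<^sub>L S t) \<le> cov (x' n) (x' n)"
      using qt_nonneg[OF x'(1) t, of n] by (simp add: qt_def)
    then show ?thesis unfolding cov_self by (rule power2_le_imp_le) simp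
  qed
  moreover have "(\<lambda>n. l2norm \<mu> (blinfun_apply (x' n))) \<longlonglongrightarrow> l2norm \<mu> (blinfun_apply z')"
    by (intro L2_tendsto_l2norm functional_dominated_convergence[OF x'(2,3)]) simp_all
  moreover have "(\<lambda>n. l2norm \<mu> (blinfun_apply (x' n o\<^sub>L S t))) \<longlonglongrightarrow> l2norm \<mu> (blinfun_apply (z' o\<^sub>L S t))"
  proof (intro L2_tendsto_l2norm functional_dominated_convergence)
    fix n x
    have C: "C * norm (S t x) \<le> C * (norm (S t) * norm x)" if "C \<ge> 0"
      using that by (intro mult_left_mono norm_blinfun)
    show "\<bar>(x' n o\<^sub>L S t) x\<bar> \<le> (\<bar>C\<bar> * norm (S t)) * norm x"
    proof -
      have "\<bar>(x' n o\<^sub>L S t) x\<bar> \<le> C * norm (S t x)" using x'(2)[of n "S t x"] by simp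
      also have "\<dots> \<le> \<bar>C\<bar> * norm (S t x)" by (intro mult_right_mono) auto
      also have "\<dots> \<le> \<bar>C\<bar> * (norm (S t) * norm x)" by (intro mult_left_mono norm_blinfun) auto
      finally show ?thesis by (simp add: mult.assoc)
    qed
  qed (use x'(3) in simp_all)
  ultimately have "l2norm \<mu> (blinfun_apply (z' o\<^sub>L S t)) \<le> l2norm \<mu> (blinfun_apply z')"
    by (intro LIMSEQ_le) auto
  then show ?thesis by (simp only: comp)
qed

lemma Y_gaussian: "t \<ge> 0 \<Longrightarrow> centred_gaussian P (\<lambda>\<omega>. blinfun_apply x' (Y t \<omega>))"
  using Y[of t] by (simp add: stochastic_convolution_def)

lemma Y_strongly_measurable: "t \<ge> 0 \<Longrightarrow> strongly_measurable P (Y t)"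
  using Y[of t] by (simp add: stochastic_convolution_def)

lemma Y_L2: "t \<ge> 0 \<Longrightarrow> (\<lambda>\<omega>. blinfun_apply x' (Y t \<omega>) :: real) \<in> L2 P"
  by (rule centred_gaussian_L2[OF P Y_gaussian])

text \<open>The isometry of the cylindrical Brownian motion. Restricting to the domain makes the
  integrand continuous, hence an element of \<open>L2\<close>.\<close>

lemma Y_variance:
  assumes g: "adjoint_generator x' a'" and t: "t \<ge> 0"
  shows "(\<integral>\<omega>. (x' (Y t \<omega>))\<^sup>2 \<partial>P) = qt t x' x'"
proof -
  define n where "n = (\<lambda>s. (norm (adj i (x' o\<^sub>L S s)))\<^sup>2)"
  define f where "f = (\<lambda>s. indicator {0..t} s *\<^sub>R adj i (x' o\<^sub>L S (t - s)))"
  have cont: "continuous_on {0..t} (\<lambda>s. adj i (x' o\<^sub>L S (t - s)))"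
    by (rule continuous_on_compose2[OF adj_orbit_continuous[OF g]]) (auto intro!: continuous_intros)
  have sm: "strongly_measurable lborel_nonneg f"
    unfolding f_def by (rule strongly_measurable_continuous_Icc[OF cont])
  have nn: "(\<integral>\<^sup>+s. ennreal ((norm (f s))\<^sup>2) \<partial>lborel_nonneg) = ennreal (qt t x' x')"
  proof -
    define F where "F = (\<lambda>s. ennreal (indicator {0..t} s *\<^sub>R n s))"
    have n: "continuous_on {0..t} n"
      unfolding n_def by (intro continuous_intros continuous_on_subset[OF adj_orbit_continuous[OF g]]) auto
    then have "(\<lambda>s. indicator {0..t} s *\<^sub>R n s) \<in> borel_measurable borel"
      by (intro borel_measurable_continuous_on_indicator) auto
    then have F[measurable]: "F \<in> borel_measurable borel" unfolding F_def by measurable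
    \<comment> \<open>Time reversal s -> t - s turns the convolution kernel into the orbit.\<close>
    have "(\<integral>\<^sup>+s. ennreal ((norm (f s))\<^sup>2) \<partial>lborel_nonneg) = (\<integral>\<^sup>+s. F (t + - 1 * s) \<partial>lborel)"
      unfolding nn_integral_lborel_nonneg
      by (intro nn_integral_cong) (auto simp: f_def F_def n_def indicator_def)
    also have "\<dots> = (\<integral>\<^sup>+s. F s \<partial>lborel)"
      using nn_integral_real_affine[OF F, of "- 1" t] by simp
    also have "\<dots> = (\<integral>\<^sup>+s. ennreal (n s) * indicator {0..t} s \<partial>lborel)"
      by (intro nn_integral_cong) (auto simp: F_def indicator_def)
    also have "\<dots> = ennreal (integral {0..t} n)"
      using t by (intro nn_integral_continuous_Icc n) (auto simp: n_def)
    finally show ?thesis by (simp add: qt_eq_integral[OF g t] n_def)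
  qed
  have int: "integrable lborel_nonneg (\<lambda>s. (norm (f s))\<^sup>2)"
    using strongly_measurable_norm[OF sm] nn by (intro integrableI_bounded) auto
  then have fL2: "f \<in> L2 lborel_nonneg" using sm by (simp add: L2_def)
  have "ennreal (\<integral>s. (norm (f s))\<^sup>2 \<partial>lborel_nonneg) = ennreal (qt t x' x')"
    using nn nn_integral_eq_integral[OF int] by simp
  then have e: "(\<integral>s. (norm (f s))\<^sup>2 \<partial>lborel_nonneg) = qt t x' x'"
    using qt_nonneg[OF g t] by (subst (asm) ennreal_inj) auto
  have ae: "AE \<omega> in P. x' (Y t \<omega>) = W f \<omega>"
    using Y[OF t] by (simp add: stochastic_convolution_def f_def)
  have [measurable]: "(\<lambda>\<omega>. x' (Y t \<omega>)) \<in> borel_measurable P" "W f \<in> borel_measurable P"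
    using L2_borel[OF Y_L2[OF t]] W fL2 by (auto simp: cylindrical_brownian_motion_def L2_borel)
  have "(\<integral>\<omega>. (x' (Y t \<omega>))\<^sup>2 \<partial>P) = (\<integral>\<omega>. W f \<omega> * W f \<omega> \<partial>P)"
    using ae by (intro integral_cong_AE) (auto simp: power2_eq_square)
  also have "\<dots> = (\<integral>s. inner (f s) (f s) \<partial>lborel_nonneg)"
    using W fL2 by (simp add: cylindrical_brownian_motion_def)
  finally show ?thesis using e by (simp add: power2_norm_eq_inner)
qed

lemma qt_add:
  "qt t (x' + y') (x' + y') = qt t x' x' + 2 * qt t x' y' + qt t y' y'"
proof -
  have "(x' + y') o\<^sub>L S t = (x' o\<^sub>L S t) + (y' o\<^sub>L S t)" by (rule blinfun_eqI) (simp add: blinfun.add_left)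
  then show ?thesis
    by (simp add: qt_def cov_add_left cov_add_right cov_sym[of y' x'] cov_sym[of "y' o\<^sub>L S t" "x' o\<^sub>L S t"])
qed

lemma qt_scaleR: "qt t (c *\<^sub>R x') (d *\<^sub>R y') = c * d * qt t x' y'"
proof -
  have "(c *\<^sub>R x') o\<^sub>L S t = c *\<^sub>R (x' o\<^sub>L S t)" for c and x' :: "'e \<Rightarrow>\<^sub>L real" by (rule blinfun_eqI) (simp add: blinfun.scaleR_left)
  then show ?thesis by (simp add: qt_def cov_scaleR_left cov_scaleR_right algebra_simps)
qed

lemma Y_covariance:
  assumes x': "adjoint_generator x' a'" and y': "adjoint_generator y' b'" and t: "t \<ge> 0"
  shows "(\<integral>\<omega>. x' (Y t \<omega>) * y' (Y t \<omega>) \<partial>P) = qt t x' y'"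
proof -
  note i = L2_integrable[OF Y_L2[OF t, of x']] L2_integrable[OF Y_L2[OF t, of y']] L2_mult_integrable[OF Y_L2[OF t] Y_L2[OF t], of x' y']
  have "(\<integral>\<omega>. ((x' + y') (Y t \<omega>))\<^sup>2 \<partial>P) =
      (\<integral>\<omega>. (x' (Y t \<omega>))\<^sup>2 + (2 * (x' (Y t \<omega>) * y' (Y t \<omega>)) + (y' (Y t \<omega>))\<^sup>2) \<partial>P)"
    by (simp add: blinfun.add_left power2_eq_square algebra_simps)
  also have "\<dots> = (\<integral>\<omega>. (x' (Y t \<omega>))\<^sup>2 \<partial>P) + (2 * (\<integral>\<omega>. x' (Y t \<omega>) * y' (Y t \<omega>) \<partial>P) + (\<integral>\<omega>. (y' (Y t \<omega>))\<^sup>2 \<partial>P))"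
    using i by simp
  finally show ?thesis
    by (simp add: Y_variance[OF x' t] Y_variance[OF y' t] Y_variance[OF adjoint_generator_add[OF x' y'] t] qt_add)
qed

lemma Y_complex_exp:
  assumes x': "adjoint_generator x' a'" and y': "adjoint_generator y' b'" and t: "t \<ge> 0"
  shows "(\<integral>\<omega>. exp (x' (Y t \<omega>)) *\<^sub>R iexp (y' (Y t \<omega>)) \<partial>P) =
    exp (complex_of_real ((qt t x' x' - qt t y' y') / 2) + \<i> * complex_of_real (qt t x' y'))"
proof -
  have "centred_gaussian P (\<lambda>\<omega>. u * x' (Y t \<omega>) + y' (Y t \<omega>))" for u
    using Y_gaussian[OF t, of "u *\<^sub>R x' + y'"] by (simp add: blinfun.bilinear_simps)
  from gaussian_complex_exp[OF P Y_gaussian[OF t] this]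
  show ?thesis by (simp add: Y_variance[OF x' t] Y_variance[OF y' t] Y_covariance[OF x' y' t])
qed

section \<open>The transition map and the invariance of the measure\<close>

definition transition :: "real \<Rightarrow> 'e \<times> 'w \<Rightarrow> 'e" where
  "transition t z = S t (fst z) + Y t (snd z)"

sublocale muP: pair_prob_space \<mu> P ..

text \<open>A sum of two measurable maps into a nonseparable space is at stake, so the noise is
  approximated by simple functions, for which the sum is measurable piece by piece.\<close>

lemma transition_measurable:
  assumes t: "t \<ge> 0"
  shows "transition t \<in> borel_measurable (\<mu> \<Otimes>\<^sub>M P)"
proof -
  obtain s where s: "\<And>n. simple_function P (s n)" "\<And>\<omega>. \<omega> \<in> space P \<Longrightarrow> (\<lambda>n. s n \<omega>) \<longlonglongrightarrow> Y t \<omega>"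
    using Y_strongly_measurable[OF t] unfolding strongly_measurable_def by metis
  show ?thesis
  proof (rule borel_measurable_LIMSEQ_metric)
    fix n
    show "(\<lambda>z. S t (fst z) + s n (snd z)) \<in> borel_measurable (\<mu> \<Otimes>\<^sub>M P)"
    proof (rule measurable_compose_countable'[where I = "s n ` space P" and f = "\<lambda>c z. S t (fst z) + c"])
      fix c
      have "(\<lambda>x. S t x + c) \<in> borel_measurable borel"
        by (intro borel_measurable_continuous_onI continuous_intros)
      then have "(\<lambda>x. S t x + c) \<in> borel_measurable \<mu>" by (simp add: measurable_cong_sets[OF sets_mu refl])
      from measurable_compose[OF measurable_fst this]
      show "(\<lambda>z. S t (fst z) + c) \<in> borel_measurable (\<mu> \<Otimes>\<^sub>M P)" .
      have "s n \<in> measurable P (count_space (s n ` space P))"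
        using s(1)[of n] by (subst measurable_count_space_eq2) (auto simp: simple_function_def)
      from measurable_compose[OF measurable_snd this]
      show "(\<lambda>z. s n (snd z)) \<in> measurable (\<mu> \<Otimes>\<^sub>M P) (count_space (s n ` space P))" .
      show "countable (s n ` space P)" using s(1)[of n] by (simp add: simple_function_def countable_finite)
    qed
  next
    fix z assume "z \<in> space (\<mu> \<Otimes>\<^sub>M P)"
    then show "(\<lambda>n. S t (fst z) + s n (snd z)) \<longlonglongrightarrow> transition t z"
      unfolding transition_def by (intro tendsto_intros s(2)) (auto simp: space_pair_measure)
  qed
qed

text \<open>
  Characteristic functionals are compared on the domain of \<open>A\<^sup>*\<close> only, where the integrand of the
  stochastic convolution is norm continuous.
\<close>

lemma transition_invariant:
  assumes t: "t \<ge> 0"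
  shows "distr (\<mu> \<Otimes>\<^sub>M P) borel (transition t) = \<mu>"
proof -
  let ?\<nu> = "distr (\<mu> \<Otimes>\<^sub>M P) borel (transition t)"
  note [measurable] = transition_measurable[OF t]
  interpret nu: prob_space ?\<nu> by (rule muP.P.prob_space_distr) simp
  have bor: "blinfun_apply x' \<in> borel_measurable borel" for x' :: "'e \<Rightarrow>\<^sub>L real"
    by (intro borel_measurable_continuous_onI continuous_intros)
  have char_gen: "(\<integral>x. iexp (x' x) \<partial>?\<nu>) = (\<integral>x. iexp (x' x) \<partial>\<mu>)"
    if g: "adjoint_generator x' a'" for x' a'
  proof -
    have [measurable]: "blinfun_apply x' \<in> borel_measurable borel" by (rule bor)
    have "(\<integral>x. iexp (x' x) \<partial>?\<nu>) = (\<integral>z. iexp (x' (transition t z)) \<partial>(\<mu> \<Otimes>\<^sub>M P))"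
      by (rule integral_distr) measurable
    also have "\<dots> = (\<integral>x. \<integral>\<omega>. iexp (x' (transition t (x, \<omega>))) \<partial>P \<partial>\<mu>)"
    proof (rule muP.integral_fst'[symmetric])
      show "integrable (\<mu> \<Otimes>\<^sub>M P) (\<lambda>z. iexp (x' (transition t z)))"
        by (rule muP.P.integrable_const_bound[of _ 1]) auto
    qed
    also have "\<dots> = (\<integral>x. iexp ((x' o\<^sub>L S t) x) * (\<integral>\<omega>. iexp (x' (Y t \<omega>)) \<partial>P) \<partial>\<mu>)"
      by (simp add: transition_def blinfun.add_right exp_add distrib_left)
    also have "\<dots> = exp (- cov (x' o\<^sub>L S t) (x' o\<^sub>L S t) / 2) * exp (- qt t x' x' / 2)"
      using functional_char[of "x' o\<^sub>L S t"] centred_gaussian_char[OF P Y_gaussian[OF t], of x']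
      by (simp add: Y_variance[OF g t])
    also have "\<dots> = exp (- cov x' x' / 2)"
      by (simp add: qt_def exp_add[symmetric] field_simps flip: of_real_mult)
    finally show ?thesis by (simp add: functional_char)
  qed
  \<comment> \<open>Extension from the domain to all functionals by bounded convergence under both
    laws.\<close>
  have char: "(\<integral>x. iexp (z' x) \<partial>?\<nu>) = (\<integral>x. iexp (z' x) \<partial>\<mu>)" for z' :: "'e \<Rightarrow>\<^sub>L real"
  proof -
    obtain x' a' C where x': "\<And>n :: nat. adjoint_generator (x' n) (a' n)"
      "\<And>x. (\<lambda>n. blinfun_apply (x' n) x) \<longlonglongrightarrow> z' x"
      using adjoint_generator_dense[of z'] by metis
    have [measurable]: "blinfun_apply y' \<in> borel_measurable borel" for y' :: "'e \<Rightarrow>\<^sub>L real" by (rule bor)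
    have lim: "(\<lambda>n. \<integral>x. iexp (x' n x) \<partial>m) \<longlonglongrightarrow> (\<integral>x. iexp (z' x) \<partial>m)"
      if "prob_space m" and [measurable_cong]: "sets m = sets borel" for m :: "'e measure"
    proof -
      interpret m: prob_space m by fact
      show ?thesis
      proof (rule integral_dominated_convergence[where w = "\<lambda>_. 1"])
        show "AE x in m. (\<lambda>n. iexp (x' n x)) \<longlonglongrightarrow> iexp (z' x)"
          by (intro AE_I2 tendsto_exp tendsto_mult tendsto_const tendsto_of_real x'(2))
      qed auto
    qed
    have "(\<lambda>n. \<integral>x. iexp (x' n x) \<partial>?\<nu>) \<longlonglongrightarrow> (\<integral>x. iexp (z' x) \<partial>\<mu>)"
      unfolding char_gen[OF x'(1)] by (rule lim[OF prob_space_axioms sets_mu])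
    moreover have "(\<lambda>n. \<integral>x. iexp (x' n x) \<partial>?\<nu>) \<longlonglongrightarrow> (\<integral>x. iexp (z' x) \<partial>?\<nu>)"
      by (rule lim[OF nu.prob_space_axioms]) simp
    ultimately show ?thesis by (rule LIMSEQ_unique[rotated])
  qed
  obtain D where D: "countable D" "AE x in \<mu>. x \<in> closure D" using separable_support by blast
  obtain s where s: "\<And>n :: nat. simple_function P (s n)" "\<And>\<omega>. \<omega> \<in> space P \<Longrightarrow> (\<lambda>n. s n \<omega>) \<longlonglongrightarrow> Y t \<omega>"
    using Y_strongly_measurable[OF t] unfolding strongly_measurable_def by metis
  define R where "R = (\<Union>n. s n ` space P)"
  have "countable R"
    unfolding R_def using s(1) by (intro countable_UN[OF countableI_type]) (simp add: simple_function_def countable_finite)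
  \<comment> \<open>A countable set whose closure carries both laws: it contains the dense set for
    \<open>\<mu>\<close> and all sums of its images under \<open>S t\<close> with values of the
    simple approximations of the noise.\<close>
  define D' where "D' = D \<union> (\<lambda>(d, r). S t d + r) ` (D \<times> R)"
  have "countable D'" unfolding D'_def using D(1) \<open>countable R\<close> by simp
  have ae_mu: "AE x in \<mu>. x \<in> closure D'"
    using D(2) closure_mono[of D D'] by (auto simp: D'_def elim!: eventually_mono)
  have in_D': "transition t (x, \<omega>) \<in> closure D'" if x: "x \<in> closure D" and w: "\<omega> \<in> space P" for x \<omega>
  proof -
    obtain d where d: "\<And>n. d n \<in> D" "d \<longlonglongrightarrow> x" using x by (auto simp: closure_sequential)
    have "(\<lambda>n. S t (d n) + s n \<omega>) \<longlonglongrightarrow> transition t (x, \<omega>)"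
      unfolding transition_def using d(2) s(2)[OF w] by (auto intro!: tendsto_intros)
    moreover have "S t (d n) + s n \<omega> \<in> D'" for n
      using d(1) w unfolding D'_def R_def by (intro UnI2 image_eqI[of _ _ "(d n, s n \<omega>)"]) auto
    ultimately show ?thesis
      unfolding closure_sequential by (intro exI[of _ "\<lambda>n. S t (d n) + s n \<omega>"]) blast
  qed
  have ae_nu: "AE x in ?\<nu>. x \<in> closure D'"
  proof -
    have m: "{x \<in> space borel. x \<in> closure D'} \<in> sets borel" by simp
    have "AE z in \<mu> \<Otimes>\<^sub>M P. transition t z \<in> closure D'"
    proof (rule muP.AE_pair_measure)
      have "transition t -` closure D' \<inter> space (\<mu> \<Otimes>\<^sub>M P) \<in> sets (\<mu> \<Otimes>\<^sub>M P)"
        by (rule measurable_sets[OF transition_measurable[OF t]]) simp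
      then show "{z \<in> space (\<mu> \<Otimes>\<^sub>M P). transition t z \<in> closure D'} \<in> sets (\<mu> \<Otimes>\<^sub>M P)"
        by (simp add: vimage_def Int_def conj_commute)
      show "AE x in \<mu>. AE \<omega> in P. transition t (x, \<omega>) \<in> closure D'"
        using D(2) by eventually_elim (rule AE_I2, rule in_D')
    qed
    then show ?thesis by (simp add: AE_distr_iff[OF transition_measurable[OF t] m])
  qed
  show ?thesis
    by (rule char_functional_eq_imp_measure_eq[OF nu.prob_space_axioms _ prob_space_axioms sets_mu char
          \<open>countable D'\<close> ae_nu ae_mu]) simp
qed

end

context ornstein_uhlenbeck
begin

text \<open>One operator for real and complex functions, given by a pointwise formula;
  \<open>OU_L2\<close> agrees with it almost everywhere, which removes \<open>SOME\<close> from
  later arguments.\<close>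

definition transition_op :: "real \<Rightarrow> ('e \<Rightarrow> 'b::{banach, second_countable_topology}) \<Rightarrow> 'e \<Rightarrow> 'b" where
  "transition_op t f x = (\<integral>\<omega>. f (transition t (x, \<omega>)) \<partial>P)"

lemma OU_eq_transition_op: "OU P S Y t f x = transition_op t f x"
  by (simp add: OU_def transition_op_def mild_solution_def transition_def)

lemma borel_measurable_mu: "f \<in> borel_measurable \<mu> \<longleftrightarrow> f \<in> borel_measurable borel"
  by (simp add: measurable_cong_sets[OF sets_mu refl])

lemma compose_transition_L2:
  fixes f :: "'e \<Rightarrow> 'b::{banach, second_countable_topology}"
  assumes f: "f \<in> L2 \<mu>" and t: "t \<ge> 0"
  shows "(\<lambda>z. f (transition t z)) \<in> L2 (\<mu> \<Otimes>\<^sub>M P)"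
    and "(\<integral>z. (norm (f (transition t z)))\<^sup>2 \<partial>(\<mu> \<Otimes>\<^sub>M P)) = (\<integral>x. (norm (f x))\<^sup>2 \<partial>\<mu>)"
proof -
  note [measurable] = transition_measurable[OF t]
  have [measurable]: "f \<in> borel_measurable borel" using L2_borel[OF f] by (simp add: borel_measurable_mu)
  have "integrable (distr (\<mu> \<Otimes>\<^sub>M P) borel (transition t)) (\<lambda>x. (norm (f x))\<^sup>2)"
    unfolding transition_invariant[OF t] by (rule L2_integrable[OF f])
  then have "integrable (\<mu> \<Otimes>\<^sub>M P) (\<lambda>z. (norm (f (transition t z)))\<^sup>2)"
    by (subst (asm) integrable_distr_eq) auto
  then show "(\<lambda>z. f (transition t z)) \<in> L2 (\<mu> \<Otimes>\<^sub>M P)" by (simp add: L2_iff)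
  have "(\<integral>x. (norm (f x))\<^sup>2 \<partial>\<mu>) = (\<integral>x. (norm (f x))\<^sup>2 \<partial>distr (\<mu> \<Otimes>\<^sub>M P) borel (transition t))"
    by (simp only: transition_invariant[OF t])
  also have "\<dots> = (\<integral>z. (norm (f (transition t z)))\<^sup>2 \<partial>(\<mu> \<Otimes>\<^sub>M P))"
    by (rule integral_distr) measurable
  finally show "(\<integral>z. (norm (f (transition t z)))\<^sup>2 \<partial>(\<mu> \<Otimes>\<^sub>M P)) = (\<integral>x. (norm (f x))\<^sup>2 \<partial>\<mu>)" ..
qed

lemma AE_compose_transition_L2:
  fixes f :: "'e \<Rightarrow> 'b::{banach, second_countable_topology}"
  assumes f: "f \<in> L2 \<mu>" and t: "t \<ge> 0"
  shows "AE x in \<mu>. (\<lambda>\<omega>. f (transition t (x, \<omega>))) \<in> L2 P"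
proof -
  note L = compose_transition_L2(1)[OF f t]
  have "AE x in \<mu>. integrable P (\<lambda>\<omega>. (norm (f (transition t (x, \<omega>))))\<^sup>2)"
    by (rule muP.AE_integrable_fst'[OF L2_integrable[OF L]])
  then show ?thesis
  proof (rule AE_mp, intro AE_I2 impI)
    fix x assume "x \<in> space \<mu>" "integrable P (\<lambda>\<omega>. (norm (f (transition t (x, \<omega>))))\<^sup>2)"
    then show "(\<lambda>\<omega>. f (transition t (x, \<omega>))) \<in> L2 P"
      using measurable_Pair2[OF L2_borel[OF L]] by (simp add: L2_iff)
  qed
qed

text \<open>The square of a mean is at most the mean of the square for almost every starting point;
  integrating over \<open>\<mu>\<close> and using invariance gives the contraction.\<close>

lemma transition_op_L2:
  fixes f :: "'e \<Rightarrow> 'b::{banach, second_countable_topology}"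
  assumes f: "f \<in> L2 \<mu>" and t: "t \<ge> 0"
  shows "transition_op t f \<in> L2 \<mu>" and "l2norm \<mu> (transition_op t f) \<le> l2norm \<mu> f"
proof -
  note L = compose_transition_L2[OF f t]
  have m: "transition_op t f \<in> borel_measurable \<mu>"
    unfolding transition_op_def[abs_def] using L2_borel[OF L(1)]
    by (intro P.borel_measurable_lebesgue_integral) (simp add: case_prod_unfold)
  have int: "integrable \<mu> (\<lambda>x. \<integral>\<omega>. (norm (f (transition t (x, \<omega>))))\<^sup>2 \<partial>P)"
    by (rule muP.integrable_fst'[OF L2_integrable[OF L(1)]])
  have ae: "AE x in \<mu>. (norm (transition_op t f x))\<^sup>2 \<le> (\<integral>\<omega>. (norm (f (transition t (x, \<omega>))))\<^sup>2 \<partial>P)"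
    using AE_compose_transition_L2[OF f t]
  proof eventually_elim
    case (elim x)
    have "norm (transition_op t f x) \<le> (\<integral>\<omega>. norm (f (transition t (x, \<omega>))) \<partial>P)"
      unfolding transition_op_def by (rule integral_norm_bound)
    also have "\<dots> \<le> l2norm P (\<lambda>\<omega>. f (transition t (x, \<omega>)))" by (rule P.integral_norm_le_l2norm[OF elim])
    finally have "(norm (transition_op t f x))\<^sup>2 \<le> (l2norm P (\<lambda>\<omega>. f (transition t (x, \<omega>))))\<^sup>2"
      by (intro power_mono) auto
    then show ?case by (simp add: l2norm_power2)
  qed
  have i2: "integrable \<mu> (\<lambda>x. (norm (transition_op t f x))\<^sup>2)"
    by (rule Bochner_Integration.integrable_bound[OF int]) (use ae m in \<open>auto elim!: eventually_mono\<close>)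
  with m show "transition_op t f \<in> L2 \<mu>" by (simp add: L2_iff)
  have "(\<integral>x. (norm (transition_op t f x))\<^sup>2 \<partial>\<mu>) \<le> (\<integral>x. \<integral>\<omega>. (norm (f (transition t (x, \<omega>))))\<^sup>2 \<partial>P \<partial>\<mu>)"
    by (rule integral_mono_AE[OF i2 int ae])
  also have "\<dots> = (\<integral>x. (norm (f x))\<^sup>2 \<partial>\<mu>)"
    unfolding L(2)[symmetric] by (rule muP.integral_fst'[OF L2_integrable[OF L(1)]])
  finally show "l2norm \<mu> (transition_op t f) \<le> l2norm \<mu> f" by (simp add: l2norm_def)
qed

lemma transition_op_diff:
  fixes f g :: "'e \<Rightarrow> 'b::{banach, second_countable_topology}"
  assumes f: "f \<in> L2 \<mu>" and g: "g \<in> L2 \<mu>" and t: "t \<ge> 0"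
  shows "AE x in \<mu>. transition_op t (\<lambda>x. f x - g x) x = transition_op t f x - transition_op t g x"
  using AE_compose_transition_L2[OF f t] AE_compose_transition_L2[OF g t]
proof eventually_elim
  case (elim x)
  then show ?case
    unfolding transition_op_def using P.L2_imp_integrable by (intro Bochner_Integration.integral_diff) auto
qed

lemma transition_op_l2norm_diff:
  fixes f g :: "'e \<Rightarrow> 'b::{banach, second_countable_topology}"
  assumes f: "f \<in> L2 \<mu>" and g: "g \<in> L2 \<mu>" and t: "t \<ge> 0"
  shows "l2norm \<mu> (\<lambda>x. transition_op t f x - transition_op t g x) \<le> l2norm \<mu> (\<lambda>x. f x - g x)"
proof -
  have fg: "(\<lambda>x. f x - g x) \<in> L2 \<mu>" by (rule L2_diff[OF f g])
  have "l2norm \<mu> (\<lambda>x. transition_op t f x - transition_op t g x) = l2norm \<mu> (transition_op t (\<lambda>x. f x - g x))"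
    using transition_op_diff[OF f g t]
    by (intro l2norm_cong_AE L2_borel L2_diff transition_op_L2[OF f t] transition_op_L2[OF g t] transition_op_L2[OF fg t])
      (auto elim!: eventually_mono)
  also have "\<dots> \<le> l2norm \<mu> (\<lambda>x. f x - g x)" by (rule transition_op_L2(2)[OF fg t])
  finally show ?thesis .
qed

lemma l2norm_zero_imp_AE:
  fixes f g :: "'e \<Rightarrow> real"
  assumes "f \<in> L2 \<mu>" "g \<in> L2 \<mu>" "l2norm \<mu> (\<lambda>x. f x - g x) = 0"
  shows "AE x in \<mu>. f x = g x"
proof -
  have "(\<integral>x. (norm (f x - g x))\<^sup>2 \<partial>\<mu>) = 0" using assms(3) l2norm_power2[of \<mu> "\<lambda>x. f x - g x"] by simp
  then have "AE x in \<mu>. (norm (f x - g x))\<^sup>2 = 0"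
    by (subst (asm) integral_nonneg_eq_0_iff_AE[OF L2_integrable[OF L2_diff[OF assms(1,2)]]]) auto
  then show ?thesis by eventually_elim simp
qed

text \<open>Truncations show that the property under \<open>SOME\<close> can be satisfied;
  contractivity shows that any approximating sequence leads to the same limit almost
  everywhere.\<close>

lemma OU_L2_eq:
  fixes f :: "'e \<Rightarrow> real"
  assumes f: "f \<in> L2 \<mu>" and t: "t \<ge> 0"
  shows "AE x in \<mu>. OU_L2 P S Y \<mu> t f x = transition_op t f x"
proof -
  have [measurable]: "f \<in> borel_measurable borel" using L2_borel[OF f] by (simp add: borel_measurable_mu)
  have bounded_L2: "F \<in> L2 \<mu>" if F: "F \<in> borel_measurable borel" and b: "bounded (range F)" for F :: "'e \<Rightarrow> real"
  proof -
    obtain C where "\<And>x. norm (F x) \<le> C" using b by (auto simp: bounded_iff)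
    then show ?thesis
      using F by (intro L2_bounded[OF finite_measure_axioms strongly_measurableI]) (auto simp: borel_measurable_mu)
  qed
  let ?Q = "\<lambda>g F. (\<forall>n :: nat. F n \<in> borel_measurable borel \<and> bounded (range (F n))) \<and>
      (\<lambda>n. l2norm \<mu> (\<lambda>x. F n x - f x)) \<longlonglongrightarrow> 0 \<and> (\<lambda>n. l2norm \<mu> (\<lambda>x. OU P S Y t (F n) x - g x)) \<longlonglongrightarrow> 0"
  define F where "F = (\<lambda>(n :: nat) x. max (- real n) (min (real n) (f x)))"
  have F1: "F n \<in> borel_measurable borel" "bounded (range (F n))" for n
  proof -
    show "F n \<in> borel_measurable borel" unfolding F_def by measurable
    show "bounded (range (F n))" unfolding bounded_iff F_def by (intro exI[of _ "real n"]) auto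
  qed
  have F2: "(\<lambda>n. l2norm \<mu> (\<lambda>x. F n x - f x)) \<longlonglongrightarrow> 0"
  proof (rule L2_dominated_convergence[where w = "\<lambda>x. \<bar>f x\<bar>"])
    show "(\<lambda>x. \<bar>f x\<bar>) \<in> L2 \<mu>" using L2_norm[OF f] by simp
    show "AE x in \<mu>. (\<lambda>n. F n x) \<longlonglongrightarrow> f x"
    proof (rule AE_I2)
      fix x
      obtain N where N: "\<bar>f x\<bar> \<le> real N" using real_arch_simple by blast
      have "F n x = f x" if "n \<ge> N" for n using N that by (auto simp: F_def)
      then show "(\<lambda>n. F n x) \<longlonglongrightarrow> f x"
        by (intro tendsto_eventually) (auto simp: eventually_sequentially)
    qed
  qed (use F1 f in \<open>auto simp: F_def borel_measurable_mu\<close>)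
  have lim: "(\<lambda>n. l2norm \<mu> (\<lambda>x. OU P S Y t (G n) x - transition_op t f x)) \<longlonglongrightarrow> 0"
    if G: "\<And>n. G n \<in> borel_measurable borel \<and> bounded (range (G n))" and L: "(\<lambda>n. l2norm \<mu> (\<lambda>x. G n x - f x)) \<longlonglongrightarrow> 0"
    for G :: "nat \<Rightarrow> 'e \<Rightarrow> real"
  proof (rule tendsto_sandwich[OF _ _ tendsto_const L])
    show "\<forall>\<^sub>F n in sequentially. l2norm \<mu> (\<lambda>x. OU P S Y t (G n) x - transition_op t f x) \<le> l2norm \<mu> (\<lambda>x. G n x - f x)"
      unfolding OU_eq_transition_op
      using transition_op_l2norm_diff[OF bounded_L2 f t] G by (intro always_eventually) auto
  qed simp
  have "?Q (transition_op t f) F" using F1 F2 lim[of F] by simp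
  then have "\<exists>g. g \<in> L2 \<mu> \<and> (\<exists>F. ?Q g F)" using transition_op_L2(1)[OF f t] by blast
  then have "OU_L2 P S Y \<mu> t f \<in> L2 \<mu> \<and> (\<exists>F. ?Q (OU_L2 P S Y \<mu> t f) F)"
    unfolding OU_L2_def by (rule someI_ex)
  then obtain G where g: "OU_L2 P S Y \<mu> t f \<in> L2 \<mu>" and G: "?Q (OU_L2 P S Y \<mu> t f) G" by blast
  have GL: "OU P S Y t (G n) \<in> L2 \<mu>" for n
    unfolding OU_eq_transition_op[abs_def] using G bounded_L2 t by (intro transition_op_L2(1)) auto
  have "(\<lambda>n. l2norm \<mu> (\<lambda>x. OU P S Y t (G n) x - OU_L2 P S Y \<mu> t f x) + l2norm \<mu> (\<lambda>x. OU P S Y t (G n) x - transition_op t f x)) \<longlonglongrightarrow> 0 + 0"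
    using G lim[of G] by (intro tendsto_add) auto
  moreover have "l2norm \<mu> (\<lambda>x. OU_L2 P S Y \<mu> t f x - transition_op t f x) \<le>
      l2norm \<mu> (\<lambda>x. OU P S Y t (G n) x - OU_L2 P S Y \<mu> t f x) + l2norm \<mu> (\<lambda>x. OU P S Y t (G n) x - transition_op t f x)" for n
    using l2norm_triangle3[OF g GL transition_op_L2(1)[OF f t], of n]
    by (simp only: l2norm_minus_commute[of \<mu> "OU_L2 P S Y \<mu> t f"])
  ultimately have "l2norm \<mu> (\<lambda>x. OU_L2 P S Y \<mu> t f x - transition_op t f x) \<le> 0 + 0"
    by (intro LIMSEQ_le_const) auto
  then have "l2norm \<mu> (\<lambda>x. OU_L2 P S Y \<mu> t f x - transition_op t f x) = 0"
    using l2norm_nonneg[of \<mu> "\<lambda>x. OU_L2 P S Y \<mu> t f x - transition_op t f x"] by linarith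
  then show ?thesis by (rule l2norm_zero_imp_AE[OF g transition_op_L2(1)[OF f t]])
qed

lemma complexification_OU_L2_eq:
  assumes f: "f \<in> L2 \<mu>" and t: "t \<ge> 0"
  shows "AE x in \<mu>. complexification (OU_L2 P S Y \<mu> t) f x = transition_op t f x"
proof -
  have re: "(\<lambda>x. Re (f x)) \<in> L2 \<mu>" and im: "(\<lambda>x. Im (f x)) \<in> L2 \<mu>"
  proof -
    have [measurable]: "f \<in> borel_measurable \<mu>" by (rule L2_borel[OF f])
    have le: "(norm (Re z))\<^sup>2 \<le> (norm z)\<^sup>2" "(norm (Im z))\<^sup>2 \<le> (norm z)\<^sup>2" for z
      by (simp_all add: cmod_power2)
    have "integrable \<mu> (\<lambda>x. (norm (Re (f x)))\<^sup>2)"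
      by (rule Bochner_Integration.integrable_bound[OF L2_integrable[OF f]]) (use le(1) in simp_all)
    moreover have "integrable \<mu> (\<lambda>x. (norm (Im (f x)))\<^sup>2)"
      by (rule Bochner_Integration.integrable_bound[OF L2_integrable[OF f]]) (use le(2) in simp_all)
    ultimately
    show "(\<lambda>x. Re (f x)) \<in> L2 \<mu>" "(\<lambda>x. Im (f x)) \<in> L2 \<mu>" by (auto simp: L2_iff)
  qed
  show ?thesis
    using OU_L2_eq[OF re t] OU_L2_eq[OF im t] AE_compose_transition_L2[OF f t]
  proof eventually_elim
    case (elim x)
    have "integrable P (\<lambda>\<omega>. f (transition t (x, \<omega>)))" by (rule P.L2_imp_integrable[OF elim(3)])
    then show ?case
      unfolding complexification_def elim(1,2) transition_op_def by (simp add: complex_eq_iff)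
  qed
qed

text \<open>A pair stands for the complex functional x' + i y'. This is the Hermitian extension of
  \<open>cov\<close>, the integral of w times the conjugate of v.\<close>

definition cov_complex :: "('e \<Rightarrow>\<^sub>L real) \<times> ('e \<Rightarrow>\<^sub>L real) \<Rightarrow> ('e \<Rightarrow>\<^sub>L real) \<times> ('e \<Rightarrow>\<^sub>L real) \<Rightarrow> complex" where
  "cov_complex w v = Complex (cov (fst w) (fst v) + cov (snd w) (snd v)) (cov (snd w) (fst v) - cov (fst w) (snd v))"

text \<open>
  The coherent state \<open>exp (w - \<integral>w\<^sup>2/2)\<close> of the complex functional \<open>w = x' + \<i> y'\<close>. The
  Ornstein-Uhlenbeck semigroup acts on coherent states by \<open>w \<mapsto> S\<^sup>*(t)w\<close>.
\<close>

definition coherent :: "('e \<Rightarrow>\<^sub>L real) \<times> ('e \<Rightarrow>\<^sub>L real) \<Rightarrow> 'e \<Rightarrow> complex" where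
  "coherent w x = exp (complex_of_real (fst w x) + \<i> * complex_of_real (snd w x)
    - (complex_of_real ((cov (fst w) (fst w) - cov (snd w) (snd w)) / 2) + \<i> * complex_of_real (cov (fst w) (snd w))))"

lemma complex_exp_split: "exp (complex_of_real a + \<i> * complex_of_real b) = exp a *\<^sub>R iexp b"
  by (simp add: exp_add scaleR_conv_of_real exp_of_real)

lemma coherent_L2: "coherent w \<in> L2 \<mu>"
proof -
  have [measurable]: "coherent w \<in> borel_measurable \<mu>" unfolding coherent_def[abs_def] by measurable
  have "norm (coherent w x) ^ 2 = exp ((2 *\<^sub>R fst w) x) * exp (- (cov (fst w) (fst w) - cov (snd w) (snd w)))" for x
    by (simp add: coherent_def power2_eq_square exp_add[symmetric] blinfun.scaleR_left)
  then show ?thesis using functional_exp_integrable[of "2 *\<^sub>R fst w"] by (simp add: L2_iff)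
qed

text \<open>The product is again the exponential of a complex Gaussian functional; in its integral
  the unmixed squares cancel against the two normalisations and only the mixed term
  survives.\<close>

lemma coherent_inner:
  "(\<integral>x. coherent w x * cnj (coherent v x) \<partial>\<mu>) = exp (cov_complex w v)"
proof -
  obtain x' y' where w: "w = (x', y')" by (cases w)
  obtain u' v' where v: "v = (u', v')" by (cases v)
  define c where "c = (\<lambda>x' y'. complex_of_real ((cov x' x' - cov y' y') / 2) + \<i> * complex_of_real (cov x' y'))"
  have "coherent w x * cnj (coherent v x) = (exp ((x' + u') x) *\<^sub>R iexp ((y' - v') x)) * exp (- c x' y' - cnj (c u' v'))" for x
    unfolding complex_exp_split[symmetric] exp_add[symmetric] coherent_def w v c_def exp_cnj
    by (rule arg_cong[where f = exp]) (simp add: blinfun.bilinear_simps algebra_simps)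
  then have "(\<integral>x. coherent w x * cnj (coherent v x) \<partial>\<mu>) =
      (\<integral>x. exp ((x' + u') x) *\<^sub>R iexp ((y' - v') x) \<partial>\<mu>) * exp (- c x' y' - cnj (c u' v'))"
    by (simp only: integral_mult_left_zero)
  also have "\<dots> = exp (c (x' + u') (y' - v')) * exp (- c x' y' - cnj (c u' v'))"
    by (simp only: functional_complex_exp c_def)
  also have "\<dots> = exp (cov_complex w v)"
    unfolding exp_add[symmetric]
    by (rule arg_cong[where f = exp])
      (simp add: complex_eq_iff c_def w v cov_complex_def cov_add_left cov_add_right cov_diff_left cov_diff_right
        cov_sym[of u' x'] cov_sym[of v' y'] cov_sym[of u' y'] cov_sym[of v' x'] cov_sym[of v' u'] field_simps)
  finally show ?thesis .
qed

lemma coherent_l2norm: "l2norm \<mu> (coherent w) = exp ((cov (fst w) (fst w) + cov (snd w) (snd w)) / 2)"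
proof -
  have "complex_of_real (\<integral>x. (norm (coherent w x))\<^sup>2 \<partial>\<mu>) = (\<integral>x. coherent w x * cnj (coherent w x) \<partial>\<mu>)"
    by (simp add: complex_norm_square[symmetric] integral_complex_of_real[symmetric])
  also have "\<dots> = complex_of_real (exp (cov (fst w) (fst w) + cov (snd w) (snd w)))"
    unfolding coherent_inner exp_of_real[symmetric]
    by (rule arg_cong[where f = exp]) (simp add: complex_eq_iff cov_complex_def cov_sym)
  finally have "(\<integral>x. (norm (coherent w x))\<^sup>2 \<partial>\<mu>) = exp (cov (fst w) (fst w) + cov (snd w) (snd w))"
    by (simp only: of_real_eq_iff)
  also have "\<dots> = (exp ((cov (fst w) (fst w) + cov (snd w) (snd w)) / 2))\<^sup>2"
    by (simp add: power2_eq_square exp_add[symmetric])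
  finally show ?thesis by (simp add: l2norm_def)
qed

definition orbit :: "real \<Rightarrow> ('e \<Rightarrow>\<^sub>L real) \<times> ('e \<Rightarrow>\<^sub>L real) \<Rightarrow> ('e \<Rightarrow>\<^sub>L real) \<times> ('e \<Rightarrow>\<^sub>L real)" where
  "orbit t w = (fst w o\<^sub>L S t, snd w o\<^sub>L S t)"

text \<open>Averaging over the noise produces the exponential of half the bilinear square of w under
  \<open>qt\<close>, which is exactly the difference between the normalisations of w and of its
  orbit.\<close>

lemma transition_op_coherent:
  assumes x': "adjoint_generator (fst w) a'" and y': "adjoint_generator (snd w) b'" and t: "t \<ge> 0"
  shows "transition_op t (coherent w) x = coherent (orbit t w) x"
proof -
  obtain x' y' where w: "w = (x', y')" by (cases w)
  define c where "c = (\<lambda>x' y'. complex_of_real ((cov x' x' - cov y' y') / 2) + \<i> * complex_of_real (cov x' y'))"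
  have "coherent w (transition t (x, \<omega>)) = (exp (x' (Y t \<omega>)) *\<^sub>R iexp (y' (Y t \<omega>))) *
      exp (complex_of_real (x' (S t x)) + \<i> * complex_of_real (y' (S t x)) - c x' y')" for \<omega>
    unfolding complex_exp_split[symmetric] exp_add[symmetric] coherent_def w c_def transition_def
    by (rule arg_cong[where f = exp]) (simp add: blinfun.bilinear_simps algebra_simps)
  then have "transition_op t (coherent w) x = (\<integral>\<omega>. exp (x' (Y t \<omega>)) *\<^sub>R iexp (y' (Y t \<omega>)) \<partial>P) *
      exp (complex_of_real (x' (S t x)) + \<i> * complex_of_real (y' (S t x)) - c x' y')"
    unfolding transition_op_def by (simp only: integral_mult_left_zero)
  also have "\<dots> = coherent (orbit t w) x"
    using x' y' t unfolding w fst_conv snd_conv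
    by (subst Y_complex_exp) (auto simp: coherent_def orbit_def c_def qt_def exp_add[symmetric] field_simps
        intro!: arg_cong[where f = exp])
  finally show ?thesis .
qed

text \<open>With respect to the inner product of L2, S^*(t) on functionals is the adjoint of the
  restricted semigroup, so the decay estimate carries over with the same constants.\<close>

lemma adjoint_stable:
  assumes "S_inf_exponentially_stable S \<mu>"
  shows "\<exists>K \<omega>. \<omega> > 0 \<and> (\<forall>t\<ge>0. \<forall>x' :: 'e \<Rightarrow>\<^sub>L real.
    l2norm \<mu> (blinfun_apply (x' o\<^sub>L S t)) \<le> K * exp (- \<omega> * t) * l2norm \<mu> (blinfun_apply x'))"
proof -
  obtain K \<omega> where \<omega>: "\<omega> > 0"
    and K: "\<And>t h. t \<ge> 0 \<Longrightarrow> h \<in> H_inf \<mu> \<Longrightarrow> l2norm \<mu> (S_inf S \<mu> t h) \<le> K * exp (- \<omega> * t) * l2norm \<mu> h"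
    using assms unfolding S_inf_exponentially_stable_def by blast
  have H: "blinfun_apply h' \<in> H_inf \<mu>" for h' :: "'e \<Rightarrow>\<^sub>L real"
    unfolding H_inf_def by (auto intro!: exI[of _ "\<lambda>_. h'"])
  have comp: "l2norm \<mu> (blinfun_apply (x' o\<^sub>L S t)) \<le> l2norm \<mu> (blinfun_apply x')" if "t \<ge> 0" for t and x' :: "'e \<Rightarrow>\<^sub>L real"
    using adjoint_semigroup_contraction[OF that, of x'] by (simp add: blinfun_compose.rep_eq o_def)
  \<comment> \<open>The choice in \<open>S_inf\<close> is meaningful only if a solution exists. The
    form u -> cov h' (u o S t) is bounded by contractivity; its representing sequence converges in
    L2 to an element that \<open>i_inf\<close> sends to the required vector.\<close>
  have S_inf: "S_inf S \<mu> t h' \<in> H_inf \<mu> \<and> i_inf \<mu> (S_inf S \<mu> t h') = S t (i_inf \<mu> h')"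
    if t: "t \<ge> 0" for t and h' :: "'e \<Rightarrow>\<^sub>L real"
  proof -
    define l where "l = (\<lambda>x'. cov h' (x' o\<^sub>L S t))"
    have l: "linear l"
      unfolding linear_iff l_def
    proof (intro conjI allI)
      fix x' y' :: "'e \<Rightarrow>\<^sub>L real" and c :: real
      have "(x' + y') o\<^sub>L S t = (x' o\<^sub>L S t) + (y' o\<^sub>L S t)" "(c *\<^sub>R x') o\<^sub>L S t = c *\<^sub>R (x' o\<^sub>L S t)"
        by (auto intro!: blinfun_eqI simp: blinfun.bilinear_simps)
      then show "cov h' ((x' + y') o\<^sub>L S t) = cov h' (x' o\<^sub>L S t) + cov h' (y' o\<^sub>L S t)"
        "cov h' ((c *\<^sub>R x') o\<^sub>L S t) = c *\<^sub>R cov h' (x' o\<^sub>L S t)"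
        by (simp_all add: cov_add_right cov_scaleR_right)
    qed
    have bd: "(l x')\<^sup>2 \<le> cov h' h' * cov x' x'" if "x' \<in> UNIV" for x'
    proof -
      have "\<bar>l x'\<bar> \<le> l2norm \<mu> (blinfun_apply h') * l2norm \<mu> (blinfun_apply (x' o\<^sub>L S t))"
        unfolding l_def by (rule cov_Cauchy_Schwarz)
      also have "\<dots> \<le> l2norm \<mu> (blinfun_apply h') * l2norm \<mu> (blinfun_apply x')"
        by (intro mult_left_mono comp t) simp
      finally have "\<bar>l x'\<bar>\<^sup>2 \<le> (l2norm \<mu> (blinfun_apply h') * l2norm \<mu> (blinfun_apply x'))\<^sup>2"
        by (intro power_mono) auto
      then show ?thesis by (simp add: cov_self power_mult_distrib)
    qed
    from riesz_sequence[OF cov_bilinear cov_sym cov_nonneg subspace_UNIV l bd]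
    obtain v where C: "\<And>e. e > 0 \<Longrightarrow> \<exists>N. \<forall>m\<ge>N. \<forall>n\<ge>N. cov (v m - v n) (v m - v n) < e"
      and lim: "\<And>u. (\<lambda>n :: nat. cov (v n) u) \<longlonglongrightarrow> l u" by blast
    have "\<exists>g\<in>L2 \<mu>. (\<lambda>n. l2norm \<mu> (\<lambda>x. v n x - g x)) \<longlonglongrightarrow> 0"
    proof (rule L2_complete)
      fix e :: real assume "e > 0"
      then obtain N where N: "\<forall>m\<ge>N. \<forall>n\<ge>N. cov (v m - v n) (v m - v n) < e\<^sup>2" using C[of "e\<^sup>2"] by auto
      have "l2norm \<mu> (\<lambda>x. v m x - v n x) < e" if "m \<ge> N" "n \<ge> N" for m n
      proof -
        have "(l2norm \<mu> (\<lambda>x. v m x - v n x))\<^sup>2 < e\<^sup>2"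
          using N that by (simp add: cov_self minus_blinfun.rep_eq)
        then show ?thesis using \<open>e > 0\<close> by (simp add: power2_less_imp_less)
      qed
      then show "\<exists>N. \<forall>m\<ge>N. \<forall>n\<ge>N. l2norm \<mu> (\<lambda>x. v m x - v n x) < e" by blast
    qed simp
    then obtain g where g: "g \<in> L2 \<mu>" "(\<lambda>n. l2norm \<mu> (\<lambda>x. v n x - g x)) \<longlonglongrightarrow> 0" by blast
    have gH: "g \<in> H_inf \<mu>" using g by (auto simp: H_inf_def)
    have "(\<integral>x. g x * u x \<partial>\<mu>) = l u" for u :: "'e \<Rightarrow>\<^sub>L real"
      using L2_tendsto_integral_mult[OF _ g(1) functional_L2 g(2), of u] lim[of u]
      by (intro LIMSEQ_unique[of "\<lambda>n. cov (v n) u"]) (simp_all add: cov_def)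
    then have "i_inf \<mu> g = S t (i_inf \<mu> h')"
      using functional_i_inf[OF g(1)] functional_i_inf[OF functional_L2, of "_ o\<^sub>L S t" h']
      by (intro eq_if_functionals_eq[of "i_inf \<mu> g"]) (simp add: l_def cov_def)
    with gH have "\<exists>g. g \<in> H_inf \<mu> \<and> i_inf \<mu> g = S t (i_inf \<mu> h')" by blast
    then show ?thesis unfolding S_inf_def by (rule someI_ex)
  qed
  have "l2norm \<mu> (blinfun_apply (x' o\<^sub>L S t)) \<le> K * exp (- \<omega> * t) * l2norm \<mu> (blinfun_apply x')"
    if t: "t \<ge> 0" for t and x' :: "'e \<Rightarrow>\<^sub>L real"
  proof -
    \<comment> \<open>With this h' the square of its norm is x' evaluated at S(t)
      \<open>i_inf\<close> h', that is, the inner product of \<open>S_inf\<close> h' with x'; one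
      factor of the norm of h' can then be divided out.\<close>
    define h' where "h' = x' o\<^sub>L S t"
    define g where "g = S_inf S \<mu> t h'"
    have g: "g \<in> H_inf \<mu>" "i_inf \<mu> g = S t (i_inf \<mu> h')" using S_inf[OF t, of h'] by (auto simp: g_def)
    have gL: "g \<in> L2 \<mu>" using g(1) by (simp add: H_inf_def)
    have "(l2norm \<mu> (blinfun_apply h'))\<^sup>2 = cov h' h'" by (simp add: cov_self)
    also have "\<dots> = h' (i_inf \<mu> h')" by (simp add: functional_i_inf cov_def)
    also have "\<dots> = x' (i_inf \<mu> g)" by (simp add: g(2) h'_def)
    also have "\<dots> = (\<integral>x. g x * x' x \<partial>\<mu>)" by (rule functional_i_inf[OF gL])
    also have "\<dots> \<le> l2norm \<mu> g * l2norm \<mu> (blinfun_apply x')"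
      using Cauchy_Schwarz_real[OF gL functional_L2, of x'] by simp
    also have "\<dots> \<le> (K * exp (- \<omega> * t) * l2norm \<mu> (blinfun_apply h')) * l2norm \<mu> (blinfun_apply x')"
      unfolding g_def by (intro mult_right_mono K t H) simp
    finally have "l2norm \<mu> (blinfun_apply h') * l2norm \<mu> (blinfun_apply h') \<le>
        (K * exp (- \<omega> * t) * l2norm \<mu> (blinfun_apply x')) * l2norm \<mu> (blinfun_apply h')"
      by (simp add: power2_eq_square mult_ac)
    moreover have "0 \<le> K * exp (- \<omega> * t) * l2norm \<mu> (blinfun_apply x')"
      using order_trans[OF l2norm_nonneg K[OF t H]] .
    ultimately have "l2norm \<mu> (blinfun_apply h') \<le> K * exp (- \<omega> * t) * l2norm \<mu> (blinfun_apply x')"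
      using l2norm_nonneg[of \<mu> "blinfun_apply h'"]
      by (cases "l2norm \<mu> (blinfun_apply h') = 0") (auto dest: mult_right_le_imp_le)
    then show ?thesis by (simp add: h'_def)
  qed
  with \<omega> show ?thesis by blast
qed

end

section \<open>Analytic semigroups on \<open>L\<^sup>2\<close>\<close>

lemma bounded_operator_L2D:
  assumes "bounded_operator_L2 M T"
  shows "f \<in> L2 M \<Longrightarrow> T f \<in> L2 M"
    and "f \<in> L2 M \<Longrightarrow> g \<in> L2 M \<Longrightarrow> AE x in M. T (\<lambda>x. a * f x + b * g x) x = a * T f x + b * T g x"
    and "\<exists>K. \<forall>f\<in>L2 M. l2norm M (T f) \<le> K * l2norm M f"
  using assms unfolding bounded_operator_L2_def by auto

text \<open>The gliding hump with the operator norm \<open>L n\<close> taken as a supremum over the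
  unit ball. Linearity of \<open>D n\<close> holds only almost everywhere and is therefore used
  through \<open>l2norm\<close>.\<close>

lemma L2_uniform_boundedness:
  fixes D :: "nat \<Rightarrow> ('a \<Rightarrow> complex) \<Rightarrow> 'a \<Rightarrow> complex"
  assumes M: "prob_space M" and D: "\<And>n. bounded_operator_L2 M (D n)"
    and large: "\<And>n. \<exists>f\<in>L2 M. l2norm M (D n f) > 4 ^ n * l2norm M f"
  shows "\<exists>f\<in>L2 M. filterlim (\<lambda>n. l2norm M (D n f)) at_top sequentially"
proof -
  interpret prob_space M by fact
  note DL = bounded_operator_L2D(1)[OF D]
  have lin: "l2norm M (D n (\<lambda>x. a * f x + b * g x)) = l2norm M (\<lambda>x. a * D n f x + b * D n g x)"
    if "f \<in> L2 M" "g \<in> L2 M" for n a b f g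
    using bounded_operator_L2D(2)[OF D[of n] that] that
    by (intro l2norm_cong_AE L2_borel DL L2_add L2_mult)
  have scale: "l2norm M (D n (\<lambda>x. a * f x)) = norm a * l2norm M (D n f)" if "f \<in> L2 M" for n a f
    using lin[OF that that, of n a 0] by (simp add: l2norm_mult)
  have minus: "l2norm M (D n (\<lambda>x. f x - g x)) = l2norm M (\<lambda>x. D n f x - D n g x)" if "f \<in> L2 M" "g \<in> L2 M" for n f g
    using lin[OF that, of n 1 "- 1"] by simp
  define B :: "('a \<Rightarrow> complex) set" where "B = {f \<in> L2 M. l2norm M f \<le> 1}"
  define L where "L = (\<lambda>n. SUP f\<in>B. l2norm M (D n f))"
  have zero: "(\<lambda>x. 0 :: complex) \<in> L2 M" by (simp add: L2_iff)
  have bdd: "bdd_above ((\<lambda>f. l2norm M (D n f)) ` B)" for n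
  proof -
    obtain K where K: "\<And>f. f \<in> L2 M \<Longrightarrow> l2norm M (D n f) \<le> K * l2norm M f"
      using bounded_operator_L2D(3)[OF D] by blast
    have "l2norm M (D n f) \<le> \<bar>K\<bar>" if "f \<in> B" for f
    proof -
      have "l2norm M (D n f) \<le> \<bar>K\<bar> * l2norm M f"
        using K[of f] that mult_right_mono[OF abs_ge_self[of K] l2norm_nonneg[of M f]] by (auto simp: B_def)
      also have "\<dots> \<le> \<bar>K\<bar> * 1" using that by (intro mult_left_mono) (auto simp: B_def)
      finally show ?thesis by simp
    qed
    then show ?thesis by (rule bdd_aboveI2)
  qed
  have L_upper: "l2norm M (D n f) \<le> L n" if "f \<in> B" for n f
    unfolding L_def by (rule cSUP_upper[OF that bdd])
  have L_bound: "l2norm M (D n f) \<le> L n * l2norm M f" if f: "f \<in> L2 M" for n f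
  proof (cases "l2norm M f = 0")
    case True
    obtain K where "l2norm M (D n f) \<le> K * l2norm M f" using bounded_operator_L2D(3)[OF D] f by blast
    then show ?thesis using True by simp
  next
    case False
    then have pos: "l2norm M f > 0" using l2norm_nonneg[of M f] by linarith
    define a where "a = complex_of_real (inverse (l2norm M f))"
    have na: "norm a = inverse (l2norm M f)" using pos by (simp only: a_def norm_of_real) simp
    have "(\<lambda>x. a * f x) \<in> B" using f pos by (auto simp: B_def L2_mult l2norm_mult na)
    from L_upper[OF this, of n] show ?thesis
      using pos by (simp add: scale[OF f] na field_simps)
  qed
  have L_large: "4 ^ n \<le> L n" for n
  proof -
    obtain f where f: "f \<in> L2 M" "l2norm M (D n f) > 4 ^ n * l2norm M f" using large by blast
    have "l2norm M f \<noteq> 0" using f(2) L_bound[OF f(1), of n] by auto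
    then have pos: "l2norm M f > 0" using l2norm_nonneg[of M f] by linarith
    have "4 ^ n * l2norm M f < L n * l2norm M f" using f(2) L_bound[OF f(1), of n] by linarith
    then show ?thesis using pos by simp
  qed
  have L_pos: "L n > 0" for n using L_large[of n] by (rule less_le_trans[rotated]) simp
  show ?thesis
  proof (rule gliding_hump[where d = "\<lambda>f g. l2norm M (\<lambda>x. f x - g x)" and L = L])
    show "L2 M \<noteq> ({} :: ('a \<Rightarrow> complex) set)" using zero by blast
    show "l2norm M (\<lambda>x. f x - h x) \<le> l2norm M (\<lambda>x. f x - g x) + l2norm M (\<lambda>x. g x - h x)"
      if "f \<in> L2 M" "g \<in> L2 M" "h \<in> L2 M" for f g h :: "'a \<Rightarrow> complex" using that by (rule l2norm_triangle3)
    show "l2norm M (\<lambda>x. f x - g x) = l2norm M (\<lambda>x. g x - f x)" for f g :: "'a \<Rightarrow> complex"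
      by (rule l2norm_minus_commute)
    show "\<exists>g\<in>L2 M. (\<lambda>n. l2norm M (\<lambda>x. f n x - g x)) \<longlonglongrightarrow> 0"
      if "\<And>n. f n \<in> L2 M" "\<And>e. e > 0 \<Longrightarrow> \<exists>N. \<forall>m\<ge>N. \<forall>n\<ge>N. l2norm M (\<lambda>x. f m x - f n x) < e"
      for f :: "nat \<Rightarrow> 'a \<Rightarrow> complex" using that by (rule L2_complete)
    show "l2norm M (D n f) \<le> l2norm M (D n g) + L n * l2norm M (\<lambda>x. f x - g x)"
      if "f \<in> L2 M" "g \<in> L2 M" for n f g
      using l2norm_le_add[OF DL DL, of f g n n] L_bound[OF L2_diff[OF that], of n] minus[OF that, of n] that by simp
    show "\<exists>g\<in>L2 M. l2norm M (\<lambda>x. f x - g x) \<le> r \<and> 3 / 4 * r * L n \<le> l2norm M (D n g)"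
      if f: "f \<in> L2 M" and r: "r > 0" for n f r
    proof -
      have "\<exists>h\<in>B. 3 / 4 * L n < l2norm M (D n h)"
      proof -
        have "B \<noteq> {}" using zero by (auto simp: B_def)
        moreover have "(SUP h\<in>B. l2norm M (D n h)) = L n" by (simp only: L_def)
        then have "3 / 4 * L n < (SUP h\<in>B. l2norm M (D n h))" using L_pos[of n] by simp
        ultimately show ?thesis using less_cSUP_iff[OF _ bdd] by blast
      qed
      then obtain h where h: "h \<in> B" "3 / 4 * L n < l2norm M (D n h)" by blast
      define u where "u = (\<lambda>x. complex_of_real r * h x)"
      have u: "u \<in> L2 M" using h(1) by (auto simp: u_def B_def L2_mult)
      have un: "l2norm M u \<le> r" using h(1) r unfolding u_def l2norm_mult by (simp add: B_def mult_left_le)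
      have uD: "3 / 4 * r * L n \<le> l2norm M (D n u)"
        using h r scale[of h n "complex_of_real r"] by (simp add: u_def B_def)
      have "2 * l2norm M (D n u) \<le> l2norm M (D n (\<lambda>x. f x + u x)) + l2norm M (D n (\<lambda>x. f x - u x))"
      proof -
        have "2 * l2norm M (D n u) = l2norm M (D n (\<lambda>x. (f x + u x) - (f x - u x)))"
          using scale[OF u, of n 2] by simp
        also have "\<dots> = l2norm M (\<lambda>x. D n (\<lambda>x. f x + u x) x - D n (\<lambda>x. f x - u x) x)"
          by (rule minus[OF L2_add[OF f u] L2_diff[OF f u]])
        also have "\<dots> \<le> l2norm M (D n (\<lambda>x. f x + u x)) + l2norm M (D n (\<lambda>x. f x - u x))"
          by (intro l2norm_triangle_diff DL L2_add L2_diff f u)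
        finally show ?thesis .
      qed
      then consider "l2norm M (D n u) \<le> l2norm M (D n (\<lambda>x. f x + u x))" | "l2norm M (D n u) \<le> l2norm M (D n (\<lambda>x. f x - u x))"
        by linarith
      then show ?thesis
      proof cases
        case 1
        then show ?thesis using uD un L2_add[OF f u] by (intro bexI[of _ "\<lambda>x. f x + u x"]) auto
      next
        case 2
        then show ?thesis using uD un L2_diff[OF f u] by (intro bexI[of _ "\<lambda>x. f x - u x"]) auto
      qed
    qed
  qed (use L_large in auto)
qed

lemma L2_cnj:
  assumes "f \<in> L2 M" shows "(\<lambda>x. cnj (f x)) \<in> L2 M"
proof -
  have "cnj \<in> borel_measurable borel" by (intro borel_measurable_continuous_onI continuous_intros)
  from measurable_compose[OF L2_borel[OF assms] this] show ?thesis
    using L2_integrable[OF assms] by (simp add: L2_iff)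
qed

text \<open>The argument is continuous at 1, which gives a disc around 1; sectors are invariant
  under positive dilations. Radii proportional to t will produce the factor 1/t in Cauchy's
  estimate.\<close>

lemma sector_contains_cballs:
  assumes "\<theta> > 0"
  shows "\<exists>\<kappa>>0. \<kappa> < 1 \<and> (\<forall>t>0. cball (complex_of_real t) (\<kappa> * t) \<subseteq> sector \<theta>)"
proof -
  have "continuous (at 1) Arg" by (rule continuous_at_Arg) (simp add: complex_nonpos_Reals_iff)
  then have "(Arg \<longlongrightarrow> 0) (at 1)" by (simp add: isCont_def)
  then obtain d where d: "d > 0" "\<And>z. z \<noteq> 1 \<Longrightarrow> dist z 1 < d \<Longrightarrow> \<bar>Arg z\<bar> < \<theta>"
    using assms unfolding Lim_at by (auto simp: dist_real_def)
  define \<kappa> where "\<kappa> = min (1/2) (d/2)"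
  have \<kappa>: "\<kappa> > 0" "\<kappa> < 1" "\<kappa> < d" using d by (auto simp: \<kappa>_def)
  have "z \<in> sector \<theta>" if t: "t > 0" and z: "z \<in> cball (complex_of_real t) (\<kappa> * t)" for t z
  proof -
    define u where "u = z / complex_of_real t"
    have z': "z = complex_of_real t * u" using t by (simp add: u_def)
    have "u - 1 = (z - complex_of_real t) / complex_of_real t" using t by (simp add: u_def field_simps)
    then have "dist u 1 = norm (z - complex_of_real t) / t" using t by (simp add: dist_norm norm_divide)
    also have "\<dots> \<le> \<kappa>" using z t by (simp add: dist_norm norm_minus_commute field_simps)
    finally have u: "dist u 1 \<le> \<kappa>" .
    have "\<bar>Arg u\<bar> < \<theta>" using d(2)[of u] u \<kappa> assms by (cases "u = 1") auto
    moreover have "u \<noteq> 0" using u \<kappa> by (auto simp: dist_norm)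
    ultimately show ?thesis using t by (simp add: sector_def z' Arg_times_of_real)
  qed
  then show ?thesis using \<kappa> by blast
qed

text \<open>The bound depends on the orbit, which the uniform boundedness principle remedies.\<close>

lemma analytic_orbit_bound:
  assumes M: "prob_space M" and T: "analytic_C0_semigroup_L2 M T" and f: "f \<in> L2 M"
  shows "\<exists>C \<delta>. \<delta> > 0 \<and> (\<forall>t s. 0 < s \<longrightarrow> s \<le> t \<longrightarrow> t \<le> \<delta> \<longrightarrow>
    l2norm M (\<lambda>x. T (t + s) f x - T t f x) \<le> C * (s / t))"
proof -
  interpret prob_space M by fact
  obtain \<theta> V where \<theta>: "\<theta> \<in> {0<..pi/2}"
    and V': "\<forall>z\<in>sector \<theta>. bounded_operator_L2 M (V z)"
      "\<forall>t>0. \<forall>f\<in>L2 M. AE x in M. V (of_real t) f x = T t f x"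
      "\<forall>f\<in>L2 M. \<forall>z\<in>sector \<theta>. \<exists>g\<in>L2 M.
         ((\<lambda>w. l2norm M (\<lambda>x. (V w f x - V z f x) / (w - z) - g x)) \<longlongrightarrow> 0) (at z)"
      "\<forall>f\<in>L2 M. \<forall>\<theta>'\<in>{0<..<\<theta>}. ((\<lambda>z. l2norm M (\<lambda>x. V z f x - f x)) \<longlongrightarrow> 0) (at 0 within sector \<theta>')"
    using T unfolding analytic_C0_semigroup_L2_def by (elim conjE bexE exE) (rule that, assumption+)
  note V = V'(1)[rule_format] and VT = V'(2)[rule_format] and Vd = V'(3)[rule_format] and V0 = V'(4)[rule_format]
  have T': "T t f \<in> L2 M" if "t \<ge> 0" for t
    using T that f unfolding analytic_C0_semigroup_L2_def C0_semigroup_L2_def by (auto intro: bounded_operator_L2D(1))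
  define \<theta>' where "\<theta>' = \<theta> / 2"
  have \<theta>': "\<theta>' \<in> {0<..<\<theta>}" using \<theta> by (auto simp: \<theta>'_def)
  obtain \<kappa> where \<kappa>: "\<kappa> > 0" "\<kappa> < 1" "\<And>t. t > 0 \<Longrightarrow> cball (complex_of_real t) (\<kappa> * t) \<subseteq> sector \<theta>'"
    using sector_contains_cballs[of \<theta>'] \<theta>' by auto
  have sub: "sector \<theta>' \<subseteq> sector \<theta>" using \<theta>' by (auto simp: sector_def)
  have "\<forall>\<^sub>F z in at 0 within sector \<theta>'. l2norm M (\<lambda>x. V z f x - f x) < 1"
    using order_tendstoD(2)[OF V0[OF f \<theta>']] by simp
  then obtain \<rho> where \<rho>: "\<rho> > 0" "\<And>z. z \<in> sector \<theta>' \<Longrightarrow> z \<noteq> 0 \<Longrightarrow> dist z 0 < \<rho> \<Longrightarrow> l2norm M (\<lambda>x. V z f x - f x) < 1"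
    unfolding eventually_at by auto
  have Vf: "V z f \<in> L2 M" if "z \<in> sector \<theta>'" for z
    using that sub V f by (auto intro: bounded_operator_L2D(1))
  define B where "B = l2norm M f + 1"
  have VB: "l2norm M (V z f) \<le> B" if "z \<in> sector \<theta>'" "norm z < \<rho>" for z
    using \<rho>(2)[OF that(1)] that l2norm_le_add[OF Vf[OF that(1)] f] by (auto simp: sector_def B_def dist_norm)
  \<comment> \<open>For r <= t + s <= 2 delta, discs of radius at most r/2 around r stay within
    modulus 3 delta, below rho.\<close>
  define \<delta> where "\<delta> = \<rho> / 5"
  have main: "l2norm M (\<lambda>x. T (t + s) f x - T t f x) \<le> (2 * B / \<kappa>) * (s / t)"
    if s: "0 < s" "s \<le> t" and t: "t \<le> \<delta>" for s t
  proof -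
    define d where "d = (\<lambda>x. T (t + s) f x - T t f x)"
    have d: "d \<in> L2 M" unfolding d_def using s by (intro L2_diff T') auto
    define dc where "dc = (\<lambda>x. cnj (d x))"
    have dc: "dc \<in> L2 M" unfolding dc_def by (rule L2_cnj[OF d])
    have dcn: "l2norm M dc = l2norm M d" by (simp add: l2norm_def dc_def)
    \<comment> \<open>The orbit is paired with the conjugate of the difference \<open>d\<close>
      itself. This gives a scalar holomorphic function whose increment from t to t + s is the
      squared norm of \<open>d\<close>.\<close>
    define \<phi> where "\<phi> = (\<lambda>z. \<integral>x. V z f x * dc x \<partial>M)"
    have diff: "\<phi> field_differentiable at z" if r: "r > 0" and z: "z \<in> ball (complex_of_real r) (\<kappa> * r)" for r z
    proof -
      have zs: "z \<in> sector \<theta>'" using z \<kappa>(3)[OF r] by auto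
      obtain g where g: "g \<in> L2 M" "((\<lambda>w. l2norm M (\<lambda>x. (V w f x - V z f x) / (w - z) - g x)) \<longlongrightarrow> 0) (at z)"
        using Vd[OF f subsetD[OF sub zs]] by blast
      have "((\<lambda>w. (\<phi> w - \<phi> z) / (w - z)) \<longlongrightarrow> (\<integral>x. g x * dc x \<partial>M)) (at z)"
      proof (rule LIM_zero_cancel, rule Lim_null_comparison)
        show "((\<lambda>w. l2norm M (\<lambda>x. (V w f x - V z f x) / (w - z) - g x) * l2norm M dc) \<longlongrightarrow> 0) (at z)"
          using tendsto_mult_right[OF g(2), of "l2norm M dc"] by simp
        have "\<forall>\<^sub>F w in at z. w \<in> ball (complex_of_real r) (\<kappa> * r)"
          using z by (intro eventually_at_in_open') auto
        then show "\<forall>\<^sub>F w in at z. norm ((\<phi> w - \<phi> z) / (w - z) - (\<integral>x. g x * dc x \<partial>M)) \<le>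
            l2norm M (\<lambda>x. (V w f x - V z f x) / (w - z) - g x) * l2norm M dc"
        proof eventually_elim
          case (elim w)
          then have ws: "w \<in> sector \<theta>'" using \<kappa>(3)[OF r] by auto
          define q where "q = (\<lambda>x. inverse (w - z) * (V w f x - V z f x) - g x)"
          have q: "q \<in> L2 M" unfolding q_def by (intro L2_diff L2_mult Vf ws zs g(1))
          have "(\<phi> w - \<phi> z) / (w - z) - (\<integral>x. g x * dc x \<partial>M) = (\<integral>x. q x * dc x \<partial>M)"
          proof -
            have "(\<integral>x. q x * dc x \<partial>M) = (\<integral>x. inverse (w - z) * (V w f x * dc x - V z f x * dc x) - g x * dc x \<partial>M)"
              by (simp add: q_def algebra_simps)
            also have "\<dots> = inverse (w - z) * (\<phi> w - \<phi> z) - (\<integral>x. g x * dc x \<partial>M)"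
              unfolding \<phi>_def using L2_mult_integrable[OF Vf[OF ws] dc] L2_mult_integrable[OF Vf[OF zs] dc] L2_mult_integrable[OF g(1) dc]
              by simp
            finally show ?thesis by (simp add: divide_inverse mult.commute)
          qed
          moreover have "q = (\<lambda>x. (V w f x - V z f x) / (w - z) - g x)"
            by (simp add: q_def fun_eq_iff divide_inverse mult.commute)
          ultimately show ?case using Cauchy_Schwarz_L2[OF q dc] by (simp only:)
        qed
      qed
      then have "(\<phi> has_field_derivative (\<integral>x. g x * dc x \<partial>M)) (at z)" by (simp only: has_field_derivative_iff)
      then show ?thesis by (auto simp: field_differentiable_def)
    qed
    have deriv: "norm (deriv \<phi> (complex_of_real r)) \<le> 2 * B * l2norm M d / (\<kappa> * t)" if r: "t \<le> r" "r \<le> t + s" for r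
    proof -
      have r0: "r > 0" using s r by linarith
      have hol: "\<phi> holomorphic_on ball (complex_of_real r) (\<kappa> * r)"
        by (rule holomorphic_onI, rule field_differentiable_at_within, rule diff[OF r0])
      have half: "\<kappa> * r / 2 < \<kappa> * r" "0 < \<kappa> * r / 2" using \<kappa> r0 by auto
      \<comment> \<open>Cauchy's estimate on a circle of radius proportional to r bounds the
        derivative by a multiple of 1/r, and r >= t; over an interval of length s this becomes
        s/t.\<close>
      have "norm ((deriv ^^ 1) \<phi> (complex_of_real r)) \<le> fact 1 * (B * l2norm M d) / (\<kappa> * r / 2) ^ 1"
      proof (rule Cauchy_inequality)
        show "\<phi> holomorphic_on ball (complex_of_real r) (\<kappa> * r / 2)"
          using half by (intro holomorphic_on_subset[OF hol]) auto
        show "continuous_on (cball (complex_of_real r) (\<kappa> * r / 2)) \<phi>"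
          using half by (intro holomorphic_on_imp_continuous_on holomorphic_on_subset[OF hol]) auto
        fix z assume z: "norm (complex_of_real r - z) = \<kappa> * r / 2"
        then have "z \<in> cball (complex_of_real r) (\<kappa> * r)" using half by (simp add: dist_norm)
        then have zs: "z \<in> sector \<theta>'" using \<kappa>(3)[OF r0] by auto
        have "norm z \<le> norm (complex_of_real r) + norm (complex_of_real r - z)"
          using norm_triangle_ineq4[of "complex_of_real r" "complex_of_real r - z"] by simp
        also have "\<dots> = r + \<kappa> * r / 2" using z r0 by simp
        also have "\<dots> \<le> r + r / 2" using \<kappa> r0 by simp
        also have "\<dots> < \<rho>" using r s t \<rho>(1) by (simp add: \<delta>_def)
        finally have "norm z < \<rho>" .
        have "norm (\<phi> z) \<le> l2norm M (V z f) * l2norm M dc"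
          unfolding \<phi>_def by (rule Cauchy_Schwarz_L2[OF Vf[OF zs] dc])
        also have "\<dots> \<le> B * l2norm M d"
          unfolding dcn by (intro mult_right_mono VB zs \<open>norm z < \<rho>\<close>) simp
        finally show "norm (\<phi> z) \<le> B * l2norm M d" .
      qed (use half in simp)
      then have "norm (deriv \<phi> (complex_of_real r)) \<le> 2 * B * l2norm M d / (\<kappa> * r)" by (simp add: field_simps)
      also have "\<dots> \<le> 2 * B * l2norm M d / (\<kappa> * t)"
        using \<kappa> s r r0 l2norm_nonneg[of M f] by (intro divide_left_mono mult_left_mono mult_nonneg_nonneg mult_pos_pos) (auto simp: B_def)
      finally show ?thesis .
    qed
    have "norm (\<phi> (complex_of_real (t + s)) - \<phi> (complex_of_real t)) \<le>
        2 * B * l2norm M d / (\<kappa> * t) * norm (complex_of_real (t + s) - complex_of_real t)"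
    proof (rule field_differentiable_bound[where f' = "deriv \<phi>" and S = "complex_of_real ` {t..t + s}"])
      have "complex_of_real ` {t..t + s} = closed_segment (complex_of_real t) (complex_of_real (t + s))"
        using s by (simp add: closed_segment_of_real closed_segment_eq_real_ivl flip: of_real_add)
      then show "convex (complex_of_real ` {t..t + s})" by simp
      fix z assume "z \<in> complex_of_real ` {t..t + s}"
      then obtain r where r: "z = complex_of_real r" "t \<le> r" "r \<le> t + s" by auto
      then have r0: "r > 0" using s by linarith
      have "\<phi> field_differentiable at z" using r0 \<kappa> r(1) by (intro diff[OF r0]) auto
      then show "(\<phi> has_field_derivative deriv \<phi> z) (at z within complex_of_real ` {t..t + s})"
        by (simp add: field_differentiable_derivI has_field_derivative_at_within)
      show "norm (deriv \<phi> z) \<le> 2 * B * l2norm M d / (\<kappa> * t)" using deriv r by simp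
    next
      show "complex_of_real (t + s) \<in> complex_of_real ` {t..t + s}" "complex_of_real t \<in> complex_of_real ` {t..t + s}"
        using s by (intro imageI; simp)+
    qed
    moreover have "\<phi> (complex_of_real (t + s)) - \<phi> (complex_of_real t) = complex_of_real ((l2norm M d)\<^sup>2)"
    proof -
      have pos: "t > 0" "t + s > 0" using s by auto
      have \<phi>T: "\<phi> (complex_of_real r) = (\<integral>x. T r f x * dc x \<partial>M)" if r: "r > 0" for r
        unfolding \<phi>_def
      proof (rule integral_cong_AE)
        have "complex_of_real r \<in> sector \<theta>'" using \<kappa>(3)[OF r] \<kappa>(1) r by auto
        then show "(\<lambda>x. V (complex_of_real r) f x * dc x) \<in> borel_measurable M"
          by (intro borel_measurable_times L2_borel[OF Vf] L2_borel[OF dc])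
        show "(\<lambda>x. T r f x * dc x) \<in> borel_measurable M"
          using r by (intro borel_measurable_times L2_borel[OF T'] L2_borel[OF dc]) simp
        show "AE x in M. V (complex_of_real r) f x * dc x = T r f x * dc x"
          using VT[OF r f] by eventually_elim simp
      qed
      have "\<phi> (complex_of_real (t + s)) - \<phi> (complex_of_real t) = (\<integral>x. d x * dc x \<partial>M)"
        using L2_mult_integrable[OF T' dc, of "t + s"] L2_mult_integrable[OF T' dc, of t] pos
        by (simp add: \<phi>T d_def left_diff_distrib del: of_real_add)
      also have "\<dots> = (\<integral>x. complex_of_real ((norm (d x))\<^sup>2) \<partial>M)"
        by (simp only: dc_def complex_norm_square)
      finally show ?thesis by (simp only: integral_complex_of_real l2norm_power2)
    qed
    ultimately have "(l2norm M d)\<^sup>2 \<le> 2 * B * l2norm M d / (\<kappa> * t) * s"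
      using s by (simp add: norm_power del: of_real_power)
    then have "l2norm M d * l2norm M d \<le> (2 * B / \<kappa> * (s / t)) * l2norm M d"
      by (simp add: power2_eq_square field_simps)
    moreover have "0 \<le> 2 * B / \<kappa> * (s / t)" using s \<kappa> by (simp add: B_def)
    ultimately have "l2norm M d \<le> 2 * B / \<kappa> * (s / t)"
      using l2norm_nonneg[of M d] mult_right_le_imp_le[of "l2norm M d" "l2norm M d" "2 * B / \<kappa> * (s / t)"]
      by (cases "l2norm M d = 0") (simp_all only: less_le, simp_all)
    then show ?thesis by (simp add: d_def)
  qed
  then show ?thesis using \<rho>(1) by (intro exI[of _ "2 * B / \<kappa>"] exI[of _ \<delta>]) (auto simp: \<delta>_def)
qed


text \<open>Without a uniform constant, violations with constant 4^n at times t_n -> 0 would make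
  suitable scaled differences diverge along a single orbit, against
  \<open>analytic_orbit_bound\<close>.\<close>

lemma analytic_difference_bound:
  assumes M: "prob_space M" and T: "analytic_C0_semigroup_L2 M T"
  shows "\<exists>C \<delta>. \<delta> > 0 \<and> (\<forall>t s. \<forall>f\<in>L2 M. 0 < s \<longrightarrow> s \<le> t \<longrightarrow> t \<le> \<delta> \<longrightarrow>
    l2norm M (\<lambda>x. T (t + s) f x - T t f x) \<le> C * (s / t) * l2norm M f)"
proof (rule ccontr)
  assume neg: "\<not> ?thesis"
  have Tb: "bounded_operator_L2 M (T t)" if "t \<ge> 0" for t
    using T that unfolding analytic_C0_semigroup_L2_def C0_semigroup_L2_def by blast
  have "\<exists>t s f. f \<in> L2 M \<and> 0 < s \<and> s \<le> t \<and> t \<le> inverse (real (Suc n)) \<and>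
      l2norm M (\<lambda>x. T (t + s) f x - T t f x) > 4 ^ n * (s / t) * l2norm M f" for n
  proof -
    have "\<not> (\<forall>t s. \<forall>f\<in>L2 M. 0 < s \<longrightarrow> s \<le> t \<longrightarrow> t \<le> inverse (real (Suc n)) \<longrightarrow>
        l2norm M (\<lambda>x. T (t + s) f x - T t f x) \<le> 4 ^ n * (s / t) * l2norm M f)"
    proof
      assume "\<forall>t s. \<forall>f\<in>L2 M. 0 < s \<longrightarrow> s \<le> t \<longrightarrow> t \<le> inverse (real (Suc n)) \<longrightarrow>
        l2norm M (\<lambda>x. T (t + s) f x - T t f x) \<le> 4 ^ n * (s / t) * l2norm M f"
      moreover have "inverse (real (Suc n)) > 0" by simp
      ultimately show False using neg by blast
    qed
    then show ?thesis by (simp only: not_all not_imp not_le bex_simps ball_simps Bex_def Ball_def)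
  qed
  then have "\<forall>n. \<exists>p. snd (snd p) \<in> L2 M \<and> 0 < fst (snd p) \<and> fst (snd p) \<le> fst p \<and> fst p \<le> inverse (real (Suc n)) \<and>
      l2norm M (\<lambda>x. T (fst p + fst (snd p)) (snd (snd p)) x - T (fst p) (snd (snd p)) x) >
        4 ^ n * (fst (snd p) / fst p) * l2norm M (snd (snd p))"
    by (simp only: split_paired_Ex fst_conv snd_conv simp_thms)
  from choice[OF this] obtain p where p: "\<And>n. snd (snd (p n)) \<in> L2 M \<and> 0 < fst (snd (p n)) \<and> fst (snd (p n)) \<le> fst (p n) \<and>
      fst (p n) \<le> inverse (real (Suc n)) \<and>
      l2norm M (\<lambda>x. T (fst (p n) + fst (snd (p n))) (snd (snd (p n))) x - T (fst (p n)) (snd (snd (p n))) x) >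
        4 ^ n * (fst (snd (p n)) / fst (p n)) * l2norm M (snd (snd (p n)))" by blast
  define t s f where "t = (\<lambda>n. fst (p n))" and "s = (\<lambda>n. fst (snd (p n)))" and "f = (\<lambda>n. snd (snd (p n)))"
  have f: "f n \<in> L2 M" and s: "0 < s n" "s n \<le> t n" and t: "t n \<le> inverse (real (Suc n))"
    and big: "l2norm M (\<lambda>x. T (t n + s n) (f n) x - T (t n) (f n) x) > 4 ^ n * (s n / t n) * l2norm M (f n)" for n
    using p[of n] by (auto simp: t_def s_def f_def)
  have t0: "t n > 0" for n using s[of n] by linarith
  define c where "c = (\<lambda>n. complex_of_real (t n / s n))"
  have cn: "norm (c n) = t n / s n" for n using t0[of n] s(1)[of n] by (simp add: c_def norm_divide)
  \<comment> \<open>The weight t/s is the reciprocal of the expected bound, so the orbitwise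
    estimate bounds \<open>D n\<close> on every single function for large n.\<close>
  define D where "D = (\<lambda>n f x. c n * (T (t n + s n) f x - T (t n) f x))"
  have Db: "bounded_operator_L2 M (D n)" for n
  proof -
    note b1 = Tb[of "t n + s n"] and b2 = Tb[of "t n"]
    have nn: "t n + s n \<ge> 0" "t n \<ge> 0" using t0[of n] s(1)[of n] by auto
    note b = b1[OF nn(1)] b2[OF nn(2)]
    obtain K1 K2 where K: "\<And>f. f \<in> L2 M \<Longrightarrow> l2norm M (T (t n + s n) f) \<le> K1 * l2norm M f"
      "\<And>f. f \<in> L2 M \<Longrightarrow> l2norm M (T (t n) f) \<le> K2 * l2norm M f"
      using bounded_operator_L2D(3)[OF b(1)] bounded_operator_L2D(3)[OF b(2)] by blast
    show ?thesis
      unfolding bounded_operator_L2_def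
    proof (intro conjI ballI allI impI)
      fix g :: "'a \<Rightarrow> complex" assume g: "g \<in> L2 M"
      show "D n g \<in> L2 M"
        unfolding D_def by (intro L2_mult L2_diff bounded_operator_L2D(1)[OF b(1)] bounded_operator_L2D(1)[OF b(2)] g)
      fix h :: "'a \<Rightarrow> complex" assume h: "h \<in> L2 M"
      show "AE x in M. D n g x = D n h x" if "AE x in M. g x = h x"
      proof -
        have "AE x in M. T (t n + s n) g x = T (t n + s n) h x" "AE x in M. T (t n) g x = T (t n) h x"
          using b g h that unfolding bounded_operator_L2_def by blast+
        then show ?thesis by eventually_elim (simp add: D_def)
      qed
      fix a b' :: complex
      show "AE x in M. D n (\<lambda>x. a * g x + b' * h x) x = a * D n g x + b' * D n h x"
        using bounded_operator_L2D(2)[OF b(1) g h, of a b'] bounded_operator_L2D(2)[OF b(2) g h, of a b']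
        by eventually_elim (simp add: D_def algebra_simps)
    next
      show "\<exists>K. \<forall>f\<in>L2 M. l2norm M (D n f) \<le> K * l2norm M f"
      proof (intro exI[of _ "norm (c n) * (K1 + K2)"] ballI)
        fix g :: "'a \<Rightarrow> complex" assume g: "g \<in> L2 M"
        have "l2norm M (D n g) = norm (c n) * l2norm M (\<lambda>x. T (t n + s n) g x - T (t n) g x)"
          unfolding D_def by (rule l2norm_mult)
        also have "\<dots> \<le> norm (c n) * (K1 * l2norm M g + K2 * l2norm M g)"
          using K[OF g] l2norm_triangle_diff[OF bounded_operator_L2D(1)[OF b(1) g] bounded_operator_L2D(1)[OF b(2) g]]
          by (intro mult_left_mono) auto
        finally show "l2norm M (D n g) \<le> norm (c n) * (K1 + K2) * l2norm M g" by (simp add: algebra_simps)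
      qed
    qed
  qed
  have "\<exists>g\<in>L2 M. filterlim (\<lambda>n. l2norm M (D n g)) at_top sequentially"
  proof (rule L2_uniform_boundedness[OF M Db])
    fix n
    have "l2norm M (D n (f n)) = t n / s n * l2norm M (\<lambda>x. T (t n + s n) (f n) x - T (t n) (f n) x)"
      unfolding D_def cn[symmetric] by (rule l2norm_mult)
    also have "\<dots> > t n / s n * (4 ^ n * (s n / t n) * l2norm M (f n))"
      using t0[of n] s(1)[of n] by (intro mult_strict_left_mono big) auto
    finally show "\<exists>f\<in>L2 M. l2norm M (D n f) > 4 ^ n * l2norm M f"
      using f[of n] t0[of n] s(1)[of n] by (intro bexI[of _ "f n"]) auto
  qed
  then obtain g where g: "g \<in> L2 M" "filterlim (\<lambda>n. l2norm M (D n g)) at_top sequentially" by blast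
  obtain C \<delta> where \<delta>: "\<delta> > 0" and C: "\<And>t s. 0 < s \<Longrightarrow> s \<le> t \<Longrightarrow> t \<le> \<delta> \<Longrightarrow>
      l2norm M (\<lambda>x. T (t + s) g x - T t g x) \<le> C * (s / t)"
    using analytic_orbit_bound[OF M T g(1)] by blast
  have le: "l2norm M (D n g) \<le> C" if "t n \<le> \<delta>" for n
  proof -
    have "l2norm M (D n g) = t n / s n * l2norm M (\<lambda>x. T (t n + s n) g x - T (t n) g x)"
      unfolding D_def cn[symmetric] by (rule l2norm_mult)
    also have "\<dots> \<le> t n / s n * (C * (s n / t n))"
      using t0[of n] s(1)[of n] by (intro mult_left_mono C s that) auto
    finally show ?thesis using t0[of n] s(1)[of n] by simp
  qed
  have "\<forall>\<^sub>F n in sequentially. inverse (real (Suc n)) < \<delta>"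
    using order_tendstoD(2)[OF LIMSEQ_inverse_real_of_nat \<delta>] .
  moreover have "\<forall>\<^sub>F n in sequentially. l2norm M (D n g) > C"
    using g(2) by (simp add: filterlim_at_top_dense)
  ultimately have "\<forall>\<^sub>F n in sequentially. False"
  proof eventually_elim
    case (elim n)
    then show ?case using le[of n] t[of n] by linarith
  qed
  then show False by simp
qed

section \<open>Sectoriality of the generator on the reproducing kernel space\<close>

context gaussian_radon
begin

lemma tendsto_cov:
  assumes u: "((\<lambda>t. l2norm \<mu> (blinfun_apply (u t - u0))) \<longlongrightarrow> 0) F"
    and v: "((\<lambda>t. l2norm \<mu> (blinfun_apply (v t - v0))) \<longlongrightarrow> 0) F"
  shows "((\<lambda>t. cov (u t) (v t)) \<longlongrightarrow> cov u0 v0) F"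
proof -
  have bound: "norm (cov (u t) (v t) - cov u0 v0) \<le>
      l2norm \<mu> (blinfun_apply (u t - u0)) * l2norm \<mu> (blinfun_apply (v t - v0)) +
      l2norm \<mu> (blinfun_apply (u t - u0)) * l2norm \<mu> (blinfun_apply v0) +
      l2norm \<mu> (blinfun_apply u0) * l2norm \<mu> (blinfun_apply (v t - v0))" for t
  proof -
    have "cov (u t) (v t) - cov u0 v0 = cov (u t - u0) (v t - v0) + cov (u t - u0) v0 + cov u0 (v t - v0)"
      by (simp add: cov_diff_left cov_diff_right)
    then show ?thesis
      using cov_Cauchy_Schwarz[of "u t - u0" "v t - v0"] cov_Cauchy_Schwarz[of "u t - u0" v0]
        cov_Cauchy_Schwarz[of u0 "v t - v0"] by simp
  qed
  have "((\<lambda>t. l2norm \<mu> (blinfun_apply (u t - u0)) * l2norm \<mu> (blinfun_apply (v t - v0)) +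
      l2norm \<mu> (blinfun_apply (u t - u0)) * l2norm \<mu> (blinfun_apply v0) +
      l2norm \<mu> (blinfun_apply u0) * l2norm \<mu> (blinfun_apply (v t - v0))) \<longlongrightarrow>
      0 * 0 + 0 * l2norm \<mu> (blinfun_apply v0) + l2norm \<mu> (blinfun_apply u0) * 0) F"
    by (intro tendsto_intros u v)
  then have "((\<lambda>t. cov (u t) (v t) - cov u0 v0) \<longlongrightarrow> 0) F"
    by (intro Lim_null_comparison[OF always_eventually[OF allI[OF bound]]]) simp
  then show ?thesis by (simp add: LIM_zero_iff)
qed

lemma functional_tendsto_at_right:
  fixes u :: "real \<Rightarrow> 'e \<Rightarrow>\<^sub>L real"
  assumes bound: "\<And>t x. 0 < t \<Longrightarrow> t < 1 \<Longrightarrow> \<bar>u t x\<bar> \<le> C * norm x"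
    and lim: "\<And>x. ((\<lambda>t. u t x) \<longlongrightarrow> blinfun_apply u0 x) (at_right 0)"
  shows "((\<lambda>t. l2norm \<mu> (blinfun_apply (u t - u0))) \<longlongrightarrow> 0) (at_right 0)"
proof (rule tendsto_at_right_sequentially[of 0 1])
  fix s :: "nat \<Rightarrow> real"
  assume s: "\<And>n. 0 < s n" "\<And>n. s n < 1" "s \<longlonglongrightarrow> 0"
  have "filterlim s (at_right 0) sequentially"
    using s by (auto simp: filterlim_at less_imp_neq[symmetric])
  then have "(\<lambda>n. u (s n) x) \<longlonglongrightarrow> u0 x" for x by (rule filterlim_compose[OF lim])
  then have "(\<lambda>n. l2norm \<mu> (\<lambda>x. u (s n) x - blinfun_apply u0 x)) \<longlonglongrightarrow> 0"
    by (intro functional_dominated_convergence[where C = C]) (use bound s in auto)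
  then show "(\<lambda>n. l2norm \<mu> (blinfun_apply (u (s n) - u0))) \<longlonglongrightarrow> 0"
    by (simp add: minus_blinfun.rep_eq)
qed simp

end

context ornstein_uhlenbeck
begin

text \<open>The Lipschitz bound makes the difference quotients uniformly bounded functionals, so the
  pointwise derivative upgrades to a limit in L2.\<close>

lemma adjoint_difference_quotient:
  assumes g: "adjoint_generator x' a'"
  shows "((\<lambda>s. l2norm \<mu> (blinfun_apply ((1 / s) *\<^sub>R ((x' o\<^sub>L S s) - x') - a'))) \<longlongrightarrow> 0) (at_right 0)"
proof -
  obtain C where C: "C \<ge> 0" "\<And>t x. t \<in> {0..1} \<Longrightarrow> \<bar>x' (S t x) - x' x\<bar> \<le> t * C * norm x"
    using adjoint_generator_le[OF g] by blast
  show ?thesis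
  proof (rule functional_tendsto_at_right[where C = C])
    show "\<bar>((1 / t) *\<^sub>R ((x' o\<^sub>L S t) - x')) x\<bar> \<le> C * norm x" if "0 < t" "t < 1" for t x
      using C(2)[of t x] that by (simp add: blinfun.bilinear_simps abs_mult field_simps)
    show "((\<lambda>t. ((1 / t) *\<^sub>R ((x' o\<^sub>L S t) - x')) x) \<longlongrightarrow> a' x) (at_right 0)" for x
      using adjoint_generator_derivative[OF g, of x] by (simp add: blinfun.bilinear_simps diff_divide_distrib)
  qed
qed

lemma adjoint_strongly_continuous:
  fixes z' :: "'e \<Rightarrow>\<^sub>L real"
  shows "((\<lambda>t. l2norm \<mu> (blinfun_apply ((z' o\<^sub>L S t) - z'))) \<longlongrightarrow> 0) (at_right 0)"
proof -
  obtain M where M: "M > 0" "\<And>t. t \<in> {0..1} \<Longrightarrow> norm (S t) \<le> M" using S_bounded by blast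
  show ?thesis
  proof (rule functional_tendsto_at_right[where C = "norm z' * M"])
    fix t :: real and x :: 'e assume t: "0 < t" "t < 1"
    have "\<bar>(z' o\<^sub>L S t) x\<bar> \<le> norm z' * norm (S t x)" using norm_blinfun[of z' "S t x"] by simp
    also have "\<dots> \<le> norm z' * (norm (S t) * norm x)" by (intro mult_left_mono norm_blinfun) simp
    also have "\<dots> \<le> norm z' * (M * norm x)" using M t by (intro mult_left_mono mult_right_mono) auto
    finally show "\<bar>(z' o\<^sub>L S t) x\<bar> \<le> norm z' * M * norm x" by (simp add: mult.assoc)
  next
    show "((\<lambda>t. (z' o\<^sub>L S t) x) \<longlongrightarrow> z' x) (at_right 0)" for x
      using blinfun.tendsto[OF tendsto_const[of z'] S_lim[of x]] by simp
  qed
qed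

text \<open>The Lyapunov equation: the derivative of \<open>qt\<close> at 0 is computed once from
  its integral form and once from the factorisation of a difference of squares.\<close>

lemma generator_quadratic:
  assumes g: "adjoint_generator x' a'"
  shows "(norm (adj i x'))\<^sup>2 = - 2 * cov a' x'"
proof -
  have "((\<lambda>t. - cov ((1 / t) *\<^sub>R ((x' o\<^sub>L S t) - x')) ((x' o\<^sub>L S t) + x')) \<longlongrightarrow> - cov a' (x' + x')) (at_right 0)"
  proof (intro tendsto_minus tendsto_cov adjoint_difference_quotient[OF g])
    show "((\<lambda>t. l2norm \<mu> (blinfun_apply ((x' o\<^sub>L S t) + x' - (x' + x')))) \<longlongrightarrow> 0) (at_right 0)"
      using adjoint_strongly_continuous[of x'] by simp
  qed
  moreover have "- cov ((1 / t) *\<^sub>R ((x' o\<^sub>L S t) - x')) ((x' o\<^sub>L S t) + x') = qt t x' x' / t" for t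
    by (simp add: qt_def cov_add_right cov_diff_left cov_scaleR_left cov_sym[of x' "x' o\<^sub>L S t"] field_simps)
      (simp add: diff_divide_distrib)
  ultimately have "((\<lambda>t. qt t x' x' / t) \<longlongrightarrow> - cov a' (x' + x')) (at_right 0)" by simp
  from tendsto_unique[OF _ qt_derivative[OF g] this] show ?thesis by (simp add: cov_add_right)
qed

text \<open>Polarisation. The symmetric part of the generator form is thereby controlled by i^*
  alone, so analyticity only has to supply the skew part.\<close>

lemma generator_symmetric:
  assumes x': "adjoint_generator x' a'" and y': "adjoint_generator y' b'"
  shows "cov a' y' + cov b' x' = - inner (adj i x') (adj i y')"
  using generator_quadratic[OF adjoint_generator_add[OF x' y']] generator_quadratic[OF x'] generator_quadratic[OF y']
  by (simp add: adj_add cov_add_left cov_add_right power2_norm_eq_inner inner_add_left inner_add_right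
      inner_commute[of "adj i y'" "adj i x'"])

text \<open>The difference on the left is the imaginary part of the Hermitian form of the generator
  at w = x' + i y'. It is bounded by differentiating the action on the coherent state of w at a time
  t, rescaling w, and letting t -> 0.\<close>

lemma generator_skew_bound:
  assumes T: "analytic_C0_semigroup_L2 \<mu> (\<lambda>t. complexification (OU_L2 P S Y \<mu> t))"
  shows "\<exists>K\<ge>0. \<forall>x' a' y' b'. adjoint_generator x' a' \<longrightarrow> adjoint_generator y' b' \<longrightarrow>
    \<bar>cov b' x' - cov a' y'\<bar> \<le> K * ((norm (adj i x'))\<^sup>2 + (norm (adj i y'))\<^sup>2)"
proof -
  obtain C \<delta> where \<delta>: "\<delta> > 0" and C: "\<And>t s f. f \<in> L2 \<mu> \<Longrightarrow> 0 < s \<Longrightarrow> s \<le> t \<Longrightarrow> t \<le> \<delta> \<Longrightarrow>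
      l2norm \<mu> (\<lambda>x. complexification (OU_L2 P S Y \<mu> (t + s)) f x - complexification (OU_L2 P S Y \<mu> t) f x) \<le>
        C * (s / t) * l2norm \<mu> f"
    using analytic_difference_bound[OF prob_space_axioms T] by metis
  have CT: "complexification (OU_L2 P S Y \<mu> r) f \<in> L2 \<mu>" if "r \<ge> 0" "f \<in> L2 \<mu>" for r f
    using T that unfolding analytic_C0_semigroup_L2_def C0_semigroup_L2_def by (auto intro: bounded_operator_L2D(1))
  have derivative_bound: "norm (cov_complex (orbit t (a', b')) (orbit t (x', y'))) \<le>
      C / t * exp ((qt t x' x' + qt t y' y') / 2)"
    if x': "adjoint_generator x' a'" and y': "adjoint_generator y' b'" and t: "0 < t" "t \<le> \<delta>" for x' a' y' b' t
  proof -
    define w where "w = (x', y')"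
    \<comment> \<open>Testing against the coherent state at time t makes \<open>F 0\<close> real,
      and exp (\<open>F 0\<close>) is the square of that state's norm. It cancels from both sides,
      leaving only exp ((|w|^2 - |v|^2) / 2).\<close>
    define v where "v = orbit t w"
    define N where "N = l2norm \<mu> (coherent w) * l2norm \<mu> (coherent v)"
    have op: "AE x in \<mu>. complexification (OU_L2 P S Y \<mu> r) (coherent w) x = coherent (orbit r w) x" if r: "r \<ge> 0" for r
    proof -
      have "transition_op r (coherent w) x = coherent (orbit r w) x" for x
        using x' y' r by (intro transition_op_coherent[of w a' b']) (simp_all add: w_def)
      with complexification_OU_L2_eq[OF coherent_L2[of w] r] show ?thesis by simp
    qed
    define F where "F = (\<lambda>s. cov_complex (orbit (t + s) w) v)"
    have diff: "norm (exp (F s) - exp (F 0)) \<le> C * (s / t) * N" if s: "0 < s" "s \<le> t" for s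
    proof -
      let ?d = "\<lambda>x. coherent (orbit (t + s) w) x - coherent (orbit t w) x"
      have dL: "?d \<in> L2 \<mu>" by (intro L2_diff coherent_L2)
      have "AE x in \<mu>. complexification (OU_L2 P S Y \<mu> (t + s)) (coherent w) x - complexification (OU_L2 P S Y \<mu> t) (coherent w) x = ?d x"
        using op[of "t + s"] op[of t] s by (auto elim: eventually_elim2)
      then have "l2norm \<mu> ?d = l2norm \<mu> (\<lambda>x. complexification (OU_L2 P S Y \<mu> (t + s)) (coherent w) x - complexification (OU_L2 P S Y \<mu> t) (coherent w) x)"
        using s by (intro l2norm_cong_AE L2_borel dL L2_diff CT coherent_L2) (auto elim!: eventually_mono)
      also have "\<dots> \<le> C * (s / t) * l2norm \<mu> (coherent w)" by (rule C[OF coherent_L2 s t(2)])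
      finally have dn: "l2norm \<mu> ?d \<le> C * (s / t) * l2norm \<mu> (coherent w)" .
      have cL: "(\<lambda>x. cnj (coherent v x)) \<in> L2 \<mu>" by (rule L2_cnj[OF coherent_L2])
      have "exp (F s) - exp (F 0) = (\<integral>x. ?d x * cnj (coherent v x) \<partial>\<mu>)"
        using L2_mult_integrable[OF coherent_L2[of "orbit (t + s) w"] cL] L2_mult_integrable[OF coherent_L2[of "orbit t w"] cL]
        by (simp add: F_def coherent_inner[symmetric] left_diff_distrib)
      also have "norm \<dots> \<le> l2norm \<mu> ?d * l2norm \<mu> (\<lambda>x. cnj (coherent v x))" by (rule Cauchy_Schwarz_L2[OF dL cL])
      also have "l2norm \<mu> (\<lambda>x. cnj (coherent v x)) = l2norm \<mu> (coherent v)" by (simp add: l2norm_def)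
      also have "l2norm \<mu> ?d * l2norm \<mu> (coherent v) \<le> C * (s / t) * l2norm \<mu> (coherent w) * l2norm \<mu> (coherent v)"
        by (intro mult_right_mono dn) simp
      finally show ?thesis by (simp add: N_def mult.assoc)
    qed
    define k where "k = cov_complex (orbit t (a', b')) v"
    have quot: "((\<lambda>s. cov ((z' o\<^sub>L S (t + s)) - (z' o\<^sub>L S t)) u' / s) \<longlongrightarrow> cov (c' o\<^sub>L S t) u') (at_right 0)"
      if z': "adjoint_generator z' c'" for z' c' u'
    proof -
      have "((\<lambda>s. cov ((1 / s) *\<^sub>R (((z' o\<^sub>L S t) o\<^sub>L S s) - (z' o\<^sub>L S t))) u') \<longlongrightarrow> cov (c' o\<^sub>L S t) u') (at_right 0)"
        using t by (intro tendsto_cov adjoint_difference_quotient adjoint_generator_shift z') (auto simp: zero_blinfun.rep_eq)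
      then show ?thesis
      proof (rule Lim_transform_eventually)
        show "\<forall>\<^sub>F s in at_right 0. cov ((1 / s) *\<^sub>R (((z' o\<^sub>L S t) o\<^sub>L S s) - (z' o\<^sub>L S t))) u' =
            cov ((z' o\<^sub>L S (t + s)) - (z' o\<^sub>L S t)) u' / s"
          using t by (auto simp: eventually_at_filter compose_S_add cov_scaleR_left)
      qed
    qed
    have Fk: "((\<lambda>s. (F s - F 0) / s) \<longlongrightarrow> k) (at_right 0)"
    proof -
      have "(F s - F 0) / s = Complex
          (cov ((x' o\<^sub>L S (t + s)) - (x' o\<^sub>L S t)) (fst v) / s + cov ((y' o\<^sub>L S (t + s)) - (y' o\<^sub>L S t)) (snd v) / s)
          (cov ((y' o\<^sub>L S (t + s)) - (y' o\<^sub>L S t)) (fst v) / s - cov ((x' o\<^sub>L S (t + s)) - (x' o\<^sub>L S t)) (snd v) / s)" for s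
        by (simp add: complex_eq_iff F_def cov_complex_def orbit_def w_def cov_diff_left add_divide_distrib diff_divide_distrib)
      then show ?thesis
        unfolding k_def cov_complex_def orbit_def fst_conv snd_conv
        by (simp only:) (intro tendsto_Complex tendsto_add tendsto_diff quot x' y')
    qed
    have F0: "(F \<longlongrightarrow> F 0) (at_right 0)"
    proof -
      have "((\<lambda>s. complex_of_real s * ((F s - F 0) / s)) \<longlongrightarrow> complex_of_real 0 * k) (at_right 0)"
        by (intro tendsto_mult Fk tendsto_of_real tendsto_ident_at)
      moreover have "\<forall>\<^sub>F s in at_right 0. complex_of_real s * ((F s - F 0) / s) = F s - F 0"
        by (simp add: eventually_at_filter)
      ultimately have "((\<lambda>s. F s - F 0) \<longlongrightarrow> complex_of_real 0 * k) (at_right 0)"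
        by (rule Lim_transform_eventually)
      then have "((\<lambda>s. F s - F 0) \<longlongrightarrow> 0) (at_right 0)" by simp
      then show ?thesis by (simp add: LIM_zero_iff)
    qed
    \<comment> \<open>Caratheodory's form of the derivative of exp avoids a case distinction where F
      s = F 0.\<close>
    obtain g where g: "\<And>z. exp z - exp (F 0) = g z * (z - F 0)" "isCont g (F 0)" "g (F 0) = exp (F 0)"
      using DERIV_exp[of "F 0"] unfolding CARAT_DERIV by blast
    have "((\<lambda>s. g (F s) * ((F s - F 0) / s)) \<longlongrightarrow> g (F 0) * k) (at_right 0)"
      by (intro tendsto_mult Fk isCont_tendsto_compose[OF g(2) F0])
    then have "((\<lambda>s. (exp (F s) - exp (F 0)) / s) \<longlongrightarrow> exp (F 0) * k) (at_right 0)"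
      by (simp add: g)
    then have "((\<lambda>s. norm ((exp (F s) - exp (F 0)) / s)) \<longlongrightarrow> norm (exp (F 0) * k)) (at_right 0)"
      by (rule tendsto_norm)
    moreover have "\<forall>\<^sub>F s in at_right 0. norm ((exp (F s) - exp (F 0)) / s) \<le> C / t * N"
    proof -
      have "norm ((exp (F s) - exp (F 0)) / s) \<le> C / t * N" if s: "0 < s" "s < t" for s
        using diff[of s] s t by (simp add: norm_divide field_simps)
      then show ?thesis using t(1) unfolding eventually_at_right_field by blast
    qed
    ultimately have upper: "norm (exp (F 0) * k) \<le> C / t * N"
      by (intro tendsto_upperbound) auto
    define W' where "W' = cov x' x' + cov y' y'"
    define V' where "V' = cov (x' o\<^sub>L S t) (x' o\<^sub>L S t) + cov (y' o\<^sub>L S t) (y' o\<^sub>L S t)"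
    have "F 0 = complex_of_real V'"
      by (simp add: F_def cov_complex_def v_def w_def orbit_def V'_def complex_eq_iff cov_sym)
    then have "norm (exp (F 0) * k) = exp V' * norm k" by (simp add: norm_mult)
    moreover have "N = exp V' * exp ((W' - V') / 2)"
      unfolding N_def coherent_l2norm exp_add[symmetric]
      by (rule arg_cong[where f = exp]) (simp add: v_def w_def orbit_def V'_def W'_def field_simps)
    ultimately have "exp V' * norm k \<le> exp V' * (C / t * exp ((W' - V') / 2))" using upper by (simp add: mult_ac)
    then have "norm k \<le> C / t * exp ((W' - V') / 2)" by (simp only: mult_le_cancel_left_pos exp_gt_zero)
    then show ?thesis by (simp add: k_def v_def w_def W'_def V'_def qt_def algebra_simps)
  qed
  define K where "K = \<bar>C\<bar> * exp 1 / 2"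
  have scaled: "norm (cov_complex (orbit t (a', b')) (orbit t (x', y'))) \<le> K * ((qt t x' x' + qt t y' y') / t + e)"
    if x': "adjoint_generator x' a'" and y': "adjoint_generator y' b'" and t: "0 < t" "t \<le> \<delta>" and e: "e > 0" for x' a' y' b' t e
  proof -
    define q where "q = qt t x' x' + qt t y' y'"
    have q0: "q \<ge> 0" unfolding q_def using qt_nonneg[OF x'] qt_nonneg[OF y'] t by (intro add_nonneg_nonneg) auto
    \<comment> \<open>The summand t e keeps the scaling factor finite when \<open>q\<close>
      vanishes; after division by t it becomes the error \<open>e\<close>, removed at the
      end.\<close>
    define \<kappa> where "\<kappa> = q + t * e"
    have \<kappa>: "\<kappa> > 0" "q \<le> \<kappa>" using q0 t e by (auto simp: \<kappa>_def add_nonneg_pos)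
    \<comment> \<open>This scaling brings the exponent r^2 q / 2 to at most 1, so the exponential is
      at most exp 1; dividing by r^2 = 2/kappa turns the bound C/t into one of order kappa/t, whose
      limit is governed by i^*.\<close>
    define r where "r = sqrt (2 / \<kappa>)"
    have r: "r * r = 2 / \<kappa>" using \<kappa> by (simp add: r_def)
    let ?k = "cov_complex (orbit t (a', b')) (orbit t (x', y'))"
    have comp: "(c *\<^sub>R z') o\<^sub>L S t = c *\<^sub>R (z' o\<^sub>L S t)" for c and z' :: "'e \<Rightarrow>\<^sub>L real"
      by (rule blinfun_eqI) (simp add: blinfun.scaleR_left)
    have "cov_complex (orbit t (r *\<^sub>R a', r *\<^sub>R b')) (orbit t (r *\<^sub>R x', r *\<^sub>R y')) = complex_of_real (r * r) * ?k"
      by (simp add: complex_eq_iff cov_complex_def orbit_def comp cov_scaleR_left cov_scaleR_right algebra_simps)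
    moreover have "qt t (r *\<^sub>R x') (r *\<^sub>R x') + qt t (r *\<^sub>R y') (r *\<^sub>R y') = (r * r) * q"
      by (simp add: qt_scaleR q_def algebra_simps)
    ultimately have "r * r * norm ?k \<le> C / t * exp (r * r * q / 2)"
      using derivative_bound[OF adjoint_generator_scaleR[OF x', of r] adjoint_generator_scaleR[OF y', of r] t]
      by (simp add: norm_mult)
    also have "\<dots> \<le> \<bar>C\<bar> / t * exp 1"
    proof (rule mult_mono)
      show "C / t \<le> \<bar>C\<bar> / t" using t by (simp add: divide_right_mono)
      show "exp (r * r * q / 2) \<le> exp 1" using \<kappa> by (simp add: r)
    qed (use t in auto)
    finally have "2 / \<kappa> * norm ?k \<le> \<bar>C\<bar> / t * exp 1" by (simp only: r)
    then have "norm ?k \<le> K * (\<kappa> / t)" using \<kappa> t by (simp add: K_def field_simps)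
    also have "\<kappa> / t = q / t + e" using t by (simp add: \<kappa>_def field_simps)
    finally show ?thesis by (simp add: q_def)
  qed
  have "\<bar>cov b' x' - cov a' y'\<bar> \<le> K * ((norm (adj i x'))\<^sup>2 + (norm (adj i y'))\<^sup>2)"
    if x': "adjoint_generator x' a'" and y': "adjoint_generator y' b'" for x' a' y' b'
  proof -
    have le: "\<bar>cov b' x' - cov a' y'\<bar> \<le> K * (((norm (adj i x'))\<^sup>2 + (norm (adj i y'))\<^sup>2) + e)" if e: "e > 0" for e
    proof (rule tendsto_le[of "at_right 0"])
      show "((\<lambda>t. \<bar>cov (b' o\<^sub>L S t) (x' o\<^sub>L S t) - cov (a' o\<^sub>L S t) (y' o\<^sub>L S t)\<bar>) \<longlongrightarrow> \<bar>cov b' x' - cov a' y'\<bar>) (at_right 0)"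
        by (intro tendsto_rabs tendsto_diff tendsto_cov adjoint_strongly_continuous)
      show "((\<lambda>t. K * ((qt t x' x' / t + qt t y' y' / t) + e)) \<longlongrightarrow> K * (((norm (adj i x'))\<^sup>2 + (norm (adj i y'))\<^sup>2) + e)) (at_right 0)"
        by (intro tendsto_intros qt_derivative[OF x'] qt_derivative[OF y'])
      have "\<bar>cov (b' o\<^sub>L S t) (x' o\<^sub>L S t) - cov (a' o\<^sub>L S t) (y' o\<^sub>L S t)\<bar> \<le> K * ((qt t x' x' / t + qt t y' y' / t) + e)"
        if t: "0 < t" "t < \<delta>" for t
      proof -
        have "\<bar>cov (b' o\<^sub>L S t) (x' o\<^sub>L S t) - cov (a' o\<^sub>L S t) (y' o\<^sub>L S t)\<bar> = \<bar>Im (cov_complex (orbit t (a', b')) (orbit t (x', y')))\<bar>"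
          by (simp add: cov_complex_def orbit_def)
        also have "\<dots> \<le> norm (cov_complex (orbit t (a', b')) (orbit t (x', y')))" by (rule abs_Im_le_cmod)
        also have "\<dots> \<le> K * ((qt t x' x' + qt t y' y') / t + e)" using t by (intro scaled x' y' e) auto
        finally show ?thesis by (simp add: add_divide_distrib)
      qed
      then show "\<forall>\<^sub>F t in at_right 0. \<bar>cov (b' o\<^sub>L S t) (x' o\<^sub>L S t) - cov (a' o\<^sub>L S t) (y' o\<^sub>L S t)\<bar> \<le>
          K * ((qt t x' x' / t + qt t y' y' / t) + e)"
        using \<delta> unfolding eventually_at_right_field by blast
    qed simp
    show ?thesis
    proof (rule tendsto_lowerbound[of "\<lambda>e. K * (((norm (adj i x'))\<^sup>2 + (norm (adj i y'))\<^sup>2) + e)" _ "at_right 0"])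
      have "((\<lambda>e. K * (((norm (adj i x'))\<^sup>2 + (norm (adj i y'))\<^sup>2) + e)) \<longlongrightarrow> K * (((norm (adj i x'))\<^sup>2 + (norm (adj i y'))\<^sup>2) + 0)) (at_right 0)"
        by (intro tendsto_intros)
      then show "((\<lambda>e. K * (((norm (adj i x'))\<^sup>2 + (norm (adj i y'))\<^sup>2) + e)) \<longlongrightarrow> K * ((norm (adj i x'))\<^sup>2 + (norm (adj i y'))\<^sup>2)) (at_right 0)"
        by simp
      show "\<forall>\<^sub>F e in at_right 0. \<bar>cov b' x' - cov a' y'\<bar> \<le> K * (((norm (adj i x'))\<^sup>2 + (norm (adj i y'))\<^sup>2) + e)"
        unfolding eventually_at_right_field using le by (intro exI[of _ 1]) auto
    qed simp
  qed
  moreover have "K \<ge> 0" by (simp add: K_def)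
  ultimately show ?thesis by blast
qed

text \<open>Symmetric and skew parts add up to a bound by a sum of squares; replacing x', y' by l
  x', y'/l leaves the form unchanged, and the best l turns the sum into a product.\<close>

lemma generator_sectorial:
  assumes T: "analytic_C0_semigroup_L2 \<mu> (\<lambda>t. complexification (OU_L2 P S Y \<mu> t))"
  shows "\<exists>K\<ge>0. \<forall>x' a' y' b'. adjoint_generator x' a' \<longrightarrow> adjoint_generator y' b' \<longrightarrow>
    \<bar>cov a' y'\<bar> \<le> K * norm (adj i x') * norm (adj i y')"
proof -
  obtain K where K0: "K \<ge> 0" and K: "\<And>x' a' y' b'. adjoint_generator x' a' \<Longrightarrow> adjoint_generator y' b' \<Longrightarrow>
      \<bar>cov b' x' - cov a' y'\<bar> \<le> K * ((norm (adj i x'))\<^sup>2 + (norm (adj i y'))\<^sup>2)"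
    using generator_skew_bound[OF T] by blast
  have sum: "\<bar>cov a' y'\<bar> \<le> (K + 1) * ((norm (adj i x'))\<^sup>2 + (norm (adj i y'))\<^sup>2)"
    if x': "adjoint_generator x' a'" and y': "adjoint_generator y' b'" for x' a' y' b'
  proof -
    have "\<bar>inner (adj i x') (adj i y')\<bar> \<le> norm (adj i x') * norm (adj i y')" by (rule Cauchy_Schwarz_ineq2)
    also have "\<dots> \<le> (norm (adj i x'))\<^sup>2 + (norm (adj i y'))\<^sup>2"
      using sum_squares_bound[of "norm (adj i x')" "norm (adj i y')"]
        mult_nonneg_nonneg[OF norm_ge_zero[of "adj i x'"] norm_ge_zero[of "adj i y'"]] by linarith
    finally have "\<bar>cov a' y' + cov b' x'\<bar> \<le> (norm (adj i x'))\<^sup>2 + (norm (adj i y'))\<^sup>2"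
      using generator_symmetric[OF x' y'] by simp
    then have "2 * \<bar>cov a' y'\<bar> \<le> (K + 1) * ((norm (adj i x'))\<^sup>2 + (norm (adj i y'))\<^sup>2)"
      using K[OF x' y'] by (simp add: algebra_simps)
    moreover have "0 \<le> (K + 1) * ((norm (adj i x'))\<^sup>2 + (norm (adj i y'))\<^sup>2)" using K0 by simp
    ultimately show ?thesis by linarith
  qed
  have "\<bar>cov a' y'\<bar> \<le> 2 * (K + 1) * norm (adj i x') * norm (adj i y')"
    if x': "adjoint_generator x' a'" and y': "adjoint_generator y' b'" for x' a' y' b'
  proof -
    define p where "p = norm (adj i x')"
    define r where "r = norm (adj i y')"
    have pr: "p \<ge> 0" "r \<ge> 0" by (simp_all add: p_def r_def)
    have le: "\<bar>cov a' y'\<bar> \<le> (K + 1) * (2 * p * r + e * (p + r))" if e: "e > 0" for e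
    proof -
      \<comment> \<open>The balancing choice is l^2 = r/p; \<open>e\<close> keeps both terms
        positive when a norm vanishes.\<close>
      define l where "l = sqrt ((r + e) / (p + e))"
      have l2: "l\<^sup>2 = (r + e) / (p + e)" using pr e by (simp add: l_def)
      have l: "l > 0" using pr e by (simp add: l_def)
      have "cov (l *\<^sub>R a') (inverse l *\<^sub>R y') = cov a' y'" using l by (simp add: cov_scaleR_left cov_scaleR_right)
      then have "\<bar>cov a' y'\<bar> \<le> (K + 1) * ((norm (adj i (l *\<^sub>R x')))\<^sup>2 + (norm (adj i (inverse l *\<^sub>R y')))\<^sup>2)"
        using sum[OF adjoint_generator_scaleR[OF x', of l] adjoint_generator_scaleR[OF y', of "inverse l"]] by simp
      also have "(norm (adj i (l *\<^sub>R x')))\<^sup>2 = (r + e) * (p\<^sup>2 / (p + e))"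
        by (simp add: adj_scaleR power_mult_distrib l2 p_def)
      also have "(norm (adj i (inverse l *\<^sub>R y')))\<^sup>2 = (p + e) * (r\<^sup>2 / (r + e))"
        using l by (simp add: adj_scaleR power_mult_distrib power_inverse l2 r_def)
      also have "(K + 1) * ((r + e) * (p\<^sup>2 / (p + e)) + (p + e) * (r\<^sup>2 / (r + e))) \<le> (K + 1) * ((r + e) * p + (p + e) * r)"
      proof -
        have "x\<^sup>2 / (x + e) \<le> x" if "x \<ge> 0" for x
          using that e by (simp add: field_simps power2_eq_square)
        then show ?thesis using K0 pr e by (intro mult_left_mono add_mono) auto
      qed
      finally show ?thesis by (simp add: algebra_simps)
    qed
    have "\<bar>cov a' y'\<bar> \<le> (K + 1) * (2 * p * r)"
    proof (rule tendsto_lowerbound[of "\<lambda>e. (K + 1) * (2 * p * r + e * (p + r))" _ "at_right 0"])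
      have "((\<lambda>e. (K + 1) * (2 * p * r + e * (p + r))) \<longlongrightarrow> (K + 1) * (2 * p * r + 0 * (p + r))) (at_right 0)"
        by (intro tendsto_intros)
      then show "((\<lambda>e. (K + 1) * (2 * p * r + e * (p + r))) \<longlongrightarrow> (K + 1) * (2 * p * r)) (at_right 0)" by simp
      show "\<forall>\<^sub>F e in at_right 0. \<bar>cov a' y'\<bar> \<le> (K + 1) * (2 * p * r + e * (p + r))"
        unfolding eventually_at_right_field using le by (intro exI[of _ 1]) auto
    qed simp
    then show ?thesis by (simp add: p_def r_def algebra_simps)
  qed
  then show ?thesis using K0 by (intro exI[of _ "2 * (K + 1)"]) auto
qed

end

section \<open>The Poincare inequality for the gradient\<close>

lemma (in prob_space) variance_tendsto:
  fixes f :: "nat \<Rightarrow> 'a \<Rightarrow> real"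
  assumes f: "\<And>k. f k \<in> L2 M" and g: "g \<in> L2 M" and lim: "(\<lambda>k. l2norm M (\<lambda>x. f k x - g x)) \<longlonglongrightarrow> 0"
  shows "(\<lambda>k. \<integral>x. (f k x - (\<integral>y. f k y \<partial>M))\<^sup>2 \<partial>M) \<longlonglongrightarrow> (\<integral>x. (g x - (\<integral>y. g y \<partial>M))\<^sup>2 \<partial>M)"
proof -
  have var: "(\<integral>x. (u x - (\<integral>y. u y \<partial>M))\<^sup>2 \<partial>M) = (l2norm M u)\<^sup>2 - (\<integral>y. u y \<partial>M)\<^sup>2" if u: "u \<in> L2 M" for u :: "'a \<Rightarrow> real"
    using variance_eq[OF L2_imp_integrable[OF u]] L2_integrable[OF u] by (simp add: l2norm_power2)
  have "(\<lambda>_. 1 :: real) \<in> L2 M" by (simp add: L2_iff)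
  from L2_tendsto_integral_mult[OF f g this lim]
  have "(\<lambda>k. \<integral>y. f k y \<partial>M) \<longlonglongrightarrow> (\<integral>y. g y \<partial>M)" by simp
  with L2_tendsto_l2norm[OF f g lim] show ?thesis
    unfolding var[OF f] var[OF g] by (intro tendsto_intros)
qed

context ornstein_uhlenbeck
begin

lemma approximant_generator:
  fixes z' :: "'e \<Rightarrow>\<^sub>L real"
  shows "\<exists>a'. adjoint_generator (approximant n z') a'"
  unfolding approximant_def
  by (rule exI, rule adjoint_generator_scaleR, rule adjoint_generator_integrated) simp

lemma approximant_l2norm:
  fixes z' :: "'e \<Rightarrow>\<^sub>L real"
  shows "(\<lambda>n. l2norm \<mu> (blinfun_apply (approximant n z' - z'))) \<longlonglongrightarrow> 0"
proof -
  obtain C where C: "\<forall>n x. \<bar>approximant n z' x\<bar> \<le> C * norm x" using approximant_bounded by blast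
  have "(\<lambda>n. l2norm \<mu> (\<lambda>x. approximant n z' x - z' x)) \<longlonglongrightarrow> 0"
    by (rule functional_dominated_convergence[where C = C]) (use C approximant_tendsto in auto)
  then show ?thesis by (simp add: minus_blinfun.rep_eq)
qed

lemma approximant_weak:
  fixes z' :: "'e \<Rightarrow>\<^sub>L real"
  shows "(\<lambda>n. inner (adj i (approximant n z')) h) \<longlonglongrightarrow> inner (adj i z') h"
  unfolding inner_adj by (rule approximant_tendsto)

lemma adjoint_domain_subspace: "subspace {x'. \<exists>a'. adjoint_generator x' a'}"
  unfolding subspace_def
  using adjoint_generator_0 adjoint_generator_add adjoint_generator_scaleR by blast

text \<open>By the sector condition the form cov a factors through i^* on the domain of the adjoint
  generator, and the minimising sequence for it converges in H. The extension to arbitrary x' makes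
  the estimate applicable outside the domain.\<close>

lemma generator_representation:
  assumes K0: "K \<ge> 0"
    and K: "\<forall>x' a' y' b'. adjoint_generator x' a' \<longrightarrow> adjoint_generator y' b' \<longrightarrow>
      \<bar>cov a' y'\<bar> \<le> K * norm (adj i x') * norm (adj i y')"
    and g: "adjoint_generator g a"
  shows "\<exists>b. norm b \<le> K * norm (adj i g) \<and> (\<forall>x'. cov a x' = inner b (adj i x'))"
proof -
  define V where "V = {x'. \<exists>a'. adjoint_generator x' a'}"
  define B where "B = (\<lambda>x' y'. inner (adj i x') (adj i y'))"
  have B: "bilinear B"
    unfolding B_def bilinear_def linear_iff by (simp add: adj_add adj_scaleR inner_add_left inner_add_right)
  have l: "linear (cov a)" by (simp add: linear_iff cov_add_right cov_scaleR_right)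
  have bd: "(cov a u)\<^sup>2 \<le> (K * norm (adj i g))\<^sup>2 * B u u" if "u \<in> V" for u
  proof -
    have "\<bar>cov a u\<bar> \<le> K * norm (adj i g) * norm (adj i u)" using that K g by (auto simp: V_def)
    from power_mono[OF this abs_ge_zero, of 2] show ?thesis
      by (simp add: B_def power_mult_distrib power2_norm_eq_inner)
  qed
  have sym: "B x' y' = B y' x'" and pos: "B x' x' \<ge> 0" for x' y' by (simp_all add: B_def inner_commute)
  have "subspace V" unfolding V_def by (rule adjoint_domain_subspace)
  from riesz_sequence[OF B sym pos this l bd]
  obtain v where v: "\<And>n :: nat. v n \<in> V"
    and C: "\<And>e. e > 0 \<Longrightarrow> \<exists>N. \<forall>m\<ge>N. \<forall>n\<ge>N. B (v m - v n) (v m - v n) < e"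
    and lim: "\<And>u. u \<in> V \<Longrightarrow> (\<lambda>n. B (v n) u) \<longlonglongrightarrow> cov a u" by blast
  have "Cauchy (\<lambda>n. adj i (v n))"
  proof (rule CauchyI)
    fix e :: real assume e: "e > 0"
    then obtain N where N: "\<forall>m\<ge>N. \<forall>n\<ge>N. B (v m - v n) (v m - v n) < e\<^sup>2" using C[of "e\<^sup>2"] by auto
    have "norm (adj i (v m) - adj i (v n)) < e" if "m \<ge> N" "n \<ge> N" for m n
      using N that e by (auto simp: B_def norm_eq_sqrt_inner real_less_lsqrt adj_diff)
    then show "\<exists>M. \<forall>m\<ge>M. \<forall>n\<ge>M. norm (adj i (v m) - adj i (v n)) < e" by blast
  qed
  then obtain b where b: "(\<lambda>n. adj i (v n)) \<longlonglongrightarrow> b" by (auto simp: Cauchy_convergent_iff convergent_def)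
  have bV: "cov a u = inner b (adj i u)" if "u \<in> V" for u
    using LIMSEQ_unique[OF lim[OF that, unfolded B_def] tendsto_inner[OF b tendsto_const]] .
  \<comment> \<open>Since b is the limit of i^* v_n, testing the sector condition with v_n itself
    bounds its norm.\<close>
  have "inner b b \<le> K * norm (adj i g) * norm b"
  proof (rule tendsto_le[of sequentially])
    show "(\<lambda>n. inner b (adj i (v n))) \<longlonglongrightarrow> inner b b" by (intro tendsto_intros b)
    show "(\<lambda>n. K * norm (adj i g) * norm (adj i (v n))) \<longlonglongrightarrow> K * norm (adj i g) * norm b" by (intro tendsto_intros b)
    have "inner b (adj i (v n)) \<le> K * norm (adj i g) * norm (adj i (v n))" for n
    proof -
      obtain c where "adjoint_generator (v n) c" using v[of n] by (auto simp: V_def)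
      with K g have "\<bar>cov a (v n)\<bar> \<le> K * norm (adj i g) * norm (adj i (v n))" by blast
      then show ?thesis using bV[OF v[of n]] by linarith
    qed
    then show "\<forall>\<^sub>F n in sequentially. inner b (adj i (v n)) \<le> K * norm (adj i g) * norm (adj i (v n))" by simp
  qed simp
  then have "norm b * norm b \<le> (K * norm (adj i g)) * norm b" by (simp add: norm_eq_sqrt_inner)
  then have "norm b \<le> K * norm (adj i g)"
    using K0 by (cases "b = 0") auto
  \<comment> \<open>The left side converges along the approximants in L2; on the right, weak
    convergence of their images in H is enough.\<close>
  moreover have "cov a x' = inner b (adj i x')" for x'
  proof (rule LIMSEQ_unique)
    show "(\<lambda>n. cov a (approximant n x')) \<longlonglongrightarrow> cov a x'"
      by (rule tendsto_cov[OF _ approximant_l2norm]) (simp add: zero_blinfun.rep_eq)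
    have "(\<lambda>n. inner b (adj i (approximant n x'))) \<longlonglongrightarrow> inner b (adj i x')"
      using approximant_weak[of x' b] by (simp add: inner_commute)
    moreover have "cov a (approximant n x') = inner b (adj i (approximant n x'))" for n
      using approximant_generator[of n x'] by (intro bV) (simp add: V_def)
    ultimately show "(\<lambda>n. cov a (approximant n x')) \<longlonglongrightarrow> inner b (adj i x')" by simp
  qed
  ultimately show ?thesis by blast
qed

text \<open>The interval is cut into N(n+1) pieces of length 1/(n+1). Contractivity bounds each
  piece by the first one, so the total is at most N times the norm of the n-th approximant, which
  tends to the norm of z'.\<close>

lemma integrated_functional_l2norm_le:
  fixes z' :: "'e \<Rightarrow>\<^sub>L real"
  shows "l2norm \<mu> (blinfun_apply (integrated_functional (real N) z')) \<le> real N * l2norm \<mu> (blinfun_apply z')"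
proof -
  have mult: "l2norm \<mu> (blinfun_apply (integrated_functional (real k * h) z')) \<le> real k * l2norm \<mu> (blinfun_apply (integrated_functional h z'))"
    if h: "h \<ge> 0" for h k
  proof (induction k)
    case 0
    have "blinfun_apply (integrated_functional 0 z') = (\<lambda>_. 0)" by (rule ext) (simp add: integrated_functional_apply)
    then show ?case by simp
  next
    case (Suc k)
    let ?G = "integrated_functional (real k * h) z'"
    have "integrated_functional (real (Suc k) * h) z' = integrated_functional (h + real k * h) z'"
      by (simp add: algebra_simps)
    also have "\<dots> = integrated_functional h z' + (?G o\<^sub>L S h)" using h by (intro integrated_functional_add) auto
    finally have "blinfun_apply (integrated_functional (real (Suc k) * h) z') =
        (\<lambda>x. integrated_functional h z' x + (?G o\<^sub>L S h) x)"
      by (auto simp: blinfun.add_left)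
    then have "l2norm \<mu> (blinfun_apply (integrated_functional (real (Suc k) * h) z')) \<le>
        l2norm \<mu> (blinfun_apply (integrated_functional h z')) + l2norm \<mu> (blinfun_apply (?G o\<^sub>L S h))"
      using l2norm_triangle[OF functional_L2[of "integrated_functional h z'"] functional_L2[of "?G o\<^sub>L S h"]] by simp
    also have "l2norm \<mu> (blinfun_apply (?G o\<^sub>L S h)) \<le> l2norm \<mu> (blinfun_apply ?G)"
      using adjoint_semigroup_contraction[OF h, of ?G] by (simp add: blinfun_compose.rep_eq o_def)
    finally show ?case using Suc.IH by (simp add: algebra_simps)
  qed
  have "l2norm \<mu> (blinfun_apply (integrated_functional (real N) z')) \<le> real N * l2norm \<mu> (blinfun_apply (approximant n z'))" for n
  proof -
    define h where "h = inverse (real (Suc n))"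
    have h: "h > 0" "real (Suc n) * h = 1" by (simp_all add: h_def)
    have "real (N * Suc n) * h = real N * (real (Suc n) * h)" by (simp only: of_nat_mult mult.assoc)
    then have "real (N * Suc n) * h = real N" using h by simp
    with mult[of h "N * Suc n"] h
    have "l2norm \<mu> (blinfun_apply (integrated_functional (real N) z')) \<le>
        real (N * Suc n) * l2norm \<mu> (blinfun_apply (integrated_functional h z'))" by simp
    moreover have "blinfun_apply (approximant n z') = (\<lambda>x. real (Suc n) * integrated_functional h z' x)"
      by (rule ext) (simp only: approximant_def h_def blinfun.scaleR_left real_scaleR_def)
    then have "l2norm \<mu> (blinfun_apply (approximant n z')) = real (Suc n) * l2norm \<mu> (blinfun_apply (integrated_functional h z'))"
      using l2norm_mult[of \<mu> "real (Suc n)" "blinfun_apply (integrated_functional h z')"] by simp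
    ultimately show ?thesis by (simp only: of_nat_mult mult.assoc)
  qed
  moreover have "(\<lambda>n. real N * l2norm \<mu> (blinfun_apply (approximant n z'))) \<longlonglongrightarrow> real N * l2norm \<mu> (blinfun_apply z')"
    using approximant_l2norm[of z'] by (intro tendsto_intros L2_tendsto_l2norm) (simp_all add: minus_blinfun.rep_eq)
  ultimately show ?thesis by (intro LIMSEQ_le_const) auto
qed

text \<open>The sector condition needs both arguments in the domain, while x' is arbitrary;
  \<open>generator_representation\<close> for g bridges the gap.\<close>

lemma gradient_coercive:
  assumes T: "analytic_C0_semigroup_L2 \<mu> (\<lambda>t. complexification (OU_L2 P S Y \<mu> t))"
    and stable: "S_inf_exponentially_stable S \<mu>"
  shows "\<exists>C\<ge>0. \<forall>x'. cov x' x' \<le> C * (norm (adj i x'))\<^sup>2"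
proof -
  obtain K where K: "K \<ge> 0" "\<forall>x' a' y' b'. adjoint_generator x' a' \<longrightarrow> adjoint_generator y' b' \<longrightarrow>
      \<bar>cov a' y'\<bar> \<le> K * norm (adj i x') * norm (adj i y')"
    using generator_sectorial[OF T] by (elim exE conjE)
  obtain L \<omega> where \<omega>: "\<omega> > 0" and L: "\<And>t (x' :: 'e \<Rightarrow>\<^sub>L real). t \<ge> 0 \<Longrightarrow>
      l2norm \<mu> (blinfun_apply (x' o\<^sub>L S t)) \<le> L * exp (- \<omega> * t) * l2norm \<mu> (blinfun_apply x')"
    using adjoint_stable[OF stable] by blast
  have "(\<lambda>n. L * exp (- \<omega> * real n)) \<longlonglongrightarrow> 0" using \<omega> by real_asymp
  then have "\<forall>\<^sub>F n in sequentially. L * exp (- \<omega> * real n) < 1 / 2" by (rule order_tendstoD) simp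
  then obtain N where N: "L * exp (- \<omega> * real N) < 1 / 2" by (auto simp: eventually_sequentially)
  \<comment> \<open>With s the norm of x': the norm of i^* g is at most 2 sqrt N s, while s^2/2 <=
    |cov a x'| <= K (2 sqrt N s) times the norm of i^* x'.\<close>
  define C where "C = (4 * K * sqrt (real N))\<^sup>2"
  have "cov x' x' \<le> C * (norm (adj i x'))\<^sup>2" for x' :: "'e \<Rightarrow>\<^sub>L real"
  proof -
    define s where "s = l2norm \<mu> (blinfun_apply x')"
    define g where "g = integrated_functional (real N) x'"
    define a where "a = (x' o\<^sub>L S (real N)) - x'"
    have s0: "s \<ge> 0" by (simp add: s_def)
    have gen: "adjoint_generator g a" unfolding g_def a_def by (rule adjoint_generator_integrated) simp
    obtain b where b: "norm b \<le> K * norm (adj i g)" "\<And>y'. cov a y' = inner b (adj i y')"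
      using generator_representation[OF K gen] by blast
    have an: "l2norm \<mu> (blinfun_apply a) \<le> 2 * s"
    proof -
      have "blinfun_apply a = (\<lambda>x. (x' o\<^sub>L S (real N)) x - x' x)" by (simp only: a_def minus_blinfun.rep_eq)
      then have "l2norm \<mu> (blinfun_apply a) \<le> l2norm \<mu> (blinfun_apply (x' o\<^sub>L S (real N))) + s"
        using l2norm_triangle_diff[OF functional_L2[of "x' o\<^sub>L S (real N)"] functional_L2[of x']] by (simp add: s_def)
      then show ?thesis
        using adjoint_semigroup_contraction[of "real N" x'] by (simp add: s_def blinfun_compose.rep_eq o_def)
    qed
    have gn: "l2norm \<mu> (blinfun_apply g) \<le> real N * s" unfolding g_def s_def by (rule integrated_functional_l2norm_le)
    have "(norm (adj i g))\<^sup>2 \<le> 2 * \<bar>cov a g\<bar>" using generator_quadratic[OF gen] by linarith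
    also have "\<dots> \<le> 2 * (l2norm \<mu> (blinfun_apply a) * l2norm \<mu> (blinfun_apply g))" using cov_Cauchy_Schwarz[of a g] by simp
    also have "\<dots> \<le> 2 * ((2 * s) * (real N * s))" using an gn s0 by (intro mult_left_mono mult_mono) auto
    also have "\<dots> = (2 * sqrt (real N) * s)\<^sup>2" by (simp add: power_mult_distrib power2_eq_square)
    finally have ig: "norm (adj i g) \<le> 2 * sqrt (real N) * s" by (rule power2_le_imp_le) (use s0 in simp)
    have "l2norm \<mu> (blinfun_apply (x' o\<^sub>L S (real N))) \<le> 1 / 2 * s"
      using L[of "real N" x'] mult_right_mono[OF less_imp_le[OF N] s0] by (simp add: s_def)
    then have "l2norm \<mu> (blinfun_apply (x' o\<^sub>L S (real N))) * s \<le> (1 / 2 * s) * s" using s0 by (rule mult_right_mono)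
    then have 1: "\<bar>cov (x' o\<^sub>L S (real N)) x'\<bar> \<le> s * s / 2"
      using cov_Cauchy_Schwarz[of "x' o\<^sub>L S (real N)" x'] by (simp add: s_def)
    have "\<bar>cov a x'\<bar> \<le> norm b * norm (adj i x')" unfolding b(2) by (rule Cauchy_Schwarz_ineq2)
    also have "\<dots> \<le> (K * norm (adj i g)) * norm (adj i x')" by (intro mult_right_mono b) simp
    also have "\<dots> \<le> (K * (2 * sqrt (real N) * s)) * norm (adj i x')"
      using ig K by (intro mult_right_mono mult_left_mono) auto
    finally have 2: "\<bar>cov a x'\<bar> \<le> (K * (2 * sqrt (real N) * s)) * norm (adj i x')" .
    have "cov a x' = cov (x' o\<^sub>L S (real N)) x' - s * s"
      by (simp add: a_def cov_diff_left cov_self s_def power2_eq_square)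
    with 1 2 have "s * s \<le> (4 * K * sqrt (real N) * norm (adj i x')) * s" by (simp add: algebra_simps)
    then have "s \<le> 4 * K * sqrt (real N) * norm (adj i x')"
      using s0 K(1) by (cases "s = 0") auto
    from power_mono[OF this s0, of 2] show ?thesis
      by (simp add: cov_self s_def C_def power_mult_distrib)
  qed
  moreover have "C \<ge> 0" by (simp add: C_def)
  ultimately show ?thesis by blast
qed

text \<open>
  If \<open>x'\<^sub>n \<longrightarrow> 0\<close> and \<open>i\<^sup>*x'\<^sub>n \<longrightarrow> u\<close>, then \<open>u\<close> is orthogonal to every functional representing \<open>cov (A\<^sup>*g)\<close>;
  letting \<open>i\<^sup>*g \<longrightarrow> u\<close> in \<open>\<parallel>i\<^sup>*g\<parallel>\<^sup>2 = - 2 cov (A\<^sup>*g) g\<close> gives \<open>u = 0\<close>.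
\<close>

lemma gradient_closable:
  fixes x' :: "nat \<Rightarrow> 'e \<Rightarrow>\<^sub>L real"
  assumes T: "analytic_C0_semigroup_L2 \<mu> (\<lambda>t. complexification (OU_L2 P S Y \<mu> t))"
    and x': "(\<lambda>n. l2norm \<mu> (blinfun_apply (x' n))) \<longlonglongrightarrow> 0" and u: "(\<lambda>n. adj i (x' n)) \<longlonglongrightarrow> u"
  shows "u = 0"
proof -
  obtain K where K: "K \<ge> 0" "\<forall>x' a' y' b'. adjoint_generator x' a' \<longrightarrow> adjoint_generator y' b' \<longrightarrow>
      \<bar>cov a' y'\<bar> \<le> K * norm (adj i x') * norm (adj i y')"
    using generator_sectorial[OF T] by (elim exE conjE)
  define V where "V = adj i ` {x'. \<exists>a'. adjoint_generator x' a'}"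
  have V: "subspace V"
    unfolding V_def by (rule linear_subspace_image[OF bounded_linear.linear[OF bounded_linear_adj] adjoint_domain_subspace])
  \<comment> \<open>The approximants are known to converge only weakly in H, so density of the range
    uses that norm closures of subspaces are weakly closed.\<close>
  have "adj i z' \<in> closure V" for z' :: "'e \<Rightarrow>\<^sub>L real"
  proof (rule weak_limit_in_closure[OF V])
    show "adj i (approximant n z') \<in> V" for n using approximant_generator[of n z'] by (auto simp: V_def)
    show "(\<lambda>n. inner (adj i (approximant n z')) b) \<longlonglongrightarrow> inner (adj i z') b" for b by (rule approximant_weak)
  qed
  then have "u \<in> closure V" by (rule closed_sequentially[OF closed_closure _ u])
  then obtain v where v: "\<And>k :: nat. v k \<in> V" "v \<longlonglongrightarrow> u" by (auto simp: closure_sequential)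
  have "norm (v k) * norm (v k) \<le> 2 * (K * norm (v k) * norm (v k - u))" for k
  proof -
    obtain g a where g: "adjoint_generator g a" "v k = adj i g" using v(1)[of k] by (auto simp: V_def)
    obtain b where b: "norm b \<le> K * norm (adj i g)" "\<And>y'. cov a y' = inner b (adj i y')"
      using generator_representation[OF K g(1)] by blast
    have "(\<lambda>n. cov a (x' n)) \<longlonglongrightarrow> cov a 0" by (rule tendsto_cov) (use x' in \<open>simp_all add: zero_blinfun.rep_eq\<close>)
    then have "(\<lambda>n. inner b (adj i (x' n))) \<longlonglongrightarrow> 0" by (simp add: b(2)[symmetric])
    from LIMSEQ_unique[OF this tendsto_inner[OF tendsto_const u]] have bu: "inner b u = 0" by simp
    have "norm (v k) * norm (v k) = - 2 * inner b (v k - u)"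
      using generator_quadratic[OF g(1)] by (simp add: g(2) b(2) bu inner_diff_right power2_eq_square)
    also have "\<dots> \<le> 2 * (norm b * norm (v k - u))" using Cauchy_Schwarz_ineq2[of b "v k - u"] by linarith
    also have "\<dots> \<le> 2 * ((K * norm (v k)) * norm (v k - u))" using b(1) g(2) by (intro mult_left_mono mult_right_mono) auto
    finally show ?thesis .
  qed
  moreover have "(\<lambda>k. norm (v k) * norm (v k)) \<longlonglongrightarrow> norm u * norm u"
    by (intro tendsto_intros v(2))
  moreover have "(\<lambda>k. 2 * (K * norm (v k) * norm (v k - u))) \<longlonglongrightarrow> 2 * (K * norm u * norm (u - u))"
    by (rule tendsto_intros v(2))+
  ultimately have "norm u * norm u \<le> 2 * (K * norm u * norm (u - u))" by (blast intro: LIMSEQ_le)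
  then show ?thesis by (simp add: mult_le_0_iff)
qed

text \<open>Closability makes the graph single valued, which gives \<open>THE\<close> in the
  definition of \<open>U\<close> its meaning.\<close>

lemma U_sequence:
  assumes T: "analytic_C0_semigroup_L2 \<mu> (\<lambda>t. complexification (OU_L2 P S Y \<mu> t))"
    and h: "h \<in> dom_U i \<mu>"
  shows "h \<in> L2 \<mu> \<and> (\<exists>x' :: nat \<Rightarrow> 'e \<Rightarrow>\<^sub>L real.
    (\<lambda>k. l2norm \<mu> (\<lambda>x. blinfun_apply (x' k) x - h x)) \<longlonglongrightarrow> 0 \<and> (\<lambda>k. adj i (x' k)) \<longlonglongrightarrow> U i \<mu> h)"
proof -
  obtain u where u: "(h, u) \<in> U_graph i \<mu>" using h by (auto simp: dom_U_def)
  have hL: "h \<in> L2 \<mu>" using u by (auto simp: U_graph_def H_inf_def)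
  have "v = w" if vw: "(h, v) \<in> U_graph i \<mu>" "(h, w) \<in> U_graph i \<mu>" for v w
  proof -
    obtain x' y' :: "nat \<Rightarrow> 'e \<Rightarrow>\<^sub>L real"
      where x': "(\<lambda>n. l2norm \<mu> (\<lambda>x. blinfun_apply (x' n) x - h x)) \<longlonglongrightarrow> 0" "(\<lambda>n. adj i (x' n)) \<longlonglongrightarrow> v"
        and y': "(\<lambda>n. l2norm \<mu> (\<lambda>x. blinfun_apply (y' n) x - h x)) \<longlonglongrightarrow> 0" "(\<lambda>n. adj i (y' n)) \<longlonglongrightarrow> w"
      using vw by (auto simp: U_graph_def)
    have le: "norm (l2norm \<mu> (blinfun_apply (x' n - y' n))) \<le>
        l2norm \<mu> (\<lambda>x. blinfun_apply (x' n) x - h x) + l2norm \<mu> (\<lambda>x. blinfun_apply (y' n) x - h x)" for n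
      using l2norm_triangle3[OF functional_L2[of "x' n"] hL functional_L2[of "y' n"]]
      by (simp add: minus_blinfun.rep_eq l2norm_minus_commute[of \<mu> h])
    have "(\<lambda>n. l2norm \<mu> (blinfun_apply (x' n - y' n))) \<longlonglongrightarrow> 0"
      by (rule Lim_null_comparison[OF always_eventually[OF allI[OF le]]]) (use tendsto_add[OF x'(1) y'(1)] in simp)
    moreover have "(\<lambda>n. adj i (x' n - y' n)) \<longlonglongrightarrow> v - w" unfolding adj_diff by (intro tendsto_diff x' y')
    ultimately have "v - w = 0" by (rule gradient_closable[OF T])
    then show "v = w" by simp
  qed
  with u have "U i \<mu> h = u" unfolding U_def by (intro the_equality)
  with u hL show ?thesis by (auto simp: U_graph_def)
qed

text \<open>The functions \<open>h j\<close> are replaced by functionals x' converging to them in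
  the graph of U. The inequality for functionals applies there, and bounded convergence carries both
  sides to the limit.\<close>

lemma cylindrical_poincare:
  assumes T: "analytic_C0_semigroup_L2 \<mu> (\<lambda>t. complexification (OU_L2 P S Y \<mu> t))"
    and C: "C \<ge> 0" "\<And>x'. cov x' x' \<le> C * (norm (adj i x'))\<^sup>2"
    and fF: "(f, F) \<in> DH_cyl_graph i \<mu>"
  shows "f \<in> L2 \<mu>" and "F \<in> L2 \<mu>"
    and "(\<integral>x. (f x - (\<integral>y. f y \<partial>\<mu>))\<^sup>2 \<partial>\<mu>) \<le> pi\<^sup>2 / 8 * C * (\<integral>x. (norm (F x))\<^sup>2 \<partial>\<mu>)"
proof -
  obtain n \<phi> h where \<phi>: "\<phi> \<in> C1b n" and h: "\<And>j. j < n \<Longrightarrow> h j \<in> dom_U i \<mu>"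
    and f: "f = (\<lambda>x. \<phi> (eval_vec n h x))"
    and F: "F = (\<lambda>x. \<Sum>j<n. partial j \<phi> (eval_vec n h x) *\<^sub>R U i \<mu> (h j))"
    using fF unfolding DH_cyl_graph_def by blast
  let ?V = "topspace (Euclidean_space n)"
  have eV: "eval_vec n c x \<in> ?V" for c :: "nat \<Rightarrow> 'e \<Rightarrow> real" and x by (simp add: eval_vec_def topspace_Euclidean_space)
  have hL: "h j \<in> L2 \<mu>" if "j < n" for j using U_sequence[OF T h[OF that]] by blast
  have "\<forall>j\<in>{..<n}. \<exists>x'. (\<lambda>k. l2norm \<mu> (\<lambda>x. blinfun_apply (x' k) x - h j x)) \<longlonglongrightarrow> 0 \<and>
      (\<lambda>k :: nat. adj i (x' k)) \<longlonglongrightarrow> U i \<mu> (h j)"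
    using U_sequence[OF T h] by simp
  from bchoice[OF this] obtain y' where y': "\<And>j. j < n \<Longrightarrow> (\<lambda>k. l2norm \<mu> (\<lambda>x. blinfun_apply (y' j k) x - h j x)) \<longlonglongrightarrow> 0"
      "\<And>j. j < n \<Longrightarrow> (\<lambda>k :: nat. adj i (y' j k)) \<longlonglongrightarrow> U i \<mu> (h j)" by auto
  have dL: "(\<lambda>x. blinfun_apply (y' j k) x - h j x) \<in> L2 \<mu>" if "j < n" for j k
    using hL[OF that] by (intro L2_diff) simp_all
  \<comment> \<open>Summing over j gives one subsequence that converges almost everywhere in all
    coordinates at once.\<close>
  have "\<exists>r. strict_mono r \<and> (AE x in \<mu>. (\<lambda>k. \<Sum>j<n. \<bar>y' j (r k) x - h j x\<bar>) \<longlonglongrightarrow> 0)"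
  proof (rule tendsto_L1_AE_subseq)
    have int: "integrable \<mu> (\<lambda>x. \<bar>blinfun_apply (y' j k) x - h j x\<bar>)" if "j < n" for j k
      by (intro integrable_abs L2_imp_integrable dL that)
    then show "integrable \<mu> (\<lambda>x. \<Sum>j<n. \<bar>y' j k x - h j x\<bar>)" for k by auto
    have eq: "(\<integral>x. norm (\<Sum>j<n. \<bar>y' j k x - h j x\<bar>) \<partial>\<mu>) = (\<Sum>j<n. \<integral>x. \<bar>y' j k x - h j x\<bar> \<partial>\<mu>)" for k
      using int by (simp add: sum_nonneg Bochner_Integration.integral_sum)
    have "(\<lambda>k. \<integral>x. \<bar>y' j k x - h j x\<bar> \<partial>\<mu>) \<longlonglongrightarrow> 0" if "j < n" for j
      by (rule Lim_null_comparison[OF _ y'(1)[OF that]])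
        (use integral_norm_le_l2norm[OF dL[OF that]] in auto)
    then show "(\<lambda>k. \<integral>x. norm (\<Sum>j<n. \<bar>y' j k x - h j x\<bar>) \<partial>\<mu>) \<longlonglongrightarrow> 0"
      unfolding eq by (intro tendsto_null_sum) auto
  qed
  then obtain r where r: "strict_mono r" "AE x in \<mu>. (\<lambda>k. \<Sum>j<n. \<bar>y' j (r k) x - h j x\<bar>) \<longlonglongrightarrow> 0" by blast
  define x' where "x' = (\<lambda>k j. y' j (r k))"
  have adj_lim: "(\<lambda>k. adj i (x' k j)) \<longlonglongrightarrow> U i \<mu> (h j)" if "j < n" for j
    using LIMSEQ_subseq_LIMSEQ[OF y'(2)[OF that] r(1)] by (simp add: x'_def o_def)
  define e where "e = (\<lambda>k. eval_vec n (\<lambda>j. blinfun_apply (x' k j)))"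
  define w where "w = (\<lambda>k x. \<Sum>j<n. partial j \<phi> (e k x) *\<^sub>R x' k j)"
  have e_lim: "AE x in \<mu>. (\<lambda>k. e k x) \<longlonglongrightarrow> eval_vec n h x"
    using r(2)
  proof eventually_elim
    case (elim x)
    show ?case
    proof (rule tendsto_coordinatewise)
      fix j
      show "(\<lambda>k. e k x j) \<longlonglongrightarrow> eval_vec n h x j"
      proof (cases "j < n")
        case True
        have le: "norm (y' j (r k) x - h j x) \<le> (\<Sum>j<n. \<bar>y' j (r k) x - h j x\<bar>)" for k
          using True member_le_sum[of j "{..<n}" "\<lambda>j. \<bar>y' j (r k) x - h j x\<bar>"] by simp
        have "(\<lambda>k. y' j (r k) x - h j x) \<longlonglongrightarrow> 0"
          by (rule Lim_null_comparison[OF always_eventually[OF allI[OF le]] elim])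
        then show ?thesis using True by (simp add: e_def eval_vec_def x'_def LIM_zero_iff)
      qed (simp add: e_def eval_vec_def)
    qed
  qed
  have cont: "(\<lambda>k. q (e k x)) \<longlonglongrightarrow> q (eval_vec n h x)"
    if q: "continuous_on UNIV (\<lambda>a. q (truncate n a))" and x: "(\<lambda>k. e k x) \<longlonglongrightarrow> eval_vec n h x"
    for q :: "(nat \<Rightarrow> real) \<Rightarrow> real" and x
  proof -
    have "isCont (\<lambda>a. q (truncate n a)) (eval_vec n h x)" using q by (simp add: continuous_on_eq_continuous_at)
    from isCont_tendsto_compose[OF this x] show ?thesis by (simp add: e_def truncate_eq[OF eV])
  qed
  obtain B0 where B0: "\<And>a. a \<in> ?V \<Longrightarrow> \<bar>\<phi> a\<bar> \<le> B0" using C1bD(3)[OF \<phi>] by blast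
  have "\<exists>B. \<forall>j<n. \<forall>a\<in>?V. \<bar>partial j \<phi> a\<bar> \<le> B j" using C1bD(4)[OF \<phi>] by metis
  then obtain B where B: "\<And>j a. j < n \<Longrightarrow> a \<in> ?V \<Longrightarrow> \<bar>partial j \<phi> a\<bar> \<le> B j" by blast
  have hm: "h j \<in> borel_measurable \<mu>" if "j < n" for j using hL[OF that] by (rule L2_borel)
  have xm: "blinfun_apply (x' k j) \<in> borel_measurable \<mu>" for k j by (rule L2_borel) simp
  have bounded_L2: "(\<lambda>x. \<phi> (eval_vec n c x)) \<in> L2 \<mu>"
    if c: "\<And>j. j < n \<Longrightarrow> c j \<in> borel_measurable \<mu>" for c
    by (rule L2_bounded[of _ _ B0]) (use eval_vec_measurable[OF C1bD(1)[OF \<phi>] c] B0[OF eV] finite_measure_axioms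
        in \<open>auto intro: strongly_measurableI\<close>)
  have gradient_measurable: "strongly_measurable \<mu> (\<lambda>x. \<Sum>j<n. partial j \<phi> (eval_vec n c x) *\<^sub>R (v j :: 'h))"
    if c: "\<And>j. j < n \<Longrightarrow> c j \<in> borel_measurable \<mu>" for c v
    by (intro strongly_measurable_sum strongly_measurable_scaleR eval_vec_measurable[OF C1bD(2)[OF \<phi>] c]) auto
  have gradient_bound: "norm (\<Sum>j<n. partial j \<phi> (eval_vec n c x) *\<^sub>R (v j :: 'h)) \<le> (\<Sum>j<n. B j * M j)"
    if v: "\<And>j. j < n \<Longrightarrow> norm (v j) \<le> M j" for c v M and x :: 'e
  proof (rule sum_norm_le)
    fix j assume j: "j \<in> {..<n}"
    then have "\<bar>partial j \<phi> (eval_vec n c x)\<bar> * norm (v j) \<le> B j * M j"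
      using B[OF _ eV] v by (intro mult_mono order_trans[OF abs_ge_zero B[OF _ eV]]) auto
    then show "norm (partial j \<phi> (eval_vec n c x) *\<^sub>R v j) \<le> B j * M j" by simp
  qed
  show fL: "f \<in> L2 \<mu>" unfolding f by (rule bounded_L2[OF hm])
  show FL: "F \<in> L2 \<mu>"
    unfolding F by (rule L2_bounded[OF finite_measure_axioms gradient_measurable[OF hm] gradient_bound[OF order_refl]])
  have fkL: "(\<lambda>x. \<phi> (e k x)) \<in> L2 \<mu>" for k unfolding e_def by (rule bounded_L2[OF xm])
  have "(\<lambda>k. l2norm \<mu> (\<lambda>x. \<phi> (e k x) - f x)) \<longlonglongrightarrow> 0"
  proof (rule L2_dominated_convergence[where w = "\<lambda>_. B0"])
    show "AE x in \<mu>. (\<lambda>k. \<phi> (e k x)) \<longlonglongrightarrow> f x"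
      using e_lim by eventually_elim (use cont[OF C1bD(1)[OF \<phi>]] in \<open>simp add: f\<close>)
  qed (use B0[OF eV] in \<open>auto simp: e_def f L2_iff intro!: L2_borel[OF bounded_L2] hm xm\<close>)
  from variance_tendsto[OF fkL fL this]
  have lhs: "(\<lambda>k. \<integral>x. (\<phi> (e k x) - (\<integral>y. \<phi> (e k y) \<partial>\<mu>))\<^sup>2 \<partial>\<mu>) \<longlonglongrightarrow> (\<integral>x. (f x - (\<integral>y. f y \<partial>\<mu>))\<^sup>2 \<partial>\<mu>)" .
  have adj_w: "adj i (w k x) = (\<Sum>j<n. partial j \<phi> (eval_vec n (\<lambda>j. blinfun_apply (x' k j)) x) *\<^sub>R adj i (x' k j))" for k x
    by (simp add: w_def e_def adj_sum adj_scaleR)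
  have "\<exists>M. \<forall>j<n. \<forall>k. norm (adj i (x' k j)) \<le> M j"
  proof -
    have "\<exists>M. \<forall>k. norm (adj i (x' k j)) \<le> M" if "j < n" for j
      using convergent_imp_Bseq[OF convergentI[OF adj_lim[OF that]]] by (auto simp: Bseq_def)
    then show ?thesis by metis
  qed
  then obtain M where M: "\<And>j k. j < n \<Longrightarrow> norm (adj i (x' k j)) \<le> M j" by blast
  define D where "D = (\<Sum>j<n. B j * M j)"
  have wD: "norm (adj i (w k x)) \<le> D" for k x unfolding adj_w D_def by (rule gradient_bound[OF M])
  have w_meas: "(\<lambda>x. (norm (adj i (w k x)))\<^sup>2) \<in> borel_measurable \<mu>" for k
    unfolding adj_w using strongly_measurable_norm[OF gradient_measurable[OF xm]] by measurable
  have w_le: "(norm (adj i (w k x)))\<^sup>2 \<le> D\<^sup>2" for k x by (intro power_mono wD) simp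
  have w_int: "integrable \<mu> (\<lambda>x. (norm (adj i (w k x)))\<^sup>2)" for k
    by (rule integrable_const_bound[where B = "D\<^sup>2"]) (use w_le w_meas in auto)
  have "(\<lambda>k. \<integral>x. (norm (adj i (w k x)))\<^sup>2 \<partial>\<mu>) \<longlonglongrightarrow> (\<integral>x. (norm (F x))\<^sup>2 \<partial>\<mu>)"
  proof (rule integral_dominated_convergence[where w = "\<lambda>_. D\<^sup>2"])
    show "AE x in \<mu>. (\<lambda>k. (norm (adj i (w k x)))\<^sup>2) \<longlonglongrightarrow> (norm (F x))\<^sup>2"
      using e_lim
    proof eventually_elim
      case (elim x)
      have "(\<lambda>k. adj i (w k x)) \<longlonglongrightarrow> F x"
        unfolding adj_w F
        by (intro tendsto_sum tendsto_scaleR adj_lim cont[OF C1bD(2)[OF \<phi>] elim, unfolded e_def]) auto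
      then show ?case by (intro tendsto_intros)
    qed
  qed (use w_le w_meas L2_integrable[OF FL] in auto)
  then have rhs: "(\<lambda>k. pi\<^sup>2 / 8 * (C * (\<integral>x. (norm (adj i (w k x)))\<^sup>2 \<partial>\<mu>))) \<longlonglongrightarrow> pi\<^sup>2 / 8 * (C * (\<integral>x. (norm (F x))\<^sup>2 \<partial>\<mu>))"
    by (intro tendsto_intros)
  have "(\<integral>x. (\<phi> (e k x) - (\<integral>y. \<phi> (e k y) \<partial>\<mu>))\<^sup>2 \<partial>\<mu>) \<le> pi\<^sup>2 / 8 * (C * (\<integral>x. (norm (adj i (w k x)))\<^sup>2 \<partial>\<mu>))" for k
  proof -
    have int: "integrable \<mu> (\<lambda>x. cov (w k x) (w k x))"
      and le: "(\<integral>x. (\<phi> (e k x) - (\<integral>y. \<phi> (e k y) \<partial>\<mu>))\<^sup>2 \<partial>\<mu>) \<le> pi\<^sup>2 / 8 * (\<integral>x. cov (w k x) (w k x) \<partial>\<mu>)"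
      unfolding w_def e_def by (rule functional_poincare[OF \<phi>])+
    \<comment> \<open>Coercivity is applied pointwise to the functional-valued derivative w, whose
      image under i^* is the gradient with values in H.\<close>
    have "(\<integral>x. cov (w k x) (w k x) \<partial>\<mu>) \<le> (\<integral>x. C * (norm (adj i (w k x)))\<^sup>2 \<partial>\<mu>)"
      by (rule integral_mono[OF int]) (use w_int C in auto)
    then have "(\<integral>x. cov (w k x) (w k x) \<partial>\<mu>) \<le> C * (\<integral>x. (norm (adj i (w k x)))\<^sup>2 \<partial>\<mu>)" by simp
    then show ?thesis by (intro order_trans[OF le] mult_left_mono) auto
  qed
  with LIMSEQ_le[OF lhs rhs] show "(\<integral>x. (f x - (\<integral>y. f y \<partial>\<mu>))\<^sup>2 \<partial>\<mu>) \<le> pi\<^sup>2 / 8 * C * (\<integral>x. (norm (F x))\<^sup>2 \<partial>\<mu>)"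
    by (auto simp: mult.assoc)
qed

text \<open>Variance and squared gradient norm are both continuous along the L2 limits that define
  the closure, so the inequality passes to every pair of the graph.\<close>

lemma gradient_graph_poincare:
  assumes T: "analytic_C0_semigroup_L2 \<mu> (\<lambda>t. complexification (OU_L2 P S Y \<mu> t))"
    and C: "C \<ge> 0" "\<And>x'. cov x' x' \<le> C * (norm (adj i x'))\<^sup>2"
    and fF: "(f, F) \<in> DH_graph i \<mu>"
  shows "(\<integral>x. (f x - (\<integral>y. f y \<partial>\<mu>))\<^sup>2 \<partial>\<mu>) \<le> pi\<^sup>2 / 8 * C * (\<integral>x. (norm (F x))\<^sup>2 \<partial>\<mu>)"
proof -
  obtain g G where fL: "f \<in> L2 \<mu>" and FL: "F \<in> L2 \<mu>" and g: "\<And>n :: nat. (g n, G n) \<in> DH_cyl_graph i \<mu>"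
    and lim: "(\<lambda>n. l2norm \<mu> (\<lambda>x. g n x - f x)) \<longlonglongrightarrow> 0" "(\<lambda>n. l2norm \<mu> (\<lambda>x. G n x - F x)) \<longlonglongrightarrow> 0"
    using fF by (auto simp: DH_graph_def)
  note cyl = cylindrical_poincare[OF T C g]
  have "(\<lambda>n. pi\<^sup>2 / 8 * C * (l2norm \<mu> (G n))\<^sup>2) \<longlonglongrightarrow> pi\<^sup>2 / 8 * C * (l2norm \<mu> F)\<^sup>2"
    by (intro tendsto_intros L2_tendsto_l2norm[OF cyl(2) FL lim(2)])
  from LIMSEQ_le[OF variance_tendsto[OF cyl(1) fL lim(1)] this] cyl(3)
  show ?thesis unfolding l2norm_power2 by auto
qed

end

theorem theorem2p11:
  fixes i :: "'h::{real_inner,complete_space} \<Rightarrow>\<^sub>L 'e::banach"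
    and S :: "real \<Rightarrow> 'e \<Rightarrow>\<^sub>L 'e"
    and P :: "'w measure"
    and W :: "(real \<Rightarrow> 'h) \<Rightarrow> 'w \<Rightarrow> real"
    and Y :: "real \<Rightarrow> 'w \<Rightarrow> 'e"
    and \<mu> :: "'e measure"
  assumes inj_i: "inj (blinfun_apply i)"
    and P: "prob_space P"
    and W: "cylindrical_brownian_motion P W"
    and S: "C0_semigroup S"
    and assumption1: "invariant_measure i S \<mu>"
    and Y: "\<And>t. t \<ge> 0 \<Longrightarrow> stochastic_convolution P W i S t (Y t)"
    and assumption2:
      "analytic_C0_semigroup_L2 \<mu> (\<lambda>t. complexification (OU_L2 P S Y \<mu> t))"
    and stable: "S_inf_exponentially_stable S \<mu>"
  shows "\<exists>C. \<forall>\<phi>\<in>W12 i \<mu>.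
    (\<integral>x. (\<phi> x - (\<integral>y. \<phi> y \<partial>\<mu>))\<^sup>2 \<partial>\<mu>) \<le> C * (\<integral>x. (norm (DH i \<mu> \<phi> x))\<^sup>2 \<partial>\<mu>)"
proof -
  have \<mu>: "centred_gaussian_radon \<mu>" using assumption1 by (simp add: invariant_measure_def)
  interpret ornstein_uhlenbeck \<mu> S i P W Y
    by (intro ornstein_uhlenbeck.intro gaussian_radon.intro c0_semigroup.intro ornstein_uhlenbeck_axioms.intro)
      (rule \<mu> S P W assumption1 | erule Y)+
  obtain C where C: "C \<ge> 0" "\<And>x'. cov x' x' \<le> C * (norm (adj i x'))\<^sup>2"
    using gradient_coercive[OF assumption2 stable] by blast
  \<comment> \<open>Whichever gradient \<open>SOME\<close> selects belongs to the graph, where the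
    inequality holds for every pair; the final constant is pi^2 / 8 times the coercivity
    constant.\<close>
  have "(\<phi>, DH i \<mu> \<phi>) \<in> DH_graph i \<mu>" if "\<phi> \<in> W12 i \<mu>" for \<phi>
    using that unfolding W12_def DH_def Domain_iff by (rule someI_ex)
  then show ?thesis using gradient_graph_poincare[OF assumption2 C] by blast
qed

end
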